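(* Suppose $$\frac{\eta}{\xi}\to\lambda\in[0,\infty]\quad\text{as }\xi,\eta\to0.$$ Then there exist maps $Q_{\xi,\eta}\in Q_\infty+H^1(\Omega;\mathcal S_0)$ with $Q_{\xi,\eta}=Q_\phi$ on $\mathbb S^2=\partial\Omega$ such that for any measurable set $U\subset\mathbb S^2$, $$\limsup_{\xi,\eta\to0}\ \eta\,E_{\xi,\eta}(Q_{\xi,\eta};\mathcal C(U))\ \le\ \int_U D_\lambda(Q_\phi(\omega))\,d\mathcal H^2(\omega).$$
   Context: $\Omega=\mathbb R^3\setminus B$, where $B$ is the closed unit ball centered at $0$. $\mathcal S_0$ is the space of symmetric traceless real $3\times3$ matrices with the Frobenius norm $|\cdot|$. $Q_\infty=\mathbf e_3\otimes \mathbf e_3-\frac13I$. Potentials: $f(Q)=\frac29-\frac12|Q|^2-\operatorname{tr}(Q^3)+\frac34|Q|^4$, which satisfies $f\ge0$ with equality iff $Q=n\otimes n-\frac13I$ for some $n\in\mathbb S^2$; and $g(Q)=\sqrt{\frac23}-\frac{Q_{33}}{|Q|}$ (the formula is for $Q\neq 0$; no value at $Q=0$ is specified). Energy: for $\xi,\eta>0$ and measurable $A\subset\Omega$, $$E_{\xi,\eta}(Q;A)=\int_A\left(\frac12|\nabla Q|^2+\frac1{\xi^2}f(Q)+\frac1{\eta^2}g(Q)\right)dx.$$ For $U\subset\mathbb S^2$, $\mathcal C(U)=\{t\omega: t>1,\ \omega\in U\}$. For $\lambda\in[0,\infty)$ and $Q\in Q_\infty+H^1((1,\infty);\mathcal S_0)$,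 $$F_\lambda(Q)=\int_1^\infty\left[\frac12\left|\frac{dQ}{dr}\right|^2+\lambda^2f(Q)+g(Q)\right]dr,$$ while $F_\infty(Q)=\int_1^\infty\left[\frac12\left|\frac{dQ}{dr}\right|^2+g(Q)\right]dr$ if $f(Q)=0$ a.e., and $F_\infty(Q)=+\infty$ otherwise. Finally $$D_\lambda(Q_0)=\min\{F_\lambda(Q): Q\in Q_\infty+H^1((1,\infty);\mathcal S_0),\ Q(1)=Q_0\}.$$ $Q_\phi=e_\phi\otimes e_\phi-\frac13I$ (defined on $\mathbb S^2\setminus\{\pm\mathbf e_3\}$), where $e_\phi$ is the longitudinal unit tangent vector: at $\omega=(\sin\phi\cos\theta,\sin\phi\sin\theta,\cos\phi)$, $\theta\in[0,2\pi)$, $\phi\in(0,\pi)$, $e_\phi=(\cos\phi\cos\theta,\cos\phi\sin\theta,-\sin\phi)$. $\mathcal H^2$ is the two-dimensional Hausdorff (surface) measure. Limits $\xi,\eta\to0$ are taken along families (or sequences) of positive pairs $(\xi,\eta)\to(0,0)$ with $\eta/\xi\to\lambda$. *)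

theory Defs
  imports "HOL-Analysis.Analysis"
begin

section \<open>Hausdorff measure\<close>

text \<open>The normalisation \<^term>\<open>unit_ball_vol (real s) * (diameter C / 2) ^ s\<close> is the one for
  which the \<open>s\<close>-dimensional Hausdorff measure of \<open>\<real>\<^sup>s\<close> is Lebesgue measure. Empty sets get weight
  \<open>0\<close> explicitly, since \<open>0 ^ 0 = 1\<close>.\<close>

definition hausdorff_weight :: "nat \<Rightarrow> 'a::metric_space set \<Rightarrow> ennreal" where
  "hausdorff_weight s C =
     (if C = {} then 0 else ennreal (unit_ball_vol (real s) * (diameter C / 2) ^ s))"

definition hausdorff_pre :: "nat \<Rightarrow> real \<Rightarrow> 'a::metric_space set \<Rightarrow> ennreal" where
  "hausdorff_pre s \<delta> A =
     (INF C \<in> {C :: nat \<Rightarrow> 'a set. A \<subseteq> (\<Union>i. C i) \<and> (\<forall>i. bounded (C i) \<and> diameter (C i) \<le> \<delta>)}.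
        \<Sum>i. hausdorff_weight s (C i))"

definition hausdorff_outer :: "nat \<Rightarrow> 'a::metric_space set \<Rightarrow> ennreal" where
  "hausdorff_outer s A = (SUP \<delta>\<in>{0<..}. hausdorff_pre s \<delta> A)"

text \<open>The measure lives on the Caratheodory measurable sets.\<close>

definition hausdorff_measure :: "nat \<Rightarrow> 'a::metric_space measure" where
  "hausdorff_measure s =
     measure_of UNIV (lambda_system UNIV UNIV (hausdorff_outer s)) (hausdorff_outer s)"

lemma hausdorff_pre_mono: "A \<subseteq> B \<Longrightarrow> hausdorff_pre s \<delta> A \<le> hausdorff_pre s \<delta> B"
  unfolding hausdorff_pre_def by (intro INF_superset_mono) auto

lemma hausdorff_pre_empty:
  assumes "0 < \<delta>" shows "hausdorff_pre s \<delta> {} = 0"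
proof -
  have "hausdorff_pre s \<delta> ({}::'a set) \<le> (\<Sum>i. hausdorff_weight s ((\<lambda>_. {}::'a set) i))"
    unfolding hausdorff_pre_def using assms by (intro INF_lower) auto
  then show ?thesis by (simp add: hausdorff_weight_def)
qed

lemma hausdorff_pre_UN:
  fixes A :: "nat \<Rightarrow> 'a::metric_space set"
  shows "hausdorff_pre s \<delta> (\<Union>n. A n) \<le> (\<Sum>n. hausdorff_pre s \<delta> (A n))"
proof (rule ennreal_le_epsilon)
  fix e :: real
  assume fin: "(\<Sum>n. hausdorff_pre s \<delta> (A n)) < top" and "0 < e"
  let ?cov = "\<lambda>n. {C :: nat \<Rightarrow> 'a set. A n \<subseteq> (\<Union>i. C i) \<and> (\<forall>i. bounded (C i) \<and> diameter (C i) \<le> \<delta>)}"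
  have ex: "\<exists>C\<in>?cov n. (\<Sum>i. hausdorff_weight s (C i)) < hausdorff_pre s \<delta> (A n) + ennreal (e * (1/2) ^ Suc n)" for n
  proof -
    have "hausdorff_pre s \<delta> (A n) \<noteq> top"
      using fin ennreal_suminf_lessD[OF fin, of n] by simp
    then have "hausdorff_pre s \<delta> (A n) < hausdorff_pre s \<delta> (A n) + ennreal (e * (1/2) ^ Suc n)"
      using \<open>0 < e\<close> ennreal_add_left_cancel_less[of "hausdorff_pre s \<delta> (A n)" 0] by auto
    then show ?thesis
      unfolding hausdorff_pre_def[of s \<delta> "A n"] INF_less_iff .
  qed
  define C where "C n = (SOME C. C \<in> ?cov n \<and>
      (\<Sum>i. hausdorff_weight s (C i)) < hausdorff_pre s \<delta> (A n) + ennreal (e * (1/2) ^ Suc n))" for n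
  have "C n \<in> ?cov n \<and>
      (\<Sum>i. hausdorff_weight s (C n i)) < hausdorff_pre s \<delta> (A n) + ennreal (e * (1/2) ^ Suc n)" for n
    unfolding C_def by (rule someI_ex[OF ex[of n, unfolded Bex_def]])
  then have C: "\<And>n. C n \<in> ?cov n"
      "\<And>n. (\<Sum>i. hausdorff_weight s (C n i)) < hausdorff_pre s \<delta> (A n) + ennreal (e * (1/2) ^ Suc n)"
    by auto
  let ?D = "\<lambda>k. C (fst (prod_decode k)) (snd (prod_decode k))"
  have sub: "(\<Union>n. A n) \<subseteq> (\<Union>k. ?D k)"
  proof
    fix x assume "x \<in> (\<Union>n. A n)"
    then obtain n i where "x \<in> C n i" using C(1) by blast
    then have "x \<in> ?D (prod_encode (n, i))" by simp
    then show "x \<in> (\<Union>k. ?D k)" by blast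
  qed
  have "hausdorff_pre s \<delta> (\<Union>n. A n) \<le> (\<Sum>k. hausdorff_weight s (?D k))"
    unfolding hausdorff_pre_def using sub C(1) by (intro INF_lower) auto
  also have "\<dots> = (\<Sum>n i. hausdorff_weight s (C n i))"
    using suminf_ennreal_2dimen[of "\<lambda>n. \<Sum>i. hausdorff_weight s (C n i)"
        "\<lambda>p. hausdorff_weight s (C (fst p) (snd p))"]
    by (simp add: comp_def)
  also have "\<dots> \<le> (\<Sum>n. hausdorff_pre s \<delta> (A n) + ennreal (e * (1/2) ^ Suc n))"
    using C(2) by (intro suminf_le) (auto intro: less_imp_le)
  also have "\<dots> = (\<Sum>n. hausdorff_pre s \<delta> (A n)) + (\<Sum>n. ennreal (e * (1/2) ^ Suc n))"
    by (rule suminf_add[symmetric]) auto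
  also have "(\<Sum>n. ennreal (e * (1/2) ^ Suc n)) = ennreal e"
  proof (rule suminf_ennreal_eq)
    show "(\<lambda>n. e * (1/2) ^ Suc n) sums e"
      using sums_mult[OF power_half_series, of e] by simp
  qed (use \<open>0 < e\<close> in auto)
  finally show "hausdorff_pre s \<delta> (\<Union>n. A n) \<le> (\<Sum>n. hausdorff_pre s \<delta> (A n)) + ennreal e" .
qed

lemma outer_measure_space_hausdorff_outer:
  "outer_measure_space UNIV (hausdorff_outer s :: 'a::metric_space set \<Rightarrow> ennreal)"
  unfolding outer_measure_space_def
proof (intro conjI)
  show "positive UNIV (hausdorff_outer s :: 'a set \<Rightarrow> ennreal)"
    by (auto simp: positive_def hausdorff_outer_def hausdorff_pre_empty)
  show "increasing UNIV (hausdorff_outer s :: 'a set \<Rightarrow> ennreal)"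
    unfolding increasing_def hausdorff_outer_def
    by (auto intro!: SUP_mono' hausdorff_pre_mono)
  show "countably_subadditive UNIV (hausdorff_outer s :: 'a set \<Rightarrow> ennreal)"
    unfolding countably_subadditive_def
  proof (intro allI impI)
    fix A :: "nat \<Rightarrow> 'a set"
    show "hausdorff_outer s (\<Union>i. A i) \<le> (\<Sum>i. hausdorff_outer s (A i))"
      unfolding hausdorff_outer_def[of s "\<Union>i. A i"]
    proof (rule SUP_least)
      fix \<delta> :: real assume "\<delta> \<in> {0<..}"
      then have "(\<Sum>i. hausdorff_pre s \<delta> (A i)) \<le> (\<Sum>i. hausdorff_outer s (A i))"
        unfolding hausdorff_outer_def by (intro suminf_le SUP_upper) auto
      with hausdorff_pre_UN[of s \<delta> A]
      show "hausdorff_pre s \<delta> (\<Union>i. A i) \<le> (\<Sum>i. hausdorff_outer s (A i))" by (rule order_trans)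
    qed
  qed
qed

lemma measure_space_hausdorff_outer:
  "measure_space UNIV (lambda_system UNIV UNIV (hausdorff_outer s)) (hausdorff_outer s)"
  using sigma_algebra.caratheodory_lemma[OF sigma_algebra_Pow[of UNIV]]
    outer_measure_space_hausdorff_outer[of s] by simp

lemma space_hausdorff_measure [simp]: "space (hausdorff_measure s) = UNIV"
  by (simp add: hausdorff_measure_def space_measure_of_conv)

lemma sets_hausdorff_measure:
  "sets (hausdorff_measure s) = lambda_system UNIV UNIV (hausdorff_outer s)"
  using measure_space_hausdorff_outer[of s] unfolding hausdorff_measure_def measure_space_def
  by (intro sigma_algebra.sets_measure_of_eq) auto

lemma emeasure_hausdorff_measure:
  "A \<in> sets (hausdorff_measure s) \<Longrightarrow> emeasure (hausdorff_measure s) A = hausdorff_outer s A"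
  using measure_space_hausdorff_outer[of s]
  unfolding sets_hausdorff_measure unfolding hausdorff_measure_def
  by (intro emeasure_measure_of_sigma) (auto simp: measure_space_def)


section \<open>Sobolev spaces\<close>

primrec C_diff :: "nat \<Rightarrow> ('a::euclidean_space \<Rightarrow> real) \<Rightarrow> bool" where
  "C_diff 0 \<phi> \<longleftrightarrow> continuous_on UNIV \<phi>"
| "C_diff (Suc k) \<phi> \<longleftrightarrow> \<phi> differentiable_on UNIV \<and>
     (\<forall>e\<in>Basis. C_diff k (\<lambda>x. frechet_derivative \<phi> (at x) e))"

definition test_function :: "'a::euclidean_space set \<Rightarrow> ('a \<Rightarrow> real) \<Rightarrow> bool" where
  "test_function \<Omega> \<phi> \<longleftrightarrow> (\<forall>k. C_diff k \<phi>) \<and>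
     compact (closure {x. \<phi> x \<noteq> 0}) \<and> closure {x. \<phi> x \<noteq> 0} \<subseteq> \<Omega>"

definition locally_integrable :: "'a::euclidean_space set \<Rightarrow> ('a \<Rightarrow> 'b::euclidean_space) \<Rightarrow> bool" where
  "locally_integrable \<Omega> u \<longleftrightarrow> (\<forall>K. compact K \<and> K \<subseteq> \<Omega> \<longrightarrow> u absolutely_integrable_on K)"

text \<open>\<open>v\<close> is a weak partial derivative of \<open>u\<close> in the direction \<open>e\<close> on the open set \<open>\<Omega>\<close>. It is
  determined up to null sets.\<close>

definition has_weak_deriv ::
    "'a::euclidean_space set \<Rightarrow> 'a \<Rightarrow> ('a \<Rightarrow> 'b::euclidean_space) \<Rightarrow> ('a \<Rightarrow> 'b) \<Rightarrow> bool" where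
  "has_weak_deriv \<Omega> e u v \<longleftrightarrow> locally_integrable \<Omega> u \<and> locally_integrable \<Omega> v \<and>
     (\<forall>\<phi>. test_function \<Omega> \<phi> \<longrightarrow>
        (\<integral>x. frechet_derivative \<phi> (at x) e *\<^sub>R u x \<partial>lebesgue_on \<Omega>)
          = - (\<integral>x. \<phi> x *\<^sub>R v x \<partial>lebesgue_on \<Omega>))"

definition weak_deriv ::
    "'a::euclidean_space set \<Rightarrow> 'a \<Rightarrow> ('a \<Rightarrow> 'b::euclidean_space) \<Rightarrow> 'a \<Rightarrow> 'b" where
  "weak_deriv \<Omega> e u = (SOME v. has_weak_deriv \<Omega> e u v)"

definition L2 :: "'a::euclidean_space set \<Rightarrow> ('a \<Rightarrow> 'b::euclidean_space) set" where
  "L2 \<Omega> = {u \<in> borel_measurable (lebesgue_on \<Omega>). integrable (lebesgue_on \<Omega>) (\<lambda>x. (norm (u x))\<^sup>2)}"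

definition H1 :: "'a::euclidean_space set \<Rightarrow> 'b::euclidean_space set \<Rightarrow> ('a \<Rightarrow> 'b) set" where
  "H1 \<Omega> S = {u \<in> L2 \<Omega>. (AE x in lebesgue_on \<Omega>. u x \<in> S) \<and>
     (\<forall>e\<in>Basis. \<exists>v\<in>L2 \<Omega>. has_weak_deriv \<Omega> e u v)}"

definition grad_norm2 :: "'a::euclidean_space set \<Rightarrow> ('a \<Rightarrow> 'b::euclidean_space) \<Rightarrow> 'a \<Rightarrow> real" where
  "grad_norm2 \<Omega> u x = (\<Sum>e\<in>Basis. (norm (weak_deriv \<Omega> e u x))\<^sup>2)"

definition H1_norm2 :: "'a::euclidean_space set \<Rightarrow> ('a \<Rightarrow> 'b::euclidean_space) \<Rightarrow> ennreal" where
  "H1_norm2 \<Omega> u = (\<integral>\<^sup>+x\<in>\<Omega>. ennreal ((norm (u x))\<^sup>2 + grad_norm2 \<Omega> u x) \<partial>lebesgue)"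

text \<open>The trace operator is the continuous extension to \<open>H\<^sup>1(\<Omega>)\<close>, with values in \<open>L\<^sup>2(\<partial>\<Omega>)\<close>, of the
  restriction to the boundary of \<open>H\<^sup>1\<close> functions that are continuous up to the boundary. The domain
  \<open>\<Omega>\<close> is meant to have a compact Lipschitz boundary.\<close>

definition has_trace ::
    "'a::euclidean_space set \<Rightarrow> ('a \<Rightarrow> 'b::euclidean_space) \<Rightarrow> ('a \<Rightarrow> 'b) \<Rightarrow> bool" where
  "has_trace \<Omega> u h \<longleftrightarrow> u \<in> H1 \<Omega> UNIV \<and>
     (\<exists>w :: nat \<Rightarrow> 'a \<Rightarrow> 'b.
        (\<forall>k. w k \<in> H1 \<Omega> UNIV \<and> continuous_on (closure \<Omega>) (w k)) \<and>
        (\<lambda>k. H1_norm2 \<Omega> (\<lambda>x. w k x - u x)) \<longlonglongrightarrow> 0 \<and>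
        (\<lambda>k. \<integral>\<^sup>+\<omega>\<in>frontier \<Omega>. ennreal ((norm (w k \<omega> - h \<omega>))\<^sup>2)
               \<partial>hausdorff_measure (DIM('a) - 1)) \<longlonglongrightarrow> 0)"


section \<open>Q-tensors and the energies\<close>

definition Omega :: "(real^3) set" where
  "Omega = - cball 0 1"

definition S0 :: "(real^3^3) set" where
  "S0 = {Q. transpose Q = Q \<and> trace Q = 0}"

definition uniaxial :: "real^3 \<Rightarrow> real^3^3" where
  "uniaxial n = (\<chi> i j. n $ i * n $ j) - (1/3) *\<^sub>R mat 1"

definition Q_inf :: "real^3^3" where
  "Q_inf = uniaxial (axis 3 1)"

text \<open>The library norm on \<^typ>\<open>real^3^3\<close> is the Frobenius norm.\<close>

definition f_pot :: "real^3^3 \<Rightarrow> real" where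
  "f_pot Q = 2/9 - 1/2 * (norm Q)\<^sup>2 - trace (Q ** Q ** Q) + 3/4 * (norm Q)^4"

text \<open>At \<open>Q = 0\<close>, where the formula has no meaning, the convention \<open>0 / 0 = 0\<close> gives the value
  \<^term>\<open>sqrt (2/3)\<close>. Any other nonnegative value leads to the same infimum \<open>D\<close> below, since cutting
  out of a profile the interval between its first and its last zero does not increase the energy.\<close>

definition g_pot :: "real^3^3 \<Rightarrow> real" where
  "g_pot Q = sqrt (2/3) - Q $ 3 $ 3 / norm Q"

text \<open>On \<^const>\<open>S0\<close> both potentials are nonnegative, so that \<^const>\<open>ennreal\<close> truncates nothing in the
  integrals below.\<close>

definition energy :: "real \<Rightarrow> real \<Rightarrow> (real^3 \<Rightarrow> real^3^3) \<Rightarrow> (real^3) set \<Rightarrow> ennreal" where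
  "energy \<xi> \<eta> Q A =
     (\<integral>\<^sup>+x\<in>A. ennreal (1/2 * grad_norm2 Omega Q x + 1/\<xi>\<^sup>2 * f_pot (Q x) + 1/\<eta>\<^sup>2 * g_pot (Q x)) \<partial>lebesgue)"

definition cone_over :: "(real^3) set \<Rightarrow> (real^3) set" where
  "cone_over U = {t *\<^sub>R \<omega> | t \<omega>. t > 1 \<and> \<omega> \<in> U}"

definition F_energy :: "ennreal \<Rightarrow> (real \<Rightarrow> real^3^3) \<Rightarrow> ennreal" where
  "F_energy lam Q =
     (if lam < \<infinity> then
        (\<integral>\<^sup>+r\<in>{1<..}. ennreal (1/2 * (norm (weak_deriv {1<..} 1 Q r))\<^sup>2
            + (enn2real lam)\<^sup>2 * f_pot (Q r) + g_pot (Q r)) \<partial>lebesgue)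
      else if (AE r in lebesgue_on {1<..}. f_pot (Q r) = 0) then
        (\<integral>\<^sup>+r\<in>{1<..}. ennreal (1/2 * (norm (weak_deriv {1<..} 1 Q r))\<^sup>2 + g_pot (Q r)) \<partial>lebesgue)
      else \<infinity>)"

text \<open>Elements of \<open>Q\<^sub>\<infinity> + H\<^sup>1((1,\<infinity>); S\<^sub>0)\<close> with prescribed value at \<open>1\<close>, given by their representative
  that is continuous on \<open>[1,\<infinity>)\<close>.\<close>

definition profiles :: "real^3^3 \<Rightarrow> (real \<Rightarrow> real^3^3) set" where
  "profiles Q0 = {Q. (\<lambda>r. Q r - Q_inf) \<in> H1 {1<..} S0 \<and> continuous_on {1..} Q \<and> Q 1 = Q0}"

text \<open>The minimum, written as an infimum in the complete lattice \<^typ>\<open>ennreal\<close>; the two agree whenever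
  the minimum is attained.\<close>

definition D :: "ennreal \<Rightarrow> real^3^3 \<Rightarrow> ennreal" where
  "D lam Q0 = (INF Q\<in>profiles Q0. F_energy lam Q)"

text \<open>The angles are the spherical coordinates of \<open>\<omega>\<close>: colatitude \<open>\<phi> = arccos \<omega>\<^sub>3\<close> and longitude
  \<open>\<theta> = arg (\<omega>\<^sub>1 + i \<omega>\<^sub>2) \<in> [0,2\<pi>)\<close>. At the two poles, a null set on which the tangent vector is not defined,
  the value is immaterial.\<close>

definition e_phi :: "real^3 \<Rightarrow> real^3" where
  "e_phi \<omega> = (let \<phi> = arccos (\<omega> $ 3); \<theta> = Arg2pi (Complex (\<omega> $ 1) (\<omega> $ 2))
     in vector [cos \<phi> * cos \<theta>, cos \<phi> * sin \<theta>, - sin \<phi>])"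

lemma e_phi_spherical:
  assumes "\<theta> \<in> {0..<2*pi}" "\<phi> \<in> {0<..<pi}"
  shows "e_phi (vector [sin \<phi> * cos \<theta>, sin \<phi> * sin \<theta>, cos \<phi>])
       = vector [cos \<phi> * cos \<theta>, cos \<phi> * sin \<theta>, - sin \<phi>]"
proof -
  have "sin \<phi> > 0" using assms(2) by (auto intro: sin_gt_zero)
  then have "Arg2pi (Complex (sin \<phi> * cos \<theta>) (sin \<phi> * sin \<theta>)) = \<theta>"
    using assms(1) by (intro Arg2pi_unique[of "sin \<phi>"]) (auto simp: complex_eq_iff Re_exp Im_exp)
  moreover have "arccos (cos \<phi>) = \<phi>" using assms(2) by (simp add: arccos_cos)
  ultimately show ?thesis by (simp add: e_phi_def Let_def)
qed

definition Q_phi :: "real^3 \<Rightarrow> real^3^3" where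
  "Q_phi \<omega> = uniaxial (e_phi \<omega>)"

text \<open>Maps in \<open>Q\<^sub>\<infinity> + H\<^sup>1(\<Omega>; S\<^sub>0)\<close> that equal \<^const>\<open>Q_phi\<close> on \<open>\<partial>\<Omega>\<close> in the sense of traces.\<close>

definition admissible :: "(real^3 \<Rightarrow> real^3^3) \<Rightarrow> bool" where
  "admissible Q \<longleftrightarrow> (\<lambda>x. Q x - Q_inf) \<in> H1 Omega S0 \<and>
     has_trace Omega (\<lambda>x. Q x - Q_inf) (\<lambda>\<omega>. Q_phi \<omega> - Q_inf)"

end

(* In the variable s = 1 + (|x|-1)/eta the rescaled energy on a thin cone is the profile energy times the
solid angle. For finite lam, cut S^2 into pieces on which Q_phi is nearly constant, smooth a nearly optimal
profile for each, and glue them by angular cutoffs; a layer of small thickness in s corrects the boundary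
value. For infinite lam the Modica-Mortola inequality gives D_infty = 2 sqrt k0 (1 - |n_3|) as a lower bound,
attained by uniaxial maps that decay exponentially in stereographic coordinates about e_3. Since Q_phi jumps
at the poles, the extension of the boundary map fades out over distance |x| - 1 from the axis. Arbitrary
Hausdorff measurable U are replaced by Borel hulls: the isodiametric inequality bounds the cone measure by
the Hausdorff measure. *)

theory Submission
  imports Defs
begin

text \<open>One map has to serve every U, where U is merely Caratheodory measurable and nothing is
  known about the measurability of D(Q_phi). Hence all estimates are uniform in U
  (\<open>good_map\<close>), and the integral on the right is approached from below by finitely many
  constants: each piece of a Borel partition has a lower bound d of D, matched there by an energy of
  at most d + eps per solid angle; the remainder of the sphere must carry little energy. The second
  obstacle is the jump at the poles. Only radial derivatives scale like 1/eta; the others blow up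
  like the inverse distance to a pole. The square of that is integrable in dimension three, so they
  add O(eta) to eta times the energy. The weight \<open>kap\<close> records this throughout, also
  for H^1 membership and the trace. Profiles are only Sobolev functions. They are represented by
  increment inequalities, which survive cutting and averaging, and which give the lower bound for
  infinite lam by adding up short increments. Averaging meets the discontinuity of g at 0: the
  potential of the averages is known to converge only where the profile is nonzero.\<close>

notation scaleR (infixr "*R" 75)

syntax
 "_LI" :: "pttrn => ennreal => ennreal" ("(LI _./ _)" 10)
 "_LI_set" :: "pttrn => 'a set => ennreal => ennreal" ("(LI _:_./ _)" [0, 0, 10] 10)
 "_LL" :: "pttrn => ennreal => ennreal" ("(LL _./ _)" 10)
 "_LL_set" :: "pttrn => 'a set => ennreal => ennreal" ("(LL _:_./ _)" [0, 0, 10] 10)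
translations
 "LI x. f" == "CONST nn_integral (CONST lborel) (%x. f)"
 "LI x:A. f" == "CONST set_nn_integral (CONST lborel) A (%x. f)"
 "LL x. f" == "CONST nn_integral (CONST lebesgue) (%x. f)"
 "LL x:A. f" == "CONST set_nn_integral (CONST lebesgue) A (%x. f)"

abbreviation (input) nsq where "nsq x == (norm x)^2"
abbreviation (input) lim_seq (infix "---->" 60) where "X ----> L == (X \<longlongrightarrow> L) sequentially"

section \<open>The isodiametric inequality in the plane\<close>

lemma emeasure_real_diameter_le:
 fixes X :: "real set"
 assumes "0 <= c" "!!x y. x : X ==> y : X ==> \<bar>x - y\<bar> <= c"
 shows "emeasure lborel X <= ennreal c"
proof (cases "X = {}")
 case False
 have "bdd_below X"
 proof -
  obtain x where "x : X" using False by auto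
  hence "x - c <= y" if "y : X" for y using assms(2)[of x y] that by auto
  thus ?thesis by (meson bdd_below.I)
 qed
 have "X <= {Inf X .. Inf X + c}"
 proof
  fix y assume y: "y : X"
  have "y - c <= Inf X"
   by (rule cInf_greatest[OF False]) (use assms(2)[of y] y in fastforce)
  thus "y : {Inf X .. Inf X + c}" using cInf_lower[OF y \<open>bdd_below X\<close>] by auto
 qed
 hence "emeasure lborel X <= emeasure lborel {Inf X .. Inf X + c}" by (intro emeasure_mono) auto
 thus ?thesis using assms(1) by simp
qed auto

lemma quarter_disc_integral:
 fixes d :: real assumes "0 < d"
 shows "((%t. sqrt (d^2 - t^2)) has_integral pi * d^2 / 4) {0..d}"
proof -
 \<comment> \<open>The usual primitive for the half-circle. At t = d it is continuous but the
   derivative formula breaks down, hence the interior form of the fundamental theorem.\<close>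
 define G where "G t = (t * sqrt (d^2 - t^2) + d^2 * arcsin (t / d)) / 2" for t
 have "((%t. sqrt (d^2 - t^2)) has_integral G d - G 0) {0..d}"
 proof (rule fundamental_theorem_of_calculus_interior)
  show "continuous_on {0..d} G"
   unfolding G_def using assms by (intro continuous_intros) (auto simp: field_simps)
  fix t assume t: "t : {0<..<d}"
  have p: "0 < d^2 - t^2" using t assms by (auto simp: power_strict_mono)
  have c: "1 - (t/d)^2 = (d^2 - t^2) / d^2" using assms by (simp add: field_simps)
  have "(G has_real_derivative
    (sqrt (d^2 - t^2) + t * ((0 - 2 * t) * (inverse (sqrt (d^2 - t^2)) / 2)) + d^2 * (inverse (sqrt (1 - (t/d)^2)) * (1/d))) / 2) (at t)"
   unfolding G_def using t assms p
   by (auto intro!: derivative_eq_intros simp: field_simps)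
  moreover have "(sqrt (d^2 - t^2) + t * ((0 - 2 * t) * (inverse (sqrt (d^2 - t^2)) / 2)) + d^2 * (inverse (sqrt (1 - (t/d)^2)) * (1/d))) / 2
    = sqrt (d^2 - t^2)"
  proof -
   define r where "r = sqrt (d^2 - t^2)"
   have r: "r > 0" "r^2 = d^2 - t^2" using p by (auto simp: r_def)
   have "sqrt (1 - (t/d)^2) = r / d" unfolding c r_def using assms by (simp add: real_sqrt_divide)
   thus ?thesis unfolding r_def[symmetric] using r assms
    by (simp add: field_simps power2_eq_square)
  qed
  ultimately show "(G has_vector_derivative sqrt (d^2 - t^2)) (at t)"
   by (simp only: has_real_derivative_iff_has_vector_derivative)
 qed (use assms in auto)
 moreover have "G d - G 0 = pi * d^2 / 4" using assms by (simp add: G_def)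
 ultimately show ?thesis by simp
qed

text \<open>The region \<open>A\<close> under the slice length \<open>l\<close> has the area of K.
  If two slices are both longer than t, they contain points of K that differ by more than t
  vertically, so the slices are at horizontal distance at most sqrt (d^2 - t^2); hence the set where
  l exceeds t has at most this length. Integrating over t gives a quarter of the disc of radius d,
  which is the area of the disc of diameter d.\<close>

lemma isodiametric_compact:
 fixes K :: "(real \<times> real) set"
 assumes K: "compact K" and d: "0 < d" "!!p q. p : K ==> q : K ==> dist p q <= d"
 shows "emeasure lborel K <= ennreal (pi * d^2 / 4)"
proof -
 have Ks[measurable]: "K : sets (lborel \<Otimes>\<^sub>M lborel)"
  using borel_compact[OF K] unfolding lborel_prod by simp
 define l where "l x = emeasure lborel (Pair x -` K)" for x
 have l_meas[measurable]: "l : borel_measurable lborel"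
  unfolding l_def using lborel.measurable_emeasure_Pair[OF Ks] .
 have sl: "compact (Pair x -` K)" for x
 proof (rule compact_eq_bounded_closed[THEN iffD2], rule conjI)
  show "bounded (Pair x -` K)"
  proof -
   have "bounded (snd ` K)" using K by (intro compact_imp_bounded compact_continuous_image continuous_intros)
   moreover have "Pair x -` K <= snd ` K" by force
   ultimately show ?thesis by (rule bounded_subset)
  qed
  show "closed (Pair x -` K)"
   using K by (intro closed_vimage compact_imp_closed continuous_intros)
 qed
 have key: "(x - x')^2 + t^2 <= d^2" if t: "0 < t" "ennreal t < l x" "ennreal t < l x'" for x x' t
 proof -
  have ext: "EX a b. (x,a) : K & (x,b) : K & t < b - a" if "ennreal t < l x" for x
  proof -
   have ne: "Pair x -` K ~= {}" using that unfolding l_def by auto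
   obtain a where a: "a : Pair x -` K" "!!y. y : Pair x -` K ==> a <= y"
    using compact_attains_inf[OF sl ne] by blast
   obtain b where b: "b : Pair x -` K" "!!y. y : Pair x -` K ==> y <= b"
    using compact_attains_sup[OF sl ne] by blast
   have "Pair x -` K <= {a..b}" using a b by auto
   hence "l x <= emeasure lborel {a..b}" unfolding l_def by (intro emeasure_mono) auto
   also have "... = ennreal (b - a)" using a b by auto
   finally have "ennreal t < ennreal (b - a)" using that by simp
   hence "t < b - a" using t(1) by (simp add: ennreal_less_iff)
   thus ?thesis using a b by auto
  qed
  obtain a b where ab: "(x,a) : K" "(x,b) : K" "t < b - a" using ext[OF t(2)] by auto
  obtain a' b' where ab': "(x',a') : K" "(x',b') : K" "t < b' - a'" using ext[OF t(3)] by auto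
  have gen: "(x - x')^2 + t^2 <= d^2" if "(x,u) : K" "(x',v) : K" "t < \<bar>u - v\<bar>" for u v
  proof -
   have "(dist (x,u) (x',v))^2 <= d^2" using d(2)[OF that(1,2)] by (intro power_mono) auto
   hence "(x - x')^2 + (u - v)^2 <= d^2" by (simp add: dist_prod_def dist_real_def)
   moreover have "t^2 <= (u - v)^2" using that(3) t(1) by (metis abs_of_pos less_eq_real_def power2_abs power_mono)
   ultimately show ?thesis by linarith
  qed
  show ?thesis
  \<comment> \<open>The differences b - a' and b' - a add up to (b - a) + (b' - a') > 2 * t, so one
    of them exceeds t.\<close>
  proof (cases "t < b - a'")
   case True thus ?thesis using gen[OF ab(2) ab'(1)] by auto
  next
   case False
   hence "t < b' - a" using ab ab' by linarith
   thus ?thesis using gen[OF ab(1) ab'(2)] by auto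
  qed
 qed
 define A where "A = {p. 0 < snd p & ennreal (snd p) < l (fst p)}"
 have A[measurable]: "A : sets (lborel \<Otimes>\<^sub>M lborel)"
 proof -
  have "A = {p : space (lborel \<Otimes>\<^sub>M lborel). 0 < snd p & ennreal (snd p) < l (fst p)}"
   by (auto simp: A_def space_pair_measure)
  also have "... : sets (lborel \<Otimes>\<^sub>M lborel)" by measurable
  finally show ?thesis .
 qed
 have "emeasure lborel K = (LI x. l x)"
  using lborel.emeasure_pair_measure_alt[OF Ks] by (simp add: lborel_prod l_def)
 also have "... = (LI x. emeasure lborel (Pair x -` A))"
 proof (rule nn_integral_cong)
  fix x :: real
  have fin: "l x < top" unfolding l_def using emeasure_bounded_finite[OF compact_imp_bounded[OF sl]] by simp
  define c where "c = enn2real (l x)"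
  have c: "l x = ennreal c" "0 <= c" using fin by (auto simp: c_def)
  have "Pair x -` A = {0<..<c}" by (auto simp: A_def c ennreal_less_iff)
  thus "l x = emeasure lborel (Pair x -` A)" using c by simp
 qed
 also have "... = (LI t. emeasure lborel ((%x. (x, t)) -` A))"
  using lborel.emeasure_pair_measure_alt[OF A] lborel_pair.emeasure_pair_measure_alt2[OF A] by simp
 also have "... <= (LI t. ennreal (indicator {0..d} t * sqrt (d^2 - t^2)))"
 proof (rule nn_integral_mono)
  fix t :: real
  show "emeasure lborel ((%x. (x, t)) -` A) <= ennreal (indicator {0..d} t * sqrt (d^2 - t^2))"
  proof (cases "(%x. (x, t)) -` A = {}")
   case False
   then obtain x where "ennreal t < l x" and t: "0 < t" by (auto simp: A_def)
   hence "t^2 <= d^2" using key[of t x x] by auto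
   hence td: "t <= d" using d(1) by (metis less_imp_le power2_le_imp_le)
   have "emeasure lborel ((%x. (x, t)) -` A) <= ennreal (sqrt (d^2 - t^2))"
   proof (rule emeasure_real_diameter_le)
    show "\<bar>x - y\<bar> <= sqrt (d^2 - t^2)" if "x : (%x. (x, t)) -` A" "y : (%x. (x, t)) -` A" for x y
     using key[of t x y] that by (intro real_le_rsqrt) (auto simp: A_def)
   qed (use \<open>t^2 <= d^2\<close> in auto)
   thus ?thesis using t td by simp
  qed (auto simp: indicator_def)
 qed
 also have "... = ennreal (pi * d^2 / 4)"
  by (rule nn_integral_has_integral_lebesgue[OF _ quarter_disc_integral[OF d(1)]]) (auto simp: power_mono)
 finally show ?thesis .
qed

section \<open>The cone measure on the sphere\<close>

text \<open>The cone measure: three times the volume of the cone over a set inside the unit ball,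
  i.e. surface area. As a push-forward of volume it turns polar coordinates into a matter of
  scaling.\<close>

definition sph :: "(real^3) measure" where
 "sph = distr (density lborel (%x. 3 * indicator (ball 0 1) x)) borel sgn"

lemma borel_measurable_sgn_vec [measurable]: "(sgn :: real^3 => real^3) : borel_measurable borel"
 unfolding sgn_div_norm[abs_def] by measurable

lemma sets_sph [simp, measurable_cong]: "sets sph = sets borel" by (simp add: sph_def)
lemma space_sph [simp]: "space sph = UNIV" by (simp add: sph_def)

lemma emeasure_sph:
 assumes [measurable]: "B : sets borel"
 shows "emeasure sph B = 3 * emeasure lborel {x : ball 0 1. sgn x : B}"
proof -
 have [measurable]: "sgn -` B : sets (borel :: (real^3) measure)"
  using measurable_sets[OF borel_measurable_sgn_vec assms] by simp
 have "emeasure sph B = (LI x. 3 * indicator {x : ball 0 1. sgn x : B} x)"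
  unfolding sph_def by (subst emeasure_distr, simp, simp, subst emeasure_density)
   (auto intro!: nn_integral_cong simp: indicator_def)
 also have "{x : ball 0 1. sgn x : B} = ball 0 1 Int sgn -` B" by auto
 also have "(LI x. 3 * indicator (ball 0 1 Int sgn -` B) x) = 3 * emeasure lborel (ball 0 1 Int sgn -` B)"
  by (subst nn_integral_cmult_indicator) auto
 also have "ball 0 1 Int sgn -` B = {x : ball 0 1. sgn x : B}" by auto
 finally show ?thesis .
qed

text \<open>Carries Tonelli's theorem from nested pairs over to \<open>real^3\<close>, for slicing
  at a fixed third coordinate.\<close>

lemma distr_vector3:
 "distr (lborel :: ((real \<times> real) \<times> real) measure) borel (%p. vector [fst (fst p), snd (fst p), snd p])
  = (lborel :: (real^3) measure)"
proof (rule lborel_eqI[symmetric])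
 let ?J = "%p :: (real \<times> real) \<times> real. (vector [fst (fst p), snd (fst p), snd p] :: real^3)"
 have [measurable]: "?J : borel \<rightarrow>\<^sub>M borel"
  unfolding borel_measurable_euclidean_space[where f="?J"]
  by (auto simp: Basis_vec_def inner_axis exhaust_3 forall_3 borel_prod[symmetric])
 fix l u :: "real^3" assume lu: "!!b. b : Basis ==> l \<bullet> b <= u \<bullet> b"
 have le: "l $ i <= u $ i" for i
  using lu[of "axis i 1"] by (simp add: inner_axis axis_in_Basis_iff)
 have pre: "?J -` box l u = box ((l$1, l$2), l$3) ((u$1, u$2), u$3)"
 proof (rule set_eqI)
  fix p :: "(real \<times> real) \<times> real"
  obtain a b c where p: "p = ((a, b), c)" by (metis surj_pair)
  have "p : box ((l$1, l$2), l$3) ((u$1, u$2), u$3) \<longleftrightarrow> (l$1 < a & a < u$1) & (l$2 < b & b < u$2) & (l$3 < c & c < u$3)"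
   unfolding p mem_box(1) Basis_prod_def by auto
  thus "p : ?J -` box l u \<longleftrightarrow> p : box ((l$1, l$2), l$3) ((u$1, u$2), u$3)"
   by (auto simp: mem_box_cart forall_3 p)
 qed
 have B: "(\<Prod>b\<in>Basis. (u - l) \<bullet> b) = (u$1 - l$1) * (u$2 - l$2) * (u$3 - l$3)"
 proof -
  have B: "Basis = (%i. axis i (1::real)) ` (UNIV :: 3 set)" by (auto simp: Basis_vec_def)
  have "(\<Prod>b\<in>Basis. (u - l) \<bullet> b) = (\<Prod>i\<in>(UNIV :: 3 set). (u - l) $ i)"
   unfolding B by (subst prod.reindex) (auto simp: inj_on_def axis_eq_axis inner_axis)
  also have "... = (u$1 - l$1) * (u$2 - l$2) * (u$3 - l$3)"
   unfolding UNIV_3 by (subst prod.insert, simp, simp)+ simp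
  finally show ?thesis .
 qed
 have "emeasure (distr lborel borel ?J) (box l u) = emeasure lborel (box ((l$1, l$2), l$3) ((u$1, u$2), u$3))"
  by (subst emeasure_distr) (auto simp: pre)
 also have "... = ennreal ((u$1 - l$1) * (u$2 - l$2) * (u$3 - l$3))"
 proof -
  have "(((u $ 1, u $ 2), u $ 3) - ((l $ 1, l $ 2), l $ 3)) = ((u$1 - l$1, u$2 - l$2), u$3 - l$3)" by simp
  moreover have "(\<Prod>b\<in>Basis. ((x, y), z) \<bullet> b) = x * y * z" for x y z :: real
  proof -
   have B3: "Basis = {((1::real, 0::real), 0::real), ((0, 1), 0), ((0, 0), 1)}"
    by (auto simp: Basis_prod_def zero_prod_def)
   show ?thesis unfolding B3 by (simp add: zero_prod_def)
  qed
  ultimately show ?thesis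
   by (subst emeasure_lborel_box) (auto simp: Basis_prod_def le)
 qed
 finally show "emeasure (distr lborel borel ?J) (box l u) = ennreal (\<Prod>b\<in>Basis. (u - l) \<bullet> b)" by (simp add: B)
qed simp

lemma emeasure_lborel_vec3_slices:
 assumes X: "X : sets borel"
 shows "emeasure lborel X = (LI h. emeasure lborel {p :: real \<times> real. (vector [fst p, snd p, h] :: real^3) : X})"
proof -
 let ?J = "%p :: (real \<times> real) \<times> real. (vector [fst (fst p), snd (fst p), snd p] :: real^3)"
 have J[measurable]: "?J : borel \<rightarrow>\<^sub>M borel"
  unfolding borel_measurable_euclidean_space[where f="?J"]
  by (auto simp: Basis_vec_def inner_axis exhaust_3 forall_3 borel_prod[symmetric])
 have JX: "?J -` X : sets (lborel \<Otimes>\<^sub>M lborel)"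
  using measurable_sets[OF J X] unfolding lborel_prod by simp
 have "emeasure lborel X = emeasure lborel (?J -` X)"
  unfolding distr_vector3[symmetric] using X by (subst emeasure_distr) auto
 also have "... = (LI h. emeasure lborel ((%p. (p, h)) -` (?J -` X)))"
  using lborel_pair.emeasure_pair_measure_alt2[OF JX] by (simp add: lborel_prod)
 finally show ?thesis by (simp add: vimage_def)
qed

lemma emeasure_lborel_scaleR_image:
 fixes S :: "'a::euclidean_space set"
 assumes "compact S"
 shows "emeasure lborel ((%x. c *R x) ` S) = \<bar>c\<bar> ^ DIM('a) * emeasure lborel S"
proof -
 have "compact ((%x. c *R x) ` S)" using assms by (rule compact_scaling)
 thus ?thesis
  using emeasure_lebesgue_affine[of c 0 S] borel_compact[OF assms] borel_compact[of "(%x. c *R x) ` S"]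
  by (simp add: ennreal_power)
qed

abbreviation "e3 \<equiv> (axis 3 1 :: real^3)"

lemma norm_vec3: "nsq (x :: real^3) = (x$1)^2 + (x$2)^2 + (x$3)^2"
 by (simp add: norm_vec_def L2_set_def sum_3)

lemma sgn_mem_sphere_iff: "U <= sphere 0 1 ==> sgn x : U ==> x ~= (0 :: 'a :: real_normed_vector)"
 by auto

text \<open>Gnomonic projection. Let G be the central projection of C to the plane at height 1. The
  part of the cone over C inside the unit ball has heights in [0,1], and its slice at height h lies
  in h *R G. So its volume is at most the integral of h^2 times the area of G, and the cone measure
  of C is at most the area of G, to which the planar inequality applies.\<close>

lemma sph_le_north:
 fixes C :: "(real^3) set"
 assumes C: "compact C" "C <= sphere 0 1" "e3 : C"
  and d: "0 < d" "d <= dl" "dl < 1" "!!v w. v : C ==> w : C ==> dist v w <= d"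
 shows "emeasure sph C <= ennreal (pi * (d * ((1 + dl) / (1 - dl)^2))^2 / 4)"
proof -
 define G where "G = (%v :: real^3. (v$1 / v$3, v$2 / v$3)) ` C"
 \<comment> \<open>A Lipschitz constant for the projection on C: third entries are at least 1 - dl
   and horizontal parts at most dl, so the quotient rule gives 1 / (1 - dl) + dl / (1 - dl)^2, which
   is 1 / (1 - dl)^2; this is rounded up. It tends to 1 with dl.\<close>
 define kappa where "kappa = (1 + dl) / (1 - dl)^2"
 have kappa: "0 < kappa" using d by (simp add: kappa_def)
 have z: "1 - dl <= v$3" "norm (v$1, v$2) <= dl" if "v : C" for v
 proof -
  have n: "norm (v - e3) <= dl" using d(4)[OF that C(3)] d(2) by (simp add: dist_norm)
  show "1 - dl <= v$3" using component_le_norm_cart[of "v - e3" 3] n by simp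
  have "nsq (v$1, v$2) <= nsq (v - e3)"
   unfolding norm_vec3 by (simp add: norm_Pair axis_def)
  thus "norm (v$1, v$2) <= dl" using n by (meson norm_ge_zero order_trans power2_le_imp_le)
 qed
 have z0: "0 < v$3" if "v : C" for v using z(1)[OF that] d by simp
 have cG: "compact G" unfolding G_def
  using C(1) z0 by (intro compact_continuous_image continuous_intros) force+
 have dG: "dist p q <= d * kappa" if pq: "p : G" "q : G" for p q
 proof -
  obtain v w where v: "v : C" "p = (v$1 / v$3, v$2 / v$3)" and w: "w : C" "q = (w$1 / w$3, w$2 / w$3)"
   using pq by (auto simp: G_def)
  define a b where "a = (v$1, v$2)" and "b = (w$1, w$2)"
  have eq: "p - q = (1 / v$3) *R (a - b) + ((w$3 - v$3) / (v$3 * w$3)) *R b"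
   using z0[OF v(1)] z0[OF w(1)] by (simp add: v w a_def b_def field_simps)
  have 1: "norm (a - b) <= d"
  proof -
   have "nsq (a - b) <= nsq (v - w)" unfolding norm_vec3 by (simp add: norm_Pair a_def b_def)
   hence "norm (a - b) <= norm (v - w)" by (meson norm_ge_zero power2_le_imp_le)
   thus ?thesis using d(4)[OF v(1) w(1)] by (simp add: dist_norm)
  qed
  have 2: "\<bar>w$3 - v$3\<bar> <= d"
   using component_le_norm_cart[of "w - v" 3] d(4)[OF w(1) v(1)] by (simp add: dist_norm)
  have i: "1 / v$3 <= 1 / (1 - dl)" "1 / w$3 <= 1 / (1 - dl)"
   using z(1)[OF v(1)] z(1)[OF w(1)] d by (auto intro!: divide_left_mono mult_pos_pos z0[OF v(1)] z0[OF w(1)])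
  have "norm (p - q) <= 1 / v$3 * norm (a - b) + \<bar>w$3 - v$3\<bar> / (v$3 * w$3) * norm b"
   unfolding eq using z0[OF v(1)] z0[OF w(1)] by (intro order_trans[OF norm_triangle_ineq]) (simp add: abs_mult)
  also have "... <= 1 / (1 - dl) * d + (d * (1 / (1 - dl) * (1 / (1 - dl)))) * dl"
  proof (intro add_mono mult_mono)
   have "\<bar>w$3 - v$3\<bar> / (v$3 * w$3) = \<bar>w$3 - v$3\<bar> * (1 / v$3 * (1 / w$3))" by simp
   also have "... <= d * (1 / (1 - dl) * (1 / (1 - dl)))"
    using 2 i z0[OF v(1)] z0[OF w(1)] d by (intro mult_mono) auto
   finally show "\<bar>w$3 - v$3\<bar> / (v$3 * w$3) <= d * (1 / (1 - dl) * (1 / (1 - dl)))" .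
  qed (use 1 i z[OF w(1)] d b_def in auto)
  also have "... <= d * kappa"
  proof -
   have "d * kappa - (1 / (1 - dl) * d + (d * (1 / (1 - dl) * (1 / (1 - dl)))) * dl) = d * dl / (1 - dl)^2"
   proof -
    define e where "e = 1 - dl"
    have "e > 0" "dl = 1 - e" using d by (auto simp: e_def)
    thus ?thesis unfolding kappa_def \<open>dl = 1 - e\<close> by (simp add: field_simps power2_eq_square)
   qed
   moreover have "0 <= d * dl / (1 - dl)^2" using d by simp
   ultimately show ?thesis by linarith
  qed
  finally show ?thesis by (simp add: dist_norm)
 qed
 have aG: "emeasure lborel G <= ennreal (pi * (d * kappa)^2 / 4)"
  by (rule isodiametric_compact[OF cG]) (use dG d kappa in auto)
 let ?X = "{x : ball 0 1. sgn x : C}"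
 have Cb: "C : sets borel" using C(1) by (rule borel_compact)
 have X: "?X : sets borel"
 proof -
  have "?X = ball 0 1 Int (sgn -` C Int space borel)" by auto
  thus ?thesis using measurable_sets[OF borel_measurable_sgn_vec Cb] by simp
 qed
 have "emeasure lborel ?X <= (LI h. ennreal (indicator {0..1} h * h^2) * emeasure lborel G)"
  unfolding emeasure_lborel_vec3_slices[OF X]
 proof (rule nn_integral_mono)
  fix h :: real
  have sub: "{p. vector [fst p, snd p, h] : ?X} <= (if h : {0..1} then (%g. h *R g) ` G else {})"
  proof
   fix p :: "real \<times> real"
   define x :: "real^3" where "x = vector [fst p, snd p, h]"
   assume "p : {p. vector [fst p, snd p, h] : ?X}"
   hence x: "norm x < 1" "sgn x : C" by (auto simp: x_def)
   have xc: "x$1 = fst p" "x$2 = snd p" "x$3 = h" by (auto simp: x_def)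
   have x0: "x ~= 0" using sgn_mem_sphere_iff[OF C(2) x(2)] .
   have xs: "x $ i = norm x * sgn x $ i" for i using x0 by (simp add: sgn_div_norm)
   have v3: "0 < sgn x $ 3" using z0[OF x(2)] .
   have h: "h = norm x * sgn x $ 3" using xs[of 3] xc(3) by simp
   have "h > 0" unfolding h using x0 v3 by simp
   have "\<bar>h\<bar> <= norm x" using component_le_norm_cart[of x 3] xc by simp
   hence h1: "h : {0..1}" using x(1) \<open>h > 0\<close> by auto
   have "fst p = norm x * sgn x $ 1" "snd p = norm x * sgn x $ 2" using xs[of 1] xs[of 2] xc by simp_all
   hence "p = h *R (sgn x $ 1 / sgn x $ 3, sgn x $ 2 / sgn x $ 3)"
    unfolding h using v3 by (simp add: prod_eq_iff)
   hence "p : (%g. h *R g) ` G" unfolding G_def using x(2) by blast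
   thus "p : (if h : {0..1} then (%g. h *R g) ` G else {})" using h1 by simp
  qed
  have "emeasure lborel {p. vector [fst p, snd p, h] : ?X} <= emeasure lborel (if h : {0..1} then (%g. h *R g) ` G else {})"
   by (rule emeasure_mono[OF sub]) (auto intro!: borel_compact compact_scaling cG)
  also have "... = ennreal (indicator {0..1} h * h^2) * emeasure lborel G"
   using emeasure_lborel_scaleR_image[OF cG, of h] by (auto simp: power2_eq_square ennreal_mult)
  finally show "emeasure lborel {p. vector [fst p, snd p, h] : ?X} <= ennreal (indicator {0..1} h * h^2) * emeasure lborel G" .
 qed
 also have "... = ennreal (1/3) * emeasure lborel G"
 proof -
  have "((%h. h^2) has_integral (1/3 - 0 :: real)) {0..1}"
  proof -
   have "((%h. h^2) has_integral ((%h. h^3/3) 1 - (%h. h^3/3) (0 :: real))) {0..1 :: real}"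
   proof (rule fundamental_theorem_of_calculus)
    fix x :: real
    have "((%h. h^3/3) has_real_derivative x^2) (at x within {0..1})"
     by (rule derivative_eq_intros refl | simp)+
    thus "((%h. h^3/3) has_vector_derivative x^2) (at x within {0..1})"
     by (simp only: has_real_derivative_iff_has_vector_derivative)
   qed simp
   thus ?thesis by simp
  qed
  hence "(LI h. ennreal (indicator {0..1} h * h^2)) = ennreal (1/3)"
   by (intro nn_integral_has_integral_lebesgue) auto
  thus ?thesis by (subst nn_integral_multc) simp_all
 qed
 finally have "emeasure sph C <= 3 * (ennreal (1/3) * emeasure lborel G)"
  unfolding emeasure_sph[OF Cb] by (rule mult_left_mono) auto
 also have "... = emeasure lborel G"
 proof -
  have "3 * ennreal (1/3) = 1" using ennreal_mult'[of 3 "1/3"] by simp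
  thus ?thesis by (simp add: mult.assoc[symmetric])
 qed
 finally show ?thesis using aG unfolding kappa_def by (rule order_trans)
qed

lemma emeasure_orthogonal_image:
 fixes f :: "real^3 => real^3"
 assumes "orthogonal_transformation f" "X : sets borel" "f ` X : sets borel" "bounded X"
 shows "emeasure lborel (f ` X) = emeasure lborel X"
proof -
 have X: "X : lmeasurable" using assms(2,4) by (simp add: bounded_set_imp_lmeasurable)
 have "emeasure lebesgue (f ` X) = emeasure lebesgue X"
  using measurable_orthogonal_image[OF assms(1) X] measure_orthogonal_image[OF assms(1) X] X
  by (simp add: emeasure_eq_measure2)
 thus ?thesis using assms(2,3) by simp
qed

lemma borel_cone_ball:
 fixes B :: "(real^3) set"
 assumes "B : sets borel"
 shows "{x : ball 0 R. sgn x : B} : sets borel"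
proof -
 have "{x : ball 0 R. sgn x : B} = ball 0 R Int (sgn -` B Int space borel)" by auto
 thus ?thesis using measurable_sets[OF borel_measurable_sgn_vec assms] by simp
qed

text \<open>Volume is rotation invariant, and a rotation moves some point of C to the north
  pole.\<close>

lemma sph_le_pairwise:
 fixes C :: "(real^3) set"
 assumes C: "compact C" "C <= sphere 0 1"
  and d: "0 < d" "d <= dl" "dl < 1" "!!v w. v : C ==> w : C ==> dist v w <= d"
 shows "emeasure sph C <= ennreal (pi * (d * ((1 + dl) / (1 - dl)^2))^2 / 4)"
proof (cases "C = {}")
 case False
 then obtain c where c: "c : C" by auto
 hence "norm c = norm e3" using C by auto
 then obtain f where f: "orthogonal_transformation f" "f c = e3"
  using rotation_exists[of c e3] by auto
 have n: "norm (f x) = norm x" for x using f(1) by (rule orthogonal_transformation_norm)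
 have lin: "linear f" using f(1) by (rule orthogonal_transformation_linear)
 have di: "dist (f x) (f y) = dist x y" for x y
  using n[of "x - y"] linear_diff[OF lin] by (simp add: dist_norm)
 have inj: "inj f" using f(1) by (rule orthogonal_transformation_inj)
 have sg: "sgn (f x) = f (sgn x)" for x using linear_scale[OF lin] by (simp add: sgn_div_norm n)
 have C': "compact (f ` C)" using C(1) linear_continuous_on[OF linear_conv_bounded_linear[THEN iffD1, OF lin]]
  by (intro compact_continuous_image) (auto intro: continuous_on_subset)
 have "emeasure sph (f ` C) <= ennreal (pi * (d * ((1 + dl) / (1 - dl)^2))^2 / 4)"
 proof (rule sph_le_north[OF C' _ _ d(1-3)])
  show "e3 : f ` C" using c f(2) by (metis imageI)
 qed (use C n di d(4) in auto)
 moreover have "emeasure sph (f ` C) = emeasure sph C"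
 proof -
  have eq: "f ` {x : ball 0 1. sgn x : C} = {x : ball 0 1. sgn x : f ` C}"
  proof (intro equalityI subsetI)
   fix y assume y: "y : {x : ball 0 1. sgn x : f ` C}"
   obtain x where x: "y = f x" using orthogonal_transformation_surj[OF f(1)] by (metis surjD)
   hence "sgn x : C" using y inj by (auto simp: sg inj_image_mem_iff)
   thus "y : f ` {x : ball 0 1. sgn x : C}" using x y n by auto
  qed (auto simp: n sg)
  have "emeasure lborel (f ` {x : ball 0 1. sgn x : C}) = emeasure lborel {x : ball 0 1. sgn x : C}"
   by (rule emeasure_orthogonal_image[OF f(1)])
    (auto simp only: eq borel_cone_ball borel_compact C' C(1) intro: bounded_subset[OF bounded_ball[of 0 1]])
  thus ?thesis
   unfolding emeasure_sph[OF borel_compact[OF C']] emeasure_sph[OF borel_compact[OF C(1)]] eq by (rule arg_cong)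
 qed
 ultimately show ?thesis by simp
qed simp

text \<open>A limit from strictly larger d: a one-point set has diameter 0, while the planar
  inequality wants 0 < d.\<close>

lemma sph_le_diameter:
 fixes C :: "(real^3) set"
 assumes C: "compact C" "C <= sphere 0 1" and d: "diameter C < dl" "dl < 1"
 shows "emeasure sph C <= ennreal (((1 + dl) / (1 - dl)^2)^2 * (pi * (diameter C / 2)^2))"
proof -
 let ?k = "(1 + dl) / (1 - dl)^2"
 have d0: "0 <= diameter C" by (rule diameter_ge_0) (use C compact_imp_bounded in auto)
 have ev: "\<forall>\<^sub>F t in at_right 0. 0 < t & diameter C + t <= dl"
  using eventually_at_right_real[of 0 "dl - diameter C"] d by (auto elim!: eventually_mono)
 have "((%t. ennreal (pi * ((diameter C + t) * ?k)^2 / 4)) \<longlongrightarrow> ennreal (pi * ((diameter C + 0) * ?k)^2 / 4)) (at_right 0)"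
  by (intro tendsto_intros) simp_all
 hence "emeasure sph C <= ennreal (pi * ((diameter C + 0) * ?k)^2 / 4)"
 proof (rule tendsto_lowerbound)
  show "\<forall>\<^sub>F t in at_right 0. emeasure sph C <= ennreal (pi * ((diameter C + t) * ?k)^2 / 4)"
   using ev
  proof eventually_elim
   case (elim t)
   show ?case
   proof (rule sph_le_pairwise[OF C])
    fix v w assume "v : C" "w : C"
    thus "dist v w <= diameter C + t"
     using diameter_bounded_bound[OF compact_imp_bounded[OF C(1)]] elim by fastforce
   qed (use elim d d0 in auto)
  qed
 qed simp
 also have "pi * ((diameter C + 0) * ?k)^2 / 4 = ?k^2 * (pi * (diameter C / 2)^2)"
  by (simp add: power_mult_distrib power_divide)
 finally show ?thesis .
qed

lemma emeasure_sph_finite: "emeasure sph B < \<infinity>"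
proof -
 have "emeasure sph B <= emeasure sph UNIV" by (rule emeasure_mono) auto
 also have "... = 3 * emeasure lborel (ball (0 :: real^3) 1)"
  by (subst emeasure_sph) (auto simp: ball_def)
 also have "... < \<infinity>"
  using emeasure_bounded_finite[OF bounded_ball[of "0 :: real^3" 1]] by (simp add: ennreal_mult_less_top)
 finally show ?thesis .
qed

lemma finite_measure_sph: "finite_measure sph"
 using emeasure_sph_finite[of UNIV] by (intro finite_measureI) auto

text \<open>This is the comparison that makes energy bounds in terms of volumes of cones into bounds in
 terms of \<open>\<H>^2\<close>: only the isodiametric direction is needed.\<close>

lemma sph_hausdorff_hull:
 fixes U :: "(real^3) set"
 assumes U: "U <= sphere 0 1" and fin: "hausdorff_outer 2 U < \<infinity>" and e: "0 < e"
 obtains B where "B : sets borel" "U <= B" "B <= sphere 0 1" "emeasure sph B <= hausdorff_outer 2 U + ennreal e"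
proof -
 define h where "h = enn2real (hausdorff_outer 2 U)"
 have h: "hausdorff_outer 2 U = ennreal h" "0 <= h" using fin by (auto simp: h_def)
 let ?k = "%dl :: real. ((1 + dl) / (1 - dl)^2)^2"
 \<comment> \<open>Half of e pays for a near-optimal cover, the other half for the distortion factor
   of \<open>sph_le_diameter\<close>, which tends to 1 with dl.\<close>
 have "((%dl. ?k dl * (h + e/2)) \<longlongrightarrow> ((1 + 0) / (1 - 0)^2)^2 * (h + e/2)) (at_right 0)"
  by (intro tendsto_intros) auto
 hence "\<forall>\<^sub>F dl in at_right 0. ?k dl * (h + e/2) < h + e"
  by (rule order_tendstoD) (use e in auto)
 moreover have "\<forall>\<^sub>F dl in at_right 0. dl : {0<..<1 :: real}" by (rule eventually_at_right_real) simp
 ultimately have "\<forall>\<^sub>F dl in at_right 0. ?k dl * (h + e/2) < h + e & dl : {0<..<1}" by (rule eventually_conj)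
 then obtain dl where dl: "?k dl * (h + e/2) < h + e" "0 < dl" "dl < 1"
  using eventually_happens by fastforce
 have "hausdorff_pre 2 (dl/2) U <= hausdorff_outer 2 U"
  unfolding hausdorff_outer_def using dl by (intro SUP_upper) auto
 also have "... < ennreal (h + e/2)" using h e by (simp add: ennreal_less_iff)
 finally obtain C :: "nat => (real^3) set" where C: "U <= (\<Union>i. C i)" "!!i. bounded (C i)" "!!i. diameter (C i) <= dl/2"
  "(\<Sum>i. hausdorff_weight 2 (C i)) < ennreal (h + e/2)"
  unfolding hausdorff_pre_def INF_less_iff by auto
 \<comment> \<open>Closing the covering sets and cutting them down to the sphere makes them compact
   without enlarging the diameter, which stays at most dl/2 < dl.\<close>
 define B where "B i = closure (C i) Int sphere 0 1" for i
 have cB: "compact (B i)" for i unfolding B_def using C(2) by (simp add: closed_Int_compact)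
 have BC: "emeasure sph (B i) <= ennreal (?k dl) * hausdorff_weight 2 (C i)" for i
 proof (cases "C i = {}")
  case False
  have d: "diameter (B i) <= diameter (C i)"
  proof -
   have "diameter (B i) <= diameter (closure (C i))"
    using C(2) by (intro diameter_subset) (auto simp: B_def)
   thus ?thesis using diameter_closure[OF C(2)[of i]] by simp
  qed
  have d0: "0 <= diameter (B i)" using cB compact_imp_bounded by (intro diameter_ge_0) blast
  have "emeasure sph (B i) <= ennreal (?k dl * (pi * (diameter (B i) / 2)^2))"
   by (rule sph_le_diameter[OF cB]) (use d C(3)[of i] dl B_def in auto)
  also have "... <= ennreal (?k dl * (pi * (diameter (C i) / 2)^2))"
   using d d0 by (intro ennreal_leI mult_left_mono power_mono) auto
  also have "... = ennreal (?k dl) * hausdorff_weight 2 (C i)"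
   using False by (simp add: hausdorff_weight_def unit_ball_vol_2 ennreal_mult')
  finally show ?thesis .
 qed (simp add: B_def)
 have "emeasure sph (\<Union>i. B i) <= (\<Sum>i. emeasure sph (B i))"
  by (rule emeasure_subadditive_countably) (auto intro: borel_compact cB)
 also have "... <= (\<Sum>i. ennreal (?k dl) * hausdorff_weight 2 (C i))"
  by (intro suminf_le BC) auto
 also have "... = ennreal (?k dl) * (\<Sum>i. hausdorff_weight 2 (C i))" by (rule ennreal_suminf_cmult)
 also have "... <= ennreal (?k dl) * ennreal (h + e/2)" using C(4) by (intro mult_left_mono) auto
 also have "... = ennreal (?k dl * (h + e/2))" using h e by (simp add: ennreal_mult)
 also have "... <= ennreal (h + e)" using dl(1) by (intro ennreal_leI) simp
 also have "... = hausdorff_outer 2 U + ennreal e" using h e by simp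
 finally have "emeasure sph (\<Union>i. B i) <= hausdorff_outer 2 U + ennreal e" .
 moreover have "U <= (\<Union>i. B i)"
 proof
  fix x assume x: "x : U"
  then obtain i where "x : C i" using C(1) by auto
  thus "x : (\<Union>i. B i)" using x U closure_subset[of "C i"] by (auto simp: B_def)
 qed
 ultimately show thesis
  using that[of "\<Union>i. B i"] by (auto simp: B_def intro!: sets.countable_UN borel_closed)
qed

section \<open>Polar coordinates\<close>

lemma emeasure_cone_ball:
 fixes B :: "(real^3) set"
 assumes B: "B : sets borel" "B <= sphere 0 1" and R: "0 <= R"
 shows "emeasure lborel {x : ball 0 R. sgn x : B} = ennreal (R^3/3) * emeasure sph B"
proof (cases "R = 0")
 case False
 hence R: "R > 0" using R by simp
 let ?X = "%R. {x : ball 0 R. sgn x : B}"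
 have eq: "?X R = (%x. R *R x + 0) ` ?X 1"
 proof (intro equalityI subsetI)
  fix x assume x: "x : ?X R"
  have "x = R *R (x /\<^sub>R R) + 0" using R by simp
  moreover have "x /\<^sub>R R : ?X 1" using x R by (auto simp: sgn_scaleR field_simps)
  ultimately show "x : (%x. R *R x + 0) ` ?X 1" by blast
 qed (use R in "auto simp: sgn_scaleR abs_mult field_simps")
 have "emeasure lebesgue (?X R) = \<bar>R\<bar> ^ DIM(real^3) * emeasure lebesgue (?X 1)"
  unfolding eq by (rule emeasure_lebesgue_affine)
 hence "emeasure lborel (?X R) = ennreal (R^3) * emeasure lborel (?X 1)"
  using R borel_cone_ball[OF B(1), of R] borel_cone_ball[OF B(1), of 1] by (simp add: ennreal_power)
 also have "... = ennreal (R^3/3) * emeasure sph B"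
 proof -
  have "ennreal (R^3/3) * 3 = ennreal (R^3)" using ennreal_mult''[of 3 "R^3/3"] R by simp
  thus ?thesis by (simp add: emeasure_sph[OF B(1)] mult.assoc[symmetric])
 qed
 finally show ?thesis .
qed simp

lemma has_integral_square:
 fixes a b :: real assumes "a <= b"
 shows "((%r. r^2) has_integral (b^3/3 - a^3/3)) {a..b}"
proof (rule fundamental_theorem_of_calculus[OF assms])
 fix x :: real
 have "((%h. h^3/3) has_real_derivative x^2) (at x within {a..b})"
  by (rule derivative_eq_intros refl | simp)+
 thus "((%h. h^3/3) has_vector_derivative x^2) (at x within {a..b})"
  by (simp only: has_real_derivative_iff_has_vector_derivative)
qed

text \<open>The push-forward \<open>M\<close> of volume on the cone under \<open>norm\<close> and
  the measure \<open>N\<close> with density proportional to r^2 are finite on half-lines and agree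
  there by \<open>emeasure_cone_ball\<close>; hence they are equal.\<close>

lemma nn_integral_cone_radial:
 fixes B :: "(real^3) set" and F :: "real => ennreal"
 assumes B: "B : sets borel" "B <= sphere 0 1" and F[measurable]: "F : borel_measurable borel"
 shows "(LI x:{x : ball 0 R. sgn x : B}. F (norm x))
  = emeasure sph B * (LI r:{0<..<R}. F r * ennreal (r^2))"
proof -
 let ?X = "{x : ball 0 R. sgn x : B}"
 note [measurable] = borel_cone_ball[OF B(1), of R]
 have im: "(indicator ?X :: _ => ennreal) : borel_measurable borel" by measurable
 define M where "M = distr (density lborel (indicator ?X)) borel norm"
 define N where "N = density lborel (%r. emeasure sph B * (ennreal (r^2) * indicator {0<..<R} r))"
 have M: "emeasure M A = emeasure lborel {x : ?X. norm x : A}" if [measurable]: "A : sets borel" for A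
 proof -
  have "emeasure M A = (LI x. indicator ?X x * indicator (norm -` A) x)"
   unfolding M_def by (subst emeasure_distr, simp, simp, subst emeasure_density) (auto intro!: measurable_sets_borel[of norm borel] simp: im[simplified])
  also have "... = (LI x. indicator {x : ?X. norm x : A} x)"
   by (intro nn_integral_cong) (auto simp: indicator_def)
  also have "... = emeasure lborel {x : ?X. norm x : A}"
  proof (rule nn_integral_indicator)
   have "{x : ?X. norm x : A} = ?X Int (norm -` A Int space borel)" by auto
   also have "... : sets borel" by measurable
   finally show "{x : ?X. norm x : A} : sets lborel" by simp
  qed
  finally show ?thesis .
 qed
 have MN: "emeasure M {t<..} = emeasure N {t<..}" for t
 proof -
  \<comment> \<open>Norms are nonnegative, so a half-line that starts below 0 cuts off
    nothing.\<close>
  define a where "a = max t 0"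
  have "emeasure N {t<..} = (LI r. emeasure sph B * (ennreal (r^2) * indicator {a<..<R} r))"
   unfolding N_def by (subst emeasure_density) (auto intro!: nn_integral_cong simp: indicator_def a_def)
  also have "... = emeasure sph B * (LI r. ennreal (r^2) * indicator {a<..<R} r)"
   by (rule nn_integral_cmult) auto
  finally have N: "emeasure N {t<..} = emeasure sph B * (LI r. ennreal (r^2) * indicator {a<..<R} r)" .
  show ?thesis
  proof (cases "a < R")
   case False
   have "~ (norm x < R & t < norm x)" for x :: "real^3"
    using False norm_ge_zero[of x] unfolding a_def by linarith
   hence e: "{x : ?X. norm x : {t<..}} = {}" by auto
   have "emeasure M {t<..} = 0" using M[of "{t<..}"] unfolding e by simp
   moreover have "{a<..<R} = {}" using False by auto
   ultimately show ?thesis unfolding N by simp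
  next
   case True
   have "(LI r. ennreal (r^2) * indicator {a<..<R} r) = (LI r. ennreal (indicator {a..R} r * r^2))"
   proof (rule nn_integral_cong_AE)
    show "AE r in lborel. ennreal (r^2) * indicator {a<..<R} r = ennreal (indicator {a..R} r * r^2)"
     using AE_lborel_singleton[of a] AE_lborel_singleton[of R]
     by eventually_elim (auto simp: indicator_def)
   qed
   also have "... = ennreal (R^3/3 - a^3/3)"
    by (rule nn_integral_has_integral_lebesgue[OF _ has_integral_square]) (use True in auto)
   finally have N': "emeasure N {t<..} = emeasure sph B * ennreal (R^3/3 - a^3/3)" using N by simp
   let ?Y = "{x : ball 0 a. sgn x : B}"
   have "?X - ?Y : sets borel" using borel_cone_ball[OF B(1)] by auto
   have "emeasure lborel {x : ?X. norm x : {t<..}} = emeasure lborel (?X - ?Y)"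
   proof (rule emeasure_eq_AE)
    have "negligible (sphere (0 :: real^3) a)" by (rule negligible_sphere)
    hence "AE x in lborel. norm (x :: real^3) ~= a"
     by (auto simp: negligible_iff_null_sets AE_completion_iff dest!: AE_not_in)
    thus "AE x in lborel. x : {x : ?X. norm x : {t<..}} \<longleftrightarrow> x : ?X - ?Y"
    proof eventually_elim
     case (elim x)
     have "x ~= 0" if "sgn x : B" using sgn_mem_sphere_iff[OF B(2) that] .
     hence "t < norm x \<longleftrightarrow> ~ norm x < a" if "sgn x : B"
      using elim that norm_ge_zero[of x] zero_less_norm_iff[of x] unfolding a_def by linarith
     thus ?case by auto
    qed
    show "{x : ?X. norm x : {t<..}} : sets lborel"
    proof -
     have "{x : ?X. norm x : {t<..}} = ?X Int (norm -` {t<..} Int space borel)" by auto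
     also have "... : sets borel" by measurable
     finally show ?thesis by simp
    qed
   qed (use \<open>?X - ?Y : sets borel\<close> in auto)
   also have "... = emeasure lborel ?X - emeasure lborel ?Y"
   proof (rule emeasure_Diff)
    have "emeasure lborel ?Y <= emeasure lborel (ball (0::real^3) a)" by (rule emeasure_mono) auto
    also have "... < \<infinity>" by (rule emeasure_bounded_finite) simp
    finally show "emeasure lborel ?Y ~= \<infinity>" by simp
   qed (use True borel_cone_ball[OF B(1)] in auto)
   also have "... = ennreal (R^3/3) * emeasure sph B - ennreal (a^3/3) * emeasure sph B"
    using emeasure_cone_ball[OF B, of R] emeasure_cone_ball[OF B, of a] True by (simp add: a_def)
   also have "... = emeasure sph B * ennreal (R^3/3 - a^3/3)"
   proof -
    obtain s where s: "emeasure sph B = ennreal s" "0 <= s"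
     using emeasure_sph_finite[of B] by (metis ennreal_cases infinity_ennreal_def less_irrefl)
    have "0 <= a" by (simp add: a_def)
    thus ?thesis using True s
     by (simp add: s ennreal_mult'[symmetric] ennreal_minus power_mono field_simps)
   qed
   finally show ?thesis unfolding N' by (subst M) simp_all
  qed
 qed
 have "M = N"
 proof (rule measure_eqI_lessThan)
  fix t
  have "emeasure M {t<..} <= emeasure lborel (ball (0::real^3) R)"
   by (subst M) (auto intro!: emeasure_mono)
  also have "... < \<infinity>" by (rule emeasure_bounded_finite) simp
  finally show "emeasure M {t<..} < \<infinity>" .
  show "emeasure M {t<..} = emeasure N {t<..}" by (rule MN)
 qed (simp_all add: M_def N_def)
 have "(LI x:?X. F (norm x)) = (\<integral>\<^sup>+r. F r \<partial>M)"
  unfolding M_def by (subst nn_integral_distr, simp, simp, subst nn_integral_density) (auto simp: mult.commute im[simplified])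
 also have "... = (LI r. emeasure sph B * (F r * ennreal (r^2) * indicator {0<..<R} r))"
  unfolding \<open>M = N\<close> N_def by (subst nn_integral_density) (auto simp: mult_ac)
 also have "... = emeasure sph B * (LI r:{0<..<R}. F r * ennreal (r^2))"
  by (rule nn_integral_cmult) auto
 finally show ?thesis .
qed

section \<open>Borel sets are Hausdorff measurable\<close>

lemma hausdorff_pre_antimono:
 assumes "dl <= dl'" shows "hausdorff_pre s dl' A <= hausdorff_pre s dl A"
 unfolding hausdorff_pre_def by (intro INF_superset_mono) (auto intro: order_trans[OF _ assms])

lemma hausdorff_outer_mono: "A <= B ==> hausdorff_outer s A <= hausdorff_outer s B"
 unfolding hausdorff_outer_def by (intro SUP_mono') (rule hausdorff_pre_mono)

text \<open>\<open>countably_subadditive\<close> speaks of disjoint families only; disjointification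
  lifts the restriction.\<close>

lemma hausdorff_outer_UN:
 fixes A :: "nat => 'a::metric_space set"
 shows "hausdorff_outer s (\<Union>n. A n) <= (\<Sum>n. hausdorff_outer s (A n))"
proof -
 have "hausdorff_outer s (\<Union>n. disjointed A n) <= (\<Sum>n. hausdorff_outer s (disjointed A n))"
  using outer_measure_space_hausdorff_outer[of s] disjoint_family_disjointed[of A]
  unfolding outer_measure_space_def countably_subadditive_def by auto
 also have "... <= (\<Sum>n. hausdorff_outer s (A n))"
  by (intro suminf_le hausdorff_outer_mono disjointed_subset) auto
 finally show ?thesis by (simp add: UN_disjointed_eq)
qed

lemma hausdorff_outer_empty [simp]: "hausdorff_outer s {} = 0"
 using outer_measure_space_hausdorff_outer[of s] unfolding outer_measure_space_def positive_def by auto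

lemma hausdorff_outer_Un:
 "hausdorff_outer s (A Un B) <= hausdorff_outer s A + hausdorff_outer s (B :: 'a::metric_space set)"
proof -
 let ?f = "%n. if n = 0 then A else if n = Suc 0 then B else {}"
 have "A Un B = (\<Union>n. ?f n)" by (auto split: if_splits)
 hence "hausdorff_outer s (A Un B) <= (\<Sum>n. hausdorff_outer s (?f n))" using hausdorff_outer_UN[of s ?f] by simp
 also have "... = (SUM n:{0, 1}. hausdorff_outer s (?f n))" by (rule suminf_finite) auto
 finally show ?thesis by simp
qed

text \<open>A covering set of diameter at most dl cannot meet both A and B, so a cover of the union
  splits into a cover of A and a cover of B.\<close>

lemma hausdorff_pre_separated:
 fixes A B :: "'a::metric_space set"
 assumes sep: "!!a b. a : A ==> b : B ==> dl < dist a b" and d: "0 <= dl"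
 shows "hausdorff_pre s dl A + hausdorff_pre s dl B <= hausdorff_pre s dl (A Un B)"
 unfolding hausdorff_pre_def[of s dl "A Un B"]
proof (rule INF_greatest)
 fix C :: "nat => 'a set"
 assume "C : {C. A Un B <= \<Union> (range C) & (ALL i. bounded (C i) & diameter (C i) <= dl)}"
 hence C: "A Un B <= \<Union> (range C)" "!!i. bounded (C i)" "!!i. diameter (C i) <= dl" by auto
 define P where "P X i = (if C i Int X = {} then {} else C i)" for X i
 have pre: "hausdorff_pre s dl X <= (\<Sum>i. hausdorff_weight s (P X i))" if "X <= A Un B" for X
  unfolding hausdorff_pre_def
 proof (rule INF_lower, safe)
  fix x assume "x : X"
  hence "x : A Un B" using \<open>X <= A Un B\<close> by auto
  then obtain i where "x : C i" using C(1) by auto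
  hence "x : P X i" using \<open>x : X\<close> by (auto simp: P_def)
  thus "x : \<Union> (range (P X))" by auto
 next
  fix i show "bounded (P X i)" "diameter (P X i) <= dl" using C d by (auto simp: P_def diameter_empty)
 qed
 have w: "hausdorff_weight s (P A i) + hausdorff_weight s (P B i) <= hausdorff_weight s (C i)" for i
 proof (cases "C i Int A ~= {} & C i Int B ~= {}")
  case True
  then obtain a b where "a : A" "b : B" "a : C i" "b : C i" by auto
  thus ?thesis using sep[of a b] diameter_bounded_bound[OF C(2)[of i], of a b] C(3)[of i] by force
 qed (auto simp: P_def hausdorff_weight_def)
 have "hausdorff_pre s dl A + hausdorff_pre s dl B <= (\<Sum>i. hausdorff_weight s (P A i)) + (\<Sum>i. hausdorff_weight s (P B i))"
  by (intro add_mono pre) auto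
 also have "... = (\<Sum>i. hausdorff_weight s (P A i) + hausdorff_weight s (P B i))" by (rule suminf_add) auto
 also have "... <= (\<Sum>i. hausdorff_weight s (C i))" by (intro suminf_le w) auto
 finally show "hausdorff_pre s dl A + hausdorff_pre s dl B <= (\<Sum>i. hausdorff_weight s (C i))" .
qed

text \<open>This is the hypothesis of Caratheodory's criterion for metric outer measures. The two
  suprema are compared at a common scale below dl, the premeasure being larger at smaller
  scales.\<close>

lemma hausdorff_outer_separated:
 fixes A B :: "'a::metric_space set"
 assumes sep: "!!a b. a : A ==> b : B ==> dl < dist a b" and d: "0 < dl"
 shows "hausdorff_outer s A + hausdorff_outer s B <= hausdorff_outer s (A Un B)"
proof -
 have *: "hausdorff_pre s x A + hausdorff_pre s y B <= hausdorff_outer s (A Un B)" if "0 < x" "0 < y" for x y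
 proof -
  define m where "m = min dl (min x y)"
  have m: "0 < m" "m <= dl" "m <= x" "m <= y" using that d by (auto simp: m_def)
  have "hausdorff_pre s x A + hausdorff_pre s y B <= hausdorff_pre s m A + hausdorff_pre s m B"
   using m by (intro add_mono hausdorff_pre_antimono) auto
  also have "... <= hausdorff_pre s m (A Un B)"
   using sep m by (intro hausdorff_pre_separated) force+
  also have "... <= hausdorff_outer s (A Un B)" unfolding hausdorff_outer_def using m by (intro SUP_upper) auto
  finally show ?thesis .
 qed
 have ne: "{0<..} ~= ({} :: real set)" by auto
 have "hausdorff_pre s x A + hausdorff_outer s B <= hausdorff_outer s (A Un B)" if "0 < x" for x
  unfolding hausdorff_outer_def[of s B] ennreal_SUP_add_right[OF ne]
  using * that by (intro SUP_least) auto
 thus ?thesis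
  unfolding hausdorff_outer_def[of s A] ennreal_SUP_add_left[OF ne, symmetric] by (intro SUP_least) auto
qed

text \<open>Caratheodory's argument. The part of A outside F is exhausted by the sets
  \<open>G n\<close> of points at distance at least 1/(n+1) from F, for which additivity is known.
  What \<open>G n\<close> misses is a union of thin shells \<open>R k\<close>. Shells of equal
  parity have positive distance from each other, so their measures sum to at most that of A; the
  series over all shells converges and its tails vanish.\<close>

lemma closed_in_hausdorff:
 fixes F :: "'a::metric_space set"
 assumes F: "closed F"
 shows "F : sets (hausdorff_measure s)"
proof -
 let ?mu = "hausdorff_outer s :: 'a set => ennreal"
 have main: "?mu (A Int F) + ?mu (A - F) <= ?mu A" if fin: "?mu A < \<infinity>" and ne: "F ~= {}" for A
 proof -
  define G where "G n = {x : A. 1 / (real n + 1) <= infdist x F}" for n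
  define R where "R n = {x : A. 1 / (real n + 2) <= infdist x F & infdist x F < 1 / (real n + 1)}" for n
  have id: "infdist x F <= infdist y F + dist x y" for x y by (metis add.commute infdist_triangle)
  have G: "?mu (A Int F) + ?mu (G n) <= ?mu A" for n
  proof -
   have "?mu (A Int F) + ?mu (G n) <= ?mu ((A Int F) Un G n)"
   proof (rule hausdorff_outer_separated)
    fix a b assume "a : A Int F" "b : G n"
    hence "1 / (real n + 1) <= dist a b"
     using infdist_le[of a F b] by (auto simp: G_def dist_commute intro: order_trans)
    moreover have "1 / (real n + 2) < 1 / (real n + 1)" by (simp add: field_simps)
    ultimately show "1 / (real n + 2) < dist a b" by linarith
   qed simp
   also have "... <= ?mu A" by (rule hausdorff_outer_mono) (auto simp: G_def)
   finally show ?thesis .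
  qed
  have alt: "(\<Sum>k<n. ?mu (R (2*k+p))) <= ?mu (\<Union>k<n. R (2*k+p))" for n p
  proof (induction n)
   case (Suc n)
   have "(\<Sum>k<Suc n. ?mu (R (2*k+p))) <= ?mu (\<Union>k<n. R (2*k+p)) + ?mu (R (2*n+p))"
    using Suc by (simp add: add_right_mono)
   also have "... <= ?mu ((\<Union>k<n. R (2*k+p)) Un R (2*n+p))"
   proof (cases "2*n+p = 0")
    case False
    define m where "m = 2*n+p"
    have m0: "m > 0" using False by (simp add: m_def)
    show ?thesis unfolding m_def[symmetric]
    proof (rule hausdorff_outer_separated)
     fix a b assume "a : (\<Union>k<n. R (2*k+p))" and b: "b : R m"
     then obtain k where k: "k < n" "a : R (2*k+p)" by auto
     have "1 / real m <= 1 / (real (2*k+p) + 2)"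
      using k(1) m0 by (intro divide_left_mono) (auto simp: m_def)
     hence "1 / real m <= infdist a F" using k(2) by (auto simp: R_def)
     moreover have "infdist b F < 1 / (real m + 1)" using b by (auto simp: R_def)
     ultimately show "1 / real m - 1 / (real m + 1) < dist a b" using id[of a b] by linarith
    qed (use m0 in "simp add: frac_less2")
   qed auto
   also have "(\<Union>k<n. R (2*k+p)) Un R (2*n+p) = (\<Union>k<Suc n. R (2*k+p))" by (auto simp: lessThan_Suc)
   finally show ?case .
  qed simp
  have altA: "(\<Sum>k<n. ?mu (R (2*k+p))) <= ?mu A" for n p
   by (rule order_trans[OF alt hausdorff_outer_mono]) (auto simp: R_def)
  have "(\<Sum>k<2*n. ?mu (R k)) <= ?mu A + ?mu A" for n
  proof -
   have "(\<Sum>k<2*n. ?mu (R k)) = (\<Sum>k<n. ?mu (R (2*k+0))) + (\<Sum>k<n. ?mu (R (2*k+1)))"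
    by (induction n) (auto simp: algebra_simps)
   also have "... <= ?mu A + ?mu A" by (intro add_mono altA)
   finally show ?thesis .
  qed
  moreover have "(\<Sum>k<n. ?mu (R k)) <= (\<Sum>k<2*n. ?mu (R k))" for n by (intro sum_mono2) auto
  ultimately have "(\<Sum>k<n. ?mu (R k)) <= ?mu A + ?mu A" for n by (meson order_trans)
  hence "(\<Sum>k. ?mu (R k)) <= ?mu A + ?mu A" unfolding suminf_eq_SUP by (intro SUP_least) auto
  hence sfin: "(\<Sum>k. ?mu (R k)) < \<infinity>" using fin by (simp add: less_top order_le_less_trans)
  \<comment> \<open>Adding the partial sum to both sides expresses that the tails tend to 0 without
    subtracting extended reals.\<close>
  have step: "?mu (A Int F) + ?mu (A - F) + (\<Sum>k<n. ?mu (R k)) <= ?mu A + (\<Sum>k. ?mu (R k))" for n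
  proof -
   have sub: "A - F <= G n Un (\<Union>k. R (k + n))"
   proof
    fix x assume x: "x : A - F"
    have pos: "0 < infdist x F" using x F ne by (simp add: infdist_pos_not_in_closed)
    show "x : G n Un (\<Union>k. R (k + n))"
    proof (cases "x : G n")
     case False
     obtain N where "inverse (real (Suc N)) < infdist x F" using reals_Archimedean[OF pos] by auto
     hence N: "1 / (real N + 1) <= infdist x F" by (simp add: inverse_eq_divide add.commute)
     define K where "K = (LEAST N. 1 / (real N + 1) <= infdist x F)"
     have K: "1 / (real K + 1) <= infdist x F" unfolding K_def by (rule LeastI[of _ N]) (rule N)
     have "n < K"
     proof (rule ccontr)
      assume "~ n < K"
      hence "1 / (real n + 1) <= 1 / (real K + 1)" by (intro divide_left_mono) auto
      thus False using False x K by (auto simp: G_def)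
     qed
     have "~ (1 / (real (K - 1) + 1) <= infdist x F)"
      unfolding K_def by (rule not_less_Least) (use \<open>n < K\<close> K_def in auto)
     hence "x : R ((K - 1 - n) + n)"
      using \<open>n < K\<close> K x by (auto simp: R_def of_nat_diff add.commute)
     thus ?thesis by blast
    qed auto
   qed
   have "?mu (A - F) <= ?mu (G n) + ?mu (\<Union>k. R (k + n))"
    by (rule order_trans[OF hausdorff_outer_mono[OF sub] hausdorff_outer_Un])
   also have "... <= ?mu (G n) + (\<Sum>k. ?mu (R (k + n)))"
    by (intro add_left_mono hausdorff_outer_UN)
   finally have "?mu (A Int F) + ?mu (A - F) + (\<Sum>k<n. ?mu (R k))
    <= (?mu (A Int F) + ?mu (G n)) + ((\<Sum>k. ?mu (R (k + n))) + (\<Sum>k<n. ?mu (R k)))"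
    by (auto simp: add.assoc intro!: add_mono)
   also have "(\<Sum>k. ?mu (R (k + n))) + (\<Sum>k<n. ?mu (R k)) = (\<Sum>k. ?mu (R k))"
    by (rule suminf_offset[symmetric]) simp
   finally show ?thesis using G[of n] by (meson add_right_mono order_trans)
  qed
  have "?mu (A Int F) + ?mu (A - F) + (\<Sum>k. ?mu (R k)) <= ?mu A + (\<Sum>k. ?mu (R k))"
   unfolding suminf_eq_SUP[of "%k. ?mu (R k)"]
   by (subst ennreal_SUP_add_right) (auto intro!: SUP_least step[unfolded suminf_eq_SUP])
  thus ?thesis using sfin ennreal_add_left_cancel_le[of "\<Sum>k. ?mu (R k)"] by (auto simp: add.commute)
 qed
 have "?mu (A Int F) + ?mu (A - F) = ?mu A" for A
 proof (rule antisym)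
  show "?mu (A Int F) + ?mu (A - F) <= ?mu A"
   using main[of A] by (cases "?mu A < \<infinity>"; cases "F = {}") (auto simp: not_less top_unique)
  show "?mu A <= ?mu (A Int F) + ?mu (A - F)"
   using hausdorff_outer_Un[of s "A Int F" "A - F"] by (simp add: Int_Diff_Un)
 qed
 thus ?thesis
  unfolding sets_hausdorff_measure using algebra.lambda_system_eq[of UNIV UNIV ?mu]
  by (simp add: lambda_system_def Int_commute Diff_eq)
qed

lemma borel_in_hausdorff:
 fixes B :: "'a::metric_space set"
 assumes "B : sets borel" shows "B : sets (hausdorff_measure s)"
proof -
 have "sets (borel :: 'a measure) = sigma_sets UNIV (Collect closed)"
  unfolding borel_eq_closed by (rule sets_measure_of) simp
 also have "... <= sets (hausdorff_measure s)"
  using sets.sigma_sets_subset[of "Collect closed" "hausdorff_measure s"] closed_in_hausdorff by auto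
 finally show ?thesis using assms by auto
qed

section \<open>The sphere has finite Hausdorff measure\<close>

text \<open>Cut the square into N^2 cells of side c = 2 r / N. A cell has diameter at most 2 c, so
  its image has weight at most pi (L c)^2, and N^2 c^2 = 4 r^2.\<close>

lemma hausdorff_outer_lipschitz_square:
 fixes g :: "real \<times> real => 'a::real_normed_vector"
 assumes r: "0 < r" and L: "0 < L"
  and lip: "!!p q. p : {-r..r} \<times> {-r..r} ==> q : {-r..r} \<times> {-r..r} ==> dist (g p) (g q) <= L * dist p q"
 shows "hausdorff_outer 2 (g ` ({-r..r} \<times> {-r..r})) <= ennreal (4 * pi * L^2 * r^2)"
 unfolding hausdorff_outer_def
proof (rule SUP_least)
 fix dl :: real assume "dl : {0<..}"
 hence dl: "0 < dl" by simp
 \<comment> \<open>Makes L * (2 * c) = 4 * L * r / N at most dl.\<close>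
 obtain N where N: "4 * L * r / dl < real N" using reals_Archimedean2 by blast
 have "0 < 4 * L * r / dl" using dl L r by simp
 hence N0: "0 < real N" using N by linarith
 define c where "c = 2 * r / real N"
 have c: "0 < c" using r N0 by (simp add: c_def)
 define Q where "Q i j = {-r + real i * c .. -r + (real i + 1) * c} \<times> {-r + real j * c .. -r + (real j + 1) * c}" for i j :: nat
 define C where "C n = (if n < N * N then g ` (Q (n div N) (n mod N) Int {-r..r} \<times> {-r..r}) else {})" for n
 have grid: "EX i<N. x : {-r + real i * c .. -r + (real i + 1) * c}" if x: "x : {-r..r}" for x
 \<comment> \<open>At x = r the floor would yield the index N, one too many.\<close>
 proof (cases "x = r")
  case True
  have "real (N - 1) * c + c = 2 * r" using N0 by (simp add: c_def of_nat_diff field_simps)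
  hence "x : {-r + real (N-1) * c .. -r + (real (N-1) + 1) * c}"
   using True c by (auto simp: algebra_simps)
  thus ?thesis using N0 by (intro exI[of _ "N - 1"]) auto
 next
  case False
  define i where "i = nat \<lfloor>(x + r) / c\<rfloor>"
  have nn: "0 <= (x + r) / c" using x c by auto
  have i: "real i <= (x + r) / c" "(x + r) / c < real i + 1"
   unfolding i_def using nn by (auto simp: of_nat_nat)
  have "(x + r) / c < real N" using x False r N0 by (auto simp: c_def field_simps)
  hence "i < N" using i(1) by linarith
  moreover have "real i * c <= x + r" "x + r < (real i + 1) * c" using i c by (auto simp: field_simps)
  ultimately show ?thesis by (intro exI[of _ i]) auto
 qed
 have dist: "dist p q <= 2 * c" if "p : Q i j" "q : Q i j" for p q i j
 proof -
  have "\<bar>fst p - fst q\<bar> <= c" "\<bar>snd p - snd q\<bar> <= c"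
   using that by (auto simp: Q_def abs_le_iff algebra_simps)
  hence "dist (fst p) (fst q) + dist (snd p) (snd q) <= 2 * c" by (simp add: dist_real_def)
  moreover have "dist p q <= dist (fst p) (fst q) + dist (snd p) (snd q)"
   unfolding dist_prod_def by (intro sqrt_sum_squares_le_sum) auto
  ultimately show ?thesis by linarith
 qed
 have dC: "dist y z <= L * (2 * c)" if "y : C n" "z : C n" for y z n
 proof -
  have "y : g ` (Q (n div N) (n mod N) Int {-r..r} \<times> {-r..r})" "z : g ` (Q (n div N) (n mod N) Int {-r..r} \<times> {-r..r})"
   using that unfolding C_def by (metis empty_iff)+
  then obtain p q where pq: "y = g p" "z = g q" "p : Q (n div N) (n mod N)" "q : Q (n div N) (n mod N)"
   "p : {-r..r} \<times> {-r..r}" "q : {-r..r} \<times> {-r..r}"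
   by (elim imageE IntE)
  have "dist y z <= L * dist p q" using lip pq by auto
  also have "... <= L * (2 * c)" using dist[OF pq(3,4)] L by (intro mult_left_mono) auto
  finally show ?thesis .
 qed
 have bC: "bounded (C n)" for n
 proof (cases "C n = {}")
  case False
  then obtain y where "y : C n" by auto
  thus ?thesis using dC[of y n] by (auto simp: bounded_def)
 qed simp
 have diamC: "diameter (C n) <= L * (2 * c)" for n
  using dC[of _ n] L c by (intro diameter_le) (auto simp: dist_norm[symmetric])
 have w: "hausdorff_weight 2 (C n) <= ennreal (pi * (L * c)^2)" for n
 proof (cases "C n = {}")
  case False
  have "0 <= diameter (C n)" using bC by (rule diameter_ge_0)
  hence "pi * (diameter (C n) / 2)^2 <= pi * (L * c)^2"
   using diamC[of n] by (intro mult_left_mono power_mono) auto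
  thus ?thesis using False by (simp add: hausdorff_weight_def unit_ball_vol_2 ennreal_leI)
 qed (simp add: hausdorff_weight_def)
 have cover: "g ` ({-r..r} \<times> {-r..r}) <= (\<Union>n. C n)"
 proof
  fix y assume "y : g ` ({-r..r} \<times> {-r..r})"
  then obtain a b where y: "y = g (a, b)" "a : {-r..r}" "b : {-r..r}" by auto
  obtain i j where ij: "i < N" "a : {-r + real i * c .. -r + (real i + 1) * c}" "j < N" "b : {-r + real j * c .. -r + (real j + 1) * c}"
   using grid[OF y(2)] grid[OF y(3)] by auto
  have "i * N + j < N * N"
  proof -
   have "i * N + j < i * N + N" using ij by simp
   also have "... <= N * N" using ij(1) by (metis Suc_leI mult_Suc add.commute mult_le_mono1)
   finally show ?thesis .
  qed
  moreover have "(i * N + j) div N = i" "(i * N + j) mod N = j" using ij by auto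
  ultimately have "y : C (i * N + j)" using ij y by (auto simp: C_def Q_def)
  thus "y : (\<Union>n. C n)" by blast
 qed
 have "hausdorff_pre 2 dl (g ` ({-r..r} \<times> {-r..r})) <= (\<Sum>n. hausdorff_weight 2 (C n))"
  unfolding hausdorff_pre_def
 proof (rule INF_lower, intro CollectI conjI allI)
  fix n
  have "L * (2 * c) <= dl" using N N0 dl by (simp add: c_def field_simps)
  thus "diameter (C n) <= dl" using diamC[of n] by linarith
 qed (use cover bC in auto)
 also have "... = (\<Sum>n<N*N. hausdorff_weight 2 (C n))"
  by (rule suminf_finite) (auto simp: C_def hausdorff_weight_def)
 also have "... <= (\<Sum>n<N*N. ennreal (pi * (L * c)^2))" by (intro sum_mono w)
 also have "... = ennreal (real (N * N) * (pi * (L * c)^2))" by (simp add: ennreal_mult' ennreal_of_nat_eq_real_of_nat)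
 also have "real (N * N) * (pi * (L * c)^2) = 4 * pi * L^2 * r^2"
  using N0 by (simp add: c_def power_mult_distrib field_simps power2_eq_square)
 finally show "hausdorff_pre 2 dl (g ` ({-r..r} \<times> {-r..r})) <= ennreal (4 * pi * L^2 * r^2)" .
qed

lemma sin_cos_diff_le: "\<bar>sin x - sin y\<bar> <= \<bar>x - y\<bar>" "\<bar>cos x - cos y\<bar> <= \<bar>x - y\<bar>" for x y :: real
proof -
 have *: "\<bar>2 * sin ((a - b)/2) * t\<bar> <= \<bar>a - b\<bar>" if "\<bar>t\<bar> <= 1" for a b t :: real
  using mult_mono[OF abs_sin_x_le_abs_x[of "(a - b)/2"] that] by (simp add: abs_mult)
 show "\<bar>sin x - sin y\<bar> <= \<bar>x - y\<bar>" unfolding sin_diff_sin by (rule *) simp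
 have "cos x - cos y = 2 * sin ((y - x)/2) * sin ((x + y)/2)" by (simp add: cos_diff_cos mult_ac)
 thus "\<bar>cos x - cos y\<bar> <= \<bar>x - y\<bar>" using *[of "sin ((x + y)/2)" y x] by (simp add: abs_minus_commute)
qed

text \<open>Provides the integrable majorant on the boundary when the trace is verified. The square
  of half-side 7 contains all angles, as 2 pi < 7.\<close>

lemma hausdorff_outer_sphere: "hausdorff_outer 2 (sphere (0::real^3) 1) < \<infinity>"
proof -
 define g where "g p = (vector [sin (fst p) * cos (snd p), sin (fst p) * sin (snd p), cos (fst p)] :: real^3)" for p
 have "sphere 0 1 <= g ` ({-7..7} \<times> {-7..7})"
 proof
  fix om :: "real^3" assume "om : sphere 0 1"
  hence n: "(om$1)^2 + (om$2)^2 + (om$3)^2 = 1" using norm_vec3[of om] by simp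
  define z where "z = Complex (om$1) (om$2)"
  have "(om$3)^2 <= 1" using n zero_le_power2[of "om$1"] zero_le_power2[of "om$2"] by linarith
  hence 3: "-1 <= om$3" "om$3 <= 1" by (auto simp: abs_square_le_1 abs_le_iff)
  have s: "sin (arccos (om$3)) = cmod z" using n by (simp add: sin_arccos[OF 3] z_def cmod_def eq_diff_eq)
  have "z = of_real (cmod z) * exp (\<i> * of_real (Arg2pi z))" by (rule Arg2pi_eq)
  hence "om$1 = cmod z * cos (Arg2pi z)" "om$2 = cmod z * sin (Arg2pi z)"
   by (auto simp: z_def complex_eq_iff Re_exp Im_exp)
  hence "om = g (arccos (om$3), Arg2pi z)" using 3 by (simp add: g_def s vec_eq_iff forall_3)
  moreover have "arccos (om$3) : {-7..7}" "Arg2pi z : {-7..7}"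
   using arccos_bounded[OF 3] Arg2pi_ge_0[of z] Arg2pi_lt_2pi[of z] pi_less_4 pi_gt3 pi_approx by auto
  ultimately show "om : g ` ({-7..7} \<times> {-7..7})" by blast
 qed
 hence "hausdorff_outer 2 (sphere (0::real^3) 1) <= hausdorff_outer 2 (g ` ({-7..7} \<times> {-7..7}))" by (rule hausdorff_outer_mono)
 also have "... <= ennreal (4 * pi * 6^2 * 7^2)"
 proof (rule hausdorff_outer_lipschitz_square)
  fix p q :: "real \<times> real"
  have le: "\<bar>fst p - fst q\<bar> <= dist p q" "\<bar>snd p - snd q\<bar> <= dist p q"
   using dist_fst_le[of p q] dist_snd_le[of p q] by (simp_all add: dist_real_def)
  have m: "\<bar>a * b - a' * b'\<bar> <= \<bar>a - a'\<bar> + \<bar>b - b'\<bar>" if "\<bar>a\<bar> <= 1" "\<bar>b'\<bar> <= 1" for a b a' b' :: real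
  proof -
   have "a * b - a' * b' = a * (b - b') + (a - a') * b'" by (simp add: algebra_simps)
   thus ?thesis using abs_triangle_ineq[of "a * (b - b')" "(a - a') * b'"] mult_right_mono[OF that(1), of "\<bar>b - b'\<bar>"]
    mult_left_mono[OF that(2), of "\<bar>a - a'\<bar>"] by (simp add: abs_mult)
  qed
  have "dist (g p) (g q) <= \<bar>(g p - g q)$1\<bar> + \<bar>(g p - g q)$2\<bar> + \<bar>(g p - g q)$3\<bar>"
   using norm_le_l1_cart[of "g p - g q"] by (simp add: dist_norm sum_3)
  also have "... <= 2 * dist p q + 2 * dist p q + 2 * dist p q"
   using m[of "sin (fst p)" "cos (snd q)" "cos (snd p)" "sin (fst q)"] m[of "sin (fst p)" "sin (snd q)" "sin (snd p)" "sin (fst q)"]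
    sin_cos_diff_le[of "fst p" "fst q"] sin_cos_diff_le[of "snd p" "snd q"] le zero_le_dist[of p q] by (simp add: g_def, linarith)
  finally show "dist (g p) (g q) <= 6 * dist p q" by simp
 qed auto
 finally show ?thesis by (rule order.strict_trans1) simp
qed

text \<open>Makes the two poles negligible in boundary integrals.\<close>

lemma hausdorff_outer_singleton: "hausdorff_outer 2 {x :: 'a::metric_space} = 0"
proof -
 have "hausdorff_pre 2 dl {x} <= 0" if "0 < dl" for dl
 proof -
  have "hausdorff_pre 2 dl {x} <= (\<Sum>i::nat. hausdorff_weight 2 {x})"
   unfolding hausdorff_pre_def using that by (intro INF_lower[of "%_. {x}"]) auto
  thus ?thesis by (simp add: hausdorff_weight_def)
 qed
 thus ?thesis by (simp add: hausdorff_outer_def)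
qed

section \<open>Smooth bump functions\<close>

text \<open>One term of the exponential series is at most the whole sum.\<close>

lemma power_mult_exp_minus_le:
 fixes y eps :: real
 assumes "0 < eps" "0 <= y"
 shows "y ^ m * exp (- (eps * y)) <= fact m / eps ^ m"
proof -
 have s: "(%n. (eps*y) ^ n /\<^sub>R fact n) sums exp (eps*y)" by (rule exp_converges)
 have "(SUM n:{m}. (eps*y) ^ n /\<^sub>R fact n) <= (\<Sum>n. (eps*y) ^ n /\<^sub>R fact n)"
  by (rule sum_le_suminf[OF sums_summable[OF s]]) (use assms in auto)
 hence "(eps*y) ^ m /\<^sub>R fact m <= exp (eps*y)" using sums_unique[OF s] by simp
 hence "(eps*y)^m <= fact m * exp (eps*y)" by (simp add: field_simps)
 thus ?thesis using assms by (simp add: exp_minus power_mult_distrib field_simps)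
qed

text \<open>For points where a formula meets the zero function to second order: the ends of bumps
  and of \<open>step\<close>.\<close>

lemma has_derivative_zero_quadratic:
 fixes f :: "real => real"
 assumes "!!t. \<bar>f t\<bar> <= K * (t - c)^2"
 shows "(f has_real_derivative 0) (at c)"
proof -
 have f0: "f c = 0" using assms[of c] by simp
 have "(%h. (f (c + h) - f c) / h) \<midarrow>0\<rightarrow> 0"
 proof (rule Lim_null_comparison)
  have "norm ((f (c + h) - f c) / h) <= K * \<bar>h\<bar>" if h: "h ~= 0" for h
  proof -
   have "\<bar>f (c + h)\<bar> <= (K * \<bar>h\<bar>) * \<bar>h\<bar>" using assms[of "c + h"] by (simp add: power2_eq_square)
   thus ?thesis using h f0 by (simp add: field_simps)
  qed
  thus "\<forall>\<^sub>F h in at 0. norm ((f (c + h) - f c) / h) <= K * \<bar>h\<bar>" by (auto simp: eventually_at_filter)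
  show "(%h. K * \<bar>h\<bar>) \<midarrow>0\<rightarrow> 0" by (auto intro!: tendsto_eq_intros)
 qed
 thus ?thesis by (simp add: DERIV_def)
qed

text \<open>The factors \<open>p\<close> and \<open>n\<close> make the family closed under
  differentiation, so that smoothness is an induction inside the family. With p = 1 and n = 0 it
  tends to the indicator of the open interval as eps tends to 0.\<close>

definition bump :: "real => real => real => real poly => nat => real => real" where
 "bump eps a b p n t = (if a < t & t < b then
   poly p t * inverse ((t - a) * (b - t)) ^ n * exp (- (eps * inverse ((t - a) * (b - t)))) else 0)"

text \<open>The exponential absorbs two more inverse powers of q = (t - a) * (b - t) than are
  present; this leaves a factor q^2, which vanishes to second order at both ends.\<close>

lemma bump_quadratic:
 assumes e: "0 < eps"
 obtains K where "!!t. \<bar>bump eps a b p n t\<bar> <= K * (t - a)^2" "!!t. \<bar>bump eps a b p n t\<bar> <= K * (t - b)^2"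
proof -
 have "bounded (poly p ` {a..b})"
  by (intro compact_imp_bounded compact_continuous_image continuous_intros) auto
 then obtain M where "0 < M" "ALL y:poly p ` {a..b}. norm y <= M" unfolding bounded_pos by blast
 hence M: "!!t. t : {a..b} ==> \<bar>poly p t\<bar> <= M" "0 < M" by auto
 define C where "C = fact (n+2) / eps ^ (n+2)"
 have C: "0 <= C" using e by (simp add: C_def)
 define K where "K = M * C * (b - a)^2"
 have K0: "0 <= K" using M(2) C by (simp add: K_def)
 have main: "\<bar>bump eps a b p n t\<bar> <= K * (t - a)^2 & \<bar>bump eps a b p n t\<bar> <= K * (t - b)^2" for t
 proof (cases "a < t & t < b")
  case False
  hence "bump eps a b p n t = 0" unfolding bump_def by (rule if_not_P)
  thus ?thesis using K0 by simp
 next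
  case t: True
  define q where "q = (t - a) * (b - t)"
  have q: "0 < q" using t by (simp add: q_def)
  have "inverse q ^ n * exp (- (eps * inverse q)) = (inverse q ^ (n+2) * exp (- (eps * inverse q))) * q^2"
   using q by (simp add: power_add field_simps power2_eq_square)
  also have "... <= C * q^2" unfolding C_def using q e by (intro mult_right_mono power_mult_exp_minus_le) auto
  finally have 1: "inverse q ^ n * exp (- (eps * inverse q)) <= C * q^2" .
  have "\<bar>bump eps a b p n t\<bar> = \<bar>poly p t\<bar> * (inverse q ^ n * exp (- (eps * inverse q)))"
   using t q by (simp add: bump_def q_def[symmetric] abs_mult)
  also have "... <= M * (C * q^2)" by (rule mult_mono[OF M(1) 1]) (use M(2) t q in auto)
  finally have 2: "\<bar>bump eps a b p n t\<bar> <= M * C * q^2" by (simp add: mult.assoc)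
  have "q^2 <= ((t - a) * (b - a))^2" "q^2 <= ((b - a) * (b - t))^2"
   unfolding q_def using t by (intro power_mono mult_mono; simp)+
  hence "M * C * q^2 <= M * C * ((t - a) * (b - a))^2" "M * C * q^2 <= M * C * ((b - a) * (b - t))^2"
   using M(2) C by (auto intro!: mult_left_mono)
  with 2 show ?thesis by (simp add: K_def power_mult_distrib power2_commute[of t b] mult_ac)
 qed
 show thesis using main that by blast
qed

text \<open>The numerator over q^(n+2) of the derivative p' q^-n - n p q' q^-(n+1) + eps p q'
  q^-(n+2), where q = (t - a) * (b - t) and the exponential is left out.\<close>

definition bump_poly_deriv :: "real => real => real => real poly => nat => real poly" where
 "bump_poly_deriv eps a b p n = (let q = [:-a, 1:] * [:b, -1:]; q' = [:a + b, -2:] in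
   pderiv p * q^2 - smult (real n) (p * q' * q) + smult eps (p * q'))"

lemma bump_has_derivative:
 assumes e: "0 < eps"
 shows "(bump eps a b p n has_real_derivative bump eps a b (bump_poly_deriv eps a b p n) (n+2) t) (at t)"
proof (cases "a < t & t < b")
 case t: True
 define q where "q = (t - a) * (b - t)"
 have q: "0 < q" using t by (simp add: q_def)
 have "((%t. poly p t * inverse ((t - a) * (b - t)) ^ n * exp (- (eps * inverse ((t - a) * (b - t)))))
   has_real_derivative bump eps a b (bump_poly_deriv eps a b p n) (n+2) t) (at t)"
 proof -
  have di: "((%t. inverse ((t - a) * (b - t))) has_real_derivative - (a + b - 2 * t) * inverse q ^ 2) (at t)"
   using q t unfolding q_def
   by (auto intro!: derivative_eq_intros simp: power2_eq_square field_simps)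
  have dp: "((%t. inverse ((t - a) * (b - t)) ^ n) has_real_derivative
    real n * (inverse q ^ (n - 1) * (- (a + b - 2 * t) * inverse q ^ 2))) (at t)"
   using DERIV_power[OF di, of n] by (simp add: q_def mult_ac)
  have de: "((%t. exp (- (eps * inverse ((t - a) * (b - t))))) has_real_derivative
    exp (- (eps * inverse q)) * (eps * ((a + b - 2 * t) * inverse q ^ 2))) (at t)"
   by (rule DERIV_cong[OF DERIV_fun_exp[OF DERIV_minus[OF DERIV_cmult[OF di, of eps]]]])
    (simp add: q_def algebra_simps)
  have D: "((%t. poly p t * inverse ((t - a) * (b - t)) ^ n * exp (- (eps * inverse ((t - a) * (b - t)))))
   has_real_derivative
    (poly (pderiv p) t * inverse q ^ n + real n * (inverse q ^ (n - 1) * (- (a + b - 2 * t) * inverse q ^ 2)) * poly p t) * exp (- (eps * inverse q))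
     + exp (- (eps * inverse q)) * (eps * ((a + b - 2 * t) * inverse q ^ 2)) * (poly p t * inverse q ^ n)) (at t)"
   using DERIV_mult[OF DERIV_mult[OF poly_DERIV dp] de] by (simp add: q_def)
  have P: "poly (bump_poly_deriv eps a b p n) t = poly (pderiv p) t * q^2 - real n * (poly p t * (a + b - 2*t) * q) + eps * (poly p t * (a + b - 2*t))"
   unfolding bump_poly_deriv_def Let_def q_def by (simp add: algebra_simps)
  have i: "inverse q ^ n = inverse q ^ (n+2) * q^2" "real n * inverse q ^ (n - 1) * inverse q ^ 2 = real n * inverse q ^ (n+2) * q"
   using q by (simp_all add: power_add field_simps power2_eq_square) (cases n; simp add: field_simps)+
  have i3: "inverse q ^ 2 * inverse q ^ n = inverse q ^ (n+2)" by (simp add: power_add power2_eq_square)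
  have "bump eps a b (bump_poly_deriv eps a b p n) (n+2) t
    = (poly (pderiv p) t * q^2 - real n * (poly p t * (a + b - 2*t) * q) + eps * (poly p t * (a + b - 2*t))) * inverse q ^ (n+2) * exp (- (eps * inverse q))"
   using t by (simp add: bump_def P q_def[symmetric])
  also have "... = (poly (pderiv p) t * (inverse q ^ (n+2) * q^2)
    - (real n * inverse q ^ (n+2) * q) * (a + b - 2 * t) * poly p t) * exp (- (eps * inverse q))
     + exp (- (eps * inverse q)) * (eps * (a + b - 2 * t)) * poly p t * inverse q ^ (n+2)"
   by (simp add: algebra_simps)
  also have "... = (poly (pderiv p) t * inverse q ^ n + real n * (inverse q ^ (n - 1) * (- (a + b - 2 * t) * inverse q ^ 2)) * poly p t) * exp (- (eps * inverse q))
     + exp (- (eps * inverse q)) * (eps * ((a + b - 2 * t) * inverse q ^ 2)) * (poly p t * inverse q ^ n)"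
   unfolding i(1)[symmetric] i(2)[symmetric] unfolding i3[symmetric] by (simp add: algebra_simps)
  finally show ?thesis using D by simp
 qed
 thus ?thesis
 proof (rule DERIV_cong_ev[THEN iffD1, rotated -1])
  show "\<forall>\<^sub>F s in nhds t. poly p s * inverse ((s - a) * (b - s)) ^ n * exp (- (eps * inverse ((s - a) * (b - s)))) = bump eps a b p n s"
   using eventually_nhds_in_open[of "{a<..<b}" t] t by (auto elim!: eventually_mono simp: bump_def)
 qed auto
next
 case False
 have z: "bump eps a b (bump_poly_deriv eps a b p n) (n+2) t = 0" unfolding bump_def using False by (rule if_not_P)
 obtain K where K: "!!t. \<bar>bump eps a b p n t\<bar> <= K * (t - a)^2" "!!t. \<bar>bump eps a b p n t\<bar> <= K * (t - b)^2"
  using bump_quadratic[OF e] by blast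
 consider "t = a" | "t = b" | "t < a" | "t > b" using False by linarith
 thus ?thesis
 proof cases
  case 1 show ?thesis unfolding z unfolding 1 by (rule has_derivative_zero_quadratic[OF K(1)])
 next
  case 2 show ?thesis unfolding z unfolding 2 by (rule has_derivative_zero_quadratic[OF K(2)])
 next
  case 3
  have "((%_. 0) has_real_derivative 0) (at t)" by simp
  thus ?thesis unfolding z has_field_derivative_def
   by (rule has_derivative_transform_within_open[of _ _ _ _ "{..<a}"]) (use 3 in "auto simp: bump_def")
 next
  case 4
  have "((%_. 0) has_real_derivative 0) (at t)" by simp
  thus ?thesis unfolding z has_field_derivative_def
   by (rule has_derivative_transform_within_open[of _ _ _ _ "{b<..}"]) (use 4 in "auto simp: bump_def")
 qed
qed

text \<open>Each coordinate has its own polynomial and exponent, because a partial derivative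
  changes one factor only.\<close>

definition box_bump :: "real => 'a => 'a => ('a => real poly) => ('a => nat) => 'a::euclidean_space => real" where
 "box_bump eps a b P N x = (\<Prod>i\<in>Basis. bump eps (a \<bullet> i) (b \<bullet> i) (P i) (N i) (x \<bullet> i))"

lemma box_bump_deriv:
 fixes a b :: "'a::euclidean_space"
 assumes e: "0 < eps"
 obtains f' where "(box_bump eps a b P N has_derivative f') (at x)"
  "!!j. j : Basis ==> f' j = box_bump eps a b (P(j := bump_poly_deriv eps (a \<bullet> j) (b \<bullet> j) (P j) (N j))) (N(j := N j + 2)) x"
proof
 let ?f = "%i x. bump eps (a \<bullet> i) (b \<bullet> i) (P i) (N i) (x \<bullet> i)"
 let ?d = "%i. bump eps (a \<bullet> i) (b \<bullet> i) (bump_poly_deriv eps (a \<bullet> i) (b \<bullet> i) (P i) (N i)) (N i + 2) (x \<bullet> i)"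
 have d: "(?f i has_derivative (%y. ?d i * (y \<bullet> i))) (at x)" for i
  using DERIV_compose_FDERIV[OF bump_has_derivative[OF e] has_derivative_inner_left[OF has_derivative_ident], of "a \<bullet> i" "b \<bullet> i" "P i" "N i" i x UNIV]
  by (simp add: mult.commute)
 show "(box_bump eps a b P N has_derivative (%y. SUM i:Basis. (?d i * (y \<bullet> i)) * (\<Prod>j\<in>Basis - {i}. ?f j x))) (at x)"
  unfolding box_bump_def[abs_def] by (rule has_derivative_prod) (rule d)
 fix j :: 'a assume j: "j : Basis"
 have "(SUM i:Basis. (?d i * (j \<bullet> i)) * (\<Prod>j\<in>Basis - {i}. ?f j x)) = (SUM i:Basis. if j = i then ?d i * (\<Prod>j\<in>Basis - {i}. ?f j x) else 0)"
  by (rule sum.cong) (auto simp: inner_Basis j)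
 also have "... = ?d j * (\<Prod>k\<in>Basis - {j}. ?f k x)" using j by simp
 also have "... = box_bump eps a b (P(j := bump_poly_deriv eps (a \<bullet> j) (b \<bullet> j) (P j) (N j))) (N(j := N j + 2)) x"
  unfolding box_bump_def by (subst prod.remove[OF finite_Basis j]) (auto intro!: prod.cong)
 finally show "(SUM i:Basis. (?d i * (j \<bullet> i)) * (\<Prod>j\<in>Basis - {i}. ?f j x))
  = box_bump eps a b (P(j := bump_poly_deriv eps (a \<bullet> j) (b \<bullet> j) (P j) (N j))) (N(j := N j + 2)) x" .
qed

lemma box_bump_differentiable:
 fixes a b :: "'a::euclidean_space"
 assumes e: "0 < eps" shows "box_bump eps a b P N differentiable (at x)"
 by (rule box_bump_deriv[OF e, where a=a and b=b and P=P and N=N and x=x]) (unfold differentiable_def, erule exI)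

text \<open>The induction runs over all P and N at once, as differentiation changes them.\<close>

lemma C_diff_box_bump:
 fixes a b :: "'a::euclidean_space"
 assumes e: "0 < eps" shows "C_diff k (box_bump eps a b P N)"
proof (induction k arbitrary: P N)
 case 0
 show ?case using box_bump_differentiable[OF e]
  by (auto simp: continuous_on_eq_continuous_at intro!: differentiable_imp_continuous_within)
next
 case (Suc k)
 have "(%x. frechet_derivative (box_bump eps a b P N) (at x) j)
   = box_bump eps a b (P(j := bump_poly_deriv eps (a \<bullet> j) (b \<bullet> j) (P j) (N j))) (N(j := N j + 2))"
  if j: "j : Basis" for j
 proof
  fix x
  obtain f' where f': "(box_bump eps a b P N has_derivative f') (at x)"
   "!!j. j : Basis ==> f' j = box_bump eps a b (P(j := bump_poly_deriv eps (a \<bullet> j) (b \<bullet> j) (P j) (N j))) (N(j := N j + 2)) x"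
   using box_bump_deriv[OF e] by blast
  show "frechet_derivative (box_bump eps a b P N) (at x) j = box_bump eps a b (P(j := bump_poly_deriv eps (a \<bullet> j) (b \<bullet> j) (P j) (N j))) (N(j := N j + 2)) x"
   using frechet_derivative_at[OF f'(1)] f'(2)[OF j] by simp
 qed
 thus ?case using Suc box_bump_differentiable[OF e]
  by (auto simp: differentiable_on_def intro: differentiable_at_withinI)
qed

lemma box_bump_support: "box_bump eps a b P N x ~= 0 ==> x : box a b"
proof -
 assume "box_bump eps a b P N x ~= 0"
 hence "bump eps (a \<bullet> i) (b \<bullet> i) (P i) (N i) (x \<bullet> i) ~= 0" if "i : Basis" for i
  using that by (auto simp: box_bump_def)
 thus "x : box a b" unfolding mem_box bump_def by meson
qed

lemma test_function_box_bump:
 fixes a b :: "'a::euclidean_space"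
 assumes "0 < eps" "cbox a b <= Om"
 shows "test_function Om (box_bump eps a b P N)"
proof -
 have "closure {x. box_bump eps a b P N x ~= 0} <= cbox a b"
  using box_bump_support box_subset_cbox by (intro closure_minimal) blast+
 thus ?thesis
  unfolding test_function_def using assms C_diff_box_bump[OF assms(1)]
  by (auto simp: compact_eq_bounded_closed simp del: bounded_closure compact_closure intro: bounded_subset[OF bounded_cbox])
qed

lemma box_bump_tendsto:
 fixes a b :: "'a::euclidean_space"
 shows "(%n. box_bump (1 / real (Suc n)) a b (%_. 1) (%_. 0) x) ----> indicator (box a b) x"
proof (cases "x : box a b")
 case False
 hence "box_bump (1 / real (Suc n)) a b (%_. 1) (%_. 0) x = 0" for n using box_bump_support by blast
 thus ?thesis using False by simp
next
 case True
 have "(%n. \<Prod>i\<in>Basis. exp (- (1 / real (Suc n) * inverse ((x \<bullet> i - a \<bullet> i) * (b \<bullet> i - x \<bullet> i)))))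
   ----> (\<Prod>i\<in>(Basis::'a set). exp (- (0 * inverse ((x \<bullet> i - a \<bullet> i) * (b \<bullet> i - x \<bullet> i)))))"
  by (intro tendsto_intros LIMSEQ_Suc[OF lim_1_over_n])
 moreover have "box_bump (1 / real (Suc n)) a b (%_. 1) (%_. 0) x =
   (\<Prod>i\<in>Basis. exp (- (1 / real (Suc n) * inverse ((x \<bullet> i - a \<bullet> i) * (b \<bullet> i - x \<bullet> i)))))" for n
  using True unfolding box_bump_def by (intro prod.cong) (auto simp: bump_def mem_box)
 ultimately show ?thesis using True by simp
qed

lemma box_bump_01:
 fixes a b :: "'a::euclidean_space"
 assumes "0 < eps" shows "0 <= box_bump eps a b (%_. 1) (%_. 0) x" "box_bump eps a b (%_. 1) (%_. 0) x <= 1"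
proof -
 have "0 <= bump eps (a \<bullet> i) (b \<bullet> i) 1 0 (x \<bullet> i) & bump eps (a \<bullet> i) (b \<bullet> i) 1 0 (x \<bullet> i) <= 1" for i
  using assms by (auto simp: bump_def)
 thus "0 <= box_bump eps a b (%_. 1) (%_. 0) x" "box_bump eps a b (%_. 1) (%_. 0) x <= 1"
  unfolding box_bump_def by (auto intro: prod_nonneg prod_le_1)
qed

section \<open>Uniqueness of weak derivatives\<close>

lemma test_function_cont: "test_function Om phi ==> continuous_on UNIV phi"
 unfolding test_function_def by (drule conjunct1, drule spec[of _ 0]) simp

lemma test_function_has_derivative:
 "test_function Om phi ==> (phi has_derivative frechet_derivative phi (at x)) (at x)"
 unfolding test_function_def
 by (drule conjunct1, drule spec[of _ "Suc 0"]) (simp add: differentiable_on_def frechet_derivative_works)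

lemma test_function_cont_partial:
 "test_function Om phi ==> e : Basis ==> continuous_on UNIV (%x. frechet_derivative phi (at x) e)"
 unfolding test_function_def by (drule conjunct1, drule spec[of _ "Suc 0"]) simp

lemma test_function_zero:
 assumes "test_function Om phi" "x ~: closure {x. phi x ~= 0}"
 shows "phi x = 0" "frechet_derivative phi (at x) = (%_. 0)"
proof -
 show "phi x = 0" using assms(2) closure_subset[of "{x. phi x ~= 0}"] by blast
 have "((%_. 0) has_derivative (%_. 0)) (at x)" by simp
 hence "(phi has_derivative (%_. 0)) (at x)"
 proof (rule has_derivative_transform_within_open)
  show "open (- closure {x. phi x ~= 0})" by auto
  show "!!y. y : - closure {x. phi x ~= 0} ==> 0 = phi y" using closure_subset[of "{x. phi x ~= 0}"] by force
 qed (use assms in auto)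
 thus "frechet_derivative phi (at x) = (%_. 0)" using frechet_derivative_at[of phi "%_. 0" x] by simp
qed

lemma loc_integrable_mult:
 fixes u :: "'a::euclidean_space => 'b::euclidean_space" and h :: "'a => real"
 assumes u: "locally_integrable Om u" and K: "compact K" "K <= Om"
  and h: "continuous_on UNIV h" "!!x. x ~: K ==> h x = 0"
 shows "integrable lebesgue (%x. indicator Om x *R (h x *R u x))"
  and "integrable lebesgue (%x. h x *R (indicator K x *R u x))"
  and "!!x. indicator Om x *R (h x *R u x) = h x *R (indicator K x *R u x)"
proof -
 show eq: "!!x. indicator Om x *R (h x *R u x) = h x *R (indicator K x *R u x)"
  using K(2) h(2) by (auto simp: indicator_def)
 have iu: "integrable lebesgue (%x. indicator K x *R u x)"
  using u K unfolding locally_integrable_def set_integrable_def by blast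
 have hm: "h : borel_measurable lebesgue"
  using borel_measurable_continuous_onI[OF h(1)] by (simp add: measurable_completion)
 have "bounded (h ` K)" using K(1) h(1) by (intro compact_imp_bounded compact_continuous_image) (auto intro: continuous_on_subset)
 then obtain M where M: "0 < M" "!!x. x : K ==> \<bar>h x\<bar> <= M" by (auto simp: bounded_pos)
 show 2: "integrable lebesgue (%x. h x *R (indicator K x *R u x))"
 proof (rule Bochner_Integration.integrable_bound[OF integrable_scaleR_right[OF iu, of M]])
  show "(%x. h x *R (indicator K x *R u x)) : borel_measurable lebesgue"
   by (rule borel_measurable_scaleR[OF hm borel_measurable_integrable[OF iu]])
  show "AE x in lebesgue. norm (h x *R (indicator K x *R u x)) <= norm (M *R (indicator K x *R u x))"
   using M by (intro AE_I2) (auto simp: indicator_def intro!: mult_right_mono)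
 qed
 thus "integrable lebesgue (%x. indicator Om x *R (h x *R u x))" unfolding eq .
qed

lemma sigma_finite_lebesgue: "sigma_finite_measure (lebesgue :: 'a::euclidean_space measure)"
proof
 obtain A :: "'a set set" where A: "countable A" "A <= sets lborel" "\<Union>A = space lborel" "ALL a:A. emeasure lborel a ~= \<infinity>"
  using lborel.sigma_finite_countable by blast
 moreover have "emeasure lebesgue a = emeasure lborel a" if "a : A" for a using A(2) that by auto
 ultimately show "EX A. countable A & A <= sets lebesgue & \<Union>A = space (lebesgue :: 'a measure) & (ALL a:A. emeasure lebesgue a ~= \<infinity>)"
  by (intro exI[of _ A]) auto
qed

text \<open>A Dynkin argument. Open boxes form an intersection-stable generator of the Borel sets;
  complements are handled by the total integral, which is the one over box A B. Lebesgue sets differ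
  from Borel sets by null sets.\<close>

lemma AE_zero_if_boxes:
 fixes f :: "'a::euclidean_space => 'b::euclidean_space"
 assumes f: "integrable lebesgue f" and A: "!!x. x ~: box A B ==> f x = 0"
  and boxes: "!!a b. box a b <= box A B ==> integral\<^sup>L lebesgue (%x. indicator (box a b) x *R f x) = 0"
 shows "AE x in lebesgue. f x = 0"
proof (rule sigma_finite_measure.density_zero[OF sigma_finite_lebesgue f])
 have si: "set_integrable lebesgue E f" if "E : sets lebesgue" for E
  unfolding set_integrable_def using f that by (rule integrable_mult_indicator[rotated])
 have borel: "(LINT x:E|lebesgue. f x) = 0" if "E : sets borel" for E
 proof -
  have "E : sigma_sets UNIV (range (%(a, b). box a b :: 'a set))"
   using that by (simp add: borel_eq_box)
  moreover have "Int_stable (range (%(a, b). box a b :: 'a set))" by (auto simp: Int_stable_def box_Int_box)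
  moreover have "range (%(a, b). box a b :: 'a set) <= Pow UNIV" by auto
  ultimately have "Int_stable (range (%(a, b). box a b :: 'a set))" "range (%(a, b). box a b :: 'a set) <= Pow UNIV"
   "E : sigma_sets UNIV (range (%(a, b). box a b :: 'a set))" by blast+
  thus ?thesis
  proof (induction E rule: sigma_sets_induct_disjoint)
   case (basic E)
   then obtain a b where E: "E = box a b" by auto
   obtain c d where cd: "box a b Int box A B = box c d" using box_Int_box[of a b A B] by blast
   have "(LINT x:E|lebesgue. f x) = (\<integral>x. indicator (box c d) x *R f x \<partial>lebesgue)"
    unfolding set_lebesgue_integral_def E cd[symmetric] using A by (intro Bochner_Integration.integral_cong) (auto simp: indicator_def)
   also have "... = 0" by (rule boxes) (use cd in auto)
   finally show ?case .
  next
   case empty thus ?case by (simp add: set_lebesgue_integral_def)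
  next
   case (compl E)
   hence "E : sets borel" by (simp add: borel_eq_box)
   hence E: "E : sets lebesgue" by simp
   have tot: "(LINT x|lebesgue. f x) = 0"
   proof -
    have "(LINT x|lebesgue. f x) = (\<integral>x. indicator (box A B) x *R f x \<partial>lebesgue)"
     using A by (intro Bochner_Integration.integral_cong) (auto simp: indicator_def)
    thus ?thesis using boxes[of A B] by simp
   qed
   have "(LINT x:UNIV - E|lebesgue. f x) = (\<integral>x. f x - indicator E x *R f x \<partial>lebesgue)"
    unfolding set_lebesgue_integral_def by (intro Bochner_Integration.integral_cong) (auto simp: indicator_def)
   also have "... = (\<integral>x. f x \<partial>lebesgue) - (LINT x:E|lebesgue. f x)"
    unfolding set_lebesgue_integral_def
    using f si[OF E] by (intro Bochner_Integration.integral_diff) (auto simp: set_integrable_def)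
   finally show ?case using tot compl by simp
  next
   case (union E)
   have E: "E i : sets lebesgue" for i
   proof -
    have "E i : sets borel" using union(2) by (auto simp: borel_eq_box)
    thus ?thesis by simp
   qed
   have "(LINT x:(\<Union>i. E i)|lebesgue. f x) = (\<Sum>i. (LINT x:(E i)|lebesgue. f x))"
    using E union(1) by (intro lebesgue_integral_countable_add si) (auto simp: disjoint_family_on_def)
   thus ?case using union by simp
  qed
 qed
 fix E :: "'a set" assume "E : sets lebesgue"
 then obtain S N N' where E: "E = S Un N" "N <= N'" "N' : null_sets lborel" "S : sets lborel"
  by (elim sets_completionE)
 have "AE x in lebesgue. x ~: N'" using E(3) by (intro AE_not_in) (auto intro: null_sets_completionI)
 hence "(LINT x:E|lebesgue. f x) = (LINT x:S|lebesgue. f x)"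
  using si[OF \<open>E : sets lebesgue\<close>] si[of S] E
  unfolding set_lebesgue_integral_def set_integrable_def
  by (intro integral_cong_AE) (auto simp: indicator_def elim!: eventually_mono)
 thus "(LINT x:E|lebesgue. f x) = 0" using borel[of S] E by simp
qed

lemma sets_lebesgue_Int_space_open: "open Om ==> Om Int space lebesgue : sets (lebesgue :: 'a::euclidean_space measure)"
 by simp

lemma test_function_integrable:
 fixes u :: "'a::euclidean_space => 'b::euclidean_space"
 assumes Om: "open Om" and phi: "test_function Om phi" and u: "locally_integrable Om u"
 shows "integrable (lebesgue_on Om) (%x. phi x *R u x)"
  and "e : Basis ==> integrable (lebesgue_on Om) (%x. frechet_derivative phi (at x) e *R u x)"
proof -
 let ?K = "closure {x. phi x ~= 0}"
 have K: "compact ?K" "?K <= Om" using phi by (auto simp: test_function_def)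
 show "integrable (lebesgue_on Om) (%x. phi x *R u x)"
  unfolding integrable_restrict_space[OF sets_lebesgue_Int_space_open[OF Om]]
  by (rule loc_integrable_mult(1)[OF u K test_function_cont[OF phi] test_function_zero(1)[OF phi]])
 show "integrable (lebesgue_on Om) (%x. frechet_derivative phi (at x) e *R u x)" if "e : Basis"
  unfolding integrable_restrict_space[OF sets_lebesgue_Int_space_open[OF Om]]
  by (rule loc_integrable_mult(1)[OF u K test_function_cont_partial[OF phi that]])
   (simp add: test_function_zero(2)[OF phi])
qed

lemma locally_integrable_add:
 "locally_integrable Om u ==> locally_integrable Om v ==> locally_integrable Om (%x. u x + v x)"
 unfolding locally_integrable_def by (auto intro: set_integral_add)

lemma locally_integrable_diff:
 "locally_integrable Om u ==> locally_integrable Om v ==> locally_integrable Om (%x. u x - v x)"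
 unfolding locally_integrable_def by (auto intro: set_integral_diff)

lemma has_weak_deriv_add:
 fixes u v u' v' :: "'a::euclidean_space => 'b::euclidean_space"
 assumes Om: "open Om" and e: "e : Basis" and "has_weak_deriv Om e u u'" "has_weak_deriv Om e v v'"
 shows "has_weak_deriv Om e (%x. u x + v x) (%x. u' x + v' x)"
 unfolding has_weak_deriv_def
proof (intro conjI allI impI)
 have l: "locally_integrable Om u" "locally_integrable Om v" "locally_integrable Om u'" "locally_integrable Om v'"
  using assms(3,4) by (auto simp: has_weak_deriv_def)
 thus "locally_integrable Om (%x. u x + v x)" "locally_integrable Om (%x. u' x + v' x)"
  by (auto intro: locally_integrable_add)
 fix phi :: "'a => real" assume phi: "test_function Om phi"
 note i = test_function_integrable[OF Om phi]
 have *: "(\<integral>x. frechet_derivative phi (at x) e *R u x \<partial>lebesgue_on Om) = - (\<integral>x. phi x *R u' x \<partial>lebesgue_on Om)"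
  "(\<integral>x. frechet_derivative phi (at x) e *R v x \<partial>lebesgue_on Om) = - (\<integral>x. phi x *R v' x \<partial>lebesgue_on Om)"
  using assms(3,4) phi unfolding has_weak_deriv_def by blast+
 show "(\<integral>x. frechet_derivative phi (at x) e *R (u x + v x) \<partial>lebesgue_on Om) = - (\<integral>x. phi x *R (u' x + v' x) \<partial>lebesgue_on Om)"
  unfolding scaleR_add_right
  using Bochner_Integration.integral_add[OF i(2)[OF l(1) e] i(2)[OF l(2) e]]
   Bochner_Integration.integral_add[OF i(1)[OF l(3)] i(1)[OF l(4)]] * by simp
qed

text \<open>The fundamental lemma of the calculus of variations. Box bumps tend boundedly to
  indicators of boxes, so the integrals of w over boxes with closure in Om vanish; countably many
  closed boxes exhaust Om.\<close>

lemma AE_zero_if_test_functions: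
 fixes w :: "'a::euclidean_space => 'b::euclidean_space"
 assumes Om: "open Om" and w: "locally_integrable Om w"
  and z: "!!phi. test_function Om phi ==> (\<integral>x. phi x *R w x \<partial>lebesgue_on Om) = 0"
 shows "AE x in lebesgue_on Om. w x = 0"
proof -
 have cb: "AE x in lebesgue. x : cbox A B --> w x = 0" if AB: "cbox A B <= Om" for A B
 proof -
  define f where "f x = indicator (cbox A B) x *R w x" for x
  have f: "integrable lebesgue f"
   using w AB compact_cbox[of A B] unfolding f_def[abs_def] locally_integrable_def set_integrable_def by blast
  have "AE x in lebesgue. indicator (box A B) x *R f x = 0"
  proof (rule AE_zero_if_boxes)
   show "integrable lebesgue (%x. indicator (box A B) x *R f x)"
    using f by (intro integrable_mult_indicator) auto
   fix a b :: 'a assume sub: "box a b <= box A B"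
   have eq: "indicator (box a b) x *R (indicator (box A B) x *R f x) = indicator (box a b) x *R f x" for x
    using sub by (auto simp: indicator_def)
   have "(\<integral>x. indicator (box a b) x *R f x \<partial>lebesgue) = 0"
   proof (cases "box a b = {}")
    case False
    have "cbox a b <= cbox A B"
     using closure_mono[OF sub] False closure_box[of a b] closure_box[of A B] sub by (metis subset_empty)
    hence ab: "cbox a b <= Om" using AB by blast
    let ?phi = "%n. box_bump (1 / real (Suc n)) a b (%_. 1) (%_. 0)"
    have t: "test_function Om (?phi n)" for n by (rule test_function_box_bump[OF _ ab]) simp
    have m: "?phi n : borel_measurable lebesgue" for n
     using borel_measurable_continuous_onI[OF test_function_cont[OF t[of n]]] by (simp add: measurable_completion)
    have "(%n. \<integral>x. ?phi n x *R f x \<partial>lebesgue) ----> (\<integral>x. indicator (box a b) x *R f x \<partial>lebesgue)"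
    proof (rule integral_dominated_convergence[where w="%x. norm (f x)"])
     show "(%x. indicator (box a b) x *R f x) : borel_measurable lebesgue"
      using borel_measurable_integrable[OF f] by (intro borel_measurable_scaleR borel_measurable_indicator) auto
     show "(%x. ?phi n x *R f x) : borel_measurable lebesgue" for n
      by (rule borel_measurable_scaleR[OF m borel_measurable_integrable[OF f]])
     show "integrable lebesgue (%x. norm (f x))" using f by simp
     show "AE x in lebesgue. (%n. ?phi n x *R f x) ----> indicator (box a b) x *R f x"
      by (intro AE_I2 tendsto_scaleR tendsto_const box_bump_tendsto)
     show "AE x in lebesgue. norm (?phi n x *R f x) <= norm (f x)" for n
      using box_bump_01[of "1 / real (Suc n)" a b] by (intro AE_I2) (simp add: mult_left_le_one_le)
    qed
    moreover have "(\<integral>x. ?phi n x *R f x \<partial>lebesgue) = 0" for n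
    proof -
     have "indicator Om x *R (?phi n x *R w x) = ?phi n x *R f x" for x
     proof (cases "?phi n x = 0")
      case False
      hence "x : box a b" by (rule box_bump_support)
      hence "x : cbox a b" using box_subset_cbox by blast
      hence "x : Om" "x : cbox A B" using \<open>cbox a b <= cbox A B\<close> ab by blast+
      thus ?thesis by (simp add: f_def)
     qed simp
     thus ?thesis using z[OF t[of n]] integral_restrict_space[OF sets_lebesgue_Int_space_open[OF Om], of "%x. ?phi n x *R w x"] by simp
    qed
    ultimately show ?thesis by (simp add: LIMSEQ_const_iff)
   qed simp
   thus "(\<integral>x. indicator (box a b) x *R (indicator (box A B) x *R f x) \<partial>lebesgue) = 0" unfolding eq .
  qed auto
  moreover have "AE x in lebesgue. x ~: cbox A B - box A B"
   using negligible_frontier_interval[of A B] by (intro AE_not_in) (simp add: negligible_iff_null_sets)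
  ultimately show ?thesis
   by eventually_elim (use box_subset_cbox in "auto simp: f_def indicator_def split: if_splits")
 qed
 obtain \<D> where D: "countable \<D>" "\<D> <= Pow Om" "!!X. X : \<D> ==> EX a b. X = cbox a b" "\<Union>\<D> = Om"
  using open_countable_Union_open_cbox[OF Om] by metis
 have "AE x in lebesgue. ALL X:\<D>. x : X --> w x = 0"
  unfolding AE_ball_countable[OF D(1)]
 proof
  fix X assume "X : \<D>"
  thus "AE x in lebesgue. x : X --> w x = 0" using D(2,3) cb by blast
 qed
 hence "AE x in lebesgue. x : Om --> w x = 0"
  by eventually_elim (use D(4) in blast)
 thus ?thesis using AE_restrict_space_iff[OF sets_lebesgue_Int_space_open[OF Om]] by auto
qed

lemma has_weak_deriv_unique:
 fixes u v v' :: "'a::euclidean_space => 'b::euclidean_space"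
 assumes Om: "open Om" and v: "has_weak_deriv Om e u v" "has_weak_deriv Om e u v'"
 shows "AE x in lebesgue_on Om. v x = v' x"
proof -
 have l: "locally_integrable Om v" "locally_integrable Om v'" using v by (auto simp: has_weak_deriv_def)
 have "AE x in lebesgue_on Om. v x - v' x = 0"
 proof (rule AE_zero_if_test_functions[OF Om locally_integrable_diff[OF l]])
  fix phi :: "'a => real" assume phi: "test_function Om phi"
  have "(\<integral>x. phi x *R v x \<partial>lebesgue_on Om) = (\<integral>x. phi x *R v' x \<partial>lebesgue_on Om)"
   using v phi unfolding has_weak_deriv_def by (metis neg_equal_iff_equal)
  thus "(\<integral>x. phi x *R (v x - v' x) \<partial>lebesgue_on Om) = 0"
   unfolding scaleR_diff_right
   using Bochner_Integration.integral_diff[OF test_function_integrable(1)[OF Om phi l(1)] test_function_integrable(1)[OF Om phi l(2)]]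
   by simp
 qed
 thus ?thesis by simp
qed

text \<open>\<open>weak_deriv\<close> is an arbitrary choice, so an explicit weak derivative can
  agree with it only almost everywhere.\<close>

lemma weak_deriv_AE:
 fixes u v :: "'a::euclidean_space => 'b::euclidean_space"
 assumes "open Om" "has_weak_deriv Om e u v"
 shows "AE x in lebesgue_on Om. weak_deriv Om e u x = v x"
 by (rule has_weak_deriv_unique[OF assms(1) _ assms(2)])
  (unfold weak_deriv_def, rule someI[where P="has_weak_deriv Om e u", OF assms(2)])

section \<open>Classical derivatives are weak derivatives\<close>

text \<open>Difference quotients along e integrate to zero by translation invariance. They converge
  to the derivative; the mean value theorem bounds them by a constant on a fixed ball, outside of
  which they vanish.\<close>

lemma integral_partial_derivative_zero:
 fixes F :: "'a::euclidean_space => 'b::euclidean_space"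
 assumes F: "!!x. (F has_derivative F' x) (at x)" and c: "continuous_on UNIV (%x. F' x e)"
  and e: "norm e = 1" and R: "!!x. R < norm x ==> F x = 0"
 shows "(\<integral>x. F' x e \<partial>lborel) = 0"
proof -
 have cF: "continuous_on UNIV F"
  using F by (auto simp: continuous_on_eq_continuous_at intro: has_derivative_continuous)
 have G0: "F' x e = 0" if x: "R < norm x" for x
 proof -
  have "open {x :: 'a. R < norm x}" by (intro open_Collect_less continuous_intros)
  hence "(F has_derivative (%_. 0)) (at x)"
   by (rule has_derivative_transform_within_open[OF has_derivative_const[of 0]]) (use x R in auto)
  thus ?thesis using has_derivative_unique[OF F[of x]] by (metis)
 qed
 have "bounded ((%x. F' x e) ` cball 0 R)"
  by (intro compact_imp_bounded compact_continuous_image continuous_on_subset[OF c]) auto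
 then obtain M where M0: "0 < M" "ALL y:(%x. F' x e) ` cball 0 R. norm y <= M" unfolding bounded_pos by blast
 have M: "norm (F' x e) <= M" for x
 proof (cases "R < norm x")
  case False hence "F' x e : (%x. F' x e) ` cball 0 R" by auto
  thus ?thesis using M0 by blast
 qed (use G0 M0 in auto)
 define h where "h n = 1 / real (Suc n)" for n
 have h: "0 < h n" "h n <= 1" for n by (auto simp: h_def)
 define D where "D n x = real (Suc n) *R (F (h n *R e + x) - F x)" for n x
 have iF: "integrable lborel F"
 proof -
  have "integrable lborel (%x. indicator (cball 0 R) x *R F x)"
   by (rule borel_integrable_compact[OF compact_cball continuous_on_subset[OF cF]]) auto
  moreover have "indicator (cball 0 R) x *R F x = F x" for x using R[of x] by (auto simp: indicator_def)
  ultimately show ?thesis by simp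
 qed
 have itr: "integrable lborel (%x. F (c + x))" "(\<integral>x. F (c + x) \<partial>lborel) = (\<integral>x. F x \<partial>lborel)" for c
 proof -
  have "integrable (distr lborel borel ((+) c)) F" using iF by (simp add: lborel_distr_plus)
  thus "integrable lborel (%x. F (c + x))" by (subst (asm) integrable_distr_eq) (use iF in auto)
  have "(\<integral>x. F x \<partial>distr lborel borel ((+) c)) = (\<integral>x. F (c + x) \<partial>lborel)"
   by (rule integral_distr) (use iF in auto)
  thus "(\<integral>x. F (c + x) \<partial>lborel) = (\<integral>x. F x \<partial>lborel)" by (simp add: lborel_distr_plus)
 qed
 have D0: "(\<integral>x. D n x \<partial>lborel) = 0" for n
  unfolding D_def using itr[of "h n *R e"] iF by simp
 have lim: "(%n. D n x) ----> F' x e" for x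
 proof -
  have "((%h. norm (F (x + h) - F x - F' x h) / norm h) \<longlongrightarrow> 0) (at 0)"
   using F[of x] by (simp add: has_derivative_at)
  moreover have "filterlim (%n. h n *R e) (at 0) sequentially"
   unfolding filterlim_at
  proof
   show "\<forall>\<^sub>F n in sequentially. h n *R e : UNIV & h n *R e ~= 0"
   proof (rule always_eventually, rule allI)
    fix n show "h n *R e : UNIV & h n *R e ~= 0" using h(1)[of n] e by auto
   qed
   have "(%n. h n *R e) ----> 0 *R e"
    unfolding h_def by (intro tendsto_intros LIMSEQ_Suc[OF lim_1_over_n])
   thus "(%n. h n *R e) ----> 0" by simp
  qed
  ultimately have "(%n. norm (F (x + h n *R e) - F x - F' x (h n *R e)) / norm (h n *R e)) ----> 0"
   by (rule filterlim_compose)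
  moreover have "norm (F (x + h n *R e) - F x - F' x (h n *R e)) / norm (h n *R e) = norm (D n x - F' x e)" for n
  proof -
   have "D n x - F' x e = real (Suc n) *R (F (x + h n *R e) - F x - F' x (h n *R e))"
    using linear_scale[OF has_derivative_linear[OF F[of x]], of "h n" e]
    by (simp add: D_def h_def algebra_simps scaleR_diff_right)
   thus ?thesis using e by (simp add: h_def)
  qed
  ultimately have "(%n. norm (D n x - F' x e)) ----> 0" by simp
  thus ?thesis by (simp add: LIM_zero_iff tendsto_norm_zero_iff)
 qed
 have bound: "norm (D n x) <= M * indicator (cball 0 (R + 1)) x" for n x
 proof (cases "norm x <= R + 1")
  case False
  have "norm x <= norm (h n *R e + x) + norm (h n *R e)" using norm_triangle_ineq4[of "h n *R e + x" "h n *R e"] by simp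
  hence "R < norm (h n *R e + x)" using False h[of n] e by simp
  thus ?thesis using False R[of x] R[of "h n *R e + x"] by (simp add: D_def)
 next
  case True
  have "norm ((%t. F (t *R e + x)) (h n) - (%t. F (t *R e + x)) 0) <= M * norm (h n - 0)"
  proof (rule differentiable_bound[of UNIV "%t. F (t *R e + x)" "%t s. s *R F' (t *R e + x) e"])
   fix t :: real
   have "((%t. F (t *R e + x)) has_derivative (%s. F' (t *R e + x) (s *R e))) (at t)"
    by (rule has_derivative_compose[OF _ F]) (auto intro!: derivative_eq_intros)
   thus "((%t. F (t *R e + x)) has_derivative (%s. s *R F' (t *R e + x) e)) (at t within UNIV)"
    by (simp add: linear_scale[OF has_derivative_linear[OF F]])
   show "onorm (%s. s *R F' (t *R e + x) e) <= M"
   proof (rule onorm_bound)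
    show "norm (s *R F' (t *R e + x) e) <= M * norm s" for s
     using mult_left_mono[OF M[of "t *R e + x"], of "\<bar>s\<bar>"] by (simp add: mult.commute)
   qed (use M0 in simp)
  qed auto
  hence "norm (F (h n *R e + x) - F x) <= M * h n" using h[of n] by simp
  hence "real (Suc n) * norm (F (h n *R e + x) - F x) <= real (Suc n) * (M * h n)" by (intro mult_left_mono) auto
  thus ?thesis using True by (simp add: D_def h_def)
 qed
 have "(%n. \<integral>x. D n x \<partial>lborel) ----> (\<integral>x. F' x e \<partial>lborel)"
 proof (rule integral_dominated_convergence[where w="%x. M * indicator (cball 0 (R + 1)) x"])
  show "(%x. F' x e) : borel_measurable lborel" using c by (simp add: borel_measurable_continuous_onI)
  show "D n : borel_measurable lborel" for n
   unfolding D_def[abs_def] using itr(1)[of "h n *R e"] iF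
   by (intro borel_measurable_scaleR borel_measurable_diff borel_measurable_const) auto
  have "integrable lborel (indicat_real (cball (0::'a) (R + 1)))"
   using emeasure_bounded_finite[OF bounded_cball] by (intro integrable_real_indicator) auto
  thus "integrable lborel (%x::'a. M * indicat_real (cball 0 (R + 1)) x)" by (rule integrable_mult_right)
 qed (use lim bound in auto)
 thus ?thesis unfolding D0 by (simp add: LIMSEQ_const_iff)
qed

text \<open>The derivative is an explicit argument because it is computed with and estimated
  later.\<close>

definition C1_on :: "'a::euclidean_space set => ('a => 'b::euclidean_space) => ('a => 'a => 'b) => bool" where
 "C1_on Om u u' \<longleftrightarrow> (ALL x:Om. (u has_derivative u' x) (at x)) & (ALL e:Basis. continuous_on Om (%x. u' x e))"

lemma C1_on_continuous: "C1_on Om u u' ==> continuous_on Om u"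
 unfolding C1_on_def by (intro continuous_at_imp_continuous_on ballI has_derivative_continuous) blast

lemma locally_integrable_continuous:
 fixes u :: "'a::euclidean_space => 'b::euclidean_space"
 assumes "continuous_on Om u" shows "locally_integrable Om u"
 unfolding locally_integrable_def set_integrable_def
proof (intro allI impI)
 fix K assume K: "compact K & K <= Om"
 hence "integrable lborel (%x. indicator K x *R u x)"
  using assms by (intro borel_integrable_compact) (auto intro: continuous_on_subset)
 thus "integrable lebesgue (%x. indicator K x *R u x)" by (simp add: integrable_completion)
qed

text \<open>The product of u with a test function, extended by 0, is C^1 on the whole space with
  compact support, so its partial derivative has integral zero; the product rule turns this into
  integration by parts.\<close>

lemma C1_on_has_weak_deriv:
 fixes u :: "'a::euclidean_space => 'b::euclidean_space"
 assumes Om: "open Om" and u: "C1_on Om u u'" and e: "e : Basis"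
 shows "has_weak_deriv Om e u (%x. u' x e)"
 unfolding has_weak_deriv_def
proof (intro conjI allI impI)
 have cu: "continuous_on Om u" using u by (rule C1_on_continuous)
 have cu': "continuous_on Om (%x. u' x e)" using u e by (simp add: C1_on_def)
 show l: "locally_integrable Om u" "locally_integrable Om (%x. u' x e)"
  using cu cu' by (auto intro: locally_integrable_continuous)
 fix phi :: "'a => real" assume phi: "test_function Om phi"
 let ?K = "closure {x. phi x ~= 0}"
 have K: "compact ?K" "?K <= Om" using phi by (auto simp: test_function_def)
 define F where "F x = (if x : Om then phi x *R u x else 0)" for x
 define F' where "F' x h = (if x : Om then phi x *R u' x h + frechet_derivative phi (at x) h *R u x else 0)" for x h
 have FK: "F x = 0" "F' x = (%_. 0)" if "x ~: ?K" for x
  using test_function_zero[OF phi that] by (auto simp: F_def F'_def)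
 have dF: "(F has_derivative F' x) (at x)" for x
 proof (cases "x : Om")
  case True
  have "((%x. phi x *R u x) has_derivative (%h. phi x *R u' x h + frechet_derivative phi (at x) h *R u x)) (at x)"
   using u True by (intro has_derivative_scaleR test_function_has_derivative[OF phi]) (auto simp: C1_on_def)
  hence "(F has_derivative (%h. phi x *R u' x h + frechet_derivative phi (at x) h *R u x)) (at x)"
   by (rule has_derivative_transform_within_open[OF _ Om True]) (simp add: F_def)
  thus ?thesis using True by (simp add: F'_def[abs_def])
 next
  case False
  hence x: "x : - ?K" using K by auto
  have "(F has_derivative (%_. 0)) (at x)"
   by (rule has_derivative_transform_within_open[OF has_derivative_const[of 0], of "- ?K"]) (use x FK(1) in auto)
  thus ?thesis using FK(2) x by simp
 qed
 have cF': "continuous_on UNIV (%x. F' x e)"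
 proof -
  have "continuous_on Om (%x. phi x *R u' x e + frechet_derivative phi (at x) e *R u x)"
   by (intro continuous_intros cu cu' continuous_on_subset[OF test_function_cont[OF phi]]
     continuous_on_subset[OF test_function_cont_partial[OF phi e]]) auto
  hence "continuous_on Om (%x. F' x e)" by (rule continuous_on_eq) (simp add: F'_def)
  moreover have "continuous_on (- ?K) (%x. F' x e)"
   by (rule continuous_on_eq[OF continuous_on_const[of _ 0]]) (use FK(2) in auto)
  ultimately have "continuous_on (Om Un - ?K) (%x. F' x e)" using Om by (intro continuous_on_open_Un) auto
  moreover have "Om Un - ?K = UNIV" using K by auto
  ultimately show ?thesis by simp
 qed
 obtain R where R: "ALL x:?K. norm x <= R" using compact_imp_bounded[OF K(1)] unfolding bounded_iff by blast
 have z: "(\<integral>x. F' x e \<partial>lborel) = 0"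
  by (rule integral_partial_derivative_zero[OF dF cF' _, of R]) (use e FK(1) R in force)+
 have "(\<integral>x. F' x e \<partial>lebesgue) = 0"
  using z cF' by (subst integral_completion) (auto intro: borel_measurable_continuous_onI)
 moreover have "(\<integral>x. F' x e \<partial>lebesgue) = (\<integral>x. phi x *R u' x e + frechet_derivative phi (at x) e *R u x \<partial>lebesgue_on Om)"
  unfolding integral_restrict_space[OF sets_lebesgue_Int_space_open[OF Om]]
  by (intro Bochner_Integration.integral_cong) (auto simp: F'_def)
 moreover have "... = (\<integral>x. phi x *R u' x e \<partial>lebesgue_on Om) + (\<integral>x. frechet_derivative phi (at x) e *R u x \<partial>lebesgue_on Om)"
  by (rule Bochner_Integration.integral_add[OF test_function_integrable(1)[OF Om phi l(2)] test_function_integrable(2)[OF Om phi l(1) e]])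
 ultimately show "(\<integral>x. frechet_derivative phi (at x) e *R u x \<partial>lebesgue_on Om) = - (\<integral>x. phi x *R u' x e \<partial>lebesgue_on Om)"
  by (simp add: eq_neg_iff_add_eq_0 add.commute)
qed

section \<open>Weak derivatives in one dimension\<close>

lemma C_diff_combine:
 assumes "C_diff k f" "C_diff k g" shows "C_diff k (%x. al * f x + be * g x)"
 using assms
proof (induction k arbitrary: f g)
 case 0 thus ?case by (auto intro!: continuous_intros)
next
 case (Suc k)
 have "(%x. frechet_derivative (%x. al * f x + be * g x) (at x) e)
   = (%x. al * frechet_derivative f (at x) e + be * frechet_derivative g (at x) e)" if "e : Basis" for e
 proof
  fix x
  have "(f has_derivative frechet_derivative f (at x)) (at x)" "(g has_derivative frechet_derivative g (at x)) (at x)"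
   using Suc.prems by (auto simp: differentiable_on_def frechet_derivative_works)
  hence "((%x. al * f x + be * g x) has_derivative (%h. al * frechet_derivative f (at x) h + be * frechet_derivative g (at x) h)) (at x)"
   by (intro has_derivative_add has_derivative_mult_right)
  from frechet_derivative_at[OF this]
  show "frechet_derivative (%x. al * f x + be * g x) (at x) e = al * frechet_derivative f (at x) e + be * frechet_derivative g (at x) e"
   by metis
 qed
 thus ?case using Suc by (auto simp: differentiable_on_def intro!: derivative_intros)
qed

lemma C_diff_bump: "0 < eps ==> C_diff k (bump eps a b p n)"
 using C_diff_box_bump[of eps k a b "%_. p" "%_. n"] by (simp add: box_bump_def[abs_def])

lemma bump_shift: "bump eps 0 d 1 0 (x - a) = bump eps a (a + d) 1 0 x"
 by (simp add: bump_def algebra_simps)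

lemma continuous_on_bump: "0 < eps ==> continuous_on A (bump eps a b p n)"
 using C_diff_bump[of eps 0 a b p n] by (auto intro: continuous_on_subset)

context
 fixes d :: real assumes d: "0 < d"
begin

text \<open>The lower limit -1 lies to the left of the support, which makes 0 an interior point when
  the integral is differentiated.\<close>

definition "bstep x = integral {-1..x} (bump 1 0 d 1 0)"

lemma bump1_bounds: "0 <= bump 1 0 d 1 0 x" "x <= 0 | d <= x ==> bump 1 0 d 1 0 x = 0" "0 < x ==> x < d ==> 0 < bump 1 0 d 1 0 x"
 by (auto simp: bump_def)

lemma bstep_neg: "x <= 0 ==> bstep x = 0"
 unfolding bstep_def by (subst integral_cong[of _ _ "%_. 0"]) (auto simp: bump1_bounds(2))

lemma bstep_deriv: "(bstep has_real_derivative bump 1 0 d 1 0 x) (at x)"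
proof (cases "x < 0")
 case True
 have "((%_. 0) has_real_derivative 0) (at x)" by simp
 hence "(bstep has_derivative (*) 0) (at x)" unfolding has_field_derivative_def
  by (rule has_derivative_transform_within_open[of _ _ _ _ "{..<0}"]) (use True bstep_neg in auto)
 thus ?thesis using True by (simp add: has_field_derivative_def bump1_bounds(2))
next
 case False
 have "((%u. integral {-1..u} (bump 1 0 d 1 0)) has_vector_derivative bump 1 0 d 1 0 x) (at x within {-1..x+1})"
  using False by (intro integral_has_vector_derivative continuous_on_bump) auto
 thus ?thesis using False
  by (simp add: bstep_def[abs_def] has_real_derivative_iff_has_vector_derivative at_within_Icc_at)
qed

lemma bstep_mono: "x <= y ==> bstep x <= bstep y"
 by (rule DERIV_nonneg_imp_nondecreasing) (use bstep_deriv bump1_bounds(1) in blast)+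

lemma bstep_cont: "continuous_on A bstep"
 by (auto intro!: continuous_at_imp_continuous_on DERIV_isCont[OF bstep_deriv])

lemma bstep_const: "d <= x ==> bstep x = bstep d"
proof -
 assume x: "d <= x"
 have "bstep x <= bstep d"
 proof -
  have "- bstep d <= - bstep x"
  proof (rule DERIV_nonneg_imp_nondecreasing[OF x])
   fix y assume "d <= y" "y <= x"
   thus "EX z. ((%y. - bstep y) has_real_derivative z) (at y) & z \<ge> 0"
    using DERIV_minus[OF bstep_deriv[of y]] bump1_bounds(2)[of y] by auto
  qed
  thus ?thesis by simp
 qed
 thus ?thesis using bstep_mono[OF x] by simp
qed

lemma bstep_pos: "0 < bstep d"
proof -
 have "bstep 0 < bstep d"
  by (rule DERIV_pos_imp_increasing_open[OF d _ bstep_cont]) (use bstep_deriv bump1_bounds(3) in blast)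
 thus ?thesis by (simp add: bstep_neg)
qed

text \<open>A smooth substitute for the indicator of (a,b], with ramps of width d to the right of a
  and of b. Its derivative is the difference of two bumps of integral one.\<close>

definition "trapez a b x = (bstep (x - a) - bstep (x - b)) / bstep d"

lemma trapez_deriv:
 "(trapez a b has_real_derivative (bump 1 a (a+d) 1 0 x - bump 1 b (b+d) 1 0 x) / bstep d) (at x)"
proof -
 have "((%x. bstep (x - c)) has_real_derivative bump 1 c (c+d) 1 0 x) (at x)" for c
 proof -
  have "((%x. x - c) has_real_derivative 1) (at x)" by (auto intro!: derivative_eq_intros)
  from DERIV_chain2[OF bstep_deriv this] show ?thesis by (simp add: bump_shift)
 qed
 thus ?thesis unfolding trapez_def[abs_def] by (intro DERIV_cdivide DERIV_diff)
qed

lemma trapez_frechet: "frechet_derivative (trapez a b) (at x) 1 = (bump 1 a (a+d) 1 0 x - bump 1 b (b+d) 1 0 x) / bstep d"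
 using frechet_derivative_at[OF trapez_deriv[of a b x, unfolded has_field_derivative_def]] by (metis mult.right_neutral)

lemma trapez_bounds:
 assumes "a < b"
 shows "0 <= trapez a b x" "trapez a b x <= 1" "x <= a | b + d <= x ==> trapez a b x = 0"
  "a + d <= x ==> x <= b ==> trapez a b x = 1"
proof -
 have le: "bstep y <= bstep d" for y using bstep_const[of y] bstep_mono[of y d] by (cases "d <= y") auto
 have ge: "0 <= bstep y" for y using bstep_neg[of y] bstep_mono[of 0 y] bstep_neg[of 0] by (cases "y <= 0") auto
 show "0 <= trapez a b x" unfolding trapez_def using bstep_mono[of "x - b" "x - a"] bstep_pos assms by simp
 show "trapez a b x <= 1" unfolding trapez_def using le[of "x - a"] ge[of "x - b"] bstep_pos by (simp add: divide_le_eq)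
 show "trapez a b x = 0" if "x <= a | b + d <= x"
  using that assms d bstep_neg bstep_const[of "x - a"] bstep_const[of "x - b"] by (auto simp: trapez_def)
 show "trapez a b x = 1" if "a + d <= x" "x <= b"
  using that assms bstep_neg bstep_const[of "x - a"] bstep_pos by (auto simp: trapez_def)
qed

lemma C_diff_trapez: "C_diff k (trapez a b)"
proof -
 have "C_diff (Suc k) (trapez a b)" for k
 proof -
  have "C_diff k (%x. (1 / bstep d) * bump 1 a (a+d) 1 0 x + (- 1 / bstep d) * bump 1 b (b+d) 1 0 x)"
   by (intro C_diff_combine C_diff_bump) auto
  moreover have "trapez a b differentiable_on UNIV"
   using trapez_deriv by (auto simp: differentiable_on_def has_field_derivative_def differentiable_def)
  ultimately show ?thesis by (simp add: trapez_frechet diff_divide_distrib)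
 qed
 thus ?thesis
  by (cases k) (auto intro!: continuous_at_imp_continuous_on DERIV_isCont[OF trapez_deriv])
qed

lemma test_function_trapez:
 assumes "a < b" "{a..b+d} <= Om"
 shows "test_function Om (trapez a b)"
proof -
 have "{x. trapez a b x ~= 0} <= {a..b+d}"
 proof
  fix x assume "x : {x. trapez a b x ~= 0}"
  hence "~ (x <= a | b + d <= x)" using trapez_bounds(3)[OF assms(1), of x] by blast
  thus "x : {a..b+d}" by auto
 qed
 hence "closure {x. trapez a b x ~= 0} <= {a..b+d}" by (intro closure_minimal) auto
 thus ?thesis
  unfolding test_function_def using assms C_diff_trapez
  by (auto simp: compact_eq_bounded_closed simp del: bounded_closure compact_closure intro: bounded_subset[of "{a..b+d}"])
qed

text \<open>Averages P with a probability density supported in [a,a+d]; for small d this recovers P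
  a.\<close>

lemma bump_average:
 fixes P :: "real => 'b::euclidean_space"
 assumes P: "continuous_on {a..a+d} P" "!!x. x : {a..a+d} ==> norm (P x - P a) <= eta" and sub: "{a..a+d} <= Om" and Om: "open Om"
 shows "integrable (lebesgue_on Om) (%x. (bump 1 a (a+d) 1 0 x / bstep d) *R P x)"
  and "norm ((\<integral>x. (bump 1 a (a+d) 1 0 x / bstep d) *R P x \<partial>lebesgue_on Om) - P a) <= eta"
proof -
 let ?m = "%x. bump 1 a (a+d) 1 0 x / bstep d"
 have c: "continuous_on {a..a+d} ?m" by (intro continuous_intros continuous_on_bump) (use bstep_pos in auto)
 have z: "?m x = 0" if "x ~: {a..a+d}" for x using that by (auto simp: bump_def)
 have m0: "0 <= ?m x" for x using bump1_bounds(1)[of "x - a"] bstep_pos by (simp add: bump_shift)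
 have one: "(?m has_integral 1) {a..a+d}"
 proof -
  have "(?m has_integral (bstep (a + d - a) / bstep d - bstep (a - a) / bstep d)) {a..a+d}"
  proof (rule fundamental_theorem_of_calculus)
   fix x
   have "((%x. bstep (x - a) / bstep d) has_real_derivative ?m x) (at x)"
   proof -
    have "((%x. x - a) has_real_derivative 1) (at x)" by (auto intro!: derivative_eq_intros)
    from DERIV_cdivide[OF DERIV_chain2[OF bstep_deriv this]] show ?thesis by (simp add: bump_shift)
   qed
   thus "((%x. bstep (x - a) / bstep d) has_vector_derivative ?m x) (at x within {a..a+d})"
    by (metis has_real_derivative_iff_has_vector_derivative has_vector_derivative_at_within)
  qed (use d in auto)
  thus ?thesis using bstep_pos by (simp add: bstep_neg less_imp_neq[symmetric])
 qed
 have ci: "continuous_on {a..a+d} (%x. ?m x *R P x)" by (intro continuous_intros c P)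
 show int: "integrable (lebesgue_on Om) (%x. ?m x *R P x)"
  unfolding integrable_restrict_space[OF sets_lebesgue_Int_space_open[OF Om]]
 proof -
  have "integrable lborel (%x. indicator {a..a+d} x *R (?m x *R P x))"
   by (rule borel_integrable_compact[OF compact_Icc ci])
  hence "integrable lebesgue (%x. indicator {a..a+d} x *R (?m x *R P x))" by (simp add: integrable_completion)
  moreover have "indicator {a..a+d} x *R (?m x *R P x) = indicator Om x *R (?m x *R P x)" for x
   using sub z[of x] by (cases "x : {a..a+d}") auto
  ultimately show "integrable lebesgue (%x. indicat_real Om x *R (?m x *R P x))" by (simp only:)
 qed
 have hi: "((%x. ?m x *R P x) has_integral integral {a..a+d} (%x. ?m x *R P x)) {a..a+d}"
  by (rule integrable_integral[OF integrable_continuous_interval[OF ci]])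
 have "((%x. ?m x *R P x) has_integral integral {a..a+d} (%x. ?m x *R P x)) Om"
  by (rule has_integral_on_superset[OF hi _ sub]) (use z in auto)
 hence L: "(\<integral>x. ?m x *R P x \<partial>lebesgue_on Om) = integral {a..a+d} (%x. ?m x *R P x)"
  using lebesgue_integral_eq_integral[OF int] Om by (simp add: integral_unique)
 have "((%x. ?m x *R P a) has_integral 1 *R P a) {a..a+d}" by (rule has_integral_scaleR_left[OF one])
 hence "((%x. ?m x *R P x - ?m x *R P a) has_integral (integral {a..a+d} (%x. ?m x *R P x) - 1 *R P a)) {a..a+d}"
  by (rule has_integral_diff[OF hi])
 hence D: "((%x. ?m x *R P x - ?m x *R P a) has_integral (integral {a..a+d} (%x. ?m x *R P x) - 1 *R P a)) {a..a+d}" .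
 have E: "((%x. ?m x * eta) has_integral 1 * eta) {a..a+d}" using has_integral_mult_left[OF one] .
 have "norm (integral {a..a+d} (%x. ?m x *R P x - ?m x *R P a)) <= integral {a..a+d} (%x. ?m x * eta)"
 proof (rule integral_norm_bound_integral[OF has_integral_integrable[OF D] has_integral_integrable[OF E]])
  fix x assume "x : {a..a+d}"
  hence "?m x * norm (P x - P a) <= ?m x * eta" using m0 P(2) by (intro mult_left_mono) auto
  thus "norm (?m x *R P x - ?m x *R P a) <= ?m x * eta"
   by (simp only: scaleR_diff_right[symmetric] norm_scaleR abs_of_nonneg[OF m0])
 qed
 thus "norm ((\<integral>x. ?m x *R P x \<partial>lebesgue_on Om) - P a) <= eta"
  unfolding L integral_unique[OF D] integral_unique[OF E] by simp
qed

end

text \<open>Test the weak derivative with trapezoids. On one side stand averages of P just to the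
  right of a and of b, on the other the integral of v against functions tending to the indicator of
  (a,b].\<close>

lemma weak_deriv_real_FTC:
 fixes P v :: "real => 'b::euclidean_space"
 assumes P: "continuous_on {1..} P" and hw: "has_weak_deriv {1<..} 1 P v" and ab: "1 < a" "a < b"
 shows "integrable lebesgue (%x. indicator {a<..b} x *R v x)"
  and "P b - P a = (\<integral>x. indicator {a<..b} x *R v x \<partial>lebesgue)"
proof -
 let ?Om = "{1::real<..}"
 have Om: "open ?Om" by simp
 define d where "d n = 1 / real (Suc n)" for n
 have d: "0 < d n" "d n <= 1" for n by (auto simp: d_def)
 have d0: "d ----> 0" unfolding d_def by (rule LIMSEQ_Suc[OF lim_1_over_n])
 define f where "f x = indicator {a..b+1} x *R v x" for x
 have "compact {a..b+1}" "{a..b+1} <= ?Om" using ab by auto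
 hence f: "integrable lebesgue f"
  using hw unfolding has_weak_deriv_def locally_integrable_def set_integrable_def f_def[abs_def] by blast
 have indf: "indicator {a<..b} x *R v x = indicator {a<..b} x *R f x" for x by (auto simp: f_def indicator_def)
 show "integrable lebesgue (%x. indicator {a<..b} x *R v x)"
  unfolding indf by (rule integrable_mult_indicator[OF _ f]) simp
 define A where "A c n = (\<integral>x. (bump 1 c (c + d n) 1 0 x / bstep (d n) (d n)) *R P x \<partial>lebesgue_on ?Om)" for c n
 have near: "EX dl>0. ALL x:{1..}. \<bar>x - c\<bar> < dl --> norm (P x - P c) < eta" if "1 < c" "0 < eta" for c eta
  using P that unfolding continuous_on_iff dist_norm real_norm_def by (metis atLeast_iff less_imp_le)
 have Aint: "integrable (lebesgue_on ?Om) (%x. (bump 1 c (c + d n) 1 0 x / bstep (d n) (d n)) *R P x)" if "1 < c" for c n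
 proof -
  have cP: "continuous_on {c..c + d n} P" using P that by (rule_tac continuous_on_subset) auto
  have "bounded ((%x. P x - P c) ` {c..c + d n})"
   by (intro compact_imp_bounded compact_continuous_image continuous_intros cP) auto
  then obtain M where "ALL y:(%x. P x - P c) ` {c..c + d n}. norm y <= M" unfolding bounded_iff by blast
  thus ?thesis
   by (intro bump_average(1)[OF d(1) cP, of M]) (use that in auto)
 qed
 have Alim: "A c ----> P c" if c: "1 < c" for c
 proof (rule metric_LIMSEQ_I)
  fix eta :: real assume eta: "0 < eta"
  obtain dl where dl: "0 < dl" "ALL x:{1..}. \<bar>x - c\<bar> < dl --> norm (P x - P c) < eta/2" using near[OF c, of "eta/2"] eta by auto
  obtain N where N: "!!n. n \<ge> N ==> d n < dl" using metric_LIMSEQ_D[OF d0 dl(1)] d by (auto simp: dist_real_def abs_of_pos)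
  show "EX N. ALL n>=N. dist (A c n) (P c) < eta"
  proof (intro exI allI impI)
   fix n assume n: "n \<ge> N"
   have "norm (A c n - P c) <= eta/2" unfolding A_def
   proof (rule bump_average(2)[OF d(1)])
    show "continuous_on {c..c + d n} P" using P c by (rule_tac continuous_on_subset) auto
    fix x assume "x : {c..c + d n}"
    hence "x : {1..}" "\<bar>x - c\<bar> < dl" using N[OF n] c by auto
    thus "norm (P x - P c) <= eta/2" using dl(2) by (meson less_imp_le)
   qed (use c in auto)
   thus "dist (A c n) (P c) < eta" using eta by (simp add: dist_norm)
  qed
 qed
 let ?Phi = "%n. trapez (d n) a b"
 have t: "test_function ?Om (?Phi n)" for n
  using ab d(1)[of n] by (intro test_function_trapez) auto
 have m: "?Phi n : borel_measurable lebesgue" for n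
  using borel_measurable_continuous_onI[OF test_function_cont[OF t[of n]]] by (simp add: measurable_completion)
 have weq: "A a n - A b n = - (\<integral>x. ?Phi n x *R f x \<partial>lebesgue)" for n
 proof -
  have "A a n - A b n = (\<integral>x. frechet_derivative (?Phi n) (at x) 1 *R P x \<partial>lebesgue_on ?Om)"
   unfolding A_def trapez_frechet[OF d(1)] diff_divide_distrib scaleR_diff_left
   using ab by (intro Bochner_Integration.integral_diff[symmetric] Aint) auto
  also have "... = - (\<integral>x. ?Phi n x *R v x \<partial>lebesgue_on ?Om)"
   using hw t[of n] unfolding has_weak_deriv_def by blast
  also have "(\<integral>x. ?Phi n x *R v x \<partial>lebesgue_on ?Om) = (\<integral>x. ?Phi n x *R f x \<partial>lebesgue)"
   unfolding integral_restrict_space[OF sets_lebesgue_Int_space_open[OF Om]]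
  proof (rule Bochner_Integration.integral_cong)
   fix x show "indicator ?Om x *R (?Phi n x *R v x) = ?Phi n x *R f x"
   proof (cases "x : {a..b+1}")
    case True thus ?thesis using ab by (simp add: f_def)
   next
    case False
    hence "?Phi n x = 0" using trapez_bounds(3)[OF d(1)[of n] ab(2), of x] d(2)[of n] by auto
    thus ?thesis by simp
   qed
  qed simp
  finally show ?thesis .
 qed
 have lim: "(%n. \<integral>x. ?Phi n x *R f x \<partial>lebesgue) ----> (\<integral>x. indicator {a<..b} x *R f x \<partial>lebesgue)"
 proof (rule integral_dominated_convergence[where w="%x. norm (f x)"])
  show "(%x. indicator {a<..b} x *R f x) : borel_measurable lebesgue"
   using borel_measurable_integrable[OF f] by (intro borel_measurable_scaleR borel_measurable_indicator) auto
  show "(%x. ?Phi n x *R f x) : borel_measurable lebesgue" for n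
   by (rule borel_measurable_scaleR[OF m borel_measurable_integrable[OF f]])
  show "integrable lebesgue (%x. norm (f x))" using f by simp
  show "AE x in lebesgue. norm (?Phi n x *R f x) <= norm (f x)" for n
   using trapez_bounds(1,2)[OF d(1)[of n] ab(2)] by (intro AE_I2) (simp add: mult_left_le_one_le)
  have "(%n. ?Phi n x) ----> indicator {a<..b} x" for x
  proof (rule tendsto_eventually)
   \<comment> \<open>Once d is below g, neither ramp reaches x. For x <= a the value is 0 for every
     d, so any positive g serves.\<close>
   define g where "g = (if x <= a then 1 else if x <= b then x - a else x - b)"
   have "0 < g" by (auto simp: g_def)
   then obtain N where "ALL n>=N. dist (d n) 0 < g" using metric_LIMSEQ_D[OF d0] by blast
   hence N: "!!n. n \<ge> N ==> d n < g" by (auto simp: dist_real_def)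
   have "?Phi n x = indicator {a<..b} x" if "n \<ge> N" for n
    using N[OF that] trapez_bounds(3)[OF d(1)[of n] ab(2), of x] trapez_bounds(4)[OF d(1)[of n] ab(2), of x]
    by (auto simp: g_def indicator_def split: if_splits)
   thus "\<forall>\<^sub>F n in sequentially. ?Phi n x = indicator {a<..b} x" by (auto simp: eventually_sequentially)
  qed
  thus "AE x in lebesgue. (%n. ?Phi n x *R f x) ----> indicator {a<..b} x *R f x"
   by (intro AE_I2 tendsto_scaleR tendsto_const)
 qed
 have "(%n. A a n - A b n) ----> P a - P b" using ab by (intro tendsto_diff Alim) auto
 moreover have "(%n. A a n - A b n) ----> - (\<integral>x. indicator {a<..b} x *R f x \<partial>lebesgue)"
  unfolding weq by (rule tendsto_minus[OF lim])
 ultimately have "P a - P b = - (\<integral>x. indicator {a<..b} x *R f x \<partial>lebesgue)" by (rule LIMSEQ_unique)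
 hence "P b - P a = (\<integral>x. indicator {a<..b} x *R f x \<partial>lebesgue)"
  by (metis minus_diff_eq minus_minus)
 thus "P b - P a = (\<integral>x. indicator {a<..b} x *R v x \<partial>lebesgue)" unfolding indf .
qed

text \<open>This metric form of absolute continuity is all that is used of a weak derivative below: unlike
 the derivative itself it passes to cut and averaged profiles without any differentiation.\<close>

lemma weak_deriv_increment:
 fixes P v :: "real => 'b::euclidean_space"
 assumes P: "continuous_on {1..} P" and hw: "has_weak_deriv {1<..} 1 P v" and ab: "1 <= a" "a <= b"
 shows "ennreal (nsq (P b - P a)) <= ennreal (b - a) * (LL x:{a..b}. ennreal (nsq (v x)))"
proof -
 have main: "ennreal (nsq (P b - P a)) <= ennreal (b - a) * (LL x:{a..b}. ennreal (nsq (v x)))"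
  if ab: "1 < a" "a < b" for a
 proof -
  let ?I = "indicator {a<..b} :: real => ennreal"
  define g where "g x = indicator {a<..b} x *R v x" for x
  have g: "integrable lebesgue g" "P b - P a = (\<integral>x. g x \<partial>lebesgue)"
   using weak_deriv_real_FTC[OF P hw ab] by (auto simp: g_def[abs_def])
  have "ennreal (norm (P b - P a)) <= (LL x. ennreal (norm (g x)))"
   unfolding g(2) by (rule integral_norm_bound_ennreal[OF g(1)])
  also have "... = (LL x. ?I x * ennreal (norm (g x)))"
   by (intro nn_integral_cong) (auto simp: g_def indicator_def)
  finally have "(ennreal (norm (P b - P a)))^2 <= (LL x. ?I x * ennreal (norm (g x)))^2"
   by (rule power_mono) simp
  also have "... <= (LL x. (?I x)^2) * (LL x. (ennreal (norm (g x)))^2)"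
   by (rule Cauchy_Schwarz_nn_integral) (use g(1) in "auto intro!: borel_measurable_indicator")
  also have "(LL x. (?I x)^2) = (LL x. ?I x)"
   by (intro nn_integral_cong) (auto simp: indicator_def)
  also have "(LL x. ?I x) = ennreal (b - a)"
   using ab by (subst nn_integral_indicator) auto
  also have "(LL x. (ennreal (norm (g x)))^2) <= (LL x:{a..b}. ennreal (nsq (v x)))"
   by (intro nn_integral_mono) (auto simp: g_def indicator_def ennreal_power)
  finally show ?thesis by (simp add: ennreal_power mult_left_mono)
 qed
 show ?thesis
 proof (cases "a = b")
  case False
  hence lt: "a < b" using ab by simp
  show ?thesis
  proof (cases "1 < a")
   case False
   hence a1: "a = 1" using ab by simp
   \<comment> \<open>The weak formulation reaches the open half-line only; the end point 1 is
     approached from inside by continuity of P.\<close>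
   define c where "c n = 1 + (b - 1) / real (Suc (Suc n))" for n
   have c: "1 < c n" "c n < b" for n
   proof -
    show "1 < c n" using lt a1 by (simp add: c_def)
    have "(b - 1) / real (Suc (Suc n)) < (b - 1) / 1" using lt a1 by (intro divide_strict_left_mono) auto
    thus "c n < b" by (simp add: c_def)
   qed
   have clim: "c ----> 1"
   proof -
    have "(%n. 1 + (b - 1) * (1 / real (Suc (Suc n)))) ----> 1 + (b - 1) * 0"
     by (intro tendsto_intros LIMSEQ_Suc[OF LIMSEQ_Suc[OF lim_1_over_n]])
    thus ?thesis by (simp add: c_def[abs_def])
   qed
   have "(%n. P (c n)) ----> P 1"
    by (rule continuous_on_tendsto_compose[OF P clim]) (use c in "auto intro!: always_eventually less_imp_le")
   hence L: "(%n. ennreal (nsq (P b - P (c n)))) ----> ennreal (nsq (P b - P 1))"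
    by (intro tendsto_intros)
   have "ennreal (nsq (P b - P 1)) <= ennreal (b - 1) * (LL x:{1..b}. ennreal (nsq (v x)))"
   proof (rule LIMSEQ_le_const2[OF L], intro exI allI impI)
    fix n
    have "ennreal (nsq (P b - P (c n))) <= ennreal (b - c n) * (LL x:{c n..b}. ennreal (nsq (v x)))"
     by (rule main[OF c])
    also have "... <= ennreal (b - 1) * (LL x:{1..b}. ennreal (nsq (v x)))"
    proof (rule mult_mono)
     show "(LL x:{c n..b}. ennreal (nsq (v x))) <= (LL x:{1..b}. ennreal (nsq (v x)))"
      using c(1)[of n] by (intro nn_integral_mono) (auto simp: indicator_def)
    qed (use c[of n] in "auto intro!: ennreal_leI")
    finally show "ennreal (nsq (P b - P (c n))) <= ennreal (b - 1) * (LL x:{1..b}. ennreal (nsq (v x)))" .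
   qed
   thus ?thesis unfolding a1 .
  qed (use main lt in auto)
 qed simp
qed

section \<open>The potentials\<close>

lemma norm_mat3: "nsq (Q :: real^3^3) = (Q$1$1)^2 + (Q$1$2)^2 + (Q$1$3)^2 + (Q$2$1)^2 + (Q$2$2)^2 + (Q$2$3)^2
  + (Q$3$1)^2 + (Q$3$2)^2 + (Q$3$3)^2"
 by (simp add: norm_vec_def L2_set_def sum_3)

lemma S0_iff: "Q : S0 \<longleftrightarrow> Q$2$1 = Q$1$2 & Q$3$1 = Q$1$3 & Q$3$2 = Q$2$3 & Q$3$3 = - Q$1$1 - Q$2$2"
 by (auto simp: S0_def transpose_def trace_def vec_eq_iff forall_3 sum_3)

lemma subspace_S0: "subspace S0"
 by (auto simp: subspace_def S0_iff right_diff_distrib)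

lemma closed_S0: "closed S0" by (rule closed_subspace[OF subspace_S0])

lemma mem_S0: "0 : S0" "x : S0 ==> y : S0 ==> x + y : S0" "x : S0 ==> y : S0 ==> x - y : S0" "x : S0 ==> c *R x : S0"
 using subspace_S0 by (auto intro: subspace_0 subspace_add subspace_diff subspace_scale)

text \<open>With N = Q + I/3 this is N^2 - N.\<close>

definition f_root :: "real^3^3 => real^3^3" where
 "f_root Q = Q ** Q - (1/3) *R Q - (2/9) *R mat 1"

text \<open>Written in the five free entries of a traceless symmetric matrix, where tr (Q^3) equals
  3 det Q.\<close>

lemma f_pot_real_identity:
 fixes a b p q r :: real
 shows "2/9 - 1/2 * (2 * (a*a + b*b + a*b + p*p + q*q + r*r))
   - (3 * ((a*b - p*p) * (-a-b) - a*r*r + 2*p*q*r - b*q*q)) + 3/4 * (2 * (a*a + b*b + a*b + p*p + q*q + r*r))^2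
  = 3/2 * ((a*a + p*p + q*q - a/3 - 2/9)^2 + (p*p + b*b + r*r - b/3 - 2/9)^2 + (q*q + r*r + (a+b)*(a+b) + (a+b)/3 - 2/9)^2
    + 2 * (a*p + p*b + q*r - p/3)^2 + 2 * (a*q + p*r - q*(a+b) - q/3)^2 + 2 * (p*q + b*r - r*(a+b) - r/3)^2)"
proof -
 \<comment> \<open>Tripling the entries clears the denominators before the polynomial identity is
   checked.\<close>
 define a' b' p' q' r' where d: "a' = 3*a" "b' = 3*b" "p' = 3*p" "q' = 3*q" "r' = 3*r"
 have e: "a = a'/3" "b = b'/3" "p = p'/3" "q = q'/3" "r = r'/3" by (auto simp: d)
 have "36 - 9 * (2 * (a'*a' + b'*b' + a'*b' + p'*p' + q'*q' + r'*r'))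
   - 18 * ((a'*b' - p'*p') * (-a'-b') - a'*r'*r' + 2*p'*q'*r' - b'*q'*q') + 3/2 * (2 * (a'*a' + b'*b' + a'*b' + p'*p' + q'*q' + r'*r'))^2
  = 3 * ((a'*a' + p'*p' + q'*q' - a' - 2)^2 + (p'*p' + b'*b' + r'*r' - b' - 2)^2 + (q'*q' + r'*r' + (a'+b')*(a'+b') + (a'+b') - 2)^2
    + 2 * (a'*p' + p'*b' + q'*r' - p')^2 + 2 * (a'*q' + p'*r' - q'*(a'+b') - q')^2 + 2 * (p'*q' + b'*r' - r'*(a'+b') - r')^2)"
  by (simp add: power2_eq_square algebra_simps)
 thus ?thesis unfolding e by (simp add: power2_eq_square field_simps)
qed

text \<open>The square root \<open>f_root\<close> vanishes exactly when \<open>Q + I/3\<close> is idempotent.\<close>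

lemma f_pot_eq:
 assumes "Q : S0" shows "f_pot Q = 3/2 * nsq (f_root Q)"
proof -
 let ?a = "Q$1$1" and ?b = "Q$2$2" and ?p = "Q$1$2" and ?q = "Q$1$3" and ?r = "Q$2$3"
 have e: "Q$2$1 = ?p" "Q$3$1 = ?q" "Q$3$2 = ?r" "Q$3$3 = - ?a - ?b" using assms by (auto simp: S0_iff)
 have n: "nsq Q = 2 * (?a*?a + ?b*?b + ?a*?b + ?p*?p + ?q*?q + ?r*?r)"
  unfolding norm_mat3 e by (simp add: power2_eq_square algebra_simps)
 have n4: "(norm Q)^4 = (nsq Q)^2" by simp
 have t: "trace (Q ** Q ** Q) = 3 * ((?a*?b - ?p*?p) * (-?a-?b) - ?a*?r*?r + 2*?p*?q*?r - ?b*?q*?q)"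
  by (simp add: trace_def matrix_matrix_mult_def sum_3 e algebra_simps)
 have r: "nsq (f_root Q) = (?a*?a + ?p*?p + ?q*?q - ?a/3 - 2/9)^2 + (?p*?p + ?b*?b + ?r*?r - ?b/3 - 2/9)^2 + (?q*?q + ?r*?r + (?a+?b)*(?a+?b) + (?a+?b)/3 - 2/9)^2
    + 2 * (?a*?p + ?p*?b + ?q*?r - ?p/3)^2 + 2 * (?a*?q + ?p*?r - ?q*(?a+?b) - ?q/3)^2 + 2 * (?p*?q + ?b*?r - ?r*(?a+?b) - ?r/3)^2"
  unfolding norm_mat3 by (simp add: f_root_def matrix_matrix_mult_def sum_3 mat_def e) (simp add: power2_eq_square algebra_simps)
 show ?thesis unfolding f_pot_def n4 n t r by (rule f_pot_real_identity)
qed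

lemma f_pot_nonneg: "Q : S0 ==> 0 <= f_pot Q" by (simp add: f_pot_eq)

lemma matrix_add_rdistrib3: "(A + B) ** (C :: real^3^3) = A ** C + B ** C"
 by (simp add: matrix_matrix_mult_def vec_eq_iff sum_3 distrib_right)

lemma norm_matrix_mult_le:
 fixes A B :: "real^3^3"
 shows "norm (A ** B) <= norm A * norm B"
proof -
 have n: "nsq (M :: real^3^3) = (SUM i:UNIV. SUM j:UNIV. (M$i$j)^2)" for M
  unfolding norm_mat3 by (simp add: sum_3)
 have "nsq (A ** B) = (SUM i:UNIV. SUM j:UNIV. (SUM k:UNIV. A$i$k * B$k$j)^2)"
  unfolding n by (simp add: matrix_matrix_mult_def)
 also have "... <= (SUM i:UNIV. SUM j:UNIV. (SUM k:UNIV. (A$i$k)^2) * (SUM k:UNIV. (B$k$j)^2))"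
  by (intro sum_mono Cauchy_Schwarz_ineq_sum)
 also have "... = (SUM i:UNIV. SUM k:UNIV. (A$i$k)^2) * (SUM j:UNIV. SUM k:UNIV. (B$k$j)^2)"
  by (simp add: sum_product)
 also have "(SUM j:UNIV. SUM k:UNIV. (B$k$j)^2) = nsq B" unfolding n by (rule sum.swap)
 also have "(SUM i:UNIV. SUM k:UNIV. (A$i$k)^2) * nsq B = (norm A * norm B)^2" unfolding n[symmetric] by (simp add: power_mult_distrib)
 finally show ?thesis by (rule power2_le_imp_le) simp
qed

lemma continuous_f_pot: "continuous_on A f_pot"
 unfolding f_pot_def[abs_def] trace_def matrix_matrix_mult_def
 by (simp only: vec_lambda_beta) (intro continuous_intros)

section \<open>Uniaxial tensors and the potential g\<close>

abbreviation "Qperp n \<equiv> ((\<chi> i j. n $ i * n $ j) :: real^3^3)"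

lemma uniaxial_S0: "norm n = 1 ==> uniaxial n : S0"
proof -
 assume "norm n = 1"
 hence s: "n$1 * n$1 + n$2 * n$2 + n$3 * n$3 = 1" by (simp add: norm_vec_def L2_set_def sum_3 power2_eq_square)
 have "uniaxial n $ i $ j = n$i * n$j - (if i = j then 1/3 else 0)" for i j by (simp add: uniaxial_def mat_def)
 thus ?thesis unfolding S0_iff using s by simp
qed

lemma norm_uniaxial:
 assumes "norm n = 1" shows "nsq (uniaxial n) = 2/3"
proof -
 let ?x = "n$1" and ?y = "n$2" and ?z = "n$3"
 have s: "?z^2 = 1 - ?x^2 - ?y^2" using assms by (simp add: norm_vec_def L2_set_def sum_3)
 have "nsq (uniaxial n) = (?x^2 - 1/3)^2 + (?y^2 - 1/3)^2 + (?z^2 - 1/3)^2 + 2 * (?x^2 * ?y^2) + 2 * (?x^2 * ?z^2) + 2 * (?y^2 * ?z^2)"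
  unfolding norm_mat3 by (simp add: uniaxial_def mat_def power2_eq_square algebra_simps)
 also have "... = 2/3" unfolding s by (simp add: power2_eq_square algebra_simps)
 finally show ?thesis .
qed

lemma f_pot_uniaxial:
 assumes "norm n = 1" shows "f_pot (uniaxial n) = 0"
proof -
 let ?x = "n$1" and ?y = "n$2" and ?z = "n$3"
 have s: "?x * ?x + ?y * ?y + ?z * ?z = 1" using assms by (simp add: norm_vec_def L2_set_def sum_3 power2_eq_square)
 have sq: "Qperp n ** Qperp n = Qperp n"
 proof -
  have "(Qperp n ** Qperp n) $ i $ j = n$i * n$j * (?x * ?x + ?y * ?y + ?z * ?z)" for i j
   by (simp add: matrix_matrix_mult_def sum_3 algebra_simps)
  thus ?thesis unfolding s by (simp add: vec_eq_iff)
 qed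
 have "f_root (uniaxial n) = Qperp n ** Qperp n - Qperp n"
  by (simp add: vec_eq_iff forall_3 f_root_def uniaxial_def matrix_matrix_mult_def sum_3 mat_def) (simp add: field_simps)
 hence "f_root (uniaxial n) = 0" unfolding sq by simp
 thus ?thesis using f_pot_eq[OF uniaxial_S0[OF assms]] by simp
qed

lemma norm_e3 [simp]: "norm (axis 3 1 :: real^3) = 1" by simp

lemma Q_inf_S0: "Q_inf : S0" unfolding Q_inf_def by (rule uniaxial_S0) simp
lemma norm_Q_inf2: "nsq Q_inf = 2/3" unfolding Q_inf_def by (rule norm_uniaxial) simp
lemma norm_Q_inf: "norm Q_inf = sqrt (2/3)" using norm_Q_inf2 by (metis norm_ge_zero real_sqrt_unique)
lemma f_pot_Q_inf: "f_pot Q_inf = 0" unfolding Q_inf_def by (rule f_pot_uniaxial) simp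
lemma f_root_Q_inf: "f_root Q_inf = 0" using f_pot_eq[OF Q_inf_S0] f_pot_Q_inf by simp

lemma inner_Q_inf: assumes "Q : S0" shows "Q \<bullet> Q_inf = Q$3$3"
proof -
 have "Q_inf $ i $ j = (if i = j then if i = 3 then 2/3 else -1/3 else 0)" for i j
  by (simp add: Q_inf_def uniaxial_def mat_def axis_def)
 hence "Q \<bullet> Q_inf = - (1/3) * Q$1$1 - (1/3) * Q$2$2 + (2/3) * Q$3$3"
  by (simp add: inner_vec_def sum_3)
 moreover have "Q$3$3 = - Q$1$1 - Q$2$2" using assms by (simp add: S0_iff)
 ultimately show ?thesis by linarith
qed

text \<open>On \<open>S0\<close> the entry Q33 is the inner product with Q_inf, so up to the factor
  |Q| the potential g is the defect in the Cauchy-Schwarz inequality for Q and Q_inf. Its sign and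
  the quadratic bound come from this.\<close>

lemma g_pot_eq: "Q : S0 ==> Q ~= 0 ==> g_pot Q * norm Q = norm Q_inf * norm Q - Q \<bullet> Q_inf"
 by (simp add: g_pot_def inner_Q_inf norm_Q_inf left_diff_distrib)

lemma g_pot_nonneg: assumes "Q : S0" shows "0 <= g_pot Q"
proof (cases "Q = 0")
 case False
 have "0 <= g_pot Q * norm Q" unfolding g_pot_eq[OF assms False] using norm_cauchy_schwarz[of Q Q_inf] by (simp add: mult.commute)
 thus ?thesis using False by (simp add: zero_le_mult_iff)
qed (simp add: g_pot_def)

lemma sqrt23: "sqrt (2/3) <= 1" "1/2 <= sqrt (2/3)" "0 < sqrt (2/3)"
proof -
 show "1/2 <= sqrt (2/3)" by (rule real_le_rsqrt) (simp add: power2_eq_square)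
qed auto

lemma g_pot_le: "g_pot Q <= 2"
proof (cases "Q = 0")
 case False
 have "\<bar>Q$3$3\<bar> <= norm Q"
  using component_le_norm_cart[of "Q$3" 3] Finite_Cartesian_Product.norm_nth_le[of Q 3] by linarith
 hence "\<bar>Q$3$3 / norm Q\<bar> <= 1" using False by (simp add: abs_divide)
 thus ?thesis unfolding g_pot_def using sqrt23 by linarith
next
 case True
 hence "g_pot Q = sqrt (2/3)" by (simp add: g_pot_def)
 thus ?thesis using sqrt23(1) by linarith
qed

text \<open>For |Q| <= 1/4 the distance to Q_inf is at least 1/4, and g <= 2 = 32 * (1/4)^2.
  Otherwise the squared distance is the squared difference of the norms plus 2 |Q| g, with 2 |Q| >
  1/2.\<close>

lemma g_pot_quadratic:
 assumes "Q : S0" shows "g_pot Q <= 32 * nsq (Q - Q_inf)"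
proof (cases "norm Q <= 1/4")
 case True
 have "norm Q_inf <= norm Q + norm (Q - Q_inf)" using norm_triangle_ineq4[of Q "Q - Q_inf"] by simp
 hence "1/4 <= norm (Q - Q_inf)" using True sqrt23(2) norm_Q_inf by linarith
 hence "(1/4)^2 <= nsq (Q - Q_inf)" by (intro power_mono) auto
 thus ?thesis using g_pot_le[of Q] by (simp add: power2_eq_square)
next
 case False
 hence Q: "Q ~= 0" "1/4 < norm Q" by auto
 have "nsq (Q - Q_inf) = nsq Q + nsq Q_inf - 2 * (Q \<bullet> Q_inf)"
  by (simp add: power2_norm_eq_inner inner_diff_left inner_diff_right inner_commute)
 also have "... = (norm Q - norm Q_inf)^2 + 2 * (g_pot Q * norm Q)"
  unfolding g_pot_eq[OF assms Q(1)] by (simp add: power2_eq_square algebra_simps)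
 finally have "2 * (g_pot Q * norm Q) <= nsq (Q - Q_inf)" by simp
 moreover have "g_pot Q * (1/4) <= g_pot Q * norm Q" using Q g_pot_nonneg[OF assms] by (intro mult_left_mono) auto
 ultimately show ?thesis using g_pot_nonneg[OF assms] zero_le_power2[of "norm (Q - Q_inf)"] by linarith
qed

lemma continuous_g_pot: "continuous_on (- {0}) g_pot"
 unfolding g_pot_def[abs_def] by (intro continuous_intros) auto

lemma borel_measurable_g_pot [measurable]: "g_pot : borel_measurable borel"
proof -
 have [measurable]: "(%Q :: real^3^3. Q$3$3) : borel_measurable borel"
  by (intro borel_measurable_continuous_onI continuous_intros)
 show ?thesis unfolding g_pot_def[abs_def] by measurable
qed

lemma borel_measurable_f_pot [measurable]: "f_pot : borel_measurable borel"
 by (rule borel_measurable_continuous_onI[OF continuous_f_pot])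

text \<open>\<open>f_root\<close> vanishes at Q_inf, hence is linear plus quadratic in p = Q -
  Q_inf, with norm at most 7/3 |p| + |p|^2. The factor 18 is 3/2 * 12, where 12 exceeds 2 *
  49/9.\<close>

lemma f_pot_quadratic:
 assumes "Q : S0" shows "f_pot Q <= 18 * (nsq (Q - Q_inf) + (norm (Q - Q_inf))^4)"
proof -
 define p where "p = Q - Q_inf"
 have Q: "Q = Q_inf + p" by (simp add: p_def)
 have "f_root Q = (Q_inf ** p + p ** Q_inf - (1/3) *R p) + p ** p"
  using f_root_Q_inf unfolding Q f_root_def
  by (simp add: matrix_add_ldistrib matrix_add_rdistrib3 algebra_simps)
 hence "norm (f_root Q) <= norm (Q_inf ** p) + norm (p ** Q_inf) + norm ((1/3) *R p) + norm (p ** p)"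
  using norm_triangle_ineq[of "Q_inf ** p + p ** Q_inf - (1/3) *R p" "p ** p"]
   norm_triangle_ineq4[of "Q_inf ** p + p ** Q_inf" "(1/3) *R p"] norm_triangle_ineq[of "Q_inf ** p" "p ** Q_inf"] by simp
 also have "... <= 1 * norm p + norm p * 1 + 1/3 * norm p + norm p * norm p"
 proof (intro add_mono)
  have "norm Q_inf <= 1" using sqrt23 norm_Q_inf by simp
  hence "norm Q_inf * norm p <= 1 * norm p" "norm p * norm Q_inf <= norm p * 1" by (intro mult_mono; simp)+
  thus "norm (Q_inf ** p) <= 1 * norm p" "norm (p ** Q_inf) <= norm p * 1"
   using norm_matrix_mult_le[of Q_inf p] norm_matrix_mult_le[of p Q_inf] by linarith+
 qed (simp_all add: norm_matrix_mult_le)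
 finally have "norm (f_root Q) <= 7/3 * norm p + nsq p" by (simp add: power2_eq_square)
 hence "nsq (f_root Q) <= (7/3 * norm p + nsq p)^2" by (intro power_mono) auto
 also have "... <= 2 * (7/3 * norm p)^2 + 2 * (nsq p)^2"
  using zero_le_power2[of "7/3 * norm p - nsq p"] by (simp add: power2_eq_square algebra_simps)
 also have "... <= 12 * (nsq p + (norm p)^4)"
 proof -
  have "(nsq p)^2 = (norm p)^4" by simp
  moreover have "(7/3 * norm p)^2 = 49/9 * nsq p" by (simp add: power2_eq_square)
  moreover have "0 <= nsq p" "0 <= (norm p)^4" by auto
  hence "2 * (49/9 * nsq p) + 2 * (norm p)^4 <= 12 * (nsq p + (norm p)^4)" by (simp add: field_simps)
  ultimately show ?thesis by (simp only:)
 qed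
 finally show ?thesis using f_pot_eq[OF assms] by (simp add: p_def)
qed

lemma g_pot_uniaxial:
 assumes "norm n = 1" shows "g_pot (uniaxial n) = sqrt (3/2) * (1 - (n$3)^2)"
proof -
 have n: "norm (uniaxial n) = sqrt (2/3)" using norm_uniaxial[OF assms] by (metis norm_ge_zero real_sqrt_unique)
 have s: "sqrt (2/3) = 2/3 * sqrt (3/2)" "sqrt (3/2) * sqrt (2/3) = 1" "0 < sqrt (2/3 :: real)"
  by (simp_all add: real_sqrt_mult[symmetric]) (simp add: real_sqrt_divide field_simps)
 have "1 / sqrt (2/3) = sqrt (3/2)" using s by (simp add: field_simps)
 hence d: "x / sqrt (2/3) = x * sqrt (3/2)" for x by (metis divide_inverse inverse_eq_divide)
 have c: "uniaxial n $ 3 $ 3 = (n$3)^2 - 1/3" by (simp add: uniaxial_def mat_def power2_eq_square)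
 show ?thesis unfolding g_pot_def n c d unfolding s(1) by (simp only: algebra_simps)
qed

section \<open>One-dimensional profiles\<close>

text \<open>A C^1 cutoff is smooth enough for H^1 maps. The cubic has slope at most 3/2, a number
  that enters several constants below.\<close>

definition step :: "real => real" where
 "step t = (if t <= 0 then 0 else if 1 <= t then 1 else 3 * t^2 - 2 * t^3)"

definition step' :: "real => real" where
 "step' t = (if t <= 0 then 0 else if 1 <= t then 0 else 6 * t * (1 - t))"

lemma step_sym: "step (1 - t) = 1 - step t"
 by (auto simp: step_def power2_eq_square power3_eq_cube algebra_simps)

lemma step_bounds: "0 <= step t" "step t <= 1"
proof -
 have *: "0 <= step t" for t
 proof (cases "0 < t & t < 1")
  case True
  hence "3 * t^2 - 2 * t^3 = t^2 * (3 - 2 * t)" by (simp add: power2_eq_square power3_eq_cube algebra_simps)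
  moreover have "0 <= t^2 * (3 - 2 * t)" using True by (intro mult_nonneg_nonneg) auto
  ultimately show ?thesis using True by (simp add: step_def)
 qed (auto simp: step_def)
 show "0 <= step t" by (rule *)
 show "step t <= 1" using *[of "1 - t"] step_sym[of t] by simp
qed

lemma step_eq: "t <= 0 ==> step t = 0" "1 <= t ==> step t = 1" "t <= 0 ==> step' t = 0" "1 <= t ==> step' t = 0"
 by (auto simp: step_def step'_def)

lemma step_quadratic: "\<bar>step t\<bar> <= 3 * (t - 0)^2"
proof -
 consider "t <= 0" | "1 <= t" | "0 < t" "t < 1" by linarith
 thus ?thesis
 proof cases
  case 2
  hence "1 <= t^2" by (rule one_le_power)
  moreover have "\<bar>step t\<bar> = 1" using 2 by (simp add: step_def)
  ultimately show ?thesis unfolding diff_0_right by linarith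
 next
  case 3
  hence "0 <= t^3" by simp
  thus ?thesis using 3 step_bounds(1)[of t] by (simp add: step_def)
 qed (auto simp: step_def)
qed

lemma step_deriv: "(step has_real_derivative step' t) (at t)"
proof -
 have 0: "(step has_real_derivative 0) (at 0)" by (rule has_derivative_zero_quadratic[OF step_quadratic])
 consider "t < 0" | "t = 0" | "0 < t" "t < 1" | "t = 1" | "1 < t" by linarith
 thus ?thesis
 proof cases
  case 1
  have "((%_. 0) has_real_derivative 0) (at t)" by simp
  hence "(step has_real_derivative 0) (at t)" unfolding has_field_derivative_def
   by (rule has_derivative_transform_within_open[of _ _ _ _ "{..<0}"]) (use 1 in "auto simp: step_def")
  thus ?thesis using 1 by (simp add: step'_def)
 next
  case 3
  have "((%t. 3 * t^2 - 2 * t^3) has_real_derivative 6 * t * (1 - t)) (at t)"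
   by (auto intro!: derivative_eq_intros simp: power2_eq_square algebra_simps)
  hence "(step has_real_derivative 6 * t * (1 - t)) (at t)" unfolding has_field_derivative_def
   by (rule has_derivative_transform_within_open[of _ _ _ _ "{0<..<1}"]) (use 3 in "auto simp: step_def")
  thus ?thesis using 3 by (simp add: step'_def)
 next
  case 4
  have "((%t. 1 - step (1 - t)) has_real_derivative 0 - 0 * (0 - 1)) (at 1)"
   by (intro DERIV_diff DERIV_const DERIV_chain2[of step _ "%t. 1 - t"] DERIV_ident) (use 0 in simp)
  thus ?thesis using 4 by (simp add: step_sym step'_def)
 next
  case 5
  have "((%_. 1) has_real_derivative 0) (at t)" by simp
  hence "(step has_real_derivative 0) (at t)" unfolding has_field_derivative_def
   by (rule has_derivative_transform_within_open[of _ _ _ _ "{1<..}"]) (use 5 in "auto simp: step_def")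
  thus ?thesis using 5 by (simp add: step'_def)
 qed (use 0 in "simp add: step'_def")
qed

lemma step'_eq: "step' t = 6 * max 0 (min 1 t) * (1 - max 0 (min 1 t))"
 by (auto simp: step'_def max_def min_def)

lemma continuous_step' [continuous_intros]: "continuous_on A f ==> continuous_on A (%x. step' (f x))"
 unfolding step'_eq by (intro continuous_intros)

lemma continuous_step [continuous_intros]:
 assumes "continuous_on A f" shows "continuous_on A (%x. step (f x))"
proof -
 have "continuous_on UNIV step" by (auto intro!: continuous_at_imp_continuous_on DERIV_isCont[OF step_deriv])
 thus ?thesis using continuous_on_compose2[OF _ assms, of UNIV step] by auto
qed

lemma step'_bounds: "0 <= step' t" "step' t <= 3/2"
proof -
 define u where "u = max 0 (min 1 t)"
 have u: "0 <= u" "u <= 1" by (auto simp: u_def)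
 show "0 <= step' t" unfolding step'_eq u_def[symmetric] using u by simp
 have "0 <= (2 * u - 1)^2" by simp
 thus "step' t <= 3/2" unfolding step'_eq u_def[symmetric] by (simp add: power2_eq_square algebra_simps)
qed

text \<open>A profile together with an upper bound \<open>w\<close> for the squared speed, extended by its initial value
 to the left of \<open>1\<close>.\<close>

definition prof_data :: "(real => real^3^3) => (real => ennreal) => bool" where
 "prof_data P w \<longleftrightarrow> continuous_on UNIV P & (ALL r<=1. P r = P 1) & (ALL r. P r : S0) & w : borel_measurable borel \<and>
   (ALL a b. a <= b --> ennreal (nsq (P b - P a)) <= ennreal (b - a) * (LI x:{a..b}. w x)) \<and>
   (LI x. w x) < \<infinity> & (LI x:{1<..}. ennreal (nsq (P x - Q_inf))) < \<infinity>"

lemma nn_integral_lebesgue_on: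
 "open Om ==> (\<integral>\<^sup>+x. f x \<partial>lebesgue_on Om) = (LL x:Om. f x)"
 by (subst nn_integral_restrict_space) auto

text \<open>Replaces the weak derivative by a Borel version \<open>w\<close> of its square, extended
  by 0. The potential \<open>phi\<close> is left open so that the energies for finite and infinite
  lam can both be rewritten.\<close>

lemma profiles_data:
 assumes P: "P : profiles Q0"
 obtains P' w where "prof_data P' w" "!!r. 1 <= r ==> P' r = P r"
  "!!phi :: real^3^3 => real. phi : borel_measurable borel ==> (!!Q. Q : S0 ==> 0 <= phi Q) ==>
   (LL r:{1<..}. ennreal (1/2 * nsq (weak_deriv {1<..} 1 P r) + phi (P r)))
    = ennreal (1/2) * (LI x. w x) + (LI r:{1<..}. ennreal (phi (P' r)))"
proof -
 let ?Om = "{1::real<..}"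
 have Om: "open ?Om" by simp
 have H: "(%r. P r - Q_inf) : H1 ?Om S0" and c: "continuous_on {1..} P" using P by (auto simp: profiles_def)
 obtain v where v: "v : L2 ?Om" "has_weak_deriv ?Om 1 (%r. P r - Q_inf) v" using H by (auto simp: H1_def)
 have "has_weak_deriv ?Om 1 (%r::real. Q_inf) (%r. 0)"
  using C1_on_has_weak_deriv[OF Om, of "%_. Q_inf" "%_ _. 0" 1] by (auto simp: C1_on_def)
 from has_weak_deriv_add[OF Om _ v(2) this] have wd: "has_weak_deriv ?Om 1 P v" by simp
 have AEv: "AE x in lebesgue. x : ?Om --> weak_deriv ?Om 1 P x = v x"
  using weak_deriv_AE[OF Om wd] AE_restrict_space_iff[OF sets_lebesgue_Int_space_open[OF Om]] by auto
 define w0 where "w0 x = ennreal (nsq (v x)) * indicator ?Om x" for x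
 have vm: "v : borel_measurable (lebesgue_on ?Om)" using v(1) by (simp add: L2_def)
 have w0m: "w0 : borel_measurable lebesgue"
 proof -
  have "(%x. ennreal (nsq (v x))) : borel_measurable (lebesgue_on ?Om)" using vm by measurable
  thus ?thesis unfolding w0_def[abs_def] by (subst (asm) borel_measurable_restrict_space_iff_ennreal) auto
 qed
 obtain w where w: "w : borel_measurable lborel" "AE x in lborel. w0 x = w x"
  using completion_ex_borel_measurable[OF w0m] by blast
 have wi: "(LI x:A. w x) = (LL x:A. w0 x)" if "A : sets borel" for A
 proof -
  have "(LI x:A. w x) = (LL x:A. w x)"
   using w(1) that by (subst nn_integral_completion) auto
  also have "... = (LL x:A. w0 x)"
   by (intro nn_integral_cong_AE) (use AE_completion[OF w(2)] in "auto elim!: eventually_mono")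
  finally show ?thesis .
 qed
 define P' where "P' r = P (max 1 r)" for r
 have cP': "continuous_on UNIV P'"
  unfolding P'_def[abs_def] by (rule continuous_on_compose2[OF c]) (auto intro!: continuous_intros)
 have P'P: "P' r = P r" if "1 <= r" for r using that by (simp add: P'_def max_def)
 \<comment> \<open>Values lie in \<open>S0\<close> almost everywhere. By continuity the exceptional
   set in the open half-line is open, hence empty; the value at 1 follows as a limit.\<close>
 have S0': "P' r : S0" for r
 proof -
  have "AE x in lebesgue_on ?Om. P x - Q_inf : S0" using H by (simp add: H1_def)
  hence AE: "AE x in lebesgue. x : ?Om --> P' x : S0"
   using AE_restrict_space_iff[OF sets_lebesgue_Int_space_open[OF Om]] mem_S0(2)[OF _ Q_inf_S0] P'P
   by (auto elim!: eventually_mono) force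
  have gt: "P' r : S0" if r: "1 < r" for r
  proof (rule ccontr)
   assume n: "P' r ~: S0"
   have op: "open (P' -` (- S0) Int ?Om)"
    using cP' closed_S0 by (intro open_Int open_vimage) auto
   have "AE x in lebesgue. x ~: P' -` (- S0) Int ?Om" using AE by eventually_elim auto
   hence "P' -` (- S0) Int ?Om : null_sets lebesgue"
    using op by (subst (asm) AE_iff_null_sets[symmetric]) auto
   hence "negligible (P' -` (- S0) Int ?Om)" by (simp add: negligible_iff_null_sets)
   thus False using open_not_negligible[OF op] n r by auto
  qed
  have "P' 1 : S0"
  proof -
   have "(%n. P' (1 + 1 / real (Suc n))) ----> P' (1 + 0)"
   proof (rule continuous_on_tendsto_compose[OF cP'])
    show "(%n. 1 + 1 / real (Suc n)) ----> 1 + 0" by (intro tendsto_intros LIMSEQ_Suc[OF lim_1_over_n])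
   qed auto
   thus ?thesis using closed_sequentially[OF closed_S0, of "%n. P' (1 + 1 / real (Suc n))"] gt by auto
  qed
  thus ?thesis using gt[of r] by (cases "1 < r") (auto simp: P'_def max_def)
 qed
 have inc: "ennreal (nsq (P' b - P' a)) <= ennreal (b - a) * (LI x:{a..b}. w x)" if ab: "a <= b" for a b
 proof -
  define a' b' where "a' = max 1 a" and "b' = max 1 b"
  have ab': "1 <= a'" "a' <= b'" "b' - a' <= b - a" using ab by (auto simp: a'_def b'_def max_def)
  have "ennreal (nsq (P' b - P' a)) <= ennreal (b' - a') * (LL x:{a'..b'}. ennreal (nsq (v x)))"
   using weak_deriv_increment[OF c wd ab'(1,2)] by (simp add: P'_def a'_def b'_def)
  also have "... <= ennreal (b - a) * (LI x:{a..b}. w x)"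
  proof (cases "a' = b'")
   case False
   hence b: "b' = b" using ab by (auto simp: a'_def b'_def max_def split: if_splits)
   have "(LL x:{a'..b'}. ennreal (nsq (v x))) <= (LL x:{a..b}. w0 x)"
   proof (rule nn_integral_mono_AE)
    have "AE x in lebesgue. x ~= (1::real)" by (rule AE_completion) (rule AE_lborel_singleton)
    thus "AE x in lebesgue. ennreal (nsq (v x)) * indicator {a'..b'} x <= w0 x * indicator {a..b} x"
     by eventually_elim (auto simp: w0_def indicator_def a'_def b split: if_splits)
   qed
   thus ?thesis unfolding wi[of "{a..b}", simplified] using ab' by (intro mult_mono ennreal_leI) auto
  qed simp
  finally show ?thesis .
 qed
 have w_tot: "(LI x. w x) = (LL x:?Om. ennreal (nsq (v x)))"
  using wi[of UNIV] by (simp add: w0_def)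
 have fin1: "(LI x. w x) < \<infinity>"
 proof -
  have "integrable (lebesgue_on ?Om) (%x. nsq (v x))" using v(1) by (simp add: L2_def)
  hence "(\<integral>\<^sup>+x. ennreal (norm (nsq (v x))) \<partial>lebesgue_on ?Om) < \<infinity>" by (simp add: integrable_iff_bounded)
  thus ?thesis unfolding w_tot nn_integral_lebesgue_on[OF Om, symmetric] by simp
 qed
 have P'm[measurable]: "P' : borel_measurable borel" by (rule borel_measurable_continuous_onI[OF cP'])
 have fin2: "(LI x:?Om. ennreal (nsq (P' x - Q_inf))) < \<infinity>"
 proof -
  have "integrable (lebesgue_on ?Om) (%x. nsq (P x - Q_inf))" using H by (simp add: H1_def L2_def)
  hence "(\<integral>\<^sup>+x. ennreal (norm (nsq (P x - Q_inf))) \<partial>lebesgue_on ?Om) < \<infinity>" by (simp add: integrable_iff_bounded)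
  hence "(LL x:?Om. ennreal (nsq (P x - Q_inf))) < \<infinity>" by (simp add: nn_integral_lebesgue_on[OF Om])
  also have "(LL x:?Om. ennreal (nsq (P x - Q_inf))) = (LL x:?Om. ennreal (nsq (P' x - Q_inf)))"
   by (intro nn_integral_cong) (auto simp: P'P indicator_def)
  also have "... = (LI x:?Om. ennreal (nsq (P' x - Q_inf)))" by (subst nn_integral_completion) auto
  finally show ?thesis .
 qed
 have en: "(LL r:?Om. ennreal (1/2 * nsq (weak_deriv ?Om 1 P r) + phi (P r)))
    = ennreal (1/2) * (LI x. w x) + (LI r:?Om. ennreal (phi (P' r)))"
  if phi[measurable]: "phi : borel_measurable borel" and pos: "!!Q. Q : S0 ==> 0 <= phi Q" for phi :: "real^3^3 => real"
 proof -
  have m2: "(%r. ennreal (phi (P' r)) * indicator ?Om r) : borel_measurable lborel" by measurable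
  have "(LL r:?Om. ennreal (1/2 * nsq (weak_deriv ?Om 1 P r) + phi (P r)))
   = (LL r. ennreal (1/2) * w0 r + ennreal (phi (P' r)) * indicator ?Om r)"
  proof (rule nn_integral_cong_AE)
   show "AE r in lebesgue. ennreal (1/2 * nsq (weak_deriv ?Om 1 P r) + phi (P r)) * indicator ?Om r
    = ennreal (1/2) * w0 r + ennreal (phi (P' r)) * indicator ?Om r"
    using AEv
   proof eventually_elim
    case (elim r)
    have "0 <= phi (P' r)" using pos S0' by blast
    hence "ennreal (1/2 * nsq (v r) + phi (P' r)) = ennreal (1/2 * nsq (v r)) + ennreal (phi (P' r))"
     by (intro ennreal_plus) auto
    also have "ennreal (1/2 * nsq (v r)) = ennreal (1/2) * ennreal (nsq (v r))" by (rule ennreal_mult) auto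
    finally show ?case using elim P'P[of r] by (cases "1 < r") (auto simp: w0_def)
   qed
  qed
  also have "... = (LL r. ennreal (1/2) * w0 r) + (LL r. ennreal (phi (P' r)) * indicator ?Om r)"
   using w0m m2 by (intro nn_integral_add borel_measurable_times) (auto intro: measurable_completion)
  also have "(LL r. ennreal (1/2) * w0 r) = ennreal (1/2) * (LI x. w x)"
   using wi[of UNIV] w0m by (simp add: nn_integral_cmult)
  also have "(LL r. ennreal (phi (P' r)) * indicator ?Om r) = (LI r:?Om. ennreal (phi (P' r)))"
   by (rule nn_integral_completion)
  finally show ?thesis .
 qed
 have wb: "w : borel_measurable borel" using w(1) by simp
 have const: "ALL r<=1. P' r = P' 1" by (simp add: P'_def max_def)
 show thesis
  using that[of P' w, OF _ P'P en] cP' const S0' wb inc fin1 fin2 unfolding prof_data_def by blast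
qed

text \<open>If the bound failed at r, increments over [r,r+1] would still be at most W, so the
  profile would stay at distance more than I from Q_inf on an interval of length one, against the
  tail bound.\<close>

lemma prof_data_sup:
 assumes pd: "prof_data P w" and b: "1 <= b"
  and I: "(LI x:{b<..}. ennreal (nsq (P x - Q_inf))) <= ennreal (I^2)" "0 <= I"
  and W: "(LI x:{b<..}. w x) <= ennreal (W^2)" "0 <= W" and r: "b < r"
 shows "norm (P r - Q_inf) <= I + W"
proof (rule ccontr)
 assume n: "~ norm (P r - Q_inf) <= I + W"
 define dl where "dl = norm (P r - Q_inf) - (I + W)"
 have dl: "0 < dl" using n by (simp add: dl_def)
 have lo: "I + dl <= norm (P x - Q_inf)" if x: "x : {r..r+1}" for x
 proof -
  have "ennreal (nsq (P x - P r)) <= ennreal (x - r) * (LI y:{r..x}. w y)"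
   using pd x unfolding prof_data_def by auto
  also have "... <= ennreal 1 * (LI x:{b<..}. w x)"
   using x r by (intro mult_mono ennreal_leI nn_integral_mono) (auto simp: indicator_def)
  also have "... <= ennreal (W^2)" using W by simp
  finally have "nsq (P x - P r) <= W^2" by (simp add: ennreal_le_iff)
  hence "norm (P x - P r) <= W" using W(2) by (rule power2_le_imp_le)
  moreover have "norm (P r - Q_inf) <= norm (P x - Q_inf) + norm (P x - P r)"
   using norm_triangle_ineq4[of "P x - Q_inf" "P x - P r"] by simp
  ultimately show ?thesis by (simp add: dl_def)
 qed
 have "ennreal ((I + dl)^2) = (LI x. ennreal ((I + dl)^2) * indicator {r..r+1} x)"
  by (subst nn_integral_cmult_indicator) auto
 also have "... <= (LI x:{b<..}. ennreal (nsq (P x - Q_inf)))"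
  using lo r I(2) dl by (intro nn_integral_mono) (auto simp: indicator_def intro!: ennreal_leI power_mono)
 also have "... <= ennreal (I^2)" by (rule I(1))
 finally have "(I + dl)^2 <= I^2" by (simp add: ennreal_le_iff)
 thus False using power2_le_imp_le[of "I + dl" I] I(2) dl by auto
qed

lemma nn_integral_tail_small:
 fixes f :: "real => ennreal"
 assumes [measurable]: "f : borel_measurable borel" and fin: "(LI x:{a<..}. f x) < \<infinity>" and e: "0 < e"
 shows "EX R0>=a. ALL R>=R0. (LI x:{R<..}. f x) <= ennreal e"
proof -
 let ?M = "density lborel f"
 have eq: "emeasure ?M {R<..} = (LI x:{R<..}. f x)" for R
  by (subst emeasure_density) auto
 have "(%n. emeasure ?M {a + real n<..}) ----> emeasure ?M (\<Inter>n. {a + real n<..})"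
 proof (rule Lim_emeasure_decseq)
  show "range (%n. {a + real n<..}) <= sets ?M" by auto
  show "decseq (%n. {a + real n<..})" by (auto simp: decseq_def)
  fix n
  have "emeasure ?M {a + real n<..} <= emeasure ?M {a<..}" by (rule emeasure_mono) auto
  thus "emeasure ?M {a + real n<..} ~= \<infinity>" using fin eq[of a] by (auto simp: top_unique)
 qed
 moreover have "(\<Inter>n. {a + real n<..}) = {}"
 proof -
  have False if "ALL n. a + real n < x" for x
   using that reals_Archimedean2[of "x - a"] by (metis add.commute diff_less_eq less_asym)
  thus ?thesis by auto
 qed
 ultimately have "(%n. emeasure ?M {a + real n<..}) ----> 0" by simp
 hence "\<forall>\<^sub>F n in sequentially. emeasure ?M {a + real n<..} < ennreal e" by (rule order_tendstoD) (use e in simp)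
 then obtain N where N: "emeasure ?M {a + real N<..} < ennreal e" by (auto simp: eventually_sequentially)
 show ?thesis
 proof (intro exI[of _ "a + real N"] conjI allI impI)
  fix R assume R: "a + real N <= R"
  have "(LI x:{R<..}. f x) <= emeasure ?M {a + real N<..}"
   unfolding eq[symmetric] using R by (intro emeasure_mono) auto
  thus "(LI x:{R<..}. f x) <= ennreal e" using N by simp
 qed simp
qed

text \<open>The integrand after an interval of length c has been deleted and the gap closed.\<close>

lemma nn_integral_cut:
 fixes F :: "real => ennreal"
 assumes [measurable]: "F : borel_measurable borel" and c: "0 <= c"
 shows "(LI x. (if x <= t then F x else F (x + c))) <= (LI x. F x)"
proof -
 have "(LI x. (if x <= t then F x else F (x + c)))
   = (LI x. F x * indicator {..t} x + F (c + 1 * x) * indicator {t + c<..} (c + 1 * x))"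
  by (intro nn_integral_cong) (auto simp: indicator_def add.commute)
 also have "... = (LI x. F x * indicator {..t} x) + (LI x. F (c + 1 * x) * indicator {t + c<..} (c + 1 * x))"
  by (intro nn_integral_add) measurable
 also have "(LI x. F (c + 1 * x) * indicator {t + c<..} (c + 1 * x)) = (LI x. F x * indicator {t + c<..} x)"
  using nn_integral_real_affine[of "%x. F x * indicator {t + c<..} x" 1 c] by simp
 also have "(LI x. F x * indicator {..t} x) + (LI x. F x * indicator {t + c<..} x)
   = (LI x. F x * indicator {..t} x + F x * indicator {t + c<..} x)"
  by (intro nn_integral_add[symmetric]) measurable
 also have "... <= (LI x. F x)"
  using c by (intro nn_integral_mono) (auto simp: indicator_def)
 finally show ?thesis .
qed

text \<open>The time between the first and the last zero of a profile is cut out, because \<open>g\<close> is not upper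
 semicontinuous at \<open>0\<close>.\<close>

lemma prof_data_cut:
 assumes pd: "prof_data P w"
 obtains P' w' t where "prof_data P' w'" "P' 1 = P 1" "!!r. 1 <= r ==> r ~= t ==> P' r ~= 0"
  "(LI x. w' x) <= (LI x. w x)"
  "!!phi :: real^3^3 => ennreal. phi : borel_measurable borel ==>
   (LI r:{1<..}. phi (P' r)) <= (LI r:{1<..}. phi (P r))"
proof (cases "{r. 1 <= r & P r = 0} = {}")
 case True
 thus thesis using that[of P w 0] pd by auto
next
 case ne: False
 have cP: "continuous_on UNIV P" and c1: "!!r. r <= 1 ==> P r = P 1" and PS: "!!r. P r : S0"
  and wm[measurable]: "w : borel_measurable borel"
  and inc: "!!a b. a <= b ==> ennreal (nsq (P b - P a)) <= ennreal (b - a) * (LI x:{a..b}. w x)"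
  and wf: "(LI x. w x) < \<infinity>"
  and uf: "(LI x:{1<..}. ennreal (nsq (P x - Q_inf))) < \<infinity>"
  using pd unfolding prof_data_def by blast+
 have Pm[measurable]: "P : borel_measurable borel" by (rule borel_measurable_continuous_onI[OF cP])
 let ?Z = "{r. 1 <= r & P r = 0}"
 have w1: "(LI x:{1<..}. w x) < \<infinity>"
 proof -
  have "(LI x:{1<..}. w x) <= (LI x. w x)" by (intro nn_integral_mono) (auto simp: indicator_def)
  thus ?thesis using wf by simp
 qed
 \<comment> \<open>Far out the profile is within 1/5 + 1/5 < 1/2 <= |Q_inf| of Q_inf, so the set of
   its zeros is bounded.\<close>
 obtain R1 where R1: "!!R. R \<ge> R1 ==> (LI x:{R<..}. w x) <= ennreal ((1/5)^2)"
  using nn_integral_tail_small[OF wm w1, of "(1/5)^2"] by auto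
 obtain R2 where R2: "!!R. R \<ge> R2 ==> (LI x:{R<..}. ennreal (nsq (P x - Q_inf))) <= ennreal ((1/5)^2)"
  using nn_integral_tail_small[OF _ uf, of "(1/5)^2"] by auto
 define R where "R = max 1 (max R1 R2)"
 have far: "P r ~= 0" if "R < r" for r
 proof
  assume "P r = 0"
  moreover have "norm (P r - Q_inf) <= 1/5 + 1/5"
   by (rule prof_data_sup[OF pd _ R2 _ R1 _ that]) (auto simp: R_def)
  ultimately show False using sqrt23(2) norm_Q_inf by simp
 qed
 have cZ: "compact ?Z"
  unfolding compact_eq_bounded_closed
 proof
  have "?Z <= {1..R}" using far by force
  thus "bounded ?Z" by (rule bounded_subset[rotated]) auto
  have "?Z = {1..} Int P -` {0}" by auto
  thus "closed ?Z" using cP by (auto intro!: closed_Int closed_vimage)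
 qed
 obtain t1 where t1: "t1 : ?Z" "!!r. r : ?Z ==> t1 <= r" using compact_attains_inf[OF cZ ne] by blast
 obtain t2 where t2: "t2 : ?Z" "!!r. r : ?Z ==> r <= t2" using compact_attains_sup[OF cZ ne] by blast
 define c where "c = t2 - t1"
 have c: "0 <= c" "t1 + c = t2" "1 <= t1" "P t1 = 0" "P t2 = 0" using t1 t2 by (auto simp: c_def)
 define P' where "P' r = (if r <= t1 then P r else P (r + c))" for r
 define w' where "w' r = (if r <= t1 then w r else w (r + c))" for r
 have w'm[measurable]: "w' : borel_measurable borel" unfolding w'_def[abs_def] by measurable
 have cP': "continuous_on UNIV P'" unfolding P'_def[abs_def]
  by (rule continuous_on_cases_le[where h="%x. x"]) (auto intro!: continuous_intros continuous_on_compose2[OF cP] continuous_on_subset[OF cP] simp: c)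
 have sh: "(LI x:{a..b}. w (x + c)) = (LI x:{a + c..b + c}. w x)" for a b
 proof -
  have "(LI x:{a + c..b + c}. w x) = (LI x. w (c + 1 * x) * indicator {a + c..b + c} (c + 1 * x))"
   using nn_integral_real_affine[of "%x. w x * indicator {a + c..b + c} x" 1 c] by simp
  also have "... = (LI x:{a..b}. w (x + c))"
   by (intro nn_integral_cong) (auto simp: indicator_def add.commute)
  finally show ?thesis by simp
 qed
 have inc': "ennreal (nsq (P' b - P' a)) <= ennreal (b - a) * (LI x:{a..b}. w' x)" if ab: "a <= b" for a b
 proof -
  consider "b <= t1" | "t1 < a" | "a <= t1" "t1 < b" by linarith
  thus ?thesis
  proof cases
   case 1
   have "(LI x:{a..b}. w' x) = (LI x:{a..b}. w x)"
    using 1 by (intro nn_integral_cong) (auto simp: w'_def indicator_def)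
   thus ?thesis using inc[OF ab] 1 ab by (simp add: P'_def)
  next
   case 2
   have "(LI x:{a..b}. w' x) = (LI x:{a..b}. w (x + c))"
    using 2 by (intro nn_integral_cong) (auto simp: w'_def indicator_def)
   thus ?thesis using inc[of "a + c" "b + c"] 2 ab sh[of a b] by (simp add: P'_def)
  next
   \<comment> \<open>Both sides of the cut meet at the value 0, so their increments add.
     Cauchy-Schwarz in the form (sqrt (x X) + sqrt (y Y))^2 <= (x + y) (X + Y) restores the
     increment inequality.\<close>
   case 3
   define X where "X = enn2real (LI x:{t1..b}. w (x + c))"
   define Y where "Y = enn2real (LI x:{a..t1}. w x)"
   have "(LI x:A. w x) < \<infinity>" for A
    using le_less_trans[OF nn_integral_mono wf, of "%x. w x * indicator A x"] by (auto simp: indicator_def)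
   hence X: "(LI x:{t1..b}. w (x + c)) = ennreal X" and Y: "(LI x:{a..t1}. w x) = ennreal Y"
    unfolding X_def Y_def sh by (auto simp: less_top)
   have XY: "0 <= X" "0 <= Y" by (auto simp: X_def Y_def)
   have "ennreal (nsq (P (b + c) - P t2)) <= ennreal (b + c - t2) * (LI x:{t2..b+c}. w x)"
    using 3 c by (intro inc) auto
   also have "... = ennreal ((b - t1) * X)"
   proof -
    have "b + c - t2 = b - t1" "(LI x:{t2..b+c}. w x) = ennreal X"
     using c(2) sh[of t1 b] X by auto
    thus ?thesis using 3 XY by (simp only:) (subst ennreal_mult, auto)
   qed
   finally have 1: "nsq (P (b + c)) <= (b - t1) * X" using c 3 XY by (subst (asm) ennreal_le_iff) auto
   have "ennreal (nsq (P t1 - P a)) <= ennreal (t1 - a) * (LI x:{a..t1}. w x)"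
    using 3 by (intro inc) auto
   also have "... = ennreal ((t1 - a) * Y)" using Y XY 3 by (simp add: ennreal_mult)
   finally have 2: "nsq (P a) <= (t1 - a) * Y" using c 3 XY by (subst (asm) ennreal_le_iff) auto
   have "norm (P' b - P' a) <= norm (P (b + c)) + norm (P a)"
    using 3 norm_triangle_ineq4 by (simp add: P'_def)
   also have "... <= sqrt ((b - t1) * X) + sqrt ((t1 - a) * Y)" using 1 2 by (intro add_mono real_le_rsqrt)
   finally have "nsq (P' b - P' a) <= (sqrt ((b - t1) * X) + sqrt ((t1 - a) * Y))^2" by (intro power_mono) auto
   also have "... <= (b - a) * (X + Y)"
   proof -
    have "2 * (sqrt ((b - t1) * Y) * sqrt ((t1 - a) * X)) <= (b - t1) * Y + (t1 - a) * X"
     using zero_le_power2[of "sqrt ((b - t1) * Y) - sqrt ((t1 - a) * X)"] 3 XY by (simp add: power2_diff)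
    moreover have "sqrt ((b - t1) * Y) * sqrt ((t1 - a) * X) = sqrt ((b - t1) * X) * sqrt ((t1 - a) * Y)"
     by (simp add: real_sqrt_mult)
    moreover have "(b - a) * (X + Y) = ((b - t1) * X + (t1 - a) * Y) + ((b - t1) * Y + (t1 - a) * X)"
     by (simp add: algebra_simps)
    moreover have "(sqrt ((b - t1) * X))^2 = (b - t1) * X" "(sqrt ((t1 - a) * Y))^2 = (t1 - a) * Y"
     using 3 XY by auto
    ultimately show ?thesis unfolding power2_sum by linarith
   qed
   finally have "ennreal (nsq (P' b - P' a)) <= ennreal (b - a) * ennreal (X + Y)"
    using ab XY by (subst ennreal_mult[symmetric]) (auto intro: ennreal_leI)
   also have "ennreal (X + Y) = (LI x. w (x + c) * indicator {t1..b} x + w x * indicator {a..t1} x)"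
    using X Y XY by (subst nn_integral_add) auto
   also have "... = (LI x:{a..b}. w' x)"
   proof (rule nn_integral_cong_AE)
    show "AE x in lborel. w (x + c) * indicator {t1..b} x + w x * indicator {a..t1} x = w' x * indicator {a..b} x"
     using AE_lborel_singleton[of t1] by eventually_elim (use 3 in "auto simp: w'_def indicator_def")
   qed
   finally show ?thesis .
  qed
 qed
 have tot: "(LI x. w' x) <= (LI x. w x)"
  unfolding w'_def by (rule nn_integral_cut) (use c in auto)
 have gen: "(LI r:{1<..}. phi (P' r)) <= (LI r:{1<..}. phi (P r))"
  if [measurable]: "phi : borel_measurable borel" for phi :: "real^3^3 => ennreal"
 proof -
  have "(LI r:{1<..}. phi (P' r))
    = (LI r. (if r <= t1 then phi (P r) * indicator {1<..} r else phi (P (r + c)) * indicator {1<..} (r + c)))"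
   using c by (intro nn_integral_cong) (auto simp: P'_def indicator_def)
  also have "... <= (LI r:{1<..}. phi (P r))" by (rule nn_integral_cut) (use c in auto)
  finally show ?thesis .
 qed
 have wf': "(LI x. w' x) < \<infinity>" using tot wf by simp
 have uf': "(LI x:{1<..}. ennreal (nsq (P' x - Q_inf))) < \<infinity>"
  using gen[of "%Q. ennreal (nsq (Q - Q_inf))"] uf by (simp add: le_less_trans)
 have 1: "P' 1 = P 1" using c by (simp add: P'_def)
 have nz: "P' r ~= 0" if "1 <= r" "r ~= t1" for r
 proof (cases "r <= t1")
  case True thus ?thesis using t1(2)[of r] that by (auto simp: P'_def)
 next
  case False thus ?thesis using t2(2)[of "r + c"] that c by (auto simp: P'_def)
 qed
 have cst: "ALL r<=1. P' r = P' 1"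
 proof (intro allI impI)
  fix r :: real assume "r <= 1"
  thus "P' r = P' 1" using c c1[of r] by (simp add: P'_def)
 qed
 have PS': "ALL r. P' r : S0" using PS by (simp add: P'_def)
 show thesis
  using that[of P' w' t1] 1 nz tot gen cP' cst PS' w'm inc' wf' uf' unfolding prof_data_def by blast
qed

section \<open>Smoothing of profiles by averages over short windows\<close>

lemma nn_integral_average:
 fixes W :: "real => ennreal"
 assumes [measurable]: "W : borel_measurable borel" and h: "0 < h"
 shows "(LI r:{a<..}. ennreal (1/h) * (LI t:{r-h..r}. W t)) <= (LI t:{a-h<..}. W t)"
proof -
 have [measurable]: "Measurable.pred (borel \<Otimes>\<^sub>M borel) (%p :: real \<times> real. fst p - h <= snd p & snd p <= fst p)"
  by measurable
 have "(LI r:{a<..}. ennreal (1/h) * (LI t:{r-h..r}. W t))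
   = (LI r. (LI t. ennreal (1/h) * (W t * (if r - h <= t & t <= r then 1 else 0)) * indicator {a<..} r))"
 proof (rule nn_integral_cong)
  fix r :: real
  have "ennreal (1/h) * (LI t:{r-h..r}. W t) * indicator {a<..} r
    = (LI t. ennreal (1/h) * (W t * indicator {r-h..r} t) * indicator {a<..} r)"
   by (subst nn_integral_multc, simp, subst nn_integral_cmult, auto)
  also have "... = (LI t. ennreal (1/h) * (W t * (if r - h <= t & t <= r then 1 else 0)) * indicator {a<..} r)"
   by (intro nn_integral_cong) (auto simp: indicator_def)
  finally show "ennreal (1/h) * (LI t:{r-h..r}. W t) * indicator {a<..} r
    = (LI t. ennreal (1/h) * (W t * (if r - h <= t & t <= r then 1 else 0)) * indicator {a<..} r)" .
 qed
 also have "... = (LI t. (LI r. ennreal (1/h) * (W t * (if r - h <= t & t <= r then 1 else 0)) * indicator {a<..} r))"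
  by (rule lborel_pair.Fubini') (simp add: case_prod_beta', measurable)
 also have "... <= (LI t:{a-h<..}. W t)"
 proof (rule nn_integral_mono)
  fix t :: real
  have "(LI r. ennreal (1/h) * (W t * (if r - h <= t & t <= r then 1 else 0)) * indicator {a<..} r)
    <= (LI r. (ennreal (1/h) * (W t * indicator {a-h<..} t)) * indicator {t..t+h} r)"
   by (intro nn_integral_mono) (auto simp: indicator_def)
  also have "... = (ennreal (1/h) * (W t * indicator {a-h<..} t)) * ennreal h"
   using h by (subst nn_integral_cmult_indicator) auto
  also have "... = W t * indicator {a-h<..} t * (ennreal (1/h) * ennreal h)" by (simp add: mult_ac)
  also have "ennreal (1/h) * ennreal h = 1" using h by (subst ennreal_mult[symmetric]) auto
  finally show "(LI r. ennreal (1/h) * (W t * (if r - h <= t & t <= r then 1 else 0)) * indicator {a<..} r)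
    <= W t * indicator {a-h<..} t" by simp
 qed
 finally show ?thesis .
qed

text \<open>\<open>S0\<close> is cut out by linear functionals, and these commute with the
  integral.\<close>

lemma has_integral_S0:
 fixes f :: "'a::euclidean_space => real^3^3"
 assumes f: "(f has_integral I) S" "!!x. f x : S0" shows "I : S0"
proof -
 have z: "L I = 0" if L: "bounded_linear L" and z: "!!Q. Q : S0 ==> L Q = 0" for L :: "real^3^3 => real"
 proof -
  have "((L \<circ> f) has_integral L I) S" by (rule has_integral_linear[OF f(1) L])
  moreover have "L \<circ> f = (%_. 0)" using z f(2) by auto
  ultimately show ?thesis by (simp add: has_integral_0_eq)
 qed
 have bl: "bounded_linear (%Q :: real^3^3. Q$i$j)" for i j
  using bounded_linear_compose[OF bounded_linear_vec_nth[of j] bounded_linear_vec_nth[of i]] .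
 have "I$2$1 - I$1$2 = 0" by (rule z[OF bounded_linear_sub[OF bl bl]]) (auto simp: S0_iff)
 moreover have "I$3$1 - I$1$3 = 0" by (rule z[OF bounded_linear_sub[OF bl bl]]) (auto simp: S0_iff)
 moreover have "I$3$2 - I$2$3 = 0" by (rule z[OF bounded_linear_sub[OF bl bl]]) (auto simp: S0_iff)
 moreover have "I$1$1 + I$2$2 + I$3$3 = 0"
  by (rule z[OF bounded_linear_add[OF bounded_linear_add[OF bl bl] bl]]) (auto simp: S0_iff)
 ultimately show ?thesis by (auto simp: S0_iff)
qed

lemma norm_integral_square_le:
 fixes u :: "real => 'b::euclidean_space"
 assumes "a <= b" "continuous_on UNIV u" "!!x. (G has_vector_derivative u x) (at x)"
 shows "ennreal (nsq (G b - G a)) <= ennreal (b - a) * (LI x:{a..b}. ennreal (nsq (u x)))"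
proof -
 let ?I = "indicator {a..b} :: real => ennreal"
 define g where "g x = indicator {a..b} x *R u x" for x
 have g: "integrable lborel g"
  unfolding g_def[abs_def] by (rule borel_integrable_compact) (auto intro: continuous_on_subset[OF assms(2)])
 have "integral\<^sup>L lborel g = G b - G a"
  unfolding g_def by (rule integral_FTC_atLeastAtMost[OF assms(1)])
   (use assms in "auto intro: has_vector_derivative_at_within continuous_on_subset")
 hence "ennreal (norm (G b - G a)) <= (LI x. ennreal (norm (g x)))"
  using integral_norm_bound_ennreal[OF g] by simp
 also have "... = (LI x. ?I x * ennreal (norm (g x)))"
  by (intro nn_integral_cong) (auto simp: g_def indicator_def)
 finally have "(ennreal (norm (G b - G a)))^2 <= (LI x. ?I x * ennreal (norm (g x)))^2"
  by (rule power_mono) simp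
 also have "... <= (LI x. (?I x)^2) * (LI x. (ennreal (norm (g x)))^2)"
  by (rule Cauchy_Schwarz_nn_integral) (use g in "auto intro!: borel_measurable_indicator")
 also have "(LI x. (?I x)^2) = (LI x. ?I x)"
  by (intro nn_integral_cong) (auto simp: indicator_def)
 also have "(LI x. ?I x) = ennreal (b - a)"
  using assms(1) by (subst nn_integral_indicator) auto
 also have "(LI x. (ennreal (norm (g x)))^2) = (LI x:{a..b}. ennreal (nsq (u x)))"
  by (intro nn_integral_cong) (auto simp: g_def indicator_def ennreal_power)
 finally show ?thesis by (simp add: ennreal_power)
qed

lemma nn_integral_four:
 fixes a k :: ennreal
 assumes "A : borel_measurable M" "B : borel_measurable M" "C : borel_measurable M" "E : borel_measurable M"
 shows "(\<integral>\<^sup>+x. a * A x + (B x + (a * C x + k * E x)) \<partial>M)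
  = a * (\<integral>\<^sup>+x. A x \<partial>M) + ((\<integral>\<^sup>+x. B x \<partial>M) + (a * (\<integral>\<^sup>+x. C x \<partial>M) + k * (\<integral>\<^sup>+x. E x \<partial>M)))"
 using assms by (simp add: nn_integral_add nn_integral_cmult)

text \<open>Average over backward windows [r-h,r]: as the profile is constant to the left of 1, the
  boundary value is kept exactly. The squared slope of the average is at most the average of
  \<open>w\<close>, so the gradient part does not grow. The potential part converges by dominated
  convergence away from the one point t where the cut profile may vanish. A cutoff on [R,R+1] makes
  p vanish for large arguments.\<close>

lemma smooth_profile_exists:
 fixes phi :: "real^3^3 => real"
 assumes pd0: "prof_data P0 w0"
  and phi[measurable]: "phi : borel_measurable borel" and phic: "continuous_on (- {0}) phi"
  and phi0: "!!Q. Q : S0 ==> 0 <= phi Q" and C: "0 <= C"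
  and phiC: "!!Q. Q : S0 ==> phi Q <= C * (nsq (Q - Q_inf) + (norm (Q - Q_inf))^4)"
  and e: "0 < e"
 obtains p p' L where "!!s. (p has_vector_derivative p' s) (at s)" "continuous_on UNIV p'" "!!s. s <= 1 ==> p s = P0 1 - Q_inf"
  "!!s. L <= s ==> p s = 0" "1 <= L" "!!s. p s : S0"
  "(LI s:{1<..}. ennreal (1/2 * nsq (p' s) + phi (Q_inf + p s)))
   <= ennreal (1/2) * (LI x. w0 x) + (LI r:{1<..}. ennreal (phi (P0 r))) + ennreal e"
proof -
 obtain P w t where pd: "prof_data P w" and P1: "P 1 = P0 1" and nz: "!!r. 1 <= r ==> r ~= t ==> P r ~= 0"
  and ww: "(LI x. w x) <= (LI x. w0 x)"
  and gen: "!!phi :: real^3^3 => ennreal. phi : borel_measurable borel ==>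
   (LI r:{1<..}. phi (P r)) <= (LI r:{1<..}. phi (P0 r))"
  by (rule prof_data_cut[OF pd0]) (rule that)
 have cP: "continuous_on UNIV P" and c1: "!!r. r <= 1 ==> P r = P 1" and PS: "!!r. P r : S0"
  and wm[measurable]: "w : borel_measurable borel"
  and inc: "!!a b. a <= b ==> ennreal (nsq (P b - P a)) <= ennreal (b - a) * (LI x:{a..b}. w x)"
  and wf: "(LI x. w x) < \<infinity>"
  and uf: "(LI x:{1<..}. ennreal (nsq (P x - Q_inf))) < \<infinity>"
  using pd unfolding prof_data_def by blast+
 have Pm[measurable]: "P : borel_measurable borel" by (rule borel_measurable_continuous_onI[OF cP])
 define u where "u r = P r - Q_inf" for r
 have cu: "continuous_on UNIV u" unfolding u_def[abs_def] by (intro continuous_intros cP)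
 have um[measurable]: "u : borel_measurable borel" by (rule borel_measurable_continuous_onI[OF cu])
 have uS: "u r : S0" for r unfolding u_def by (intro mem_S0 PS Q_inf_S0)
 have w1: "(LI x:{1<..}. w x) < \<infinity>"
  using le_less_trans[OF nn_integral_mono wf, of "%x. w x * indicator {1<..} x"] by (auto simp: indicator_def)
 obtain G where G: "!!x. (G has_vector_derivative u x) (at x)"
  using einterval_antiderivative[of "-\<infinity>" \<infinity> u] continuous_on_eq_continuous_at[of UNIV u] cu by auto
 define M where "M = max (norm (u 1)) (sqrt (enn2real (LI x:{1<..}. ennreal (nsq (u x)))) + sqrt (enn2real (LI x:{1<..}. w x)))"
 have uM: "norm (u r) <= M" for r
 proof (cases "1 < r")
  case True
  have "norm (P r - Q_inf) <= sqrt (enn2real (LI x:{1<..}. ennreal (nsq (u x)))) + sqrt (enn2real (LI x:{1<..}. w x))"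
   by (rule prof_data_sup[OF pd order_refl _ _ _ _ True]) (use uf w1 in "auto simp: u_def less_top")
  thus ?thesis by (simp add: M_def u_def)
 next
  case False
  hence "u r = u 1" using c1[of r] by (simp add: u_def)
  thus ?thesis by (simp add: M_def)
 qed
 have M0: "0 <= M" using uM[of 1] norm_ge_zero order_trans by blast
 \<comment> \<open>On [R,R+1] the slope of the cutoff, at most 3/2, adds 9/4 |q|^2 to half the
   squared slope, and phi is at most C (1 + M^2) |q|^2 because |q| <= M.\<close>
 define K where "K = 9/4 + C * (1 + M^2)"
 have K: "0 < K" using C by (auto simp: K_def intro!: add_pos_nonneg)
 obtain R1 where R1: "!!R. R \<ge> R1 ==> (LI x:{R<..}. w x) <= ennreal (e/4)"
  using nn_integral_tail_small[OF wm w1, of "e/4"] e by auto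
 obtain R2 where R2: "!!R. R \<ge> R2 ==> (LI x:{R<..}. ennreal (nsq (u x))) <= ennreal (e/(4*K))"
  using nn_integral_tail_small[OF _ uf, of "e/(4*K)"] e K unfolding u_def by auto
 \<comment> \<open>The summand 1 leaves room for the windows, whose length is at most 1.\<close>
 define R where "R = max 1 (max R1 R2) + 1"
 have R: "2 <= R" "R1 <= R - 1" "R2 <= R - 1" by (auto simp: R_def)
 define q where "q h r = (1/h) *R (G r - G (r - h))" for h r
 define q' where "q' h r = (1/h) *R (u r - u (r - h))" for h r
 have qd: "(q h has_vector_derivative q' h r) (at r)" for h r
 proof -
  have "((%r. G (r - h)) has_vector_derivative u (r - h)) (at r)"
  proof -
   have "((%r. r - h) has_vector_derivative 1) (at r)"
    unfolding has_real_derivative_iff_has_vector_derivative[symmetric] by (auto intro!: derivative_eq_intros)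
   from vector_diff_chain_at[OF this G] show ?thesis by (simp add: o_def)
  qed
  thus ?thesis unfolding q_def[abs_def] q'_def
   by (intro has_vector_derivative_scaleR[of "%_. 1/h" 0, simplified] has_vector_derivative_diff G)
 qed
 have cq': "continuous_on UNIV (q' h)" for h
  unfolding q'_def[abs_def] by (intro continuous_intros continuous_on_compose2[OF cu]) auto
 have cq: "continuous_on UNIV (q h)" for h
  using qd by (auto intro!: continuous_at_imp_continuous_on has_vector_derivative_continuous)
 have GI: "(u has_integral (G b - G a)) {a..b}" if "a <= b" for a b
  by (rule fundamental_theorem_of_calculus[OF that]) (use G has_vector_derivative_at_within in blast)
 have qS: "q h r : S0" if "0 < h" for h r
  unfolding q_def by (rule mem_S0(4)) (rule has_integral_S0[OF GI[of "r - h" r] uS], use that in simp)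
 have qnear: "norm (q h r - c) <= B" if h: "0 < h" and B: "!!x. x : {r-h..r} ==> norm (u x - c) <= B" "0 <= B" for h r c B
 proof -
  have "((%x. u x - c) has_integral ((G r - G (r - h)) - h *R c)) {r-h..r}"
   using has_integral_diff[OF GI[of "r - h" r] has_integral_const_real[of c "r - h" r]] h by simp
  hence "((%x. u x - c) has_integral ((G r - G (r - h)) - h *R c)) (cbox (r-h) r)" by simp
  from has_integral_bound[OF B(2) this] have "norm ((G r - G (r - h)) - h *R c) <= B * measure lborel (cbox (r-h) r)"
   using B(1) by simp
  hence "norm ((G r - G (r - h)) - h *R c) <= B * h" using h by simp
  moreover have "q h r - c = (1/h) *R ((G r - G (r - h)) - h *R c)" using h by (simp add: q_def scaleR_diff_right)
  ultimately have "norm (q h r - c) <= (1/h) * (B * h)" using h by (simp add: pos_divide_le_eq)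
  thus ?thesis using h by simp
 qed
 have qM: "norm (q h r) <= M" if "0 < h" for h r using qnear[OF that, of r 0 M] uM M0 by simp
 have q1: "q h r = u 1" if "0 < h" "r <= 1" for h r
 proof -
  have "norm (q h r - u 1) <= 0"
  proof (rule qnear[OF that(1)])
   fix x assume "x : {r-h..r}"
   hence "u x = u 1" using c1[of x] that by (simp add: u_def)
   thus "norm (u x - u 1) <= 0" by simp
  qed simp
  thus ?thesis by simp
 qed
 have q'w: "ennreal (nsq (q' h r)) <= ennreal (1/h) * (LI t:{r-h..r}. w t)" if h: "0 < h" for h r
 proof -
  have "ennreal (nsq (q' h r)) = ennreal (1/h^2) * ennreal (nsq (P r - P (r - h)))"
   using h by (subst ennreal_mult[symmetric]) (auto simp: q'_def u_def power_divide)
  also have "... <= ennreal (1/h^2) * (ennreal h * (LI t:{r-h..r}. w t))"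
   using inc[of "r - h" r] h by (intro mult_left_mono) auto
  also have "... = ennreal (1/h) * (LI t:{r-h..r}. w t)"
   unfolding mult.assoc[symmetric] using h by (subst ennreal_mult[symmetric]) (auto simp: power2_eq_square)
  finally show ?thesis .
 qed
 have qu: "ennreal (nsq (q h r)) <= ennreal (1/h) * (LI t:{r-h..r}. ennreal (nsq (u t)))" if h: "0 < h" for h r
 proof -
  have "ennreal (nsq (q h r)) = ennreal (1/h^2) * ennreal (nsq (G r - G (r - h)))"
   using h by (subst ennreal_mult[symmetric]) (auto simp: q_def power_divide)
  also have "... <= ennreal (1/h^2) * (ennreal h * (LI t:{r-h..r}. ennreal (nsq (u t))))"
   using norm_integral_square_le[of "r - h" r u G] cu G h by (intro mult_left_mono) auto
  also have "... = ennreal (1/h) * (LI t:{r-h..r}. ennreal (nsq (u t)))"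
   unfolding mult.assoc[symmetric] using h by (subst ennreal_mult[symmetric]) (auto simp: power2_eq_square)
  finally show ?thesis .
 qed
 have avg: "(LI r:{a<..}. ennreal (nsq (q' h r))) <= (LI t:{a-h<..}. w t)"
  "(LI r:{a<..}. ennreal (nsq (q h r))) <= (LI t:{a-h<..}. ennreal (nsq (u t)))" if h: "0 < h" for h a
 proof -
  show "(LI r:{a<..}. ennreal (nsq (q' h r))) <= (LI t:{a-h<..}. w t)"
   by (rule order_trans[OF nn_integral_mono nn_integral_average[OF wm h]]) (intro mult_right_mono q'w h, simp)
  show "(LI r:{a<..}. ennreal (nsq (q h r))) <= (LI t:{a-h<..}. ennreal (nsq (u t)))"
   by (rule order_trans[OF nn_integral_mono nn_integral_average[OF _ h]]) (intro mult_right_mono qu h, simp, measurable)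
 qed
 define hn where "hn n = 1 / real (Suc n)" for n
 have hn: "0 < hn n" "hn n <= 1" for n by (auto simp: hn_def)
 have hn0: "hn ----> 0" unfolding hn_def by (rule LIMSEQ_Suc[OF lim_1_over_n])
 have qm[measurable]: "q h : borel_measurable borel" for h by (rule borel_measurable_continuous_onI[OF cq])
 have q'm[measurable]: "q' h : borel_measurable borel" for h by (rule borel_measurable_continuous_onI[OF cq'])
 have phiM: "phi (Q_inf + v) <= C * (1 + M^2) * nsq v" if v: "v : S0" "norm v <= M" for v
 proof -
  have "phi (Q_inf + v) <= C * (nsq v + (norm v)^4)" using phiC[of "Q_inf + v"] mem_S0(2)[OF Q_inf_S0 v(1)] by simp
  also have "nsq v + (norm v)^4 = nsq v * (1 + nsq v)" by (simp add: algebra_simps power2_eq_square power4_eq_xxxx)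
  also have "C * (nsq v * (1 + nsq v)) <= C * (nsq v * (1 + M^2))"
   using C v(2) by (intro mult_left_mono add_left_mono power_mono) auto
  finally show ?thesis by (simp add: mult_ac)
 qed
 \<comment> \<open>Convergence is used on a bounded interval only; beyond R the potential is
   estimated through K and the small tails.\<close>
 have lim: "(%n. LI r:{1<..R}. ennreal (phi (Q_inf + q (hn n) r))) ----> (LI r:{1<..R}. ennreal (phi (P r)))"
 proof (rule nn_integral_dominated_convergence[where w="%r. ennreal (C * (1 + M^2) * M^2) * indicator {1<..R} r"])
  show "(LI r. ennreal (C * (1 + M^2) * M^2) * indicator {1<..R} r) < \<infinity>"
   using R by (subst nn_integral_cmult_indicator) (auto simp: ennreal_mult_less_top)
  show "AE r in lborel. ennreal (phi (Q_inf + q (hn n) r)) * indicator {1<..R} r <= ennreal (C * (1 + M^2) * M^2) * indicator {1<..R} r" for n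
  proof (intro AE_I2 mult_right_mono ennreal_leI)
   fix r
   have "phi (Q_inf + q (hn n) r) <= C * (1 + M^2) * nsq (q (hn n) r)" by (rule phiM[OF qS qM]) (use hn in auto)
   also have "... <= C * (1 + M^2) * M^2" using qM[OF hn(1)] C by (intro mult_left_mono power_mono) auto
   finally show "phi (Q_inf + q (hn n) r) <= C * (1 + M^2) * M^2" .
  qed simp
  show "AE r in lborel. (%n. ennreal (phi (Q_inf + q (hn n) r)) * indicator {1<..R} r) ----> ennreal (phi (P r)) * indicator {1<..R} r"
   using AE_lborel_singleton[of t]
  proof eventually_elim
   case (elim r)
   show ?case
   proof (cases "1 < r")
    case True
    hence Pr: "P r ~= 0" using nz[of r] elim by simp
    have ql: "(%n. q (hn n) r) ----> u r"
    proof (rule metric_LIMSEQ_I)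
     fix eta :: real assume eta: "0 < eta"
     obtain dl where dl: "0 < dl" "!!x. \<bar>x - r\<bar> < dl ==> norm (u x - u r) < eta/2"
      using cu[unfolded continuous_on_iff, rule_format, of r "eta/2"] eta by (auto simp: dist_norm)
     obtain N where N: "ALL n>=N. dist (hn n) 0 < dl" using metric_LIMSEQ_D[OF hn0 dl(1)] by blast
     show "EX N. ALL n>=N. dist (q (hn n) r) (u r) < eta"
     proof (intro exI allI impI)
      fix n assume "N <= n"
      hence "hn n < dl" using N hn(1)[of n] by (auto simp: dist_real_def)
      hence "norm (q (hn n) r - u r) <= eta/2"
       using dl(2) eta by (intro qnear[OF hn(1)] less_imp_le) auto
      thus "dist (q (hn n) r) (u r) < eta" using eta by (simp add: dist_norm)
     qed
    qed
    have "(%n. Q_inf + q (hn n) r) ----> Q_inf + u r" by (intro tendsto_intros ql)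
    hence "(%n. Q_inf + q (hn n) r) ----> P r" by (simp add: u_def)
    moreover have "isCont phi (P r)" using phic Pr by (simp add: continuous_on_eq_continuous_at open_Compl)
    ultimately have "(%n. phi (Q_inf + q (hn n) r)) ----> phi (P r)" by (rule isCont_tendsto_compose[rotated])
    hence "(%n. ennreal (phi (Q_inf + q (hn n) r))) ----> ennreal (phi (P r))" by (rule tendsto_ennrealI)
    thus ?thesis using \<open>1 < r\<close> by (cases "r <= R") auto
   qed auto
  qed
 qed measurable
 define I where "I = (LI r:{1<..}. ennreal (phi (P r)))"
 have "EX n. (LI r:{1<..R}. ennreal (phi (Q_inf + q (hn n) r))) <= I + ennreal (e/2)"
 proof (cases "I = \<infinity>")
  case False
  have "(LI r:{1<..R}. ennreal (phi (P r))) <= I"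
   unfolding I_def by (intro nn_integral_mono) (auto simp: indicator_def)
  also have "I < I + ennreal (e/2)" using False e ennreal_add_left_cancel_less[of I 0 "ennreal (e/2)"] by auto
  finally have "\<forall>\<^sub>F n in sequentially. (LI r:{1<..R}. ennreal (phi (Q_inf + q (hn n) r))) < I + ennreal (e/2)"
   by (rule order_tendstoD(2)[OF lim])
  thus ?thesis by (meson eventually_sequentially less_imp_le order_refl)
 qed simp
 then obtain n where n: "(LI r:{1<..R}. ennreal (phi (Q_inf + q (hn n) r))) <= I + ennreal (e/2)" by blast
 define h where "h = hn n"
 have h: "0 < h" "h <= 1" using hn[of n] by (auto simp: h_def)
 define p where "p r = (1 - step (r - R)) *R q h r" for r
 define p' where "p' r = (1 - step (r - R)) *R q' h r + (- step' (r - R)) *R q h r" for r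
 have pd': "(p has_vector_derivative p' r) (at r)" for r
 proof -
  have "((%r. r - R) has_real_derivative 1) (at r)" by (auto intro!: derivative_eq_intros)
  from DERIV_chain2[OF step_deriv this]
  have "((%r. 1 - step (r - R)) has_real_derivative (0 - step' (r - R) * 1)) (at r)" by (intro DERIV_diff DERIV_const)
  hence "((%r. 1 - step (r - R)) has_real_derivative (- step' (r - R))) (at r)" by simp
  from has_vector_derivative_scaleR[OF this qd[of h r]] show ?thesis by (simp add: p_def[abs_def] p'_def)
 qed
 have cp': "continuous_on UNIV p'"
  unfolding p'_def[abs_def] by (intro continuous_intros cq cq')
 have p1: "p s = P0 1 - Q_inf" if "s <= 1" for s
  using q1[OF h(1) that] R that P1 by (simp add: p_def step_eq u_def)
 have pL: "p s = 0" if "R + 1 <= s" for s using that by (simp add: p_def step_eq)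
 have pS: "p s : S0" for s unfolding p_def by (intro mem_S0 qS h)
 have pm[measurable]: "p' : borel_measurable borel" by (rule borel_measurable_continuous_onI[OF cp'])
 have "(LI s:{1<..}. ennreal (1/2 * nsq (p' s) + phi (Q_inf + p s)))
  <= (LI s. ennreal (1/2) * (ennreal (nsq (q' h s)) * indicator {1<..} s)
    + (ennreal (phi (Q_inf + q h s)) * indicator {1<..R} s
    + (ennreal (1/2) * (ennreal (nsq (q' h s)) * indicator {R<..} s) + ennreal K * (ennreal (nsq (q h s)) * indicator {R<..} s))))"
 proof (rule nn_integral_mono)
  fix s
  have half: "ennreal (1/2) * ennreal (nsq (q' h s)) = ennreal (1/2 * nsq (q' h s))" by (rule ennreal_mult[symmetric]) auto
  consider "s <= 1" | "1 < s" "s <= R" | "R < s" by linarith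
  thus "ennreal (1/2 * nsq (p' s) + phi (Q_inf + p s)) * indicator {1<..} s <= ennreal (1/2) * (ennreal (nsq (q' h s)) * indicator {1<..} s)
    + (ennreal (phi (Q_inf + q h s)) * indicator {1<..R} s
    + (ennreal (1/2) * (ennreal (nsq (q' h s)) * indicator {R<..} s) + ennreal K * (ennreal (nsq (q h s)) * indicator {R<..} s)))"
  proof cases
   case 2
   hence "p' s = q' h s" "p s = q h s" by (auto simp: p_def p'_def step_eq)
   thus ?thesis using 2 phi0[OF mem_S0(2)[OF Q_inf_S0 qS[OF h(1), of s]]] half by (simp add: ennreal_plus)
  next
   case 3
   have th: "0 <= 1 - step (s - R)" "1 - step (s - R) <= 1" using step_bounds[of "s - R"] by auto
   have "norm (p' s) <= norm ((1 - step (s - R)) *R q' h s) + norm ((- step' (s - R)) *R q h s)"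
    unfolding p'_def by (rule norm_triangle_ineq)
   also have "... = (1 - step (s - R)) * norm (q' h s) + step' (s - R) * norm (q h s)"
    using th step'_bounds(1)[of "s - R"] by simp
   also have "... <= 1 * norm (q' h s) + 3/2 * norm (q h s)"
    by (rule add_mono[OF mult_right_mono[OF th(2)] mult_right_mono[OF step'_bounds(2)]]) auto
   finally have "norm (p' s) <= norm (q' h s) + 3/2 * norm (q h s)" by simp
   hence "nsq (p' s) <= (norm (q' h s) + 3/2 * norm (q h s))^2" by (intro power_mono) auto
   also have "... <= 2 * nsq (q' h s) + 2 * (9/4 * nsq (q h s))"
    using zero_le_power2[of "norm (q' h s) - 3/2 * norm (q h s)"] by (simp add: power2_eq_square algebra_simps)
   finally have 1: "1/2 * nsq (p' s) <= nsq (q' h s) + 9/4 * nsq (q h s)" by simp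
   have np: "norm (p s) <= norm (q h s)" unfolding p_def using th by (simp add: mult_left_le_one_le)
   have "phi (Q_inf + p s) <= C * (1 + M^2) * nsq (p s)" by (rule phiM[OF pS order_trans[OF np qM[OF h(1)]]])
   also have "... <= C * (1 + M^2) * nsq (q h s)" using np C by (intro mult_left_mono power_mono) auto
   finally have "1/2 * nsq (p' s) + phi (Q_inf + p s) <= (1/2 * nsq (q' h s) + 1/2 * nsq (q' h s)) + K * nsq (q h s)"
    using 1 by (simp add: K_def algebra_simps)
   hence "ennreal (1/2 * nsq (p' s) + phi (Q_inf + p s)) <= ennreal ((1/2 * nsq (q' h s) + 1/2 * nsq (q' h s)) + K * nsq (q h s))"
    by (rule ennreal_leI)
   also have "... = (ennreal (1/2 * nsq (q' h s)) + ennreal (1/2 * nsq (q' h s))) + ennreal K * ennreal (nsq (q h s))"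
   proof -
    have 1: "ennreal K * ennreal (nsq (q h s)) = ennreal (K * nsq (q h s))"
     using K by (intro ennreal_mult[symmetric]) auto
    have 2: "ennreal (1/2 * nsq (q' h s)) + ennreal (1/2 * nsq (q' h s)) = ennreal (1/2 * nsq (q' h s) + 1/2 * nsq (q' h s))"
     by (intro ennreal_plus[symmetric]) auto
    show ?thesis unfolding 1 2 using K by (intro ennreal_plus) auto
   qed
   finally show ?thesis using 3 R unfolding half[symmetric] by (simp add: add.assoc)
  qed auto
 qed
 also have "... = ennreal (1/2) * (LI s:{1<..}. ennreal (nsq (q' h s)))
   + ((LI s:{1<..R}. ennreal (phi (Q_inf + q h s)))
   + (ennreal (1/2) * (LI s:{R<..}. ennreal (nsq (q' h s))) + ennreal K * (LI s:{R<..}. ennreal (nsq (q h s)))))"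
  by (rule nn_integral_four) measurable
 also have "... <= ennreal (1/2) * (LI x. w0 x) + ((I + ennreal (e/2)) + (ennreal (1/2) * ennreal (e/4) + ennreal K * ennreal (e/(4*K))))"
 proof (intro add_mono mult_left_mono)
  have "(LI t:{1-h<..}. w t) <= (LI x. w x)" by (intro nn_integral_mono) (auto simp: indicator_def)
  thus "(LI s:{1<..}. ennreal (nsq (q' h s))) <= (LI x. w0 x)"
   using avg(1)[OF h(1), of 1] ww by (meson order_trans)
  show "(LI s:{1<..R}. ennreal (phi (Q_inf + q h s))) <= I + ennreal (e/2)" using n by (simp add: h_def)
  show "(LI s:{R<..}. ennreal (nsq (q' h s))) <= ennreal (e/4)"
   using avg(1)[OF h(1), of R] R1[of "R - h"] R h by (meson diff_left_mono order_trans)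
  show "(LI s:{R<..}. ennreal (nsq (q h s))) <= ennreal (e/(4*K))"
   using avg(2)[OF h(1), of R] R2[of "R - h"] R h by (meson diff_left_mono order_trans)
 qed auto
 also have "... <= ennreal (1/2) * (LI x. w0 x) + (I + ennreal e)"
 proof -
  have "ennreal (e/2) + (ennreal (1/2) * ennreal (e/4) + ennreal K * ennreal (e/(4*K))) = ennreal (e/2 + (1/2 * (e/4) + K * (e/(4*K))))"
   using e K by (subst ennreal_plus, simp, simp, subst ennreal_plus, simp, simp, subst ennreal_mult, simp, simp, subst ennreal_mult, simp, simp) (rule refl)
  also have "... <= ennreal e" using e K by (intro ennreal_leI) (simp add: field_simps)
  finally show ?thesis unfolding add.assoc by (intro add_left_mono)
 qed
 also have "... <= ennreal (1/2) * (LI x. w0 x) + ((LI r:{1<..}. ennreal (phi (P0 r))) + ennreal e)"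
  unfolding I_def by (intro add_left_mono add_right_mono gen) measurable
 finally show thesis
  using that[of p p' "R + 1"] pd' cp' p1 pL pS R by (simp add: add.assoc)
qed

section \<open>Continuously differentiable maps\<close>

definition C1 :: "'a::euclidean_space set => ('a => 'b::euclidean_space) => bool" where
 "C1 Om u \<longleftrightarrow> (EX u'. C1_on Om u u')"

lemma C1_onI: "(!!x. x : Om ==> (u has_derivative u' x) (at x)) ==> (!!e. e : Basis ==> continuous_on Om (%x. u' x e)) ==> C1_on Om u u'"
 by (simp add: C1_on_def)

lemma C1_onD: "C1_on Om u u' ==> x : Om ==> (u has_derivative u' x) (at x)" "C1_on Om u u' ==> e : Basis ==> continuous_on Om (%x. u' x e)"
 by (auto simp: C1_on_def)

lemma C1_on_const: "C1_on Om (%x. c) (%x h. 0)" by (intro C1_onI) auto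

lemma C1_on_linear: "bounded_linear f ==> C1_on Om f (%x. f)"
 by (intro C1_onI bounded_linear_imp_has_derivative) auto

lemma C1_on_add: "C1_on Om u u' ==> C1_on Om v v' ==> C1_on Om (%x. u x + v x) (%x h. u' x h + v' x h)"
 by (rule C1_onI, rule has_derivative_add[OF C1_onD(1) C1_onD(1)], assumption+, rule continuous_on_add[OF C1_onD(2) C1_onD(2)])

lemma C1_on_diff: "C1_on Om u u' ==> C1_on Om v v' ==> C1_on Om (%x. u x - v x) (%x h. u' x h - v' x h)"
 by (rule C1_onI, rule has_derivative_diff[OF C1_onD(1) C1_onD(1)], assumption+, rule continuous_on_diff[OF C1_onD(2) C1_onD(2)])

lemma C1_on_scaleR:
 assumes "C1_on Om f f'" "C1_on Om u u'"
 shows "C1_on Om (%x. f x *R u x) (%x h. f x *R u' x h + f' x h *R u x)"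
proof (rule C1_onI)
 fix x assume x: "x : Om"
 show "((%x. f x *R u x) has_derivative (%h. f x *R u' x h + f' x h *R u x)) (at x)"
  by (rule has_derivative_scaleR[OF C1_onD(1)[OF assms(1) x] C1_onD(1)[OF assms(2) x]])
next
 fix e :: 'a assume e: "e : Basis"
 show "continuous_on Om (%x. f x *R u' x e + f' x e *R u x)"
  by (intro continuous_on_add continuous_on_scaleR C1_on_continuous[OF assms(1)] C1_on_continuous[OF assms(2)]
    C1_onD(2)[OF assms(1) e] C1_onD(2)[OF assms(2) e])
qed

lemma C1_on_curve:
 fixes f :: "'a::euclidean_space => real" and h :: "real => 'b::euclidean_space"
 assumes f: "C1_on Om f f'" and h: "!!t. t : T ==> (h has_vector_derivative h' t) (at t)" "continuous_on T h'"
  and T: "!!x. x : Om ==> f x : T"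
 shows "C1_on Om (%x. h (f x)) (%x e. f' x e *R h' (f x))"
proof (rule C1_onI)
 fix x assume x: "x : Om"
 show "((%x. h (f x)) has_derivative (%e. f' x e *R h' (f x))) (at x)"
  using has_derivative_compose[OF C1_onD(1)[OF f x], of h "%y. y *R h' (f x)"] h(1)[OF T[OF x]]
  by (simp add: has_vector_derivative_def)
next
 fix e :: 'a assume "e : Basis"
 thus "continuous_on Om (%x. f' x e *R h' (f x))"
  using T by (intro continuous_on_scaleR C1_onD(2)[OF f] continuous_on_compose2[OF h(2) C1_on_continuous[OF f]]) auto
qed

lemma C1_on_cong:
 assumes "C1_on Om u u'" "open Om" "!!x. x : Om ==> u x = v x" shows "C1_on Om v u'"
proof (rule C1_onI)
 fix x assume x: "x : Om"
 show "(v has_derivative u' x) (at x)"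
  by (rule has_derivative_transform_within_open[OF C1_onD(1)[OF assms(1) x] assms(2) x assms(3)])
qed (rule C1_onD(2)[OF assms(1)])

lemma C1_on_subset: "C1_on Om u u' ==> A <= Om ==> C1_on A u u'"
 by (rule C1_onI, erule C1_onD(1), erule subsetD, assumption, rule continuous_on_subset[OF C1_onD(2)])

lemma C1_cong: "C1 Om u ==> open Om ==> (!!x. x : Om ==> u x = v x) ==> C1 Om v"
 unfolding C1_def by (elim exE, rule exI, rule C1_on_cong)

lemma C1_const: "C1 Om (%x. c)" unfolding C1_def by (rule exI, rule C1_on_const)
lemma C1_linear: "bounded_linear f ==> C1 Om f" unfolding C1_def by (rule exI, rule C1_on_linear)
lemma C1_add: "C1 Om u ==> C1 Om v ==> C1 Om (%x. u x + v x)" unfolding C1_def by (elim exE, rule exI, rule C1_on_add)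
lemma C1_diff: "C1 Om u ==> C1 Om v ==> C1 Om (%x. u x - v x)" unfolding C1_def by (elim exE, rule exI, rule C1_on_diff)
lemma C1_scaleR: "C1 Om f ==> C1 Om u ==> C1 Om (%x. f x *R u x)" unfolding C1_def by (elim exE, rule exI, rule C1_on_scaleR)
lemma C1_mult: "C1 Om f ==> C1 Om g ==> C1 Om (%x. f x * g x :: real)" using C1_scaleR[of Om f g] by simp
lemma C1_curve:
 fixes h :: "real => 'b::euclidean_space"
 shows "C1 Om f ==> (!!t. t : T ==> (h has_vector_derivative h' t) (at t)) ==> continuous_on T h' ==> (!!x. x : Om ==> f x : T)
  ==> C1 Om (%x. h (f x))"
 unfolding C1_def by (elim exE, rule exI, rule C1_on_curve)

lemma C1_inverse:
 assumes "C1 Om f" "!!x. x : Om ==> f x ~= (0::real)" shows "C1 Om (%x. inverse (f x))"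
proof (rule C1_curve[OF assms(1), of "- {0}" inverse "%t. - (inverse t ^ Suc (Suc 0))"])
 fix t :: real assume "t : - {0}"
 thus "(inverse has_vector_derivative - (inverse t ^ Suc (Suc 0))) (at t)"
  unfolding has_real_derivative_iff_has_vector_derivative[symmetric] by (intro DERIV_inverse) auto
qed (use assms(2) in "auto intro!: continuous_intros")

lemma C1_sqrt:
 assumes "C1 Om f" "!!x. x : Om ==> 0 < f x" shows "C1 Om (%x. sqrt (f x))"
proof (rule C1_curve[OF assms(1), of "{0<..}" sqrt "%t. inverse (sqrt t) / 2"])
 fix t :: real assume "t : {0<..}"
 thus "(sqrt has_vector_derivative inverse (sqrt t) / 2) (at t)"
  unfolding has_real_derivative_iff_has_vector_derivative[symmetric] by (intro DERIV_real_sqrt) auto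
qed (use assms(2) in "auto intro!: continuous_intros")

lemma step_has_vector_derivative: "(step has_vector_derivative step' t) (at t)"
 using step_deriv by (simp add: has_real_derivative_iff_has_vector_derivative)

lemma C1_step: "C1 Om f ==> C1 Om (%x. step (f x))"
 by (rule C1_curve[OF _ step_has_vector_derivative, of _ _ UNIV]) (auto intro: continuous_intros)

lemma C1_sum: "finite J ==> (!!j. j : J ==> C1 Om (u j)) ==> C1 Om (%x. SUM j:J. u j x)"
 by (induction J rule: finite_induct) (auto intro: C1_const C1_add)

text \<open>The Frechet derivative serves as common derivative, since it agrees with each of the two
  local ones.\<close>

lemma C1_Un:
 assumes "C1 A u" "C1 B u" "open A" "open B" shows "C1 (A Un B) u"
proof -
 obtain a b where ab: "C1_on A u a" "C1_on B u b" using assms by (auto simp: C1_def)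
 let ?D = "%x. frechet_derivative u (at x)"
 have a: "?D x = a x" if "x : A" for x using frechet_derivative_at[OF C1_onD(1)[OF ab(1) that]] by simp
 have b: "?D x = b x" if "x : B" for x using frechet_derivative_at[OF C1_onD(1)[OF ab(2) that]] by simp
 have "C1_on (A Un B) u ?D"
 proof (rule C1_onI)
  fix x assume "x : A Un B"
  thus "(u has_derivative ?D x) (at x)"
  proof
   assume x: "x : A" show ?thesis unfolding a[OF x] by (rule C1_onD(1)[OF ab(1) x])
  next
   assume x: "x : B" show ?thesis unfolding b[OF x] by (rule C1_onD(1)[OF ab(2) x])
  qed
 next
  fix e :: 'a assume e: "e : Basis"
  have "continuous_on A (%x. ?D x e)"
   by (rule continuous_on_eq[OF C1_onD(2)[OF ab(1) e]]) (simp only: a)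
  moreover have "continuous_on B (%x. ?D x e)"
   by (rule continuous_on_eq[OF C1_onD(2)[OF ab(2) e]]) (simp only: b)
  ultimately show "continuous_on (A Un B) (%x. ?D x e)" using assms by (intro continuous_on_open_Un)
 qed
 thus ?thesis by (auto simp: C1_def)
qed

text \<open>A pointwise bound on partial derivatives that follows the algebraic structure of a
  function; it stands in for the unwieldy derivative of \<open>W\<close>. \<open>gb_unique\<close>
  transfers the bound to any given derivative.\<close>

definition gb :: "'a::euclidean_space => ('a => 'b::euclidean_space) => real => bool" where
 "gb x u k \<longleftrightarrow> (EX D. (u has_derivative D) (at x) & (ALL e:Basis. norm (D e) <= k))"

lemma gb_mono: "gb x u k ==> k <= k' ==> gb x u k'" unfolding gb_def by (meson order_trans)
lemma gb_const: "gb x (%_. c) 0" unfolding gb_def by (intro exI[of _ "%_. 0"]) auto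
lemma gb_linear: "bounded_linear f ==> (!!e. e : Basis ==> norm (f e) <= k) ==> gb x f k"
 unfolding gb_def by (intro exI[of _ f] conjI ballI bounded_linear_imp_has_derivative)
lemma gb_add: assumes "gb x u k" "gb x v l" shows "gb x (%x. u x + v x) (k + l)"
proof -
 obtain D E where "(u has_derivative D) (at x)" "ALL e:Basis. norm (D e) <= k" "(v has_derivative E) (at x)" "ALL e:Basis. norm (E e) <= l"
  using assms by (auto simp: gb_def)
 thus ?thesis unfolding gb_def
  by (intro exI[of _ "%h. D h + E h"] conjI has_derivative_add ballI order_trans[OF norm_triangle_ineq] add_mono) auto
qed
lemma gb_diff_const: "gb x u k ==> gb x (%x. u x - c) k"
 by (drule gb_add[OF _ gb_const[of x "- c"]]) simp
lemma gb_scaleR: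
 fixes f :: "'a::euclidean_space => real"
 assumes "gb x f k" "gb x u l" shows "gb x (%x. f x *R u x) (\<bar>f x\<bar> * l + k * norm (u x))"
proof -
 obtain D E where D: "(f has_derivative D) (at x)" "ALL e:Basis. norm (D e) <= k" and E: "(u has_derivative E) (at x)" "ALL e:Basis. norm (E e) <= l"
  using assms by (auto simp: gb_def)
 have "norm (f x *R E e + D e *R u x) <= \<bar>f x\<bar> * l + k * norm (u x)" if "e : Basis" for e
  using D(2) E(2) that by (intro order_trans[OF norm_triangle_ineq] add_mono) (auto intro: mult_left_mono mult_right_mono)
 thus ?thesis unfolding gb_def using has_derivative_scaleR[OF D(1) E(1)] by blast
qed
lemma gb_mult: "gb x f k ==> gb x g l ==> gb x (%x. f x * g x :: real) (\<bar>f x\<bar> * l + k * \<bar>g x\<bar>)"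
 using gb_scaleR[of x f k g l] by simp
lemma gb_curve:
 fixes f :: "'a::euclidean_space => real" and h :: "real => real"
 assumes f: "gb x f k" and h: "(h has_real_derivative h') (at (f x))"
 shows "gb x (%x. h (f x)) (k * \<bar>h'\<bar>)"
proof -
 obtain D where D: "(f has_derivative D) (at x)" "ALL e:Basis. norm (D e) <= k" using f by (auto simp: gb_def)
 have "((%x. h (f x)) has_derivative (%e. D e * h')) (at x)" by (rule DERIV_compose_FDERIV[OF h D(1)])
 thus ?thesis unfolding gb_def using D(2) by (intro exI[of _ "%e. D e * h'"]) (auto simp: abs_mult intro: mult_right_mono)
qed
lemma gb_unique: "gb x u k ==> (u has_derivative u1) (at x) ==> e : Basis ==> norm (u1 e) <= k"
 unfolding gb_def by (elim exE conjE) (drule (1) has_derivative_unique, simp)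

section \<open>Stereographic coordinates on the uniaxial tensors\<close>

text \<open>Inverse stereographic projection with centre e3, for w orthogonal to e3. The origin goes
  to - e3, which represents Q_inf since n and - n give the same tensor; the unit disc goes to the
  lower hemisphere, where e_phi takes its values.\<close>

definition stereo :: "real^3 => real^3" where
 "stereo w = inverse (1 + w \<bullet> w) *R (2 *R w + (w \<bullet> w - 1) *R e3)"

lemma e3_simps [simp]: "e3 \<bullet> e3 = 1" by (simp add: inner_axis_axis)

lemma norm_stereo:
 assumes "w \<bullet> e3 = 0" shows "norm (stereo w) = 1"
proof -
 let ?s = "1 + w \<bullet> w"
 have s: "0 < ?s" using inner_ge_zero[of w] by linarith
 have "nsq (2 *R w + (w \<bullet> w - 1) *R e3) = ?s^2"
  using assms unfolding power2_norm_eq_inner by (simp add: inner_add_left inner_add_right inner_commute) (simp add: power2_eq_square algebra_simps)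
 hence "norm (2 *R w + (w \<bullet> w - 1) *R e3) = ?s" using s by (simp add: power2_eq_iff_nonneg)
 thus ?thesis unfolding stereo_def using s by simp
qed

abbreviation outer :: "real^3 => real^3 => real^3^3" where "outer a b \<equiv> (\<chi> i j. a$i * b$j)"

lemma inner_outer: "outer a b \<bullet> outer c d = (a \<bullet> c) * (b \<bullet> d)"
 by (simp add: inner_vec_def sum_product mult_ac)

lemma bounded_bilinear_outer: "bounded_bilinear outer"
proof
 show "EX K. ALL a b. norm (outer a b) <= norm a * norm b * K"
 proof (intro exI[of _ 1] allI)
  fix a b
  have "nsq (outer a b) = (norm a * norm b)^2" by (simp add: power2_norm_eq_inner inner_outer power_mult_distrib)
  thus "norm (outer a b) <= norm a * norm b * 1" by (simp add: power2_eq_iff_nonneg)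
 qed
qed (auto simp: vec_eq_iff algebra_simps)

text \<open>Stereographic projection is conformal, and \<open>n \<mapsto> n \<otimes> n - I/3\<close> multiplies lengths by \<open>\<surd>2\<close>.\<close>

lemma C1_on_uniaxial_stereo:
 assumes w: "C1_on Om w w'" and z: "!!x. w x \<bullet> e3 = 0" "!!x e. x : Om ==> w' x e \<bullet> e3 = 0"
 obtains U where "C1_on Om (%x. uniaxial (stereo (w x))) U"
  "!!x e. x : Om ==> nsq (U x e) = 8 * nsq (w' x e) / (1 + w x \<bullet> w x)^2"
proof -
 let ?s = "%x. 1 + w x \<bullet> w x"
 have s: "0 < ?s x" for x using inner_ge_zero[of "w x"] by linarith
 have s0: "?s x ~= 0" for x using s[of x] by simp
 define N where "N x = 2 *R w x + (w x \<bullet> w x - 1) *R e3" for x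
 define N' where "N' x e = 2 *R w' x e + (2 * (w x \<bullet> w' x e)) *R e3" for x e
 define n where "n x = stereo (w x)" for x
 define n' where "n' x e = inverse (?s x) *R N' x e + (- (2 * (w x \<bullet> w' x e)) * inverse (?s x)^2) *R N x" for x e
 have nN: "n x = inverse (?s x) *R N x" for x by (simp add: n_def stereo_def N_def)
 have cw: "continuous_on Om w" by (rule C1_on_continuous[OF w])
 have dw: "x : Om ==> (w has_derivative w' x) (at x)" for x by (rule C1_onD(1)[OF w])
 have di: "((%x. w x \<bullet> w x) has_derivative (%h. 2 * (w x \<bullet> w' x h))) (at x)" if "x : Om" for x
  using has_derivative_inner[OF dw[OF that] dw[OF that]] by (simp add: inner_commute)
 have dn: "(n has_derivative n' x) (at x)" if x: "x : Om" for x
 proof -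
  have "((%x. ?s x) has_derivative (%h. 2 * (w x \<bullet> w' x h))) (at x)"
   using has_derivative_add[OF has_derivative_const[of 1] di[OF x]] by simp
  from Deriv.has_derivative_inverse[OF _ this]
  have "((%x. inverse (?s x)) has_derivative (%h. - (2 * (w x \<bullet> w' x h)) * inverse (?s x)^2)) (at x)"
   using s[of x] by (simp add: power2_eq_square mult_ac)
  moreover have "(N has_derivative N' x) (at x)"
   unfolding N_def[abs_def] N'_def[abs_def]
   by (intro has_derivative_add has_derivative_scaleR_right has_derivative_scaleR_left dw x)
    (use has_derivative_diff[OF di[OF x] has_derivative_const[of 1]] in simp)
  ultimately have "((%x. inverse (?s x) *R N x) has_derivative (%h. inverse (?s x) *R N' x h + (- (2 * (w x \<bullet> w' x h)) * inverse (?s x)^2) *R N x)) (at x)"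
   by (rule has_derivative_scaleR)
  thus ?thesis by (simp add: nN[abs_def] n'_def[abs_def])
 qed
 have norm_n: "norm (n x) = 1" for x unfolding n_def by (rule norm_stereo[OF z(1)])
 have nn': "n x \<bullet> n' x e = 0" if x: "x : Om" for x e
 proof -
  have "((%x. n x \<bullet> n x) has_derivative (%h. n x \<bullet> n' x h + n' x h \<bullet> n x)) (at x)" by (rule has_derivative_inner[OF dn[OF x] dn[OF x]])
  moreover have "(%x. n x \<bullet> n x) = (%x. 1)" using norm_n by (simp add: dot_square_norm)
  ultimately have "((%x. 1) has_derivative (%h. n x \<bullet> n' x h + n' x h \<bullet> n x)) (at x)" by simp
  from fun_cong[OF has_derivative_unique[OF this has_derivative_const], of e]
  show ?thesis by (simp add: inner_commute)
 qed
 have norm_n': "nsq (n' x e) = 4 * nsq (w' x e) / (?s x)^2" if x: "x : Om" for x e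
 proof -
  define a where "a = w x \<bullet> w' x e"
  have w3: "w x \<bullet> e3 = 0" "e3 \<bullet> w x = 0" "w' x e \<bullet> e3 = 0" "e3 \<bullet> w' x e = 0" using z(1) z(2)[OF x] by (auto simp: inner_commute)
  define v where "v = w' x e"
  have NN: "N x \<bullet> N x = (?s x)^2" unfolding N_def using w3 by (simp add: inner_add_left inner_add_right) (simp add: power2_eq_square algebra_simps)
  have MN: "N' x e \<bullet> N x = 2 * a * ?s x" unfolding N_def N'_def a_def[symmetric] using w3 by (simp add: inner_add_left inner_add_right a_def inner_commute) (simp add: algebra_simps)
  have MM: "N' x e \<bullet> N' x e = 4 * (v \<bullet> v) + 4 * a^2" unfolding N'_def a_def[symmetric] using w3
   by (simp add: inner_add_left inner_add_right v_def) (simp add: power2_eq_square)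
  define i where "i = inverse (?s x)"
  have i: "i * ?s x = 1" using s[of x] by (simp add: i_def)
  have gen: "nsq (i *R p + c *R q) = i^2 * (p \<bullet> p) + 2 * i * c * (p \<bullet> q) + c^2 * (q \<bullet> q)" for p q :: "real^3" and c
   unfolding power2_norm_eq_inner inner_add_left inner_add_right inner_commute[of q p]
   by (simp add: inner_commute[of q p]) (simp add: power2_eq_square algebra_simps)
  have "nsq (n' x e) = i^2 * (4 * (v \<bullet> v) + 4 * a^2) + 2 * i * (- (2 * a) * i^2) * (2 * a * ?s x) + (- (2 * a) * i^2)^2 * (?s x)^2"
   unfolding n'_def i_def[symmetric] a_def[symmetric] gen NN MN MM ..
  also have "... = i^2 * (4 * (v \<bullet> v) + 4 * a^2) - 8 * a^2 * i^2 * (i * ?s x) + 4 * a^2 * i^2 * (i * ?s x)^2"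
   by algebra
  also have "... = 4 * nsq v * i^2" unfolding i by (simp add: power2_norm_eq_inner) (simp add: algebra_simps)
  finally show ?thesis by (simp add: i_def v_def power_inverse divide_inverse)
 qed
 define U where "U x e = outer (n x) (n' x e) + outer (n' x e) (n x)" for x e
 have C: "C1_on Om (%x. uniaxial (stereo (w x))) U"
 proof (rule C1_onI)
  fix x assume x: "x : Om"
  have "((%x. outer (n x) (n x) - (1/3) *R mat 1) has_derivative (%e. U x e - 0)) (at x)"
   unfolding U_def by (intro has_derivative_diff has_derivative_const bounded_bilinear.FDERIV[OF bounded_bilinear_outer] dn x)
  thus "((%x. uniaxial (stereo (w x))) has_derivative U x) (at x)" by (simp add: uniaxial_def n_def)
 next
  fix e :: 'a assume e: "e : Basis"
  have c': "continuous_on Om (%x. w' x e)" by (rule C1_onD(2)[OF w e])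
  have "continuous_on Om (%x. n' x e)" "continuous_on Om n"
   unfolding n'_def N'_def N_def nN[abs_def] by (intro continuous_intros cw c' ballI s0)+
  thus "continuous_on Om (%x. U x e)"
   unfolding U_def by (intro continuous_on_add bounded_bilinear.continuous_on[OF bounded_bilinear_outer])
 qed
 have "nsq (U x e) = 8 * nsq (w' x e) / (?s x)^2" if x: "x : Om" for x e
 proof -
  \<comment> \<open>The mixed terms contain \<open>n x \<bullet> n' x e\<close>, which is 0; twice
    the square of \<open>n'\<close> remains.\<close>
  have "nsq (U x e) = 2 * nsq (n' x e)"
   unfolding U_def power2_norm_eq_inner inner_add_left inner_add_right inner_outer
   using nn'[OF x, of e] norm_n[of x] by (simp add: inner_commute dot_square_norm)
  thus ?thesis using norm_n'[OF x] by simp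
 qed
 with C show thesis by (rule that)
qed

section \<open>The extension of the boundary map\<close>

definition hp :: "real^3 => real^3" where "hp x = x - (x $ 3) *R e3"

abbreviation rad :: "real^3 => real" where "rad x \<equiv> norm (hp x)"

lemma bounded_linear_hp: "bounded_linear hp"
 unfolding hp_def[abs_def] by (rule bounded_linear_sub[OF bounded_linear_ident bounded_linear_compose[OF bounded_linear_scaleR_left bounded_linear_vec_nth]])

lemma hp_nth: "hp x $ 1 = x $ 1" "hp x $ 2 = x $ 2" "hp x $ 3 = 0" by (auto simp: hp_def axis_def)

lemma hp_e3: "hp x \<bullet> e3 = 0" by (simp add: inner_axis hp_nth)

lemma rad_eq: "(rad x)^2 = (x$1)^2 + (x$2)^2" "nsq x = (rad x)^2 + (x$3)^2"
 unfolding power2_norm_eq_inner inner_vec_def sum_3 by (simp_all add: hp_nth power2_eq_square)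

lemma rad_le: "rad x <= norm x"
 by (rule power2_le_imp_le) (simp_all add: rad_eq(2)[of x])

lemma hp_scaleR: "hp (c *R x) = c *R hp x"
 by (simp add: hp_def algebra_simps)

lemma rad_eq_0_iff: "rad x = 0 \<longleftrightarrow> x = (x$3) *R e3"
 by (simp add: hp_def)

text \<open>The stereographic coordinate of e_phi, i.e. its horizontal part divided by one minus its
  third entry: for |x| = 1 the horizontal part is x_3 times the horizontal unit vector, and the
  third entry is - rad x. The formula is homogeneous of degree 0.\<close>

definition w0 :: "real^3 => real^3" where
 "w0 x = (x$3 * inverse (norm x + rad x)) *R (inverse (rad x) *R hp x)"

text \<open>Off the axis this is 1 for |x| - 1 <= rad x and 0 for |x| - 1 >= 2 rad x. Where it
  varies, rad x is comparable with the distance to the nearer pole, so the gradient grows no faster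
  than the inverse of that distance.\<close>

definition fade :: "real^3 => real" where
 "fade x = 1 - step ((norm x - 1) * inverse (rad x) - 1)"

text \<open>On the axis the convention \<open>inverse 0 = 0\<close> makes \<^term>\<open>W\<close> vanish.\<close>

definition W :: "real^3 => real^3" where "W x = fade x *R w0 x"

lemma fade_bounds: "0 <= fade x" "fade x <= 1" using step_bounds by (auto simp: fade_def)

lemma fade_eq_1: "norm x - 1 <= rad x ==> 0 < rad x ==> fade x = 1"
 by (simp add: fade_def step_eq field_simps)

lemma W_e3: "W x \<bullet> e3 = 0" "w0 x \<bullet> e3 = 0" by (auto simp: W_def w0_def hp_e3)

lemma norm_w0: "0 < rad x ==> norm (w0 x) = \<bar>x$3\<bar> / (norm x + rad x)"
 using norm_ge_zero[of x] by (simp add: w0_def divide_inverse abs_mult)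

lemma norm_w0_le: "norm (w0 x) <= 1"
proof (cases "0 < rad x")
 case True
 have "\<bar>x$3\<bar> <= norm x" using component_le_norm_cart[of x 3] by simp
 thus ?thesis unfolding norm_w0[OF True] using True by (intro divide_le_eq_1_pos[THEN iffD2]) linarith+
qed (simp add: w0_def)

lemma norm_W_le: "norm (W x) <= 1"
 unfolding W_def using fade_bounds[of x] norm_w0_le[of x] by (simp add: mult_le_one)

lemma w0_scaleR: assumes "0 < c" shows "w0 (c *R x) = w0 x"
proof (cases "rad x = 0")
 case False
 have "inverse (norm (c *R x) + rad (c *R x)) = inverse c * inverse (norm x + rad x)"
  using assms by (simp add: hp_scaleR distrib_left[symmetric])
 thus ?thesis using assms by (simp add: w0_def hp_scaleR)
qed (simp add: w0_def hp_scaleR)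

lemma w0_sgn: "w0 (sgn x) = w0 x"
proof (cases "x = 0")
 case False thus ?thesis using w0_scaleR[of "inverse (norm x)" x] by (simp add: sgn_div_norm divide_inverse)
qed simp

lemma stereo_w0:
 assumes "norm om = 1" "0 < rad om" shows "stereo (w0 om) = e_phi om"
proof -
 define rho z where "rho = rad om" and "z = om $ 3"
 have r: "rho^2 + z^2 = 1" "0 < rho" using rad_eq(2)[of om] assms by (auto simp: rho_def z_def)
 have r12: "rho^2 = (om$1)^2 + (om$2)^2" by (simp add: rho_def rad_eq(1))
 have z1: "\<bar>z\<bar> <= 1" using r by (metis abs_le_square_iff abs_1 le_add_same_cancel2 one_power2 zero_le_power2)
 have ac: "cos (arccos z) = z" "sin (arccos z) = rho"
  using z1 r(1) r(2) by (auto simp: sin_arccos abs_le_iff cos_arccos_abs) (metis abs_of_pos add_diff_cancel_right' real_sqrt_abs)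
 define c where "c = Complex (om$1) (om$2)"
 have nc: "norm c = rho" using r12 r(2) by (simp add: c_def cmod_def real_sqrt_unique)
 have "c = of_real (norm c) * exp (\<i> * of_real (Arg2pi c))" by (rule Arg2pi_eq)
 hence "Re c = rho * cos (Arg2pi c)" "Im c = rho * sin (Arg2pi c)" unfolding nc
  by (auto simp: Re_exp Im_exp dest: arg_cong[where f = Re] arg_cong[where f = Im])
 hence th: "cos (Arg2pi c) = om$1 / rho" "sin (Arg2pi c) = om$2 / rho" using r(2) by (auto simp: c_def field_simps)
 have n2: "w0 om \<bullet> w0 om = (1 - rho) / (1 + rho)"
 proof -
  have "w0 om \<bullet> w0 om = z^2 / (1 + rho)^2"
   using norm_w0[OF assms(2)] assms(1) by (simp add: dot_square_norm power_divide z_def rho_def)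
  also have "z^2 = (1 - rho) * (1 + rho)" using r(1) by (simp add: power2_eq_square algebra_simps)
  finally show ?thesis using r(2) by (simp add: power2_eq_square)
 qed
 have i: "inverse (1 + w0 om \<bullet> w0 om) = (1 + rho) / 2" unfolding n2 using r(2) by (simp add: field_simps)
 have m: "w0 om \<bullet> w0 om - 1 = - 2 * rho / (1 + rho)" unfolding n2 using r(2) by (simp add: field_simps)
 have w: "w0 om = (z / ((1 + rho) * rho)) *R hp om" using assms(1) by (simp add: w0_def z_def rho_def divide_inverse)
 have e: "e_phi om = vector [z * (om$1 / rho), z * (om$2 / rho), - rho]"
  unfolding e_phi_def Let_def c_def[symmetric] z_def[symmetric] ac th by simp
 have p: "1 + rho ~= 0" using r(2) by simp
 show ?thesis unfolding stereo_def i m unfolding w e vec_eq_iff forall_3 using p r(2) by (simp add: hp_nth axis_def)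
qed

lemma Q_phi_eq: assumes "norm om = 1" "0 < rad om" shows "Q_phi om = uniaxial (stereo (w0 om))"
 by (simp add: Q_phi_def stereo_w0[OF assms])

lemma uniaxial_W: assumes "0 < rad x" "norm x - 1 <= rad x" shows "uniaxial (stereo (W x)) = Q_phi (sgn x)"
proof -
 have x: "x ~= 0" using assms(1) by (auto simp: hp_def)
 hence "0 < rad (sgn x)" using assms(1) by (simp add: sgn_div_norm hp_scaleR)
 thus ?thesis using Q_phi_eq[of "sgn x"] x fade_eq_1[OF assms(2,1)] by (simp add: W_def w0_sgn norm_sgn)
qed

section \<open>Regularity of the extension\<close>

lemma C1_nth: "C1 Om (%x::real^3. x $ i)" by (intro C1_linear bounded_linear_vec_nth)

lemma rad_sqrt: "rad x = sqrt (x$1 * x$1 + x$2 * x$2)" "norm x = sqrt (x$1 * x$1 + x$2 * x$2 + x$3 * x$3)"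
proof -
 show "rad x = sqrt (x$1 * x$1 + x$2 * x$2)" by (rule real_sqrt_unique[symmetric]) (use rad_eq(1)[of x] in "simp_all add: power2_eq_square")
 show "norm x = sqrt (x$1 * x$1 + x$2 * x$2 + x$3 * x$3)" by (rule real_sqrt_unique[symmetric]) (use rad_eq[of x] in "simp_all add: power2_eq_square")
qed

lemma C1_rad: "(!!x. x : Om ==> 0 < rad x) ==> C1 Om rad"
proof -
 assume p: "!!x. x : Om ==> 0 < rad x"
 have "0 < x$1 * x$1 + x$2 * x$2" if "x : Om" for x using p[OF that] unfolding rad_sqrt(1) by simp
 thus "C1 Om rad" unfolding rad_sqrt(1) by (intro C1_sqrt C1_add C1_mult C1_nth)
qed

lemma C1_norm: "(!!x. x : Om ==> 0 < norm (x::real^3)) ==> C1 Om (norm :: real^3 => real)"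
proof -
 assume p: "!!x. x : Om ==> 0 < norm (x::real^3)"
 have "0 < x$1 * x$1 + x$2 * x$2 + x$3 * x$3" if "x : Om" for x using p[OF that] unfolding rad_sqrt(2) by simp
 hence "C1 Om (%x. sqrt (x$1 * x$1 + x$2 * x$2 + x$3 * x$3))" by (intro C1_sqrt C1_add C1_mult C1_nth)
 thus "C1 Om (norm :: real^3 => real)" by (simp only: rad_sqrt(2)[symmetric])
qed

text \<open>Off the axis \<open>W\<close> is given by C^1 formulas, and on the open region around
  the axis it vanishes. Together the two sets contain Omega and its boundary without the
  poles.\<close>

definition Om1 :: "(real^3) set" where "Om1 = {x. 0 < rad x} Un {x. 2 * rad x < norm x - 1}"

lemma continuous_rad: "continuous_on A rad"
 by (intro continuous_on_norm linear_continuous_on bounded_linear_hp)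

lemma open_Om1: "open {x. 0 < rad x}" "open {x. 2 * rad x < norm x - 1}" "open Om1"
proof -
 show 1: "open {x. 0 < rad x}" by (intro open_Collect_less continuous_on_const continuous_rad)
 show 2: "open {x. 2 * rad x < norm x - 1}"
  by (intro open_Collect_less continuous_on_mult continuous_on_diff continuous_on_norm_id continuous_on_const continuous_rad)
 show "open Om1" unfolding Om1_def by (rule open_Un[OF 1 2])
qed

lemma Omega_subset_Om1: "Omega <= Om1"
proof
 fix x assume "x : Omega" hence "1 < norm x" by (simp add: Omega_def)
 thus "x : Om1" unfolding Om1_def by (cases "0 < rad x") auto
qed

lemma W_eq_0: assumes "2 * rad x < norm x - 1" shows "W x = 0"
proof (cases "0 < rad x")
 case True
 hence "1 <= (norm x - 1) * inverse (rad x) - 1" using assms by (simp add: field_simps)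
 thus ?thesis by (simp add: W_def fade_def step_eq)
qed (simp add: W_def w0_def)

lemma C1_W: "C1 Om1 W"
 unfolding Om1_def
proof (rule C1_Un[OF _ _ open_Om1(1,2)])
 have pos: "0 < norm x" "norm x + rad x ~= 0" "rad x ~= 0" if "0 < rad x" for x
  using that rad_le[of x] by linarith+
 show "C1 {x. 0 < rad x} W"
  unfolding W_def[abs_def] fade_def w0_def
  by (intro C1_scaleR C1_diff C1_const C1_step C1_mult C1_inverse C1_add C1_rad C1_norm C1_nth C1_linear bounded_linear_hp)
   (use pos in auto)
 show "C1 {x. 2 * rad x < norm x - 1} W"
  by (rule C1_cong[OF C1_const[of _ 0] open_Om1(2)]) (simp add: W_eq_0)
qed

text \<open>Bounds the squared gradient of the extension: one inverse square singularity at each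
  pole, integrable in dimension three.\<close>

definition kap :: "real^3 => real" where
 "kap x = inverse (nsq (x - e3)) + inverse (nsq (x + e3))"

lemma kap_nonneg: "0 <= kap x" by (simp add: kap_def)

text \<open>Allows bounded quantities to be absorbed into \<open>kap\<close> on the ball of radius
  2, where the distance to e3 is at most 3.\<close>

lemma kap_ge: assumes "norm x < 2" "x ~= e3" shows "1/9 <= kap x"
proof -
 have "norm (x - e3) <= 3" using norm_triangle_ineq4[of x e3] assms(1) by simp
 hence "nsq (x - e3) <= 3^2" by (intro power_mono) auto
 hence "inverse (3^2) <= inverse (nsq (x - e3))" using assms(2) by (intro le_imp_inverse_le) auto
 thus ?thesis unfolding kap_def by (simp add: add_increasing2)
qed

lemma gb_norm_linear:
 assumes "bounded_linear f" "!!x. norm (f x) <= norm x" "f x ~= 0"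
 shows "gb x (%x::'a::euclidean_space. norm (f x :: 'b::euclidean_space)) 1"
 unfolding gb_def
proof (intro exI[of _ "%h. f h \<bullet> sgn (f x)"] conjI ballI)
 show "((%x. norm (f x)) has_derivative (%h. f h \<bullet> sgn (f x))) (at x)"
  using has_derivative_compose[OF bounded_linear_imp_has_derivative[OF assms(1)] has_derivative_norm[OF assms(3)]] by simp
 fix e :: 'a assume "e : Basis"
 hence "norm (f e) <= 1" using assms(2)[of e] by simp
 thus "norm (f e \<bullet> sgn (f x)) <= 1"
  using Cauchy_Schwarz_ineq2[of "f e" "sgn (f x)"] by (simp add: norm_sgn split: if_splits)
qed

lemma gb_W:
 assumes x: "1 < norm x" "norm x < 2" "norm x - 1 <= 2 * rad x" "0 < rad x"
 shows "gb x W (17 / rad x)"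
proof -
 define rho where "rho = rad x"
 have r: "0 < rho" "rho < 2" "norm x - 1 <= 2 * rho" using x rad_le[of x] by (auto simp: rho_def)
 have hx: "hp x ~= 0" using x(4) by auto
 have nx: "x ~= 0" using x by auto
 have x3: "\<bar>x$3\<bar> <= norm x" using component_le_norm_cart[of x 3] by simp
 have hpl: "norm (hp e) <= 1" if "e : Basis" for e using rad_le[of e] that by simp
 have b1: "gb x rad 1" by (rule gb_norm_linear[OF bounded_linear_hp rad_le hx])
 have b2: "gb x norm 1" using gb_norm_linear[OF bounded_linear_ident _ nx] by simp
 have b3: "gb x (%x. x $ 3) 1"
  by (rule gb_linear[OF bounded_linear_vec_nth]) (use component_le_norm_cart norm_Basis in "metis real_norm_def")
 have b4: "gb x hp 1" by (rule gb_linear[OF bounded_linear_hp hpl])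
 have inv: "gb x (%x. inverse (f x)) (k / (f x)^2)" if "gb x f k" "0 < f x" for f :: "real^3 => real" and k
  using gb_curve[OF that(1), of inverse "- (inverse (f x) ^ Suc (Suc 0))"] DERIV_inverse[of "f x"] that(2)
  by (simp add: power2_eq_square divide_inverse abs_mult)
 have n1: "1 <= norm x + rho" using x r by linarith
 have b5: "gb x (%x. inverse (norm x + rad x)) 2"
 proof (rule gb_mono[OF inv[OF gb_add[OF b2 b1]]])
  show "0 < norm x + rad x" using n1 by (simp add: rho_def)
  have "1 <= (norm x + rho)^2" using n1 by simp
  thus "(1 + 1) / (norm x + rad x)^2 <= 2" by (simp add: rho_def divide_le_eq)
 qed
 have b6: "gb x (%x. x$3 * inverse (norm x + rad x)) 5"
 proof (rule gb_mono[OF gb_mult[OF b3 b5]])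
  have "\<bar>inverse (norm x + rad x)\<bar> <= 1" using n1 by (simp add: rho_def inverse_le_1_iff)
  thus "\<bar>x$3\<bar> * 2 + 1 * \<bar>inverse (norm x + rad x)\<bar> <= 5" using x3 x(2) by linarith
 qed
 have b7: "gb x (%x. inverse (rad x)) (1 / rho^2)" using inv[OF b1] r by (simp add: rho_def)
 have b8: "gb x (%x. inverse (rad x) *R hp x) (2 / rho)"
 proof (rule gb_mono[OF gb_scaleR[OF b7 b4]])
  show "\<bar>inverse (rad x)\<bar> * 1 + 1 / rho^2 * norm (hp x) <= 2 / rho"
   using r by (simp add: rho_def[symmetric] field_simps power2_eq_square)
 qed
 have b9: "gb x w0 (2 / rho + 5)"
  unfolding w0_def[abs_def]
 proof (rule gb_mono[OF gb_scaleR[OF b6 b8]])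
  have "\<bar>x$3 * inverse (norm x + rad x)\<bar> <= 1"
   using norm_w0_le[of x] norm_w0[OF x(4)] n1 by (simp add: abs_mult divide_inverse rho_def)
  hence "\<bar>x$3 * inverse (norm x + rad x)\<bar> * (2 / rho) <= 1 * (2 / rho)" using r by (intro mult_right_mono) auto
  moreover have "norm (inverse (rad x) *R hp x) = 1" using r by (simp add: rho_def)
  ultimately show "\<bar>x$3 * inverse (norm x + rad x)\<bar> * (2 / rho) + 5 * norm (inverse (rad x) *R hp x) <= 2 / rho + 5" by simp
 qed
 have b10: "gb x (%x. (norm x - 1) * inverse (rad x) - 1) (3 / rho)"
 proof (rule gb_diff_const, rule gb_mono[OF gb_mult[OF gb_diff_const[OF b2, of 1] b7]])
  have "\<bar>norm x - 1\<bar> * (1 / rho^2) <= 2 * rho * (1 / rho^2)" using r x by (intro mult_right_mono) auto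
  also have "... = 2 / rho" using r by (simp add: power2_eq_square)
  finally show "\<bar>norm x - 1\<bar> * (1 / rho^2) + 1 * \<bar>inverse (rad x)\<bar> <= 3 / rho"
   using r by (simp add: rho_def[symmetric] divide_inverse)
 qed
 let ?y = "(norm x - 1) * inverse (rad x) - 1"
 have b11: "gb x (%x. step ((norm x - 1) * inverse (rad x) - 1)) (9 / (2 * rho))"
 proof (rule gb_mono[OF gb_curve[OF b10 step_deriv]])
  have "\<bar>step' ?y\<bar> <= 3/2" using step'_bounds[of ?y] by auto
  hence "3 / rho * \<bar>step' ?y\<bar> <= 3 / rho * (3/2)" using r by (intro mult_left_mono) auto
  thus "3 / rho * \<bar>step' ?y\<bar> <= 9 / (2 * rho)" by simp
 qed
 have b12: "gb x fade (9 / (2 * rho))"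
 proof -
  have "gb x (%x. (-1) * step ((norm x - 1) * inverse (rad x) - 1) - (-1)) (\<bar>-1\<bar> * (9 / (2 * rho)) + 0 * \<bar>step ?y\<bar>)"
   by (rule gb_diff_const[OF gb_mult[OF gb_const b11]])
  thus ?thesis by (simp add: fade_def[abs_def])
 qed
 show ?thesis unfolding W_def[abs_def]
 proof (rule gb_mono[OF gb_scaleR[OF b12 b9]])
  have f1: "\<bar>fade x\<bar> * (2 / rho + 5) <= 1 * (2 / rho + 5)" using fade_bounds[of x] r by (intro mult_right_mono) auto
  have f2: "9 / (2 * rho) * norm (w0 x) <= 9 / (2 * rho)" using norm_w0_le[of x] r by (intro mult_left_le) auto
  \<comment> \<open>As rho < 2, the constant 5 is at most 10 / rho, and 2 + 10 + 9/2 <= 17.\<close>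
  have f3: "2 / rho + 5 + 9 / (2 * rho) <= 17 / rad x" using r by (simp add: rho_def[symmetric] field_simps)
  show "\<bar>fade x\<bar> * (2 / rho + 5) + 9 / (2 * rho) * norm (w0 x) <= 17 / rad x"
   by (rule order_trans[OF add_mono[OF f1[unfolded mult_1] f2] f3])
 qed
qed

text \<open>In this region the pole on the side of x differs from x by at most 3 rad x vertically
  and rad x horizontally, so its distance is at most 4 rad x; hence 16.\<close>

lemma rad_kap:
 assumes "1 < norm x" "norm x - 1 <= 2 * rad x" "0 < rad x" shows "1 / (rad x)^2 <= 16 * kap x"
proof -
 define rho where "rho = rad x"
 have key: "1 / rho^2 <= 16 * inverse (nsq (x - sig *R e3))" if s: "sig = 1 | sig = -1" "0 <= sig * x$3" for sig
 proof -
  have e: "x - sig *R e3 = hp x + (x$3 - sig) *R e3" by (simp add: hp_def algebra_simps)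
  have x3: "\<bar>x$3\<bar> <= norm x" using component_le_norm_cart[of x 3] by simp
  have "norm x <= rad x + \<bar>x$3\<bar>" using norm_triangle_ineq[of "hp x" "(x$3) *R e3"] by (simp add: hp_def)
  hence "\<bar>x$3 - sig\<bar> <= 3 * rho" using s x3 assms by (auto simp: rho_def abs_if split: if_splits)
  hence "norm (x - sig *R e3) <= 4 * rho" unfolding e
   using norm_triangle_ineq[of "hp x" "(x$3 - sig) *R e3"] by (simp add: rho_def)
  hence "nsq (x - sig *R e3) <= (4 * rho)^2" by (intro power_mono) auto
  moreover have "x - sig *R e3 ~= 0" using assms(3) by (auto simp: hp_def axis_def)
  ultimately have "inverse ((4 * rho)^2) <= inverse (nsq (x - sig *R e3))" by (intro le_imp_inverse_le) auto
  moreover have "16 * inverse ((4 * rho)^2) = 1 / rho^2" by (simp add: power_mult_distrib field_simps)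
  ultimately show ?thesis by linarith
 qed
 have p: "0 <= inverse (nsq (x - e3))" "0 <= inverse (nsq (x + e3))" by simp_all
 show ?thesis
 proof (cases "0 <= x$3")
  case True
  have "1 / rho^2 <= 16 * inverse (nsq (x - e3))" using key[of 1] True by simp
  thus ?thesis unfolding kap_def rho_def distrib_left using p by (elim order_trans) simp
 next
  case False
  have "1 / rho^2 <= 16 * inverse (nsq (x + e3))" using key[of "-1"] False by simp
  thus ?thesis unfolding kap_def rho_def distrib_left using p by (elim order_trans) simp
 qed
qed

text \<open>The constant is 16 * 17^2, from \<open>rad_kap\<close> and \<open>gb_W\<close>.
  Orthogonality to e3 is what the conformal identity for \<open>stereo\<close> asks of the
  derivative.\<close>

lemma W_C1_on:
 obtains W' where "C1_on Om1 W W'" "!!x e. x : Om1 ==> W' x e \<bullet> e3 = 0"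
  "!!x e. 1 < norm x ==> norm x < 2 ==> e : Basis ==> nsq (W' x e) <= 4624 * kap x"
proof -
 obtain W' where W': "C1_on Om1 W W'" using C1_W by (auto simp: C1_def)
 show thesis
 proof (rule that[OF W'])
  fix x :: "real^3" and e assume x: "x : Om1"
  have "((%x. W x \<bullet> e3) has_derivative (%h. W' x h \<bullet> e3)) (at x)"
   by (rule has_derivative_inner_left[OF C1_onD(1)[OF W' x]])
  hence "((%x. 0) has_derivative (%h. W' x h \<bullet> e3)) (at x)" by (simp add: W_e3)
  from fun_cong[OF has_derivative_unique[OF this has_derivative_const], of e]
  show "W' x e \<bullet> e3 = 0" by simp
 next
  fix x :: "real^3" and e :: "real^3" assume x: "1 < norm x" "norm x < 2" and e: "e : Basis"
  have xO: "x : Om1" using Omega_subset_Om1 x by (auto simp: Omega_def)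
  show "nsq (W' x e) <= 4624 * kap x"
  proof (cases "2 * rad x < norm x - 1")
   case True
   have "(W has_derivative (%h. 0)) (at x)"
    by (rule has_derivative_transform_within_open[OF has_derivative_const open_Om1(2)]) (use True W_eq_0 in auto)
   hence "W' x = (%h. 0)" using has_derivative_unique C1_onD(1)[OF W' xO] by blast
   thus ?thesis using kap_nonneg[of x] by simp
  next
   case False
   hence p: "0 < rad x" "norm x - 1 <= 2 * rad x" using x by auto
   have "norm (W' x e) <= 17 / rad x" by (rule gb_unique[OF gb_W[OF x p(2,1)] C1_onD(1)[OF W' xO] e])
   hence "nsq (W' x e) <= (17 / rad x)^2" by (intro power_mono) auto
   also have "... = 289 * (1 / (rad x)^2)" by (simp add: power_divide)
   finally show ?thesis using rad_kap[OF x(1) p(2,1)] by simp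
  qed
 qed
qed

section \<open>Integrability of the weight\<close>

lemma borel_measurable_kap [measurable]: "kap : borel_measurable borel"
 unfolding kap_def[abs_def] by measurable

text \<open>In polar coordinates around a pole the factor r^-2 cancels against r^2. A ball of radius
  2 moved by a unit vector stays in the ball of radius 3.\<close>

lemma nn_integral_kap_finite: "(LI x:ball 0 2. ennreal (kap x)) < \<infinity>"
proof -
 have m: "(%x. ennreal (inverse (nsq (x + a))) * indicator (ball 0 R) x) : borel_measurable borel" for a :: "real^3" and R
  by (intro borel_measurable_times_ennreal borel_measurable_indicator borel_open open_ball) measurable
 let ?I = "LI x:ball (0::real^3) 3. ennreal (inverse (nsq x))"
 have I: "?I < \<infinity>"
 proof -
  have "?I = (LI x:{x\<in>ball (0::real^3) 3. sgn x : sphere 0 1}. ennreal (inverse (nsq x)))"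
  proof (intro nn_integral_cong)
   fix x :: "real^3"
   show "ennreal (inverse (nsq x)) * indicator (ball 0 3) x = ennreal (inverse (nsq x)) * indicator {x\<in>ball (0::real^3) 3. sgn x : sphere 0 1} x"
    by (cases "x = 0") (auto simp: indicator_def norm_sgn)
  qed
  also have "... = emeasure sph (sphere 0 1) * (LI r:{0<..<3}. ennreal (inverse (r^2)) * ennreal (r^2))"
   by (rule nn_integral_cone_radial) auto
  also have "(LI r:{0<..<3}. ennreal (inverse (r^2)) * ennreal (r^2)) <= (LI r. indicator {0<..<3::real} r)"
   by (intro nn_integral_mono) (auto simp: indicator_def ennreal_mult[symmetric] field_simps)
  also have "... = 3" by simp
  finally have "?I <= emeasure sph (sphere 0 1) * 3" by (simp add: mult_left_mono)
  also have "... < \<infinity>" using emeasure_sph_finite[of "sphere 0 1"] by (simp add: ennreal_mult_less_top)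
  finally show ?thesis .
 qed
 have tr: "(LI x:ball 0 2. ennreal (inverse (nsq (x + a)))) <= ?I" if "norm a = 1" for a :: "real^3"
 proof -
  have "?I = (LI x. ennreal (inverse (nsq (a + x))) * indicator (ball 0 3) (a + x))"
   using m[of 0 3] by (subst lborel_distr_plus[of a, symmetric], subst nn_integral_distr) (simp_all del: mem_ball mem_ball_0)
  moreover have "(LI x:ball 0 2. ennreal (inverse (nsq (x + a)))) <= ..."
  proof (intro nn_integral_mono)
   fix x :: "real^3"
   have "norm (a + x) < 3" if "norm x < 2" using norm_triangle_ineq[of a x] that \<open>norm a = 1\<close> by simp
   thus "ennreal (inverse (nsq (x + a))) * indicator (ball 0 2) x <= ennreal (inverse (nsq (a + x))) * indicator (ball 0 3) (a + x)"
    by (auto simp: indicator_def add.commute)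
  qed
  ultimately show ?thesis by simp
 qed
 have "(LI x:ball 0 2. ennreal (kap x))
   = (LI x. ennreal (inverse (nsq (x + (- e3)))) * indicator (ball 0 2) x + ennreal (inverse (nsq (x + e3))) * indicator (ball 0 2) x)"
  by (intro nn_integral_cong) (simp add: kap_def distrib_right)
 also have "... = (LI x:ball 0 2. ennreal (inverse (nsq (x + (- e3))))) + (LI x:ball 0 2. ennreal (inverse (nsq (x + e3))))"
  by (rule nn_integral_add; subst measurable_cong_sets[OF sets_lborel refl]; rule m)
 also have "... <= ?I + ?I" by (intro add_mono tr) auto
 also have "... < \<infinity>" using I by simp
 finally show ?thesis .
qed

section \<open>Admissible maps from continuously differentiable ones\<close>

lemma mem_Omega: "x : Omega \<longleftrightarrow> 1 < norm x" by (auto simp: Omega_def)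

lemma open_Omega: "open Omega" unfolding Omega_def by (intro open_Compl closed_cball)

lemma borel_Omega [measurable]: "Omega : sets borel" by (rule borel_open[OF open_Omega])

lemma grad_norm2_AE:
 assumes "C1_on Omega u u'"
 shows "AE x in lebesgue. x : Omega --> grad_norm2 Omega u x = (SUM e:Basis. nsq (u' x e))"
proof -
 have "AE x in lebesgue_on Omega. ALL e:Basis. weak_deriv Omega e u x = u' x e"
  by (rule AE_finite_allI[OF finite_Basis]) (rule weak_deriv_AE[OF open_Omega C1_on_has_weak_deriv[OF open_Omega assms]])
 moreover have "Omega Int space lebesgue : sets lebesgue" by (rule sets_lebesgue_Int_space_open[OF open_Omega])
 ultimately have "AE x in lebesgue. x : Omega --> (ALL e:Basis. weak_deriv Omega e u x = u' x e)"
  by (simp only: AE_restrict_space_iff)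
 thus ?thesis by (rule AE_mp) (auto simp: grad_norm2_def)
qed

text \<open>The gradient bound by \<^const>\<open>kap\<close> reflects the discontinuity of the boundary map at the poles.\<close>

definition kap_C1 :: "real => real => (real^3 => real^3^3) => (real^3 => real^3 => real^3^3) => bool" where
 "kap_C1 M c u u' \<longleftrightarrow> 0 <= M & 0 <= c & C1_on Omega u u' & (ALL x:Omega. norm (u x) <= M & (3/2 <= norm x --> u x = 0)
   & (ALL e:Basis. norm x < 2 --> nsq (u' x e) <= c * kap x))"

lemma kap_C1D:
 assumes "kap_C1 M c u u'"
 shows "0 <= M" "0 <= c" "C1_on Omega u u'" "!!x. x : Omega ==> norm (u x) <= M" "!!x. x : Omega ==> 3/2 <= norm x ==> u x = 0"
  "!!x e. x : Omega ==> e : Basis ==> norm x < 2 ==> nsq (u' x e) <= c * kap x"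
 using assms by (auto simp: kap_C1_def)

lemma kap_C1_outside:
 assumes "kap_C1 M c u u'" "3/2 < norm x" shows "u' x e = 0"
proof -
 have x: "x : Omega" using assms(2) by (simp add: mem_Omega)
 have "open {x::real^3. 3/2 < norm x}" by (intro open_Collect_less continuous_intros)
 hence "(u has_derivative (%h. 0)) (at x)"
  by (rule has_derivative_transform_within_open[OF has_derivative_const])
   (use assms kap_C1D(5)[OF assms(1)] in "auto simp: mem_Omega")
 from fun_cong[OF has_derivative_unique[OF C1_onD(1)[OF kap_C1D(3)[OF assms(1)] x] this], of e]
 show ?thesis .
qed

text \<open>The weight dominates up to |x| = 2 and v vanishes from beyond 3/2 on. This serves for
  maps as well as for their partial derivatives.\<close>

lemma L2_Omega:
 fixes v :: "real^3 => real^3^3"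
 assumes v: "continuous_on Omega v" and C: "0 <= C"
  and b: "!!x. x : Omega ==> norm x < 2 ==> nsq (v x) <= C * kap x" and z: "!!x. x : Omega ==> 3/2 < norm x ==> v x = 0"
 shows "v : L2 Omega"
proof -
 have m: "v : borel_measurable (lebesgue_on Omega)"
  by (rule continuous_imp_measurable_on_sets_lebesgue[OF v]) (simp add: open_Omega)
 have "(\<integral>\<^sup>+x. ennreal (norm (nsq (v x))) \<partial>lebesgue_on Omega) = (LL x:Omega. ennreal (norm (nsq (v x))))"
  by (rule nn_integral_lebesgue_on[OF open_Omega])
 also have "... <= (LL x. ennreal C * (ennreal (kap x) * indicator (ball 0 2) x))"
 proof (rule nn_integral_mono)
  fix x :: "real^3"
  show "ennreal (norm (nsq (v x))) * indicator Omega x <= ennreal C * (ennreal (kap x) * indicator (ball 0 2) x)"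
  proof (cases "x : Omega & norm x < 2")
   case True
   hence "ennreal (nsq (v x)) <= ennreal (C * kap x)" using b by (intro ennreal_leI) auto
   thus ?thesis using True C kap_nonneg[of x] by (simp add: ennreal_mult)
  next
   case False
   hence "x : Omega ==> v x = 0" using z by auto
   thus ?thesis by (cases "x : Omega") auto
  qed
 qed
 also have "... = (LI x. ennreal C * (ennreal (kap x) * indicator (ball 0 2) x))" by (rule nn_integral_completion)
 also have "... = ennreal C * (LI x:ball 0 2. ennreal (kap x))"
  by (rule nn_integral_cmult) (intro borel_measurable_times_ennreal borel_measurable_indicator, measurable)
 also have "... < \<infinity>" using nn_integral_kap_finite by (simp add: ennreal_mult_less_top)
 finally have "integrable (lebesgue_on Omega) (%x. nsq (v x))"
  using m by (intro integrableI_bounded) auto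
 with m show ?thesis by (simp add: L2_def)
qed

lemma le_mult_kap: assumes "x : Omega" "norm x < 2" shows "(M::real)^2 <= M^2 * (9 * kap x)"
proof -
 have "x ~= e3" using assms(1) by (auto simp: mem_Omega)
 hence "1 <= 9 * kap x" using kap_ge[OF assms(2)] by simp
 hence "M^2 * 1 <= M^2 * (9 * kap x)" by (rule mult_left_mono) simp
 thus ?thesis by simp
qed

lemma kap_C1_H1:
 assumes k: "kap_C1 M c u u'" and S: "!!x. x : Omega ==> u x : S"
 shows "u : H1 Omega S"
proof -
 note K = kap_C1D[OF k]
 have "u : L2 Omega"
 proof (rule L2_Omega[OF C1_on_continuous[OF K(3)], of "9 * M^2"])
  fix x :: "real^3" assume x: "x : Omega" "norm x < 2"
  have "nsq (u x) <= M^2" using K(4)[OF x(1)] by (intro power_mono) auto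
  also have "... <= M^2 * (9 * kap x)" by (rule le_mult_kap[OF x])
  finally show "nsq (u x) <= 9 * M^2 * kap x" by simp
 qed (use K(5) in auto)
 moreover have "(%x. u' x e) : L2 Omega & has_weak_deriv Omega e u (%x. u' x e)" if e: "e : Basis" for e
  using L2_Omega[OF C1_onD(2)[OF K(3) e] K(2) K(6)[OF _ e] kap_C1_outside[OF k]] C1_on_has_weak_deriv[OF open_Omega K(3) e] by simp
 moreover have "AE x in lebesgue_on Omega. u x : S"
  by (rule AE_I2) (use S in "simp add: space_restrict_space")
 ultimately show ?thesis unfolding H1_def by blast
qed

lemma H1_norm2_C1:
 assumes "C1_on Omega u u'"
 shows "H1_norm2 Omega u = (LL x:Omega. ennreal (nsq (u x) + (SUM e:Basis. nsq (u' x e))))"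
 unfolding H1_norm2_def
 by (rule nn_integral_cong_AE, rule AE_mp[OF grad_norm2_AE[OF assms]]) (auto simp: indicator_def)

lemma norm_add_square_le: "nsq (a + b :: 'a::real_inner) <= 2 * nsq a + 2 * nsq b"
proof -
 have "nsq (a + b) + nsq (a - b) = 2 * nsq a + 2 * nsq b"
  unfolding power2_norm_eq_inner by (simp add: inner_add_left inner_add_right inner_diff_left inner_diff_right)
 thus ?thesis using zero_le_power2[of "norm (a - b)"] by linarith
qed

lemma closure_Omega: "closure Omega = - ball 0 1" "frontier Omega = sphere 0 1"
 by (simp_all add: Omega_def closure_complement frontier_complement frontier_cball)

lemma kap_dilate: assumes "1 < norm x" "1 <= t" shows "kap (t *R x) <= kap x"
proof -
 have *: "inverse (nsq (t *R x - a)) <= inverse (nsq (x - a))" if a: "norm a = 1" for a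
 proof (rule le_imp_inverse_le)
  have "x \<bullet> a <= norm x" using norm_cauchy_schwarz[of x a] a by simp
  also have "norm x <= x \<bullet> x" using mult_left_mono[of 1 "norm x" "norm x"] assms(1) by (simp add: dot_square_norm power2_eq_square)
  finally have "0 <= (t - 1) * ((t + 1) * (x \<bullet> x) - 2 * (x \<bullet> a))"
   using assms(2) mult_right_mono[of 2 "t + 1" "x \<bullet> x"] by (intro mult_nonneg_nonneg) auto
  also have "... = nsq (t *R x - a) - nsq (x - a)"
   unfolding power2_norm_eq_inner by (simp add: inner_diff_left inner_diff_right inner_commute algebra_simps power2_eq_square)
  finally show "nsq (x - a) <= nsq (t *R x - a)" by simp
  show "0 < nsq (x - a)" using a assms(1) by auto
 qed
 show ?thesis using *[of e3] *[of "- e3"] by (simp add: kap_def)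
qed

text \<open>The dilations of \<^term>\<open>u\<close> are continuous up to the boundary, and by \<open>kap_dilate\<close> they are dominated.\<close>

lemma kap_C1_has_trace:
 assumes k: "kap_C1 M c u u'" and cont: "continuous_on (closure Omega - {e3, - e3}) u"
  and h: "!!om. norm om = 1 ==> om ~= e3 ==> om ~= - e3 ==> u om = h om" "!!om. norm om = 1 ==> norm (h om) <= M"
 shows "has_trace Omega u h"
proof -
 note K = kap_C1D[OF k]
 have uH: "u : H1 Omega UNIV" by (rule kap_C1_H1[OF k]) simp
 \<comment> \<open>Dilations by at most 2 multiply squared derivatives by at most 4, so all
   approximants share the bound 4 * c.\<close>
 define t where "t n = 1 + 1 / real (Suc n)" for n
 have t: "1 < t n" "t n <= 2" for n by (auto simp: t_def)
 have t1: "t ----> 1" using tendsto_add[OF tendsto_const LIMSEQ_Suc[OF lim_1_over_n], of 1] by (simp add: t_def[abs_def])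
 have tx: "(%n. t n *R x) ----> x" for x :: "real^3" using tendsto_scaleR[OF t1 tendsto_const[of x]] by simp
 have nt: "norm x <= norm (t n *R x)" for x :: "real^3" and n using mult_right_mono[of 1 "t n" "norm x"] t(1)[of n] by simp
 have tO: "t n *R x : Omega" if "1 <= norm x" for x n
  using mult_strict_right_mono[OF t(1)[of n], of "norm x"] that t(1)[of n] unfolding mem_Omega by (simp only: norm_scaleR) linarith
 define w where "w n x = u (t n *R x)" for n x
 define w' where "w' n x e = t n *R u' (t n *R x) e" for n x e
 have w: "C1_on Omega (w n) (w' n)" for n
 proof (rule C1_onI)
  fix x assume x: "x : Omega"
  have d: "(u has_derivative u' (t n *R x)) (at (t n *R x))" by (rule C1_onD(1)[OF K(3) tO]) (use x in "simp add: mem_Omega")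
  have "w' n x = (%e. u' (t n *R x) (t n *R e))"
   using linear_scale[OF has_derivative_linear[OF d]] by (simp add: w'_def fun_eq_iff)
  thus "(w n has_derivative w' n x) (at x)" unfolding w_def
   using has_derivative_compose[OF has_derivative_scaleR_right[OF has_derivative_ident] d] by simp
 next
  fix e :: "real^3" assume "e : Basis"
  thus "continuous_on Omega (%x. w' n x e)" unfolding w'_def
   by (intro continuous_intros continuous_on_compose2[OF C1_onD(2)[OF K(3)]]) (auto intro!: tO simp: mem_Omega)
 qed
 have kw: "kap_C1 M (4 * c) (w n) (w' n)" for n
  unfolding kap_C1_def
 proof (intro conjI ballI impI w)
  fix x e :: "real^3" assume x: "x : Omega"
  have x1: "1 < norm x" and O: "t n *R x : Omega" using x tO[of x n] by (auto simp: mem_Omega)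
  show "norm (w n x) <= M" unfolding w_def by (rule K(4)[OF O])
  show "w n x = 0" if "3/2 <= norm x" unfolding w_def by (rule K(5)[OF O order_trans[OF that nt]])
  assume e: "e : Basis"
  have "nsq (u' (t n *R x) e) <= c * kap x"
  proof (cases "norm (t n *R x) < 2")
   case True
   thus ?thesis using K(6)[OF O e] mult_left_mono[OF kap_dilate[OF x1 less_imp_le[OF t(1)[of n]]] K(2)] by (meson order_trans)
  qed (use kap_C1_outside[OF k, of "t n *R x" e] kap_nonneg[of x] K(2) in simp)
  hence "(t n)^2 * nsq (u' (t n *R x) e) <= 2^2 * (c * kap x)" using t[of n] by (intro mult_mono power_mono) auto
  thus "nsq (w' n x e) <= 4 * c * kap x" by (simp add: w'_def power_mult_distrib)
 qed (use K in auto)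
 define d where "d n x = nsq (w n x - u x) + (SUM e:Basis. nsq (w' n x e - u' x e))" for n x
 have lim1: "(%n. H1_norm2 Omega (%x. w n x - u x)) ----> 0"
 proof -
  have cont': "continuous_on Omega (d n)" for n
   unfolding d_def[abs_def] by (intro continuous_intros C1_on_continuous[OF w] C1_on_continuous[OF K(3)] C1_onD(2)[OF w] C1_onD(2)[OF K(3)])
  have m: "(%x. ennreal (d n x) * indicator Omega x) : borel_measurable lborel" for n
  proof -
   have "(%x. ennreal (indicator Omega x *R d n x)) : borel_measurable borel"
    using borel_measurable_continuous_on_indicator[OF borel_Omega cont'[of n]] by measurable
   moreover have "(%x. ennreal (indicator Omega x *R d n x)) = (%x. ennreal (d n x) * indicator Omega x)" by (auto simp: indicator_def)
   ultimately show ?thesis by simp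
  qed
  have "H1_norm2 Omega (%x. w n x - u x) = (LI x. ennreal (d n x) * indicator Omega x)" for n
   unfolding H1_norm2_C1[OF C1_on_diff[OF w K(3)]] d_def[symmetric] by (rule nn_integral_completion)
  moreover have "(%n. LI x. ennreal (d n x) * indicator Omega x) ----> (\<integral>\<^sup>+x. 0 \<partial>(lborel :: (real^3) measure))"
  \<comment> \<open>Here 36 M^2 is 9 (2 M)^2, by 1 <= 9 kap, and 30 c is 2 * 4 c + 2 c summed over
    three directions.\<close>
  proof (rule nn_integral_dominated_convergence[where w = "%x. ennreal (36 * M^2 + 30 * c) * (ennreal (kap x) * indicator (ball 0 2) x)"])
   have mk: "(%x. ennreal (kap x) * indicator (ball 0 2) x) : borel_measurable lborel"
    using borel_open[OF open_ball, of "0::real^3" 2] by measurable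
   thus "(%x. ennreal (36 * M^2 + 30 * c) * (ennreal (kap x) * indicator (ball 0 2) x)) : borel_measurable lborel" by measurable
   show "(LI x. ennreal (36 * M^2 + 30 * c) * (ennreal (kap x) * indicator (ball 0 2) x)) < \<infinity>"
    using nn_integral_kap_finite by (simp add: nn_integral_cmult[OF mk] ennreal_mult_less_top)
   show "AE x in lborel. ennreal (d n x) * indicator Omega x <= ennreal (36 * M^2 + 30 * c) * (ennreal (kap x) * indicator (ball 0 2) x)" for n
   proof (rule AE_I2)
    fix x :: "real^3"
    show "ennreal (d n x) * indicator Omega x <= ennreal (36 * M^2 + 30 * c) * (ennreal (kap x) * indicator (ball 0 2) x)"
    proof (cases "x : Omega & norm x < 2")
     case True
     hence x: "x : Omega" "norm x < 2" by auto
     have "norm (w n x - u x) <= 2 * M" using norm_triangle_ineq4[of "w n x" "u x"] kap_C1D(4)[OF kw x(1), of n] K(4)[OF x(1)] by linarith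
     hence "nsq (w n x - u x) <= (2 * M)^2" by (intro power_mono) auto
     hence "nsq (w n x - u x) <= (2 * M)^2 * (9 * kap x)" using le_mult_kap[OF x] by (rule order_trans)
     hence 1: "nsq (w n x - u x) <= 36 * M^2 * kap x" by (simp add: power_mult_distrib mult_ac)
     have "nsq (w' n x e - u' x e) <= 10 * c * kap x" if "e : Basis" for e
      using norm_add_square_le[of "w' n x e" "- u' x e"] kap_C1D(6)[OF kw x(1) that x(2), of n] K(6)[OF x(1) that x(2)] by simp
     hence "(SUM e:Basis. nsq (w' n x e - u' x e)) <= (SUM e:(Basis::(real^3) set). 10 * c * kap x)" by (rule sum_mono)
     hence "d n x <= (36 * M^2 + 30 * c) * kap x" using 1 by (simp add: d_def algebra_simps)
     hence "ennreal (d n x) <= ennreal ((36 * M^2 + 30 * c) * kap x)" by (rule ennreal_leI)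
     thus ?thesis using True kap_nonneg[of x] K(2) by (simp add: ennreal_mult)
    next
     case False
     have "d n x = 0" if "x : Omega"
      using kap_C1_outside[OF k, of x] kap_C1_outside[OF kw, of x n] K(5)[OF that] kap_C1D(5)[OF kw that, of n] False that by (simp add: d_def)
     thus ?thesis by (cases "x : Omega") auto
    qed
   qed
   show "AE x in lborel. (%n. ennreal (d n x) * indicator Omega x) ----> 0"
   proof (rule AE_I2)
    fix x :: "real^3"
    show "(%n. ennreal (d n x) * indicator Omega x) ----> 0"
    proof (cases "x : Omega")
     case True
     have lim: "(%n. f (t n *R x)) ----> f x" if "continuous_on Omega f" for f :: "real^3 => real^3^3"
      by (rule continuous_on_tendsto_compose[OF that tx True]) (use tO[of x] True in "simp add: mem_Omega")
     have "(%n. d n x) ----> nsq (u x - u x) + (SUM e:Basis. nsq (1 *R u' x e - u' x e))"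
      unfolding d_def w_def w'_def by (intro tendsto_intros t1 lim C1_on_continuous[OF K(3)] C1_onD(2)[OF K(3)])
     from tendsto_ennrealI[OF this] show ?thesis using True by simp
    qed simp
   qed
  qed (rule m, simp)
  ultimately show ?thesis by simp
 qed
 have lim2: "(%n. \<integral>\<^sup>+om\<in>frontier Omega. ennreal (nsq (w n om - h om)) \<partial>hausdorff_measure 2) ----> 0"
 proof -
  let ?S = "sphere (0::real^3) 1" and ?H = "hausdorff_measure 2 :: (real^3) measure"
  let ?f = "%n om. ennreal (nsq (w n om - u om)) * indicator (?S - {e3, - e3}) om"
  have null: "AE om in ?H. om ~= p" for p
   by (rule AE_I[of _ _ "{p}"]) (use borel_in_hausdorff[of "{p}"] in "auto simp: emeasure_hausdorff_measure hausdorff_outer_singleton")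
  have cw: "continuous_on (?S - {e3, - e3}) (%om. nsq (w n om - u om))" for n
   unfolding w_def
   by (intro continuous_intros continuous_on_compose2[OF C1_on_continuous[OF K(3)]] continuous_on_subset[OF cont]) (auto simp: closure_Omega intro!: tO)
  have fm: "?f n : borel_measurable ?H" for n
  proof -
   have "(%om. ennreal (indicator (?S - {e3, - e3}) om *R nsq (w n om - u om))) = ?f n" by (auto simp: indicator_def)
   moreover have "(%om. ennreal (indicator (?S - {e3, - e3}) om *R nsq (w n om - u om))) : borel_measurable borel"
    using borel_measurable_continuous_on_indicator[OF _ cw[of n]] by measurable
   ultimately have "?f n : borel_measurable borel" by (simp only:)
   thus ?thesis by (rule borel_measurable_subalgebra[rotated 2]) (auto intro: borel_in_hausdorff)
  qed
  have eq: "(\<integral>\<^sup>+om\<in>frontier Omega. ennreal (nsq (w n om - h om)) \<partial>?H) = (\<integral>\<^sup>+om. ?f n om \<partial>?H)" for n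
   by (rule nn_integral_cong_AE, rule AE_mp[OF AE_conjI[OF null[of e3] null[of "- e3"]]], rule AE_I2)
    (use h(1) in "auto simp: closure_Omega indicator_def")
  have Sm: "?S : sets ?H" by (rule borel_in_hausdorff) simp
  have "(%n. \<integral>\<^sup>+om. ?f n om \<partial>?H) ----> (\<integral>\<^sup>+om. 0 \<partial>?H)"
  proof (rule nn_integral_dominated_convergence[where w = "%om. ennreal ((2 * M)^2) * indicator ?S om"])
   show "(%om. ennreal ((2 * M)^2) * indicator ?S om) : borel_measurable ?H" using Sm by measurable
   show "(\<integral>\<^sup>+om. ennreal ((2 * M)^2) * indicator ?S om \<partial>?H) < \<infinity>"
    using hausdorff_outer_sphere by (simp add: nn_integral_cmult_indicator[OF Sm] emeasure_hausdorff_measure[OF Sm] ennreal_mult_less_top)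
   show "AE om in ?H. ?f n om <= ennreal ((2 * M)^2) * indicator ?S om" for n
   proof (rule AE_I2)
    fix om :: "real^3"
    have "nsq (w n om - u om) <= (2 * M)^2" if "norm om = 1" "om ~= e3" "om ~= - e3"
    proof (rule power_mono)
     show "norm (w n om - u om) <= 2 * M"
      using norm_triangle_ineq4[of "w n om" "u om"] K(4)[OF tO, of om n] h[OF that(1)] that by (simp add: w_def)
    qed simp
    thus "?f n om <= ennreal ((2 * M)^2) * indicator ?S om" by (auto simp: indicator_def intro!: ennreal_leI)
   qed
   show "AE om in ?H. (%n. ?f n om) ----> 0"
   proof (rule AE_I2)
    fix om :: "real^3"
    show "(%n. ?f n om) ----> 0"
    proof (cases "om : ?S - {e3, - e3}")
     case True
     have "(%n. w n om) ----> u om" unfolding w_def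
     proof (rule continuous_on_tendsto_compose[OF cont tx])
      have "Omega <= closure Omega - {e3, - e3}" by (auto simp: closure_Omega mem_Omega)
      thus "\<forall>\<^sub>F n in sequentially. t n *R om : closure Omega - {e3, - e3}"
       using tO[of om] True by (intro always_eventually) auto
     qed (use True in "auto simp: closure_Omega")
     hence "(%n. nsq (w n om - u om)) ----> nsq (u om - u om)" by (intro tendsto_intros)
     from tendsto_ennrealI[OF this] show ?thesis using True by simp
    qed simp
   qed
  qed (rule fm, simp)
  thus ?thesis unfolding eq by simp
 qed
 show ?thesis unfolding has_trace_def
 proof (intro conjI exI[of _ w] allI uH kap_C1_H1[OF kw] lim1)
  show "continuous_on (closure Omega) (w n)" for n unfolding w_def
   by (intro continuous_on_compose2[OF C1_on_continuous[OF K(3)]] continuous_intros) (auto simp: closure_Omega intro!: tO)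
  show "(%n. \<integral>\<^sup>+om\<in>frontier Omega. ennreal (nsq (w n om - h om)) \<partial>hausdorff_measure (DIM(real^3) - 1)) ----> 0"
   using lim2 by simp
 qed simp
qed

lemma kap_C1_admissible:
 assumes k: "kap_C1 M c u u'" and cont: "continuous_on (closure Omega - {e3, - e3}) u"
  and h: "!!om. norm om = 1 ==> om ~= e3 ==> om ~= - e3 ==> u om = Q_phi om - Q_inf" "!!om. norm om = 1 ==> norm (Q_phi om - Q_inf) <= M"
  and S: "!!x. x : Omega ==> u x : S0"
 shows "admissible (%x. Q_inf + u x)"
 using kap_C1_H1[OF k S] kap_C1_has_trace[OF k cont h] by (simp add: admissible_def)

section \<open>The energy on cones\<close>

definition dens :: "real => real => (real^3 => real^3^3) => (real^3 => real^3 => real^3^3) => real^3 => real" where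
 "dens xi eta Q Q' x = 1/2 * (SUM e:Basis. nsq (Q' x e)) + 1/xi^2 * f_pot (Q x) + 1/eta^2 * g_pot (Q x)"

lemma energy_C1:
 assumes "C1_on Omega Q Q'" "A <= Omega"
 shows "energy xi eta Q A = (LI x:A. ennreal (dens xi eta Q Q' x))"
proof -
 have "energy xi eta Q A = (LL x:A. ennreal (dens xi eta Q Q' x))"
  unfolding energy_def
  by (rule nn_integral_cong_AE, rule AE_mp[OF grad_norm2_AE[OF assms(1)]], rule AE_I2)
   (use assms(2) in "auto simp: indicator_def dens_def")
 also have "... = (LI x:A. ennreal (dens xi eta Q Q' x))" by (rule nn_integral_completion)
 finally show ?thesis .
qed

lemma cone_over_eq: assumes "U <= sphere 0 1" shows "cone_over U = {x. 1 < norm x & sgn x : U}"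
proof (intro set_eqI iffI)
 fix x assume "x : cone_over U"
 then obtain t om where *: "x = t *R om" "1 < t" "om : U" by (auto simp: cone_over_def)
 hence "norm om = 1" using assms by auto
 thus "x : {x. 1 < norm x & sgn x : U}" using * by (simp add: sgn_div_norm)
next
 fix x :: "real^3" assume "x : {x. 1 < norm x & sgn x : U}"
 moreover have "x = norm x *R sgn x" by (cases "x = 0") (simp_all add: sgn_div_norm)
 ultimately show "x : cone_over U" unfolding cone_over_def by blast
qed

lemma cone_over_Omega: "U <= sphere 0 1 ==> cone_over U <= Omega"
 by (auto simp: cone_over_eq mem_Omega)

lemma borel_cone_over:
 assumes "B : sets borel" "B <= sphere 0 1" shows "cone_over B : sets borel"
proof -
 have "cone_over B = Omega Int (\<Union>n::nat. {x : ball 0 (real n). sgn x : B})"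
  unfolding cone_over_eq[OF assms(2)] using reals_Archimedean2 by (auto simp: mem_Omega)
 also have "... : sets borel" using borel_cone_ball[OF assms(1)] by (intro sets.Int borel_Omega sets.countable_UN) auto
 finally show ?thesis .
qed

lemma energy_mono: "A <= B ==> energy xi eta Q A <= energy xi eta Q B"
 unfolding energy_def by (intro nn_integral_mono) (auto simp: indicator_def)

text \<open>Multiplying the map and its derivatives by the indicator of Omega makes the density
  Borel on the whole space.\<close>

lemma energy_Un:
 assumes Q: "C1_on Omega Q Q'" and AB: "A : sets borel" "B : sets borel" "A <= Omega" "B <= Omega"
 shows "energy xi eta Q (A Un B) <= energy xi eta Q A + energy xi eta Q B"
proof -
 let ?q = "%x. indicator Omega x *R Q x" and ?q' = "%e x. indicator Omega x *R Q' x e"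
 have [measurable]: "?q : borel_measurable borel"
  by (rule borel_measurable_continuous_on_indicator[OF borel_Omega C1_on_continuous[OF Q]])
 have m': "?q' e : borel_measurable borel" if "e : Basis" for e
  by (rule borel_measurable_continuous_on_indicator[OF borel_Omega C1_onD(2)[OF Q that]])
 define d where "d x = 1/2 * (SUM e:Basis. nsq (?q' e x)) + 1/xi^2 * f_pot (?q x) + 1/eta^2 * g_pot (?q x)" for x
 have [measurable]: "d : borel_measurable borel"
 proof -
  have [measurable]: "(%x. SUM e:Basis. nsq (?q' e x)) : borel_measurable borel"
   by (intro borel_measurable_sum borel_measurable_power measurable_compose[OF m' borel_measurable_norm])
  have [measurable]: "(%x. f_pot (?q x)) : borel_measurable borel" "(%x. g_pot (?q x)) : borel_measurable borel"
   by (rule measurable_compose[OF _ borel_measurable_f_pot] measurable_compose[OF _ borel_measurable_g_pot], measurable)+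
  show ?thesis unfolding d_def[abs_def] by measurable
 qed
 have eq: "energy xi eta Q S = (LI x:S. ennreal (d x))" if "S <= Omega" for S
  unfolding energy_C1[OF Q that] by (intro nn_integral_cong) (use that in "auto simp: d_def dens_def indicator_def")
 have mA: "(%x. ennreal (d x) * indicator S x) : borel_measurable lborel" if "S : sets borel" for S
  using that by measurable
 have "energy xi eta Q (A Un B) <= (LI x. ennreal (d x) * indicator A x + ennreal (d x) * indicator B x)"
  using AB by (subst eq) (auto simp: indicator_def intro!: nn_integral_mono)
 also have "... = (LI x:A. ennreal (d x)) + (LI x:B. ennreal (d x))"
  by (rule nn_integral_add[OF mA[OF AB(1)] mA[OF AB(2)]])
 finally show ?thesis by (simp only: eq[OF AB(3)] eq[OF AB(4)])
qed

text \<open>The substitution s = 1 + (r - 1) / eta absorbs the factor 1 / eta, and the Jacobian r^2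
  is at most (1 + eta L)^2 on the layer.\<close>

lemma nn_integral_radial_scale:
 assumes H[measurable]: "H : borel_measurable borel" and eta: "0 < eta" and L: "0 <= L"
  and B: "B : sets borel" "B <= sphere 0 1"
 shows "(LI x:{x : ball 0 (1 + eta * L). sgn x : B}. ennreal (H (1 + (norm x - 1) / eta) / eta) * indicator {1<..} (norm x))
  <= ennreal ((1 + eta * L)^2) * emeasure sph B * (LI s:{1<..}. ennreal (H s))"
proof -
 define F where "F r = ennreal (H (1 + (r - 1) / eta) / eta) * indicator {1<..} r" for r :: real
 have [measurable]: "F : borel_measurable borel" unfolding F_def[abs_def] by measurable
 have eq: "(LI x:{x : ball 0 (1 + eta * L). sgn x : B}. F (norm x))
   = emeasure sph B * (LI r:{0<..<1 + eta * L}. F r * ennreal (r^2))"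
  by (rule nn_integral_cone_radial[OF B]) measurable
 have "(LI r:{0<..<1 + eta * L}. F r * ennreal (r^2)) <= (LI r. ennreal ((1 + eta * L)^2) * F r)"
 proof (rule nn_integral_mono)
  fix r :: real
  show "F r * ennreal (r^2) * indicator {0<..<1 + eta * L} r <= ennreal ((1 + eta * L)^2) * F r"
  proof (cases "0 < r & r < 1 + eta * L")
   case True
   hence "r^2 <= (1 + eta * L)^2" by (intro power_mono) auto
   hence "F r * ennreal (r^2) <= F r * ennreal ((1 + eta * L)^2)" by (intro mult_left_mono ennreal_leI) auto
   thus ?thesis using True by (simp add: mult.commute)
  qed auto
 qed
 also have "(LI r. ennreal ((1 + eta * L)^2) * F r) = ennreal ((1 + eta * L)^2) * (LI r. F r)"
  by (rule nn_integral_cmult) measurable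
 finally have le: "(LI r:{0<..<1 + eta * L}. F r * ennreal (r^2)) <= ennreal ((1 + eta * L)^2) * (LI r. F r)" .
 have "(LI r. F r) = ennreal \<bar>eta\<bar> * (LI s. F ((1 - eta) + eta * s))"
  by (rule nn_integral_real_affine) (use eta in auto)
 also have "... = (LI s. ennreal \<bar>eta\<bar> * F ((1 - eta) + eta * s))" by (rule nn_integral_cmult[symmetric]) measurable
 also have "... = (LI s:{1<..}. ennreal (H s))"
 proof (rule nn_integral_cong)
  fix s :: real
  have "(1 - eta + eta * s - 1) / eta = s - 1" using eta by (simp add: field_simps)
  moreover have "1 < 1 - eta + eta * s \<longleftrightarrow> 1 < s" using eta mult_less_cancel_left_pos[of eta 1 s] by auto
  moreover have "ennreal eta * ennreal (H s / eta) = ennreal (H s)" using eta by (simp add: ennreal_mult'[symmetric])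
  ultimately show "ennreal \<bar>eta\<bar> * F ((1 - eta) + eta * s) = ennreal (H s) * indicator {1<..} s"
   using eta by (simp add: F_def indicator_def)
 qed
 finally have "emeasure sph B * (LI r:{0<..<1 + eta * L}. F r * ennreal (r^2))
   <= emeasure sph B * (ennreal ((1 + eta * L)^2) * (LI s:{1<..}. ennreal (H s)))"
  using le by (intro mult_left_mono) auto
 also have "... = ennreal ((1 + eta * L)^2) * emeasure sph B * (LI s:{1<..}. ennreal (H s))" by (simp only: mult_ac)
 finally have "emeasure sph B * (LI r:{0<..<1 + eta * L}. F r * ennreal (r^2))
   <= ennreal ((1 + eta * L)^2) * emeasure sph B * (LI s:{1<..}. ennreal (H s))" .
 thus ?thesis unfolding eq[symmetric] by (simp only: F_def)
qed

text \<open>\<open>H\<close> bounds the radial density in the rescaled variable, and the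
  \<open>kap\<close> term collects what carries no 1/eta. The latter contributes O(eta) for every B,
  so it is an error uniform in the set.\<close>

lemma energy_cone_le:
 assumes Q: "C1_on Omega Q Q'" and eta: "0 < eta" and L: "0 <= L" and c: "0 <= c" and H[measurable]: "H : borel_measurable borel"
  and H0: "!!s. 0 <= H s"
  and B: "B : sets borel" "B <= sphere 0 1"
  and le: "!!x. x : cone_over B ==> eta^2 * dens xi eta Q Q' x
   <= (if norm x < 1 + eta * L then H (1 + (norm x - 1) / eta) else 0) + (if norm x < 2 then eta^2 * c * kap x else 0)"
 shows "ennreal eta * energy xi eta Q (cone_over B)
  <= ennreal ((1 + eta * L)^2) * emeasure sph B * (LI s:{1<..}. ennreal (H s)) + ennreal (eta * c) * (LI x:ball 0 2. ennreal (kap x))"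
proof -
 let ?S = "{x : ball 0 (1 + eta * L). sgn x : B}"
 have S: "?S : sets borel" by (rule borel_cone_ball[OF B(1)])
 let ?a = "%x::real^3. ennreal (H (1 + (norm x - 1) / eta) / eta) * indicator {1<..} (norm x) * indicator ?S x"
 let ?b = "%x::real^3. ennreal (kap x) * indicator (ball 0 2) x"
 have ma: "?a : borel_measurable lborel" using S by measurable
 have mb: "?b : borel_measurable lborel" using borel_open[OF open_ball, of "0::real^3" 2] by measurable
 have "ennreal eta * energy xi eta Q (cone_over B) <= ennreal eta * (LI x. ennreal (1/eta) * (?a x + ennreal (eta * c) * ?b x))"
  unfolding energy_C1[OF Q cone_over_Omega[OF B(2)]]
 proof (intro mult_left_mono nn_integral_mono)
  fix x :: "real^3"
  show "ennreal (dens xi eta Q Q' x) * indicator (cone_over B) x <= ennreal (1/eta) * (?a x + ennreal (eta * c) * ?b x)"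
  proof (cases "x : cone_over B")
   case True
   hence x: "1 < norm x" "sgn x : B" using cone_over_eq[OF B(2)] by auto
   let ?h = "if norm x < 1 + eta * L then H (1 + (norm x - 1) / eta) else 0" and ?k = "if norm x < 2 then eta^2 * c * kap x else 0"
   have hk: "0 <= ?h" "0 <= ?k" using H0 c kap_nonneg[of x] by auto
   have "dens xi eta Q Q' x <= 1 / eta * (?h / eta + ?k / eta)" using le[OF True] eta by (simp add: field_simps power2_eq_square)
   hence "ennreal (dens xi eta Q Q' x) <= ennreal (1 / eta * (?h / eta + ?k / eta))" by (rule ennreal_leI)
   also have "... = ennreal (1/eta) * (ennreal (?h / eta) + ennreal (?k / eta))"
    using eta hk by (simp only: ennreal_mult' ennreal_plus divide_nonneg_pos zero_le_divide_1_iff less_imp_le)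
   also have "ennreal (?h / eta) = ?a x" using x by (auto simp: indicator_def)
   also have "ennreal (?k / eta) = ennreal (eta * c) * ?b x"
    using eta c kap_nonneg[of x] by (auto simp: indicator_def ennreal_mult[symmetric] power2_eq_square)
   finally show ?thesis using True by simp
  qed simp
 qed auto
 also have "... = ennreal eta * (ennreal (1/eta) * (LI x. ?a x + ennreal (eta * c) * ?b x))"
  by (subst nn_integral_cmult[OF borel_measurable_add[OF ma borel_measurable_times_ennreal[OF borel_measurable_const mb]]]) (rule refl)
 also have "... = (LI x. ?a x + ennreal (eta * c) * ?b x)"
  using eta by (simp add: mult.assoc[symmetric] ennreal_mult[symmetric] del: mult.assoc)
 also have "... = (LI x. ?a x) + (LI x. ennreal (eta * c) * ?b x)"
  by (rule nn_integral_add[OF ma]) (use mb in "rule borel_measurable_times_ennreal[OF borel_measurable_const]")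
 also have "(LI x. ennreal (eta * c) * ?b x) = ennreal (eta * c) * (LI x. ?b x)"
  by (rule nn_integral_cmult[OF mb])
 finally show ?thesis
  using nn_integral_radial_scale[OF H eta L B] by (elim order_trans) (intro add_right_mono)
qed

section \<open>Recovery sequences from partitions of the sphere\<close>

text \<open>The class \<A> is carried through the induction because E is subadditive on that
  class.\<close>

lemma finite_UN_subadditive:
 fixes E :: "'a set => ennreal"
 assumes "finite J" and sub: "!!A B. A : \<A> ==> B : \<A> ==> E (A Un B) <= E A + E B"
  and cl: "!!A B. A : \<A> ==> B : \<A> ==> A Un B : \<A>" and J: "!!j. j : J ==> B j : \<A>" and Z: "Z : \<A>"
 shows "(UN j:J. B j) Un Z : \<A> & E ((UN j:J. B j) Un Z) <= (SUM j:J. E (B j)) + E Z"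
 using assms(1) J
proof (induction J rule: finite_induct)
 case empty thus ?case using Z by simp
next
 case (insert i J)
 have IH: "(UN j:J. B j) Un Z : \<A>" "E ((UN j:J. B j) Un Z) <= (SUM j:J. E (B j)) + E Z" using insert by auto
 have eq: "(UN j:insert i J. B j) Un Z = B i Un ((UN j:J. B j) Un Z)" by auto
 have "E (B i Un ((UN j:J. B j) Un Z)) <= E (B i) + ((SUM j:J. E (B j)) + E Z)"
  by (rule order_trans[OF sub[OF _ IH(1)]]) (use insert.prems IH(2) in "auto intro: add_left_mono")
 thus ?case unfolding eq using cl[OF _ IH(1)] insert by (simp add: add.assoc)
qed

text \<open>On V j a Borel hull of U Int V j with nearly its Hausdorff measure carries the energy
  bound, and d j times that measure is a lower bound for the integral over U Int V j. The errors are
  eps times the total cone measure, from a j <= d j + eps, and three times eps: from the hulls, from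
  the additive terms in the energy bounds, and from the remainder.\<close>

lemma partition_bound:
 fixes E :: "(real^3) set => ennreal" and V :: "'j => (real^3) set" and d a :: "'j => real"
 assumes E: "!!U U'. U <= U' ==> U' <= sphere 0 1 ==> E U <= E U'"
   "!!A B. A : sets borel ==> B : sets borel ==> A <= sphere 0 1 ==> B <= sphere 0 1 ==> E (A Un B) <= E A + E B"
  and J: "finite J" "disjoint_family_on V J" "!!j. j : J ==> V j : sets borel" "!!j. j : J ==> V j <= sphere 0 1"
  and d: "!!j. j : J ==> 0 <= d j" "!!j om. j : J ==> om : V j ==> ennreal (d j) <= dl om"
  and a: "!!j. j : J ==> 0 <= a j" "!!j. j : J ==> a j <= d j + eps"
   "!!j B. j : J ==> B : sets borel ==> B <= V j ==> E B <= ennreal (a j) * emeasure sph B + ennreal eps'"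
  and Z: "E (sphere 0 1 - (UN j:J. V j)) <= ennreal eps"
  and eps: "0 < eps" "0 < eps'" "real (card J) * eps' <= eps"
  and U: "U <= sphere 0 1" "U : sets (hausdorff_measure 2)"
 shows "E U <= (\<integral>\<^sup>+om\<in>U. dl om \<partial>hausdorff_measure 2) + ennreal (eps * (measure sph UNIV + 3))"
proof -
 let ?S = "hausdorff_measure 2 :: (real^3) measure"
 have UV: "U Int V j : sets ?S" if "j : J" for j using U(2) borel_in_hausdorff[OF J(3)[OF that]] by (rule sets.Int)
 have ex: "EX B. B : sets borel & U Int V j <= B & B <= V j \<and>
   ennreal (a j) * emeasure sph B <= ennreal (d j) * emeasure ?S (U Int V j) + ennreal eps * emeasure sph (V j) + ennreal eps'" if j: "j : J" for j
 proof -
  have aB: "ennreal (a j) * emeasure sph B <= ennreal (d j) * emeasure sph B + ennreal eps * emeasure sph (V j)"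
   if "B <= V j" for B
  proof -
   have "ennreal (a j) * emeasure sph B <= ennreal (d j + eps) * emeasure sph B" by (intro mult_right_mono ennreal_leI a j) auto
   also have "... = ennreal (d j) * emeasure sph B + ennreal eps * emeasure sph B" using d(1)[OF j] eps by (simp add: distrib_right)
   also have "... <= ennreal (d j) * emeasure sph B + ennreal eps * emeasure sph (V j)"
    by (intro add_left_mono mult_left_mono emeasure_mono[OF that]) (simp_all add: sets_sph J(3)[OF j])
   finally show ?thesis .
  qed
  show ?thesis
  \<comment> \<open>An efficient hull exists only for finite Hausdorff measure, and eps' / d j asks
    for d j > 0. In the remaining cases all of V j will do: either d j is 0 on both sides or the
    right-hand side is infinite.\<close>
  proof (cases "d j = 0 | emeasure ?S (U Int V j) = \<infinity>")
   case True
   hence "ennreal (d j) * emeasure sph (V j) <= ennreal (d j) * emeasure ?S (U Int V j)"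
    using d(1)[OF j] by (auto simp: ennreal_mult_top)
   hence "ennreal (a j) * emeasure sph (V j) <= ennreal (d j) * emeasure ?S (U Int V j) + ennreal eps * emeasure sph (V j) + ennreal eps'"
    using aB[of "V j"] by (meson add_increasing2 add_right_mono order_refl order_trans zero_le)
   thus ?thesis using J(3)[OF j] by blast
  next
   case False
   hence d0: "0 < d j" and fin: "hausdorff_outer 2 (U Int V j) < \<infinity>"
    using d(1)[OF j] emeasure_hausdorff_measure[OF UV[OF j]] by (auto simp: top.not_eq_extremum)
   obtain B where B: "B : sets borel" "U Int V j <= B" "emeasure sph B <= hausdorff_outer 2 (U Int V j) + ennreal (eps' / d j)"
    by (rule sph_hausdorff_hull[OF _ fin, of "eps' / d j"]) (use U(1) d0 eps(2) in auto)
   have "ennreal (d j) * emeasure sph (B Int V j) <= ennreal (d j) * (emeasure ?S (U Int V j) + ennreal (eps' / d j))"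
    unfolding emeasure_hausdorff_measure[OF UV[OF j]]
    by (intro mult_left_mono order_trans[OF emeasure_mono B(3)]) (auto simp: sets_sph B)
   also have "... = ennreal (d j) * emeasure ?S (U Int V j) + ennreal eps'"
    using d0 eps(2) by (simp add: distrib_left ennreal_mult[symmetric])
   finally have "ennreal (a j) * emeasure sph (B Int V j) <= ennreal (d j) * emeasure ?S (U Int V j) + ennreal eps' + ennreal eps * emeasure sph (V j)"
    using aB[of "B Int V j"] by (meson Int_lower2 add_right_mono order_trans)
   thus ?thesis using B J(3)[OF j] by (intro exI[of _ "B Int V j"]) (auto simp: add_ac)
  qed
 qed
 obtain B where B: "!!j. j : J ==> B j : sets borel" "!!j. j : J ==> U Int V j <= B j" "!!j. j : J ==> B j <= V j"
   "!!j. j : J ==> ennreal (a j) * emeasure sph (B j) <= ennreal (d j) * emeasure ?S (U Int V j) + ennreal eps * emeasure sph (V j) + ennreal eps'"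
  using bchoice[of J "%j B. B : sets borel & U Int V j <= B & B <= V j \<and>
   ennreal (a j) * emeasure sph B <= ennreal (d j) * emeasure ?S (U Int V j) + ennreal eps * emeasure sph (V j) + ennreal eps'"] ex by blast
 let ?Z = "sphere 0 1 - (UN j:J. V j)"
 have Zb: "?Z : sets borel" using J(1,3) by (intro sets.Diff sets.finite_UN) auto
 have "(UN j:J. B j) Un ?Z : {A. A : sets borel & A <= sphere 0 1} & E ((UN j:J. B j) Un ?Z) <= (SUM j:J. E (B j)) + E ?Z"
 proof (rule finite_UN_subadditive[OF J(1), where E = E and B = B and Z = ?Z and \<A> = "{A. A : sets borel & A <= sphere 0 1}"])
  show "B j : {A. A : sets borel & A <= sphere 0 1}" if "j : J" for j using B(1,3)[OF that] J(4)[OF that] by blast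
  show "?Z : {A. A : sets borel & A <= sphere 0 1}" using Zb by blast
  show "E (A Un B) <= E A + E B" if "A : {A. A : sets borel & A <= sphere 0 1}" "B : {A. A : sets borel & A <= sphere 0 1}" for A B
   using E(2) that by blast
  show "A Un B : {A. A : sets borel & A <= sphere 0 1}" if "A : {A. A : sets borel & A <= sphere 0 1}" "B : {A. A : sets borel & A <= sphere 0 1}" for A B :: "(real^3) set"
   using that by (simp add: sets.Un)
 qed
 hence sub: "E ((UN j:J. B j) Un ?Z) <= (SUM j:J. E (B j)) + E ?Z" by (rule conjunct2)
 have "E U <= E ((UN j:J. B j) Un ?Z)"
 proof (rule E(1))
  show "U <= (UN j:J. B j) Un ?Z" using U(1) B(2) by blast
  show "(UN j:J. B j) Un ?Z <= sphere 0 1" using B(3) J(4) by blast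
 qed
 also note sub
 also have "(SUM j:J. E (B j)) + E ?Z <= (SUM j:J. (ennreal (d j) * emeasure ?S (U Int V j) + ennreal eps * emeasure sph (V j) + ennreal eps') + ennreal eps') + ennreal eps"
  by (intro add_mono sum_mono Z order_trans[OF a(3)[OF _ B(1) B(3)] add_right_mono[OF B(4)]])
 also have "... = (SUM j:J. ennreal (d j) * emeasure ?S (U Int V j)) + ennreal eps * (SUM j:J. emeasure sph (V j)) + (of_nat (card J) * ennreal eps' + of_nat (card J) * ennreal eps' + ennreal eps)"
  by (simp add: sum.distrib sum_distrib_left add_ac)
 finally have E1: "E U <= (SUM j:J. ennreal (d j) * emeasure ?S (U Int V j)) + ennreal eps * (SUM j:J. emeasure sph (V j)) + (of_nat (card J) * ennreal eps' + of_nat (card J) * ennreal eps' + ennreal eps)" .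
 have "(SUM j:J. emeasure sph (V j)) = emeasure sph (UN j:J. V j)"
  using J by (intro sum_emeasure) (auto simp: sets_sph)
 also have "... <= ennreal (measure sph UNIV)"
  using emeasure_mono[of "UN j:J. V j" UNIV sph] finite_measure.emeasure_eq_measure[OF finite_measure_sph, of UNIV] by (simp add: sets_sph)
 finally have E2: "(SUM j:J. emeasure sph (V j)) <= ennreal (measure sph UNIV)" .
 have "(SUM j:J. ennreal (d j) * emeasure ?S (U Int V j)) = (SUM j:J. \<integral>\<^sup>+om. ennreal (d j) * indicator (U Int V j) om \<partial>?S)"
  by (intro sum.cong refl nn_integral_cmult_indicator[symmetric] UV)
 also have "... = (\<integral>\<^sup>+om. (SUM j:J. ennreal (d j) * indicator (U Int V j) om) \<partial>?S)"
  by (rule nn_integral_sum[symmetric]) (intro borel_measurable_times_ennreal borel_measurable_const borel_measurable_indicator UV)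
 \<comment> \<open>The integral is a supremum over simple functions below the integrand, so a simple
   minorant is enough whether or not dl is measurable.\<close>
 also have "... <= (\<integral>\<^sup>+om\<in>U. dl om \<partial>?S)"
 proof (rule nn_integral_mono)
  fix om :: "real^3"
  show "(SUM j:J. ennreal (d j) * indicator (U Int V j) om) <= dl om * indicator U om"
  proof (cases "EX j:J. om : U Int V j")
   case True
   then obtain j where j: "j : J" "om : U" "om : V j" by auto
   have "om ~: V i" if "i : J" "i ~= j" for i using J(2) that j by (auto simp: disjoint_family_on_def)
   hence "(SUM i:J. ennreal (d i) * indicator (U Int V i) om) = (SUM i:J. if i = j then ennreal (d j) else 0)"
    using j by (intro sum.cong) auto
   also have "... = ennreal (d j)" using j J(1) by simp
   finally show ?thesis using d(2)[OF j(1,3)] j by simp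
  next
   case False
   hence "(SUM j:J. ennreal (d j) * indicator (U Int V j) om) = 0" by (intro sum.neutral) auto
   thus ?thesis by simp
  qed
 qed
 finally have E3: "(SUM j:J. ennreal (d j) * emeasure ?S (U Int V j)) <= (\<integral>\<^sup>+om\<in>U. dl om \<partial>?S)" .
 have E4: "of_nat (card J) * ennreal eps' <= ennreal eps"
  using eps by (simp add: ennreal_of_nat_eq_real_of_nat ennreal_mult[symmetric])
 have "E U <= (\<integral>\<^sup>+om\<in>U. dl om \<partial>?S) + ennreal eps * ennreal (measure sph UNIV) + (ennreal eps + ennreal eps + ennreal eps)"
  by (rule order_trans[OF E1]) (intro add_mono mult_left_mono E2 E3 E4 order_refl zero_le)
 also have "... = (\<integral>\<^sup>+om\<in>U. dl om \<partial>?S) + ennreal (eps * (measure sph UNIV + 3))"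
  using eps(1) by (simp add: ennreal_mult[symmetric] ennreal_plus[symmetric] add.assoc algebra_simps del: ennreal_plus)
 finally show ?thesis .
qed

text \<open>The error does not depend on U, so that the map can be fixed before U is.\<close>

definition good_map :: "ennreal => real => real => real => (real^3 => real^3^3) => bool" where
 "good_map lam eps xi eta Q \<longleftrightarrow> admissible Q & (ALL U. U <= sphere 0 1 & U : sets (hausdorff_measure 2) \<longrightarrow>
   ennreal eta * energy xi eta Q (cone_over U) <= (\<integral>\<^sup>+om\<in>U. D lam (Q_phi om) \<partial>hausdorff_measure 2) + ennreal eps)"

lemma good_mapI:
 fixes V :: "'j => (real^3) set" and d a :: "'j => real"
 assumes Q: "C1_on Omega Q Q'" "admissible Q"
  and J: "finite J" "disjoint_family_on V J" "!!j. j : J ==> V j : sets borel" "!!j. j : J ==> V j <= sphere 0 1"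
  and d: "!!j. j : J ==> 0 <= d j" "!!j om. j : J ==> om : V j ==> ennreal (d j) <= D lam (Q_phi om)"
  and a: "!!j. j : J ==> 0 <= a j" "!!j. j : J ==> a j <= d j + eps"
   "!!j B. j : J ==> B : sets borel ==> B <= V j ==> ennreal eta * energy xi eta Q (cone_over B) <= ennreal (a j) * emeasure sph B + ennreal eps'"
  and Z: "ennreal eta * energy xi eta Q (cone_over (sphere 0 1 - (UN j:J. V j))) <= ennreal eps"
  and eps: "0 < eps" "0 < eps'" "real (card J) * eps' <= eps"
 shows "good_map lam (eps * (measure sph UNIV + 3)) xi eta Q"
proof -
 let ?E = "%U. ennreal eta * energy xi eta Q (cone_over U)"
 have E1: "?E U <= ?E U'" if "U <= U'" for U U'
  by (intro mult_left_mono energy_mono) (use that in "auto simp: cone_over_def")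
 have E2: "?E (A Un B) <= ?E A + ?E B" if "A : sets borel" "B : sets borel" "A <= sphere 0 1" "B <= sphere 0 1" for A B
 proof -
  have "cone_over (A Un B) = cone_over A Un cone_over B" by (auto simp: cone_over_def)
  hence "?E (A Un B) <= ennreal eta * (energy xi eta Q (cone_over A) + energy xi eta Q (cone_over B))"
   by (simp only:) (intro mult_left_mono energy_Un[OF Q(1)] borel_cone_over cone_over_Omega that zero_le)
  thus ?thesis by (simp add: distrib_left)
 qed
 show ?thesis unfolding good_map_def
 proof (intro conjI allI impI Q(2))
  fix U :: "(real^3) set" assume "U <= sphere 0 1 & U : sets (hausdorff_measure 2)"
  hence U: "U <= sphere 0 1" "U : sets (hausdorff_measure 2)" by auto
  show "?E U <= (\<integral>\<^sup>+om\<in>U. D lam (Q_phi om) \<partial>hausdorff_measure 2) + ennreal (eps * (measure sph UNIV + 3))"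
   by (rule partition_bound[where E = ?E and V = V and d = d and a = a and J = J and dl = "%om. D lam (Q_phi om)", OF E1 E2 J d a Z eps U])
 qed
qed

text \<open>For each i take a map whose error is less than eta i above the infimum of the possible
  errors. If an error eps is eventually possible, the chosen one is eventually below eps + eta i.
  This does the work of a diagonal sequence along an arbitrary filter.\<close>

lemma recovery_of_good_maps:
 fixes F :: "'i filter" and xi eta :: "'i => real"
 assumes pos: "\<forall>\<^sub>F i in F. 0 < xi i & 0 < eta i" and eta0: "(eta \<longlongrightarrow> 0) F" and A: "admissible Q0"
  and ev: "!!eps. 0 < eps ==> \<forall>\<^sub>F i in F. EX Q. good_map lam eps (xi i) (eta i) Q"
 shows "EX Q :: 'i => real^3 => real^3^3.
  (ALL i. admissible (Q i)) \<and>
  (ALL U. U <= sphere 0 1 & U : sets (hausdorff_measure 2) \<longrightarrow>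
   Limsup F (%i. ennreal (eta i) * energy (xi i) (eta i) (Q i) (cone_over U))
    <= (\<integral>\<^sup>+om\<in>U. D lam (Q_phi om) \<partial>hausdorff_measure 2))"
proof -
 define G where "G i = {eps. 0 < eps & (EX Q. good_map lam eps (xi i) (eta i) Q)}" for i
 have bdd: "bdd_below (G i)" for i by (rule bdd_belowI[of _ 0]) (auto simp: G_def)
 have "EX Q. admissible Q & (G i ~= {} & 0 < eta i --> (EX eps. eps < Inf (G i) + eta i & good_map lam eps (xi i) (eta i) Q))" for i
 proof (cases "G i ~= {} & 0 < eta i")
  case True
  then obtain eps where "eps : G i" "eps < Inf (G i) + eta i" using cInf_lessD[of "G i" "Inf (G i) + eta i"] by auto
  thus ?thesis unfolding G_def good_map_def by blast
 next
  case False thus ?thesis using A by blast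
 qed
 then obtain Q where Q: "!!i. admissible (Q i)"
   "!!i. G i ~= {} ==> 0 < eta i ==> EX eps. eps < Inf (G i) + eta i & good_map lam eps (xi i) (eta i) (Q i)"
  by metis
 have "Limsup F (%i. ennreal (eta i) * energy (xi i) (eta i) (Q i) (cone_over U))
   <= (\<integral>\<^sup>+om\<in>U. D lam (Q_phi om) \<partial>hausdorff_measure 2)" (is "_ <= ?I")
  if U: "U <= sphere 0 1" "U : sets (hausdorff_measure 2)" for U
 proof (rule ennreal_le_epsilon)
  fix e :: real assume e: "0 < e"
  have "\<forall>\<^sub>F i in F. eta i < e / 2" using order_tendstoD(2)[OF eta0, of "e/2"] e by simp
  moreover have "\<forall>\<^sub>F i in F. EX Q. good_map lam (e/2) (xi i) (eta i) Q" using e by (intro ev) simp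
  ultimately have "\<forall>\<^sub>F i in F. ennreal (eta i) * energy (xi i) (eta i) (Q i) (cone_over U) <= ?I + ennreal e"
   using pos
  proof eventually_elim
   case (elim i)
   have mem: "e/2 : G i" using elim e by (simp add: G_def)
   then obtain eps where eps: "eps < Inf (G i) + eta i" "good_map lam eps (xi i) (eta i) (Q i)" using Q(2)[of i] elim by blast
   have "eps <= e" using eps(1) cInf_lower[OF mem bdd] elim by linarith
   have "ennreal (eta i) * energy (xi i) (eta i) (Q i) (cone_over U) <= ?I + ennreal eps" using eps(2) U unfolding good_map_def by blast
   also have "... <= ?I + ennreal e" by (intro add_left_mono ennreal_leI \<open>eps <= e\<close>)
   finally show ?case .
  qed
  thus "Limsup F (%i. ennreal (eta i) * energy (xi i) (eta i) (Q i) (cone_over U)) <= ?I + ennreal e"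
   by (rule Limsup_bounded)
 qed
 thus ?thesis using Q(1) by (intro exI[of _ Q]) auto
qed

section \<open>A lower bound for uniaxial profiles\<close>

text \<open>Entries are inner products of rows, so the principal 2 by 2 minors are Gram determinants
  and nonnegative. Twice their sum is (tr N)^2 - tr (N^2) = (tr N)^2 - tr N = 0; hence all rows are
  parallel.\<close>

lemma projection_rank_one:
 fixes N :: "real^3^3"
 assumes sym: "!!i j. N$i$j = N$j$i" and idem: "!!i j. (SUM k:UNIV. N$i$k * N$k$j) = N$i$j" and tr: "N$1$1 + N$2$2 + N$3$3 = 1"
 obtains n where "norm n = 1" "!!i j. N$i$j = n$i * n$j"
proof -
 have vv: "N$i \<bullet> N$j = N$i$j" for i j
  using idem[of i j] by (simp add: inner_vec_def sym[of _ j])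
 define m where "m i j = N$i$i * N$j$j - (N$i$j)^2" for i j
 have m0: "0 <= m i j" for i j
  using Cauchy_Schwarz_ineq[of "N$i" "N$j"] by (simp add: m_def vv)
 have "N$1$1 = N$1$1 * N$1$1 + N$1$2 * N$1$2 + N$1$3 * N$1$3" "N$2$2 = N$1$2 * N$1$2 + N$2$2 * N$2$2 + N$2$3 * N$2$3"
  "N$3$3 = N$1$3 * N$1$3 + N$2$3 * N$2$3 + N$3$3 * N$3$3"
  using idem[of 1 1] idem[of 2 2] idem[of 3 3] sym[of 2 1] sym[of 3 1] sym[of 3 2] by (simp_all add: sum_3)
 hence "(N$1$1 + N$2$2 + N$3$3)^2 - (N$1$1 + N$2$2 + N$3$3) = 2 * (m 1 2 + m 1 3 + m 2 3)"
  by (simp add: m_def power2_eq_square algebra_simps)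
 hence "m 1 2 + m 1 3 + m 2 3 = 0" using tr by simp
 hence z: "m 1 2 = 0" "m 1 3 = 0" "m 2 3 = 0" using m0[of 1 2] m0[of 1 3] m0[of 2 3] by linarith+
 have msym: "m i j = m j i" for i j by (simp add: m_def sym[of i j])
 have "m i i = 0" for i by (simp add: m_def power2_eq_square)
 hence "ALL i j. m i j = 0" unfolding forall_3 using z msym[of 2 1] msym[of 3 1] msym[of 3 2] by simp
 hence mz: "m i j = 0" for i j by blast
 have par: "N$i$i * N$j$k = N$i$j * N$i$k" for i j k
 proof -
  have "(N$i$i *R N$j - N$i$j *R N$i) \<bullet> (N$i$i *R N$j - N$i$j *R N$i) = N$i$i * m i j"
   by (simp add: inner_diff_left inner_diff_right vv sym[of j i]) (simp add: m_def power2_eq_square algebra_simps)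
  hence "N$i$i *R N$j - N$i$j *R N$i = 0" using mz by simp
  hence "(N$i$i *R N$j - N$i$j *R N$i) $ k = 0" by simp
  thus ?thesis by simp
 qed
 have nn: "0 <= N$i$i" for i using inner_ge_zero[of "N$i"] by (simp add: vv)
 have "EX i. N$i$i ~= 0" using tr by (metis add_0 zero_neq_one)
 then obtain i where i: "0 < N$i$i" using nn by (metis less_eq_real_def)
 define n where "n = (1 / sqrt (N$i$i)) *R N$i"
 have s: "sqrt (N$i$i) * sqrt (N$i$i) = N$i$i" using i by simp
 show thesis
 proof (rule that[of n])
  have "nsq n = 1" using i by (simp add: n_def power_divide dot_square_norm[symmetric] vv power_mult_distrib)
  thus "norm n = 1" by (simp add: power2_eq_1_iff) (smt (verit) norm_ge_zero)
  show "N$j$k = n$j * n$k" for j k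
   using par[of i j k] i s by (simp add: n_def field_simps)
 qed
qed

text \<open>A zero of f makes N = Q + I/3 a projection, of trace one since Q is traceless.\<close>

lemma f_pot_0_uniaxial:
 assumes "Q : S0" "f_pot Q = 0" obtains n where "norm n = 1" "Q = uniaxial n"
proof -
 have "f_root Q = 0" using f_pot_eq[OF assms(1)] assms(2) by simp
 hence QQ: "Q ** Q = (1/3) *R Q + (2/9) *R mat 1" by (simp add: f_root_def algebra_simps)
 define N :: "real^3^3" where "N = Q + (1/3) *R mat 1"
 have QN: "Q $ i $ j = N $ i $ j - (if i = j then 1/3 else 0)" for i j by (simp add: N_def mat_def)
 have sy: "Q $ i $ j = Q $ j $ i" for i j
 proof -
  have "ALL i j. Q $ i $ j = Q $ j $ i" using assms(1) by (simp add: S0_iff forall_3)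
  thus ?thesis by blast
 qed
 have tr: "Q$1$1 + Q$2$2 + Q$3$3 = 0" using assms(1) by (simp add: S0_def trace_def sum_3)
 have q: "(SUM k:UNIV. Q$i$k * Q$k$j) = (1/3) * Q$i$j + (if i = j then 2/9 else 0)" for i j
 proof -
  have "(Q ** Q) $ i $ j = ((1/3) *R Q + (2/9) *R mat 1) $ i $ j" unfolding QQ ..
  thus ?thesis by (simp add: matrix_matrix_mult_def mat_def)
 qed
 have id: "(SUM k:UNIV. N$i$k * N$k$j) = N$i$j" for i j
 proof -
  have "(SUM k:UNIV. N$i$k * N$k$j) = (SUM k:UNIV. Q$i$k * Q$k$j) + (2/3) * Q$i$j + (if i = j then 1/9 else 0)"
   using exhaust_3[of i] exhaust_3[of j] by (auto simp: N_def mat_def sum_3 algebra_simps)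
  thus ?thesis unfolding q by (simp add: N_def mat_def)
 qed
 have "N$1$1 + N$2$2 + N$3$3 = 1" using tr by (simp add: N_def mat_def)
 moreover have "N$i$j = N$j$i" for i j using sy[of i j] by (simp add: N_def mat_def)
 ultimately obtain n where n: "norm n = 1" "!!i j. N$i$j = n$i * n$j"
  using projection_rank_one[of N] id by blast
 have "Q = uniaxial n" by (simp add: vec_eq_iff QN n(2) uniaxial_def mat_def)
 with n(1) show thesis by (rule that)
qed

text \<open>The finite form of the bound |n'| sqrt (1 - n_3^2) for the slope of |n_3|, with |Q'| =
  sqrt 2 |n'|. Writing b = x a + m with m orthogonal to a, the argument uses |x| <= 1 and is blind
  to the signs of a and b, as befits uniaxial tensors.\<close>

lemma uniaxial_increment:
 assumes a: "norm a = 1" and b: "norm b = 1"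
 shows "sqrt 2 * (\<bar>b$3\<bar> - \<bar>a$3\<bar>) <= norm (uniaxial b - uniaxial a) * sqrt (1 - (a$3)^2)"
proof -
 define x where "x = a \<bullet> b"
 have aa: "a \<bullet> a = 1" "b \<bullet> b = 1" using a b by (simp_all add: dot_square_norm)
 have x1: "\<bar>x\<bar> <= 1" using Cauchy_Schwarz_ineq2[of a b] a b by (simp add: x_def)
 have a3: "\<bar>a$3\<bar> <= 1" using component_le_norm_cart[of a 3] a by simp
 define m where "m = b - x *R a"
 have mm: "m \<bullet> m = 1 - x^2" unfolding m_def
  by (simp add: inner_diff_left inner_diff_right aa x_def[symmetric] inner_commute[of b a] power2_eq_square)
 have ma: "m \<bullet> a = 0" unfolding m_def by (simp add: inner_diff_left aa x_def[symmetric] inner_commute[of b a])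
 define v where "v = e3 - (a$3) *R a"
 have ae: "a \<bullet> e3 = a$3" "e3 \<bullet> a = a$3" "m \<bullet> e3 = m$3" by (simp_all add: inner_axis inner_axis')
 have vv: "v \<bullet> v = 1 - (a$3)^2" unfolding v_def
  by (simp add: inner_diff_left inner_diff_right aa ae power2_eq_square)
 have "m$3 = m \<bullet> v" unfolding v_def by (simp add: inner_diff_right ae ma)
 hence m3: "\<bar>m$3\<bar> <= sqrt (1 - x^2) * sqrt (1 - (a$3)^2)"
  using Cauchy_Schwarz_ineq2[of m v] by (simp add: norm_eq_sqrt_inner mm vv)
 have "b$3 = x * a$3 + m$3" by (simp add: m_def)
 hence "\<bar>b$3\<bar> <= \<bar>x\<bar> * \<bar>a$3\<bar> + \<bar>m$3\<bar>" by (metis abs_mult abs_triangle_ineq)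
 also have "\<bar>x\<bar> * \<bar>a$3\<bar> <= 1 * \<bar>a$3\<bar>" using x1 by (intro mult_right_mono) auto
 finally have b3: "\<bar>b$3\<bar> - \<bar>a$3\<bar> <= sqrt (1 - x^2) * sqrt (1 - (a$3)^2)" using m3 by simp
 have "uniaxial b - uniaxial a = outer b b - outer a a" by (simp add: uniaxial_def)
 hence "nsq (uniaxial b - uniaxial a) = 2 * (1 - x^2)"
  unfolding power2_norm_eq_inner
  by (simp add: inner_diff_left inner_diff_right inner_outer aa x_def[symmetric] inner_commute[of b a] power2_eq_square)
 hence "norm (uniaxial b - uniaxial a) = sqrt (2 * (1 - x^2))" by (metis norm_ge_zero real_sqrt_unique)
 thus ?thesis using mult_left_mono[OF b3, of "sqrt 2"] by (simp only: real_sqrt_mult mult.assoc real_sqrt_ge_zero zero_le_numeral)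
qed

lemma ennreal_add_le: "ennreal (x + y) <= ennreal x + ennreal y"
proof (cases "0 <= x & 0 <= y")
 case True thus ?thesis by simp
next
 case False
 then consider "y <= 0" | "x <= 0" by linarith
 thus ?thesis
 proof cases
  case 1
  hence "ennreal (x + y) <= ennreal x" by (intro ennreal_leI) simp
  thus ?thesis by (rule order_trans) simp
 next
  case 2
  hence "ennreal (x + y) <= ennreal y" by (intro ennreal_leI) simp
  thus ?thesis by (rule order_trans) simp
 qed
qed

lemma nn_integral_Icc_Ioc:
 fixes f :: "real => ennreal"
 shows "(LI x:{a..b}. f x) = (LI x:{a<..b}. f x)"
 by (rule nn_integral_cong_AE, rule AE_mp[OF AE_lborel_singleton[of a]]) (auto simp: indicator_def)

text \<open>Young's inequality: Del^2 / (2 h) + h gam >= sqrt 2 Del sqrt gam >= 2 c.\<close>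

lemma modica_mortola_step:
 fixes V :: ennreal
 assumes h: "0 < h" and inc: "ennreal (Del^2) <= ennreal h * V" and gam: "0 <= gam" and c: "sqrt 2 * c <= Del * sqrt gam"
 shows "ennreal (2 * c) <= ennreal (1/2) * V + ennreal (h * gam)"
proof (cases "V = \<infinity>")
 case True thus ?thesis by (simp add: ennreal_mult_top)
next
 case False
 then obtain v where v: "V = ennreal v" "0 <= v" by (cases V) auto
 have "ennreal (Del^2) <= ennreal (h * v)" using inc h v by (simp add: ennreal_mult)
 hence d: "Del^2 <= h * v" using h v by (simp add: ennreal_le_iff)
 have "0 <= (Del - sqrt 2 * h * sqrt gam)^2" by simp
 also have "... = Del^2 - 2 * sqrt 2 * h * (Del * sqrt gam) + 2 * h^2 * gam"
  using gam by (simp add: power2_diff power_mult_distrib)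
 finally have "2 * sqrt 2 * h * (Del * sqrt gam) <= h * v + 2 * h^2 * gam" using d by linarith
 moreover have "2 * sqrt 2 * h * (sqrt 2 * c) <= 2 * sqrt 2 * h * (Del * sqrt gam)" using c h by (intro mult_left_mono) auto
 moreover have "2 * sqrt 2 * h * (sqrt 2 * c) = h * (4 * c)" by (simp add: algebra_simps)
 ultimately have "h * (4 * c) <= h * (v + 2 * h * gam)" by (simp add: power2_eq_square algebra_simps)
 hence "4 * c <= v + 2 * h * gam" using h by simp
 hence "ennreal (2 * c) <= ennreal (v / 2 + h * gam)" by (intro ennreal_leI) simp
 also have "... = ennreal (v / 2) + ennreal (h * gam)" using v h gam by (intro ennreal_plus) auto
 also have "ennreal (v / 2) = ennreal (1/2) * V" using ennreal_mult'[of "1/2" v] v by simp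
 finally show ?thesis .
qed

text \<open>The factor in g = k0 (1 - n_3^2) on uniaxial tensors; its square root is the decay rate
  of optimal profiles.\<close>

definition k0 :: real where "k0 = sqrt (3/2)"

lemma k0: "0 < k0" by (simp add: k0_def)

text \<open>Short increments are estimated by \<open>modica_mortola_step\<close> with gam frozen at
  the left end, and the local inequalities are added up by bisection. The director n is a mere
  selection with arbitrary signs, so only |n_3| appears.\<close>

lemma modica_mortola:
 fixes P :: "real => real^3^3" and n :: "real => real^3"
 assumes pd: "prof_data P w" and n: "!!r. 1 <= r ==> norm (n r) = 1" "!!r. 1 <= r ==> P r = uniaxial (n r)"
 shows "ennreal (2 * sqrt k0 * (1 - \<bar>n 1 $ 3\<bar>)) <= ennreal (1/2) * (LI x. w x) + (LI r:{1<..}. ennreal (g_pot (P r)))"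
proof -
 have cP: "continuous_on UNIV P" and wm: "w : borel_measurable borel"
  and inc: "!!a b. a <= b ==> ennreal (nsq (P b - P a)) <= ennreal (b - a) * (LI x:{a..b}. w x)"
  using pd by (auto simp: prof_data_def)
 \<comment> \<open>Expressed through P, gam is visibly continuous, whereas n may jump between
   opposite vectors.\<close>
 define gam where "gam r = k0 * (2/3 - P r $ 3 $ 3)" for r
 have P33: "P r $ 3 $ 3 = (n r $ 3)^2 - 1/3" if "1 <= r" for r
  by (simp add: n(2)[OF that] uniaxial_def mat_def power2_eq_square)
 have n3: "(n r $ 3)^2 <= 1" if "1 <= r" for r
  using component_le_norm_cart[of "n r" 3] n(1)[OF that] by (simp add: abs_square_le_1)
 have gam1: "gam r = k0 * (1 - (n r $ 3)^2)" if "1 <= r" for r by (simp add: gam_def P33[OF that])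
 have gamg: "gam r = g_pot (P r)" if "1 <= r" for r
  using g_pot_uniaxial[OF n(1)[OF that]] by (simp add: gam1[OF that] n(2)[OF that] k0_def)
 have gam0: "0 <= gam r" if "1 <= r" for r using n3[OF that] k0 by (simp add: gam1[OF that])
 have cgam: "continuous_on S gam" for S
  unfolding gam_def[abs_def] by (intro continuous_intros continuous_on_subset[OF cP]) auto
 have gamm: "(%x. ennreal (gam x)) : borel_measurable borel"
  using borel_measurable_continuous_onI[OF cgam[of UNIV]] by measurable
 define I where "I A = ennreal (1/2) * (LI x:A. w x) + (LI r:A. ennreal (gam r))" for A
 have I_Un: "I {a<..c} = I {a<..b} + I {b<..c}" if "a <= b" "b <= c" for a b c
 proof -
  have un: "{a<..c} = {a<..b} Un {b<..c}" and disj: "{a<..b} Int {b<..c} = {}" using that by auto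
  have "(LI x:{a<..c}. f x) = (LI x:{a<..b}. f x) + (LI x:{b<..c}. f x)" if f: "f : borel_measurable borel" for f :: "real => ennreal"
   unfolding un by (rule nn_integral_disjoint_pair) (use f disj in auto)
  from this[OF wm] this[OF gamm] show ?thesis unfolding I_def by (simp add: distrib_left add_ac)
 qed
 have step: "ennreal (2 * sqrt k0 * (\<bar>n b $ 3\<bar> - \<bar>n a $ 3\<bar>) - (b - a) * om) <= I {a<..b}"
  if ab: "1 <= a" "a < b" and osc: "!!r. a <= r ==> r <= b ==> gam a <= gam r + om" and om: "0 < om" for a b om
 proof -
  let ?c = "sqrt k0 * (\<bar>n b $ 3\<bar> - \<bar>n a $ 3\<bar>)"
  have b1: "1 <= b" using ab by simp
  have "sqrt (gam a) = sqrt k0 * sqrt (1 - (n a $ 3)^2)" by (simp add: gam1[OF ab(1)] real_sqrt_mult)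
  hence "sqrt 2 * ?c <= norm (P b - P a) * sqrt (gam a)"
   using mult_left_mono[OF uniaxial_increment[OF n(1)[OF ab(1)] n(1)[OF b1]], of "sqrt k0"] k0
   by (simp add: n(2)[OF ab(1)] n(2)[OF b1] mult_ac)
  moreover have "ennreal (nsq (P b - P a)) <= ennreal (b - a) * (LI x:{a<..b}. w x)"
   using inc[of a b] ab unfolding nn_integral_Icc_Ioc by simp
  ultimately have 1: "ennreal (2 * ?c) <= ennreal (1/2) * (LI x:{a<..b}. w x) + ennreal ((b - a) * gam a)"
   using ab gam0[OF ab(1)] by (intro modica_mortola_step) auto
  have "ennreal ((b - a) * gam a) = (LI r. ennreal (gam a) * indicator {a<..b} r)"
   using ab gam0[OF ab(1)] by (simp add: nn_integral_cmult_indicator ennreal_mult mult.commute)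
  also have "... <= (LI r. ennreal (gam r) * indicator {a<..b} r + ennreal om * indicator {a<..b} r)"
  proof (rule nn_integral_mono)
   fix r :: real
   have "ennreal (gam a) <= ennreal (gam r) + ennreal om" if "a < r" "r <= b"
   proof -
    have "ennreal (gam a) <= ennreal (gam r + om)" using osc[of r] that by (intro ennreal_leI) simp
    thus ?thesis using gam0[of r] that ab om by simp
   qed
   thus "ennreal (gam a) * indicator {a<..b} r <= ennreal (gam r) * indicator {a<..b} r + ennreal om * indicator {a<..b} r"
    by (auto simp: indicator_def)
  qed
  also have "... = (LI r:{a<..b}. ennreal (gam r)) + (LI r. ennreal om * indicator {a<..b} r)"
   using gamm by (intro nn_integral_add) auto
  also have "(LI r. ennreal om * indicator {a<..b} r) = ennreal ((b - a) * om)"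
   using ab om by (simp add: nn_integral_cmult_indicator ennreal_mult mult.commute)
  finally have 2: "ennreal ((b - a) * gam a) <= (LI r:{a<..b}. ennreal (gam r)) + ennreal ((b - a) * om)" .
  have "ennreal (2 * ?c) <= I {a<..b} + ennreal ((b - a) * om)"
   unfolding I_def add.assoc by (rule order_trans[OF 1 add_left_mono[OF 2]])
  moreover have "ennreal (2 * ?c - (b - a) * om) = ennreal (2 * ?c) - ennreal ((b - a) * om)"
   using ab om by (intro ennreal_minus[symmetric]) auto
  ultimately have "ennreal (2 * ?c - (b - a) * om) <= I {a<..b}"
   by (simp add: ennreal_minus_le_iff add.commute)
  thus ?thesis by (simp add: mult.assoc)
 qed
 have main: "ennreal (2 * sqrt k0 * (\<bar>n T $ 3\<bar> - \<bar>n 1 $ 3\<bar>)) <= I {1<..}" if T: "1 < T" for T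
 proof (rule ennreal_le_epsilon)
  fix e :: real assume e: "0 < e"
  \<comment> \<open>The freezing error om per unit length adds up to e over [1,T].\<close>
  define om where "om = e / (T - 1)"
  have om: "0 < om" using e T by (simp add: om_def)
  define Z where "Z r = 2 * sqrt k0 * \<bar>n r $ 3\<bar> - om * r" for r
  have "(1::real) <= 1 --> ennreal (Z T - Z 1) <= I {1<..T}"
  \<comment> \<open>The property has to be additive over adjacent intervals and true on all short
    ones; with the linear term in \<open>Z\<close> the errors telescope along with |n_3|.\<close>
  proof (rule Bolzano[where P = "%a b. 1 <= a --> ennreal (Z b - Z a) <= I {a<..b}"])
   fix a b c assume *: "1 <= a --> ennreal (Z b - Z a) <= I {a<..b}" "1 <= b --> ennreal (Z c - Z b) <= I {b<..c}" "a <= b" "b <= c"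
   show "1 <= a --> ennreal (Z c - Z a) <= I {a<..c}"
   proof
    assume "1 <= a"
    hence "ennreal (Z b - Z a) + ennreal (Z c - Z b) <= I {a<..c}" unfolding I_Un[OF *(3,4)] using * by (intro add_mono) auto
    from order_trans[OF ennreal_add_le this] show "ennreal (Z c - Z a) <= I {a<..c}" by simp
   qed
  next
   fix x :: real
   obtain d where d: "0 < d" "!!r. \<bar>r - x\<bar> < d ==> \<bar>gam r - gam x\<bar> < om/2"
    using cgam[of UNIV] half_gt_zero[OF om] unfolding continuous_on_iff dist_real_def by blast
   have "ennreal (Z b - Z a) <= I {a<..b}" if ab: "a <= x" "x <= b" "b - a < d" "1 <= a" for a b
   proof (cases "a < b")
    case True
    have "gam a <= gam r + om" if "a <= r" "r <= b" for r using d(2)[of a] d(2)[of r] that ab by (smt (verit) field_sum_of_halves)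
    from step[OF ab(4) True this om] show ?thesis by (simp add: Z_def algebra_simps)
   next
    case False
    hence "a = b" using ab by simp
    thus ?thesis by simp
   qed
   thus "EX d>0. ALL a b. a <= x & x <= b & b - a < d --> 1 <= a --> ennreal (Z b - Z a) <= I {a<..b}" using d(1) by blast
  qed (use T in simp)
  moreover have "om * (T - 1) = e" using T by (simp add: om_def)
  hence "Z T - Z 1 = 2 * sqrt k0 * (\<bar>n T $ 3\<bar> - \<bar>n 1 $ 3\<bar>) - e" by (simp add: Z_def algebra_simps)
  ultimately have "ennreal (2 * sqrt k0 * (\<bar>n T $ 3\<bar> - \<bar>n 1 $ 3\<bar>) - e) <= I {1<..T}" by simp
  also have "I {1<..T} <= I {1<..}" unfolding I_def
   by (intro add_mono mult_left_mono nn_integral_mono) (auto simp: indicator_def)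
  finally have *: "ennreal (2 * sqrt k0 * (\<bar>n T $ 3\<bar> - \<bar>n 1 $ 3\<bar>) - e) <= I {1<..}" .
  have "ennreal (2 * sqrt k0 * (\<bar>n T $ 3\<bar> - \<bar>n 1 $ 3\<bar>)) <= ennreal (2 * sqrt k0 * (\<bar>n T $ 3\<bar> - \<bar>n 1 $ 3\<bar>) - e) + ennreal e"
   using ennreal_add_le[of "2 * sqrt k0 * (\<bar>n T $ 3\<bar> - \<bar>n 1 $ 3\<bar>) - e" e] by simp
  also have "... <= I {1<..} + ennreal e" using * by (rule add_right_mono)
  finally show "ennreal (2 * sqrt k0 * (\<bar>n T $ 3\<bar> - \<bar>n 1 $ 3\<bar>)) <= I {1<..} + ennreal e" .
 qed
 have "ennreal (2 * sqrt k0 * (1 - \<bar>n 1 $ 3\<bar>)) <= I {1<..}"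
 proof (rule ennreal_le_epsilon)
  fix e :: real assume fin: "I {1<..} < top" and e: "0 < e"
  define eps where "eps = e / (2 * sqrt k0)"
  have eps: "0 < eps" using e k0 by (simp add: eps_def)
  \<comment> \<open>If gam stayed above k0 * eps, its integral over the half-line would be infinite;
    so the director comes close to the axis somewhere.\<close>
  have "EX T>1. gam T < k0 * eps"
  proof (rule ccontr)
   assume "~ (EX T>1. gam T < k0 * eps)"
   hence ge: "k0 * eps <= gam r" if "1 < r" for r using that by (meson not_less)
   have "(LI r. ennreal (k0 * eps) * indicator {1::real<..} r) <= (LI r:{1<..}. ennreal (gam r))"
    by (intro nn_integral_mono) (auto simp: indicator_def intro!: ennreal_leI ge)
   also have "... <= I {1<..}" by (simp add: I_def)
   also have "(LI r. ennreal (k0 * eps) * indicator {1::real<..} r) = ennreal (k0 * eps) * emeasure lborel {1::real<..}"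
    by (rule nn_integral_cmult_indicator) simp
   also have "emeasure lborel {1::real<..} = \<infinity>"
   proof -
    have "ennreal (real m) <= emeasure lborel {1::real<..}" for m :: nat
    proof -
     have "emeasure lborel {1<..1 + real m} <= emeasure lborel {1::real<..}" by (rule emeasure_mono) auto
     thus ?thesis by simp
    qed
    thus ?thesis by (metis ennreal_Ex_less_of_nat ennreal_of_nat_eq_real_of_nat infinity_ennreal_def leD top.not_eq_extremum)
   qed
   finally show False using fin k0 eps by (simp add: ennreal_mult_top)
  qed
  then obtain T where T: "1 < T" "gam T < k0 * eps" by blast
  have "1 - (n T $ 3)^2 < eps" using T gam1[of T] k0 by simp
  moreover have "(n T $ 3)^2 <= \<bar>n T $ 3\<bar>"
  proof -
   have "\<bar>n T $ 3\<bar> <= 1" using n3[of T] T by (simp add: abs_square_le_1)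
   hence "\<bar>n T $ 3\<bar> * \<bar>n T $ 3\<bar> <= 1 * \<bar>n T $ 3\<bar>" by (rule mult_right_mono) simp
   thus ?thesis by (simp add: power2_eq_square abs_mult[symmetric])
  qed
  ultimately have "2 * sqrt k0 * (1 - \<bar>n 1 $ 3\<bar>) <= 2 * sqrt k0 * (\<bar>n T $ 3\<bar> - \<bar>n 1 $ 3\<bar> + eps)"
   using k0 by (intro mult_left_mono) auto
  also have "... = 2 * sqrt k0 * (\<bar>n T $ 3\<bar> - \<bar>n 1 $ 3\<bar>) + e" using k0 by (simp add: eps_def field_simps)
  finally have "ennreal (2 * sqrt k0 * (1 - \<bar>n 1 $ 3\<bar>)) <= ennreal (2 * sqrt k0 * (\<bar>n T $ 3\<bar> - \<bar>n 1 $ 3\<bar>) + e)" by (rule ennreal_leI)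
  also have "... <= ennreal (2 * sqrt k0 * (\<bar>n T $ 3\<bar> - \<bar>n 1 $ 3\<bar>)) + ennreal e" by (rule ennreal_add_le)
  also have "... <= I {1<..} + ennreal e" by (rule add_right_mono[OF main[OF T(1)]])
  finally show "ennreal (2 * sqrt k0 * (1 - \<bar>n 1 $ 3\<bar>)) <= I {1<..} + ennreal e" .
 qed
 also have "I {1<..} <= ennreal (1/2) * (LI x. w x) + (LI r:{1<..}. ennreal (g_pot (P r)))"
  unfolding I_def by (intro add_mono mult_left_mono nn_integral_mono) (auto simp: indicator_def gamg)
 finally show ?thesis .
qed

text \<open>Profiles of finite energy satisfy f = 0 almost everywhere, hence on all of
  [1,\<infinity>) by continuity, and so have a director at every point.\<close>

lemma D_infinity_ge:
 assumes m: "norm m = 1" shows "ennreal (2 * sqrt k0 * (1 - \<bar>m $ 3\<bar>)) <= D \<infinity> (uniaxial m)"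
 unfolding D_def
proof (rule INF_greatest)
 fix P assume P: "P : profiles (uniaxial m)"
 show "ennreal (2 * sqrt k0 * (1 - \<bar>m $ 3\<bar>)) <= F_energy \<infinity> P"
 proof (cases "AE r in lebesgue_on {1<..}. f_pot (P r) = 0")
  case True
  obtain P' w where pd: "prof_data P' w" and PP: "!!r. 1 <= r ==> P' r = P r"
   and int: "!!phi :: real^3^3 => real. phi : borel_measurable borel ==> (!!Q. Q : S0 ==> 0 <= phi Q) ==>
   (LL r:{1<..}. ennreal (1/2 * nsq (weak_deriv {1<..} 1 P r) + phi (P r)))
    = ennreal (1/2) * (LI x. w x) + (LI r:{1<..}. ennreal (phi (P' r)))"
   using profiles_data[OF P] by blast
  have cP: "continuous_on UNIV P'" and S: "!!r. P' r : S0" using pd by (auto simp: prof_data_def)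
  let ?C = "{r. f_pot (P' r) = 0}"
  have cl: "closed ?C"
   by (intro closed_Collect_eq continuous_on_compose2[OF continuous_f_pot[of UNIV] cP] continuous_on_const) auto
  have "AE r in lebesgue. r : {1<..} --> f_pot (P r) = 0"
   using True by (subst (asm) AE_restrict_space_iff) auto
  hence "AE r\<in>{1<..} in lebesgue. r : ?C" by (rule AE_mp) (simp add: PP)
  hence "{1<..} <= ?C" using mem_closed_if_AE_lebesgue_open[OF open_greaterThan cl] by blast
  hence "closure {1<..} <= ?C" by (rule closure_minimal[OF _ cl])
  hence f0: "f_pot (P' r) = 0" if "1 <= r" for r using that by auto
  have "EX n. norm n = 1 & P' r = uniaxial n" if "1 <= r" for r
   using f_pot_0_uniaxial[OF S f0[OF that]] by metis
  then obtain n where n: "!!r. 1 <= r ==> norm (n r) = 1" "!!r. 1 <= r ==> P' r = uniaxial (n r)" by metis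
  have "uniaxial (n 1) = uniaxial m" using n(2)[of 1] PP[of 1] P by (simp add: profiles_def)
  hence "uniaxial (n 1) $ 3 $ 3 = uniaxial m $ 3 $ 3" by simp
  \<comment> \<open>Opposite vectors give the same tensor, so m_3 is recovered up to sign.\<close>
  hence "\<bar>n 1 $ 3\<bar> = \<bar>m $ 3\<bar>" by (simp add: uniaxial_def mat_def) (metis abs_mult_self_eq real_sqrt_abs2)
  hence "ennreal (2 * sqrt k0 * (1 - \<bar>m $ 3\<bar>)) <= ennreal (1/2) * (LI x. w x) + (LI r:{1<..}. ennreal (g_pot (P' r)))"
   using modica_mortola[OF pd n] by simp
  also have "... = F_energy \<infinity> P"
   using int[of g_pot] g_pot_nonneg True by (simp add: F_energy_def)
  finally show ?thesis .
 qed (simp add: F_energy_def)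
qed

section \<open>The uniaxial recovery sequence\<close>

lemma norm_add_square_split:
 fixes a b :: "'a::real_inner"
 assumes "0 < nu" shows "nsq (a + b) <= (1 + nu) * nsq a + (1 + 1/nu) * nsq b"
proof -
 have "0 <= (nu * norm a - norm b)^2" by simp
 hence "2 * nu * (norm a * norm b) <= nu^2 * nsq a + nsq b" by (simp add: power2_diff power_mult_distrib)
 hence "2 * (norm a * norm b) <= nu * nsq a + (1/nu) * nsq b" using assms by (simp add: field_simps power2_eq_square)
 moreover have "nsq (a + b) <= (norm a + norm b)^2" by (intro power_mono norm_triangle_ineq) auto
 ultimately show ?thesis by (simp add: power2_sum algebra_simps)
qed

text \<open>The squared components of x/|x| sum to 1, so the radial part contributes the square of
  A. It alone carries 1/eta; Young's inequality with small nu keeps its factor near 1 and leaves a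
  multiple of eta^2 for the rest.\<close>

lemma sum_radial_split:
 fixes A :: "'b::real_inner" and B :: "'a::euclidean_space => 'b" and x :: 'a
 assumes x: "x ~= 0" and nu: "0 < nu" and eta: "0 < eta" and B: "!!e. e : Basis ==> nsq (B e) <= b"
 shows "eta^2 * (SUM e:Basis. nsq ((e \<bullet> sgn x) *R ((1/eta) *R A) + B e))
  <= (1 + nu) * nsq A + (1 + 1/nu) * eta^2 * (real DIM('a) * b)"
proof -
 have s: "(SUM e:Basis. (e \<bullet> sgn x)^2) = 1"
 proof -
  have "nsq (sgn x) = (SUM e:Basis. (e \<bullet> sgn x)^2)"
   unfolding power2_norm_eq_inner euclidean_inner[of "sgn x" "sgn x"] by (simp add: inner_commute power2_eq_square)
  thus ?thesis using x by (simp add: norm_sgn)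
 qed
 have "(SUM e:Basis. nsq ((e \<bullet> sgn x) *R ((1/eta) *R A) + B e))
   <= (SUM e:Basis. (1 + nu) * ((e \<bullet> sgn x)^2 * (nsq A / eta^2)) + (1 + 1/nu) * b)"
 proof (rule sum_mono)
  fix e :: 'a assume e: "e : Basis"
  have "nsq ((e \<bullet> sgn x) *R ((1/eta) *R A)) = (e \<bullet> sgn x)^2 * (nsq A / eta^2)"
   by (simp add: power_mult_distrib power_divide)
  thus "nsq ((e \<bullet> sgn x) *R ((1/eta) *R A) + B e) <= (1 + nu) * ((e \<bullet> sgn x)^2 * (nsq A / eta^2)) + (1 + 1/nu) * b"
   using norm_add_square_split[OF nu, of "(e \<bullet> sgn x) *R ((1/eta) *R A)" "B e"] mult_left_mono[OF B[OF e], of "1 + 1/nu"] nu by simp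
 qed
 also have "... = (1 + nu) * (nsq A / eta^2) + real DIM('a) * ((1 + 1/nu) * b)"
  unfolding sum.distrib sum_distrib_left[symmetric] sum_distrib_right[symmetric] s by simp
 finally have "eta^2 * (SUM e:Basis. nsq ((e \<bullet> sgn x) *R ((1/eta) *R A) + B e))
   <= eta^2 * ((1 + nu) * (nsq A / eta^2) + real DIM('a) * ((1 + 1/nu) * b))" by (rule mult_left_mono) simp
 also have "... = (1 + nu) * nsq A + (1 + 1/nu) * eta^2 * (real DIM('a) * b)"
  using eta by (simp add: field_simps)
 finally show ?thesis .
qed

lemma C1_on_norm: "C1_on (- {0}) (norm :: 'a::euclidean_space => real) (%x e. e \<bullet> sgn x)"
proof (rule C1_onI)
 fix x :: 'a assume "x : - {0}" thus "(norm has_derivative (%e. e \<bullet> sgn x)) (at x)" by (intro has_derivative_norm) auto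
next
 fix e :: 'a show "continuous_on (- {0}) (%x. e \<bullet> sgn x)"
  by (intro continuous_on_inner continuous_on_const continuous_on_sgn continuous_on_id) auto
qed

lemma C1_on_radial:
 fixes h :: "real => 'b::euclidean_space"
 assumes h: "!!s. (h has_vector_derivative h' s) (at s)" "continuous_on UNIV h'"
 shows "C1_on (- {0}) (%x::'a::euclidean_space. h (1 + (norm x - 1) / eta)) (%x e. (e \<bullet> sgn x) *R ((1/eta) *R h' (1 + (norm x - 1) / eta)))"
proof (rule C1_on_curve[OF C1_on_norm, of UNIV])
 fix r :: real
 have "((%r. 1 + (r - 1) / eta) has_vector_derivative (1/eta)) (at r)"
  unfolding has_real_derivative_iff_has_vector_derivative[symmetric] divide_inverse by (auto intro!: derivative_eq_intros)
 from vector_diff_chain_at[OF this h(1)]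
 show "((%r. h (1 + (r - 1) / eta)) has_vector_derivative (1/eta) *R h' (1 + (r - 1) / eta)) (at r)" by (simp add: o_def)
next
 have "continuous_on UNIV (%r. 1 + (r - 1) * inverse eta)" by (intro continuous_intros)
 hence "continuous_on UNIV (%r. h' (1 + (r - 1) * inverse eta))" by (rule continuous_on_compose2[OF h(2)]) simp
 thus "continuous_on UNIV (%r. (1/eta) *R h' (1 + (r - 1) / eta))" by (intro continuous_on_scaleR continuous_on_const) (simp add: divide_inverse)
qed simp

lemma Om1_nonzero: "Om1 <= - {0}" by (auto simp: Om1_def hp_def)

lemma closure_Omega_subset_Om1: "closure Omega - {e3, - e3} <= Om1"
proof
 fix x assume "x : closure Omega - {e3, - e3}"
 hence x: "1 <= norm x" "x ~= e3" "x ~= - e3" by (auto simp: closure_Omega)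
 show "x : Om1"
 proof (cases "rad x = 0")
  case True
  hence e: "x = (x$3) *R e3" using rad_eq_0_iff by blast
  have "norm x = \<bar>x$3\<bar>" by (subst e) simp
  moreover have "\<bar>x$3\<bar> ~= 1"
  proof
   assume "\<bar>x$3\<bar> = 1"
   hence "x$3 = 1 | x$3 = -1" by linarith
   thus False using e x by (metis scaleR_minus1_left scaleR_one)
  qed
  ultimately show ?thesis using x True by (simp add: Om1_def)
 qed (simp add: Om1_def)
qed

lemma e3_poles: "norm om = 1 ==> om ~= e3 ==> om ~= - e3 ==> 0 < rad om"
proof -
 assume o: "norm om = 1" "om ~= e3" "om ~= - e3"
 hence "om : Om1" by (intro subsetD[OF closure_Omega_subset_Om1]) (simp add: closure_Omega)
 hence "0 < rad om | 2 * rad om < norm om - 1" by (simp only: Om1_def Un_iff mem_Collect_eq)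
 thus "0 < rad om" using norm_ge_zero[of "hp om"] o(1) by linarith
qed

lemma norm_e_phi: "norm (e_phi om) = 1"
proof -
 define a t where "a = arccos (om $ 3)" and "t = Arg2pi (Complex (om $ 1) (om $ 2))"
 have "e_phi om \<bullet> e_phi om = (cos a * cos t)^2 + (cos a * sin t)^2 + (sin a)^2"
  by (simp add: e_phi_def Let_def a_def t_def inner_vec_def sum_3 power2_eq_square)
 also have "... = (cos a)^2 * ((cos t)^2 + (sin t)^2) + (sin a)^2" by (simp only: power_mult_distrib distrib_left)
 also have "... = 1" by simp
 finally show ?thesis by (simp only: norm_eq_1)
qed

lemma norm_uniaxial_diff_le: assumes "norm a = 1" shows "norm (uniaxial a - Q_inf) <= 2"
proof -
 have "norm (uniaxial a) <= 1" by (rule power2_le_imp_le) (simp_all add: norm_uniaxial[OF assms])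
 moreover have "norm Q_inf <= 1" by (rule power2_le_imp_le) (simp_all add: norm_Q_inf2)
 ultimately show ?thesis using norm_triangle_ineq4[of "uniaxial a" Q_inf] by linarith
qed

section \<open>Exponential profiles in stereographic coordinates\<close>

lemma stereo_0: "uniaxial (stereo 0) = Q_inf"
 by (simp add: stereo_def Q_inf_def uniaxial_def vec_eq_iff)

lemma g_pot_stereo:
 assumes "w \<bullet> e3 = 0" shows "g_pot (uniaxial (stereo w)) = 4 * k0 * nsq w / (1 + w \<bullet> w)^2"
proof -
 define t where "t = w \<bullet> w"
 have t: "0 <= t" by (simp add: t_def)
 have w3: "w $ 3 = 0" using assms by (simp add: inner_axis)
 have "stereo w $ 3 = (t - 1) / (1 + t)" by (simp add: stereo_def w3 t_def[symmetric] divide_inverse)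
 moreover have "1 - ((t - 1) / (1 + t))^2 = 4 * t / (1 + t)^2"
 proof -
  have "1 - ((t - 1) / (1 + t))^2 = ((1 + t)^2 - (t - 1)^2) / (1 + t)^2"
   unfolding power_divide diff_divide_distrib[of "(1 + t)^2" "(t - 1)^2" "(1 + t)^2"] using t by simp
  also have "(1 + t)^2 - (t - 1)^2 = 4 * t" by (simp add: power2_eq_square algebra_simps)
  finally show ?thesis .
 qed
 ultimately show ?thesis unfolding g_pot_uniaxial[OF norm_stereo[OF assms]]
  by (simp add: k0_def t_def[symmetric] power2_norm_eq_inner)
qed

text \<open>A path w(s) of coordinates has energy density 4 (|w'|^2 + k0 |w|^2) / (1 + |w|^2)^2,
  whose two parts balance if |w'| = sqrt k0 |w|. This is the case of equality in Young's inequality;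
  the second factor makes the profile vanish from L + 1 on.\<close>

definition prof :: "real => real => real" where "prof L s = exp (- sqrt k0 * (s - 1)) * (1 - step (s - L))"

definition prof' :: "real => real => real" where
 "prof' L s = - sqrt k0 * exp (- sqrt k0 * (s - 1)) * (1 - step (s - L)) - exp (- sqrt k0 * (s - 1)) * step' (s - L)"

lemma prof_deriv: "(prof L has_vector_derivative prof' L s) (at s)"
proof -
 have "((%s. step (s - L)) has_real_derivative step' (s - L)) (at s)"
 proof -
  have "((%s. s - L) has_real_derivative 1) (at s)" by (auto intro!: derivative_eq_intros)
  from DERIV_chain'[OF this step_deriv] show ?thesis by simp
 qed
 hence "(prof L has_real_derivative prof' L s) (at s)"
  unfolding prof_def[abs_def] prof'_def by (auto intro!: derivative_eq_intros simp: algebra_simps)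
 thus ?thesis by (simp add: has_real_derivative_iff_has_vector_derivative)
qed

lemma continuous_prof': "continuous_on UNIV (prof' L)"
proof -
 have "continuous_on UNIV (%s. step (s - L))" "continuous_on UNIV (%s. step' (s - L))"
  by (rule continuous_on_compose2[OF continuous_step[of UNIV]] continuous_on_compose2[OF continuous_step'[of UNIV]]; auto intro!: continuous_intros)+
 thus ?thesis unfolding prof'_def[abs_def] by (intro continuous_intros)
qed

lemma prof_bounds:
 assumes "1 <= s" shows "0 <= prof L s" "prof L s <= exp (- sqrt k0 * (s - 1))" "prof L s <= 1"
  "\<bar>prof' L s\<bar> <= (sqrt k0 + 3/2) * exp (- sqrt k0 * (s - 1))" "\<bar>prof' L s\<bar> <= sqrt k0 + 3/2"
proof -
 let ?E = "exp (- sqrt k0 * (s - 1))"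
 have E: "0 < ?E" "?E <= 1" using assms k0 by auto
 show 0: "0 <= prof L s" using step_bounds[of "s - L"] by (simp add: prof_def)
 show 1: "prof L s <= ?E" unfolding prof_def using step_bounds[of "s - L"] by (intro mult_left_le) auto
 thus "prof L s <= 1" using E by linarith
 have "sqrt k0 * ?E * (1 - step (s - L)) <= sqrt k0 * ?E" using step_bounds[of "s - L"] k0 by (intro mult_left_le) auto
 moreover have "?E * step' (s - L) <= ?E * (3/2)" using step'_bounds[of "s - L"] by (intro mult_left_mono) auto
 moreover have "0 <= sqrt k0 * ?E * (1 - step (s - L))" "0 <= ?E * step' (s - L)"
  using step_bounds[of "s - L"] step'_bounds[of "s - L"] k0 by auto
 moreover have "prof' L s = - (sqrt k0 * ?E * (1 - step (s - L))) - ?E * step' (s - L)" by (simp add: prof'_def)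
 moreover have "(sqrt k0 + 3/2) * ?E = sqrt k0 * ?E + ?E * (3/2)" by (simp only: distrib_right mult.commute[of ?E "3/2"])
 ultimately show 2: "\<bar>prof' L s\<bar> <= (sqrt k0 + 3/2) * ?E" by linarith
 have "(sqrt k0 + 3/2) * ?E <= sqrt k0 + 3/2" using E k0 by (intro mult_left_le) auto
 thus "\<bar>prof' L s\<bar> <= sqrt k0 + 3/2" using 2 by linarith
qed

text \<open>T stands for the squared length of the coordinate that the profile multiplies.\<close>

definition Hinf :: "real => real => real => real" where
 "Hinf L T s = 4 * T * ((prof' L s)^2 + k0 * (prof L s)^2) / (1 + T * (prof L s)^2)^2"

lemma continuous_prof: "continuous_on UNIV (prof L)"
 by (intro continuous_at_imp_continuous_on ballI has_vector_derivative_continuous[OF prof_deriv])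

lemma Hinf_measurable [measurable]: "Hinf L T : borel_measurable borel"
 using borel_measurable_continuous_onI[OF continuous_prof'] borel_measurable_continuous_onI[OF continuous_prof]
 unfolding Hinf_def[abs_def] by measurable

lemma Hinf_nonneg: "0 <= T ==> 0 <= Hinf L T s" using k0 by (simp add: Hinf_def)

text \<open>T / (1 + T G)^2 increases in T as long as T G <= 1. Since all coordinates lie in the
  unit disc, fading \<open>W\<close> out only lowers the bound, and one T serves a whole latitude
  ring.\<close>

lemma Hinf_mono:
 assumes "0 <= t" "t <= T" "T <= 1" "1 <= s" shows "Hinf L t s <= Hinf L T s"
proof -
 define G where "G = (prof L s)^2"
 have G: "0 <= G" "G <= 1" using prof_bounds(1,3)[OF assms(4), of L] by (auto simp: G_def power_le_one)
 have "t * (1 + T * G)^2 <= T * (1 + t * G)^2"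
 proof -
  have "T * t * G^2 <= 1 * 1" using assms G by (intro mult_mono mult_le_one power_le_one) auto
  hence "0 <= (T - t) * (1 - T * t * G^2)" using assms by (intro mult_nonneg_nonneg) auto
  thus ?thesis by (simp add: power2_eq_square algebra_simps)
 qed
 hence "t / (1 + t * G)^2 <= T / (1 + T * G)^2"
  using assms G by (simp add: divide_le_eq le_divide_eq add_nonneg_pos field_simps) (smt (verit, best) G(1) assms(1) assms(2) mult_nonneg_nonneg zero_less_power)
 hence "4 * ((prof' L s)^2 + k0 * G) * (t / (1 + t * G)^2) <= 4 * ((prof' L s)^2 + k0 * G) * (T / (1 + T * G)^2)"
  using k0 G by (intro mult_left_mono) auto
 thus ?thesis unfolding Hinf_def G_def by (simp add: mult_ac)
qed

text \<open>\<open>A\<close> is a primitive of the density \<open>f\<close> without cutoff, whose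
  integral is at most 4 sqrt k0 T / (1 + T). For T = (1 - rho) / (1 + rho) this is 2 sqrt k0 (1 -
  rho), the value in \<open>D_infinity_ge\<close>. The exponential remainder comes from
  [L,L+1].\<close>

lemma Hinf_integral:
 assumes T: "0 <= T" "T <= 1" and L: "1 <= L"
 shows "(LI s:{1<..}. ennreal (Hinf L T s * indicator {..L + 1} s))
  <= ennreal (4 * sqrt k0 * (T / (1 + T)) + 4 * ((sqrt k0 + 3/2)^2 + k0) * exp (- 2 * sqrt k0 * (L - 1)))"
proof -
 define kappa where "kappa = sqrt k0"
 have kappa: "0 < kappa" "kappa^2 = k0" using k0 by (auto simp: kappa_def)
 define E where "E s = exp (- kappa * (s - 1))" for s
 define f where "f s = 8 * k0 * T * (E s)^2 / (1 + T * (E s)^2)^2" for s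
 define A where "A s = - 4 * kappa * (T * (E s)^2 / (1 + T * (E s)^2))" for s
 define c where "c = 4 * ((kappa + 3/2)^2 + k0) * exp (- 2 * kappa * (L - 1))"
 have pos: "0 < 1 + T * (E s)^2" for s using T by (simp add: add_pos_nonneg)
 have cE: "continuous_on UNIV E" unfolding E_def[abs_def] by (intro continuous_intros)
 have fm: "f : borel_measurable borel"
  unfolding f_def[abs_def] by (intro borel_measurable_continuous_onI continuous_intros cE) (use pos in "auto simp: less_imp_neq[symmetric] dest: less_imp_neq")
 have c0: "0 <= c" using k0 by (simp add: c_def)
 have f0: "0 <= f s" for s using T k0 by (simp add: f_def)
 have le: "ennreal (Hinf L T s * indicator {..L + 1} s) * indicator {1<..} s <= ennreal (f s) * indicator {1..L} s + ennreal c * indicator {L..L+1} s" for s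
 proof -
  consider "s <= 1 | L + 1 < s" | "1 < s" "s <= L" | "1 < s" "L < s" "s <= L + 1" by linarith
  thus ?thesis
  proof cases
   case 2
   have p: "prof L s = E s" "prof' L s = - kappa * E s" using 2 by (simp_all add: prof_def prof'_def step_eq E_def kappa_def)
   have "Hinf L T s = f s" unfolding Hinf_def f_def p by (simp add: power_mult_distrib kappa(2))
   thus ?thesis using 2 by (auto simp: indicator_def)
  next
   case 3
   have gen: "4 * 1 * ((a * e)^2 + k0 * e^2) = 4 * (a^2 + k0) * e^2" for a e :: real
    by (simp add: power_mult_distrib algebra_simps)
   have EL: "E s <= E L" using 3 kappa by (simp add: E_def)
   have E0: "0 < E s" by (simp add: E_def)
   have "(prof' L s)^2 <= ((kappa + 3/2) * E L)^2"
   proof (rule abs_le_square_iff[THEN iffD1])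
    have "\<bar>prof' L s\<bar> <= (kappa + 3/2) * E s" using prof_bounds(4)[of s L] 3 by (simp add: kappa_def E_def)
    also have "... <= (kappa + 3/2) * E L" using EL kappa by (intro mult_left_mono) auto
    finally show "\<bar>prof' L s\<bar> <= \<bar>(kappa + 3/2) * E L\<bar>" by simp
   qed
   moreover have "(prof L s)^2 <= (E L)^2"
   proof (rule power_mono)
    have "prof L s <= E s" unfolding E_def kappa_def using prof_bounds(2)[of s L] 3 by simp
    thus "prof L s <= E L" using EL by (rule order_trans)
    show "0 <= prof L s" using prof_bounds(1)[of s L] 3 by simp
   qed
   ultimately have X: "4 * T * ((prof' L s)^2 + k0 * (prof L s)^2) <= 4 * 1 * (((kappa + 3/2) * E L)^2 + k0 * (E L)^2)"
    using T k0 by (intro mult_mono add_mono mult_left_mono) auto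
   have E2: "(E L)^2 = exp (- 2 * kappa * (L - 1))" unfolding E_def by (simp add: power2_eq_square exp_add[symmetric] algebra_simps)
   have n: "4 * T * ((prof' L s)^2 + k0 * (prof L s)^2) <= c"
    by (rule X[unfolded gen, unfolded E2, folded c_def])
   have pp: "0 < 1 + T * (prof L s)^2" using T by (simp add: add_pos_nonneg)
   have "1^2 <= (1 + T * (prof L s)^2)^2" using T by (intro power_mono) auto
   hence "4 * T * ((prof' L s)^2 + k0 * (prof L s)^2) / (1 + T * (prof L s)^2)^2 <= 4 * T * ((prof' L s)^2 + k0 * (prof L s)^2) / 1"
    using T k0 pp by (intro divide_left_mono) auto
   hence "Hinf L T s <= 4 * T * ((prof' L s)^2 + k0 * (prof L s)^2)" by (simp only: Hinf_def div_by_1)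
   hence "ennreal (Hinf L T s) <= ennreal c" using n by (intro ennreal_leI) linarith
   thus ?thesis using 3 by (auto simp: indicator_def add_increasing)
  qed (auto simp: indicator_def)
 qed
 have "(LI s:{1<..}. ennreal (Hinf L T s * indicator {..L + 1} s)) <= (LI s. ennreal (f s) * indicator {1..L} s + ennreal c * indicator {L..L+1} s)"
  by (intro nn_integral_mono le)
 also have "... = (LI s. ennreal (f s) * indicator {1..L} s) + (LI s. ennreal c * indicator {L..L+1} s)"
  using fm by (intro nn_integral_add) auto
 also have "(LI s. ennreal c * indicator {L..L+1} s) = ennreal c" by (simp add: nn_integral_cmult_indicator)
 also have "(LI s. ennreal (f s) * indicator {1..L} s) = ennreal (A L - A 1)"
 proof -
  have "(A has_real_derivative f s) (at s)" for s
  proof -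
  have dE: "((%s. (E s)^2) has_real_derivative (- 2 * kappa * (E s)^2)) (at s)"
   unfolding E_def by (auto intro!: derivative_eq_intros simp: power2_eq_square)
  have "((%s. T * (E s)^2 / (1 + T * (E s)^2)) has_real_derivative
    ((T * (- 2 * kappa * (E s)^2)) * (1 + T * (E s)^2) - T * (E s)^2 * (T * (- 2 * kappa * (E s)^2))) / ((1 + T * (E s)^2) * (1 + T * (E s)^2))) (at s)"
  proof (rule DERIV_divide)
   show d1: "((%s. T * (E s)^2) has_real_derivative T * (- 2 * kappa * (E s)^2)) (at s)" by (rule DERIV_cmult[OF dE])
   show "((%s. 1 + T * (E s)^2) has_real_derivative T * (- 2 * kappa * (E s)^2)) (at s)" using DERIV_add[OF DERIV_const d1] by simp
   show "1 + T * (E s)^2 ~= 0" using pos[of s] by simp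
  qed
  from DERIV_cmult[OF this, of "- 4 * kappa"]
  have "(A has_real_derivative - 4 * kappa * (((T * (- 2 * kappa * (E s)^2)) * (1 + T * (E s)^2) - T * (E s)^2 * (T * (- 2 * kappa * (E s)^2))) / ((1 + T * (E s)^2) * (1 + T * (E s)^2)))) (at s)"
   by (simp add: A_def[abs_def])
  moreover have "- 4 * kappa * (((T * (- 2 * kappa * (E s)^2)) * (1 + T * (E s)^2) - T * (E s)^2 * (T * (- 2 * kappa * (E s)^2))) / ((1 + T * (E s)^2) * (1 + T * (E s)^2))) = f s"
   unfolding f_def kappa(2)[symmetric] by (simp add: power2_eq_square algebra_simps)
  ultimately show ?thesis by simp
  qed
  thus ?thesis using f0 L by (intro nn_integral_FTC_Icc[OF fm]) (auto intro: has_field_derivative_at_within)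
 qed
 also have "ennreal (A L - A 1) <= ennreal (4 * kappa * (T / (1 + T)))"
 proof (rule ennreal_leI)
  have "A L <= 0" using kappa T pos[of L] by (simp add: A_def)
  moreover have "A 1 = - 4 * kappa * (T / (1 + T))" by (simp add: A_def E_def)
  ultimately show "A L - A 1 <= 4 * kappa * (T / (1 + T))" by simp
 qed
 finally have "(LI s:{1<..}. ennreal (Hinf L T s * indicator {..L + 1} s)) <= ennreal (4 * kappa * (T / (1 + T))) + ennreal c"
  by (simp add: add_right_mono)
 also have "... = ennreal (4 * kappa * (T / (1 + T)) + c)" using kappa T c0 by (intro ennreal_plus[symmetric]) auto
 finally show ?thesis by (simp only: kappa_def c_def)
qed

lemma norm_w0_square: assumes "norm om = 1" "0 < rad om" shows "nsq (w0 om) = (1 - rad om) / (1 + rad om)"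
proof -
 have "(om$3)^2 = (1 - rad om) * (1 + rad om)" using rad_eq(2)[of om] assms(1) by (simp add: power2_eq_square algebra_simps)
 thus ?thesis using assms(2) by (simp add: norm_w0[OF assms(2)] assms(1) power_divide) (simp add: power2_eq_square)
qed

lemma nn_integral_kap: obtains i0 where "0 <= i0" "(LI x:ball 0 2. ennreal (kap x)) = ennreal i0"
 using nn_integral_kap_finite by (cases "LI x:ball 0 2. ennreal (kap x)") auto

section \<open>The poles as a null set\<close>

lemma borel_poles: "{om : sphere 0 1. rad om = 0} : sets borel"
proof -
 have "closed (sphere 0 1 Int {om. rad om = 0})"
  by (intro closed_Int closed_sphere closed_Collect_eq continuous_rad continuous_on_const)
 moreover have "{om : sphere 0 1. rad om = 0} = sphere 0 1 Int {om. rad om = 0}" by blast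
 ultimately show ?thesis by (simp only: borel_closed)
qed

lemma sph_poles: "emeasure sph {om : sphere 0 1. rad om = 0} = 0"
proof -
 let ?Z = "{om : sphere 0 1. rad om = 0}"
 have Z: "?Z : sets borel" by (rule borel_poles)
 have "negligible {x :: real^3. x \<bullet> axis 1 1 = 0}" by (rule negligible_standard_hyperplane) (simp add: axis_in_Basis_iff)
 moreover have "{x : ball 0 1. sgn x : ?Z} <= {x :: real^3. x \<bullet> axis 1 1 = 0}"
 proof
  fix x assume "x : {x : ball 0 1. sgn x : ?Z}"
  hence "rad (sgn x) = 0" "x ~= 0" by auto
  hence "rad x = 0" by (simp add: sgn_div_norm hp_scaleR)
  hence "x $ 1 = 0" using hp_nth(1)[of x] by simp
  thus "x : {x. x \<bullet> axis 1 1 = 0}" by (simp add: inner_axis)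
 qed
 ultimately have "negligible {x : ball 0 1. sgn x : ?Z}" by (rule negligible_subset)
 hence N: "{x : ball 0 1. sgn x : ?Z} : null_sets lebesgue" by (simp only: negligible_iff_null_sets)
 have "{x : ball 0 1. sgn x : ?Z} : sets lborel" unfolding sets_lborel by (rule borel_cone_ball[OF Z])
 hence "{x : ball 0 1. sgn x : ?Z} : null_sets lborel" using N by (simp only: null_sets_completion_iff)
 hence "emeasure lborel {x : ball 0 1. sgn x : ?Z} = 0" by (rule null_setsD1)
 thus ?thesis unfolding emeasure_sph[OF Z] by (simp only: mult_zero_right)
qed

lemma e_phi_3: assumes "norm om = 1" shows "\<bar>e_phi om $ 3\<bar> = rad om"
proof -
 have "\<bar>om$3\<bar> <= 1" using component_le_norm_cart[of om 3] assms by simp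
 hence "sin (arccos (om$3)) = sqrt (1 - (om$3)^2)" by (intro sin_arccos) auto
 moreover have "1 - (om$3)^2 = (rad om)^2" using rad_eq(2)[of om] assms by simp
 ultimately show ?thesis by (simp add: e_phi_def Let_def)
qed

lemma prof_outside: assumes "L + 1 <= s" shows "prof L s = 0" "prof' L s = 0" "Hinf L T s = 0"
 using assms by (simp_all add: prof_def prof'_def Hinf_def step_eq)

text \<open>On uniaxial values f vanishes, so xi drops out of the bound. The factor 4 is half of the
  8 in the conformal identity, and 13872 = 3 * 4624 sums the bound for \<open>W\<close> over three
  directions. The bound on eta keeps the layer inside |x| <= 3/2.\<close>

lemma uniaxial_map:
 assumes eta: "0 < eta" and L: "1 <= L" "eta * (L + 1) <= 1/2" and nu: "0 < nu"
 defines "s \<equiv> %x::real^3. 1 + (norm x - 1) / eta"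
 defines "Q \<equiv> %x. uniaxial (stereo (prof L (s x) *R W x))"
 obtains Q' where "C1_on Omega Q Q'" "admissible Q"
  "!!x xi. x : Omega ==> eta^2 * dens xi eta Q Q' x
   <= (1 + nu) * Hinf L (nsq (W x)) (s x) + (if norm x < 2 then eta^2 * (4 * (1 + 1/nu) * 13872) * kap x else 0)"
proof -
 obtain W' where W': "C1_on Om1 W W'" "!!x e. x : Om1 ==> W' x e \<bullet> e3 = 0"
   "!!x e. 1 < norm x ==> norm x < 2 ==> e : Basis ==> nsq (W' x e) <= 4624 * kap x"
  by (rule W_C1_on) blast
 define w where "w x = prof L (s x) *R W x" for x
 define w' where "w' x e = prof L (s x) *R W' x e + ((e \<bullet> sgn x) *R ((1/eta) *R prof' L (s x))) *R W x" for x e :: "real^3"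
 have w1: "C1_on Om1 w w'"
  unfolding w_def[abs_def] w'_def[abs_def] s_def
  by (rule C1_on_scaleR[OF C1_on_subset[OF C1_on_radial[OF prof_deriv continuous_prof'] Om1_nonzero] W'(1)])
 have w3: "w x \<bullet> e3 = 0" for x by (simp add: w_def W_e3)
 have w3': "w' x e \<bullet> e3 = 0" if "x : Om1" for x e by (simp add: w'_def inner_add_left W_e3 W'(2)[OF that])
 obtain U where U: "C1_on Om1 (%x. uniaxial (stereo (w x))) U"
   "!!x e. x : Om1 ==> nsq (U x e) = 8 * nsq (w' x e) / (1 + w x \<bullet> w x)^2"
  using C1_on_uniaxial_stereo[OF w1 w3 w3'] by blast
 have Qw: "Q = (%x. uniaxial (stereo (w x)))" by (simp add: Q_def w_def)
 have OO: "x : Om1" if "x : Omega" for x using Omega_subset_Om1 that by blast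
 have QU: "C1_on Omega Q U" unfolding Qw by (rule C1_on_subset[OF U(1) Omega_subset_Om1])
 have s1: "1 <= s x" if "x : Omega" for x using that eta by (simp add: s_def mem_Omega)
 have far: "L + 1 <= s x" if "3/2 <= norm x" for x
 proof -
  have "eta * (L + 1) <= norm x - 1" using L that by linarith
  hence "L + 1 <= (norm x - 1) / eta" using eta by (simp add: field_simps)
  thus ?thesis by (simp add: s_def)
 qed
 have sq: "eta^2 * (SUM e:Basis. nsq (w' x e))
   <= (1 + mu) * ((prof' L (s x))^2 * nsq (W x)) + (1 + 1/mu) * eta^2 * (if norm x < 2 then 13872 * kap x else 0)"
  if x: "x : Omega" and mu: "0 < mu" for x mu
 proof -
  have x1: "1 < norm x" "x ~= 0" using x by (auto simp: mem_Omega)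
  have B: "nsq (prof L (s x) *R W' x e) <= (if norm x < 2 then 4624 * kap x else 0)" if e: "e : Basis" for e
  proof (cases "norm x < 2")
   case True
   have "(prof L (s x))^2 * nsq (W' x e) <= 1 * (4624 * kap x)"
    using prof_bounds(1,3)[OF s1[OF x], of L] W'(3)[OF x1(1) True e] kap_nonneg[of x]
    by (intro mult_mono power_le_one) auto
   thus ?thesis using True by (simp add: power_mult_distrib)
  next
   case False
   thus ?thesis using prof_outside(1)[OF far[of x]] by simp
  qed
  have w'eq: "w' x e = (e \<bullet> sgn x) *R ((1/eta) *R (prof' L (s x) *R W x)) + prof L (s x) *R W' x e" for e
   by (simp add: w'_def)
  have "eta^2 * (SUM e:Basis. nsq ((e \<bullet> sgn x) *R ((1/eta) *R (prof' L (s x) *R W x)) + prof L (s x) *R W' x e))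
   <= (1 + mu) * nsq (prof' L (s x) *R W x) + (1 + 1/mu) * eta^2 * (real DIM(real^3) * (if norm x < 2 then 4624 * kap x else 0))"
   by (rule sum_radial_split[OF x1(2) mu eta B])
  thus ?thesis unfolding w'eq by (rule order_trans) (simp add: power_mult_distrib)
 qed
 define g1 where "g1 = sqrt k0 + 3/2"
 \<comment> \<open>This blows up as eta tends to 0 but serves admissibility at fixed eta. Here 18 =
   2 * 9 through 1 <= 9 kap, and 27744 = 2 * 13872 comes from the splitting with mu = 1.\<close>
 define c where "c = 8 * (18 * g1^2 / eta^2 + 27744)"
 have k: "kap_C1 2 c (%x. Q x - Q_inf) U"
  unfolding kap_C1_def
 proof (intro conjI ballI impI)
  show "0 <= c" by (simp add: c_def)
  show "C1_on Omega (%x. Q x - Q_inf) U" using C1_on_diff[OF QU C1_on_const[of Omega Q_inf]] by simp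
  fix x assume x: "x : Omega"
  show "norm (Q x - Q_inf) <= 2" unfolding Qw by (rule norm_uniaxial_diff_le[OF norm_stereo[OF w3]])
  show "Q x - Q_inf = 0" if "3/2 <= norm x" using prof_outside(1)[OF far[OF that]] stereo_0 by (simp add: Q_def)
  fix e :: "real^3" assume e: "e : Basis" and x2: "norm x < 2"
  have x1: "x ~= e3" using x by (auto simp: mem_Omega)
  have W1: "nsq (W x) <= 1" using norm_W_le[of x] by (simp add: power_le_one)
  have p: "(prof' L (s x))^2 <= g1^2" using prof_bounds(5)[OF s1[OF x], of L] k0 by (intro abs_le_square_iff[THEN iffD1]) (simp add: g1_def)
  have pW: "(prof' L (s x))^2 * nsq (W x) <= g1^2 * 1" by (rule mult_mono[OF p W1]) auto
  have "nsq (w' x e) <= (SUM e:Basis. nsq (w' x e))" using e by (intro member_le_sum) auto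
  hence "eta^2 * nsq (w' x e) <= eta^2 * (SUM e:Basis. nsq (w' x e))" by (intro mult_left_mono) auto
  also have "... <= 2 * g1^2 + 2 * eta^2 * (13872 * kap x)" using sq[OF x, of 1] pW x2 by simp
  finally have "nsq (w' x e) <= 2 * g1^2 / eta^2 + 27744 * kap x" using eta by (simp add: field_simps)
  moreover have "1 <= 9 * kap x" using kap_ge[OF x2 x1] by simp
  hence "2 * g1^2 / eta^2 * 1 <= 2 * g1^2 / eta^2 * (9 * kap x)" by (rule mult_left_mono) simp
  ultimately have w: "nsq (w' x e) <= (18 * g1^2 / eta^2 + 27744) * kap x" by (simp add: algebra_simps)
  have "1^2 <= (1 + w x \<bullet> w x)^2" by (intro power_mono) auto
  hence "8 * nsq (w' x e) / (1 + w x \<bullet> w x)^2 <= 8 * nsq (w' x e) / 1"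
   using inner_ge_zero[of "w x"] by (intro divide_left_mono) (auto simp: add_nonneg_eq_0_iff)
  also have "... <= 8 * ((18 * g1^2 / eta^2 + 27744) * kap x)" unfolding div_by_1 by (rule mult_left_mono[OF w]) simp
  also have "... = c * kap x" by (simp only: c_def mult.assoc)
  finally show "nsq (U x e) <= c * kap x" unfolding U(2)[OF OO[OF x]] .
 qed simp
 have adm: "admissible Q"
 proof -
  have "admissible (%x. Q_inf + (Q x - Q_inf))"
  proof (rule kap_C1_admissible[OF k])
   show "continuous_on (closure Omega - {e3, - e3}) (%x. Q x - Q_inf)"
    unfolding Qw by (intro continuous_on_diff continuous_on_const continuous_on_subset[OF C1_on_continuous[OF U(1)] closure_Omega_subset_Om1])
   fix om :: "real^3" assume o: "norm om = 1"
   show "norm (Q_phi om - Q_inf) <= 2" unfolding Q_phi_def by (rule norm_uniaxial_diff_le[OF norm_e_phi])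
   assume n: "om ~= e3" "om ~= - e3"
   have r: "0 < rad om" by (rule e3_poles[OF o n])
   have "prof L (s om) = 1" using L(1) by (simp add: s_def o prof_def step_eq)
   moreover have "sgn om = om" using o by (simp add: sgn_div_norm)
   ultimately show "Q om - Q_inf = Q_phi om - Q_inf" using uniaxial_W[OF r] o r by (simp add: Q_def)
  next
   fix x show "Q x - Q_inf : S0" unfolding Qw by (intro mem_S0(3) uniaxial_S0 norm_stereo w3 Q_inf_S0)
  qed
  thus ?thesis by simp
 qed
 show thesis
 proof (rule that[OF QU adm])
  fix x xi assume x: "x : Omega"
  define q where "q = (1 + w x \<bullet> w x)^2"
  have ww: "w x \<bullet> w x = nsq (W x) * (prof L (s x))^2"
   by (simp add: w_def dot_square_norm power_mult_distrib)
  have q1: "1 <= q" unfolding q_def by (rule one_le_power) simp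
  let ?b = "if norm x < 2 then 13872 * kap x else 0"
  have b0: "0 <= ?b" using kap_nonneg[of x] by simp
  have f0: "f_pot (Q x) = 0" unfolding Qw by (rule f_pot_uniaxial[OF norm_stereo[OF w3]])
  have "eta^2 * dens xi eta Q U x = eta^2 * (1/2 * (SUM e:Basis. 8 * nsq (w' x e) / q)) + g_pot (Q x)"
   using eta unfolding dens_def f0 U(2)[OF OO[OF x]] q_def by (simp add: distrib_left)
  also have "... = 4 / q * (eta^2 * (SUM e:Basis. nsq (w' x e))) + 4 * k0 * (w x \<bullet> w x) / q"
   unfolding Qw g_pot_stereo[OF w3] sum_divide_distrib[symmetric] sum_distrib_left[symmetric] by (simp add: q_def power2_norm_eq_inner)
  also have "... <= 4 / q * ((1 + nu) * ((prof' L (s x))^2 * nsq (W x)) + (1 + 1/nu) * eta^2 * ?b) + 4 * k0 * (w x \<bullet> w x) / q"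
   using q1 by (intro add_right_mono mult_left_mono sq[OF x nu]) auto
  also have "... <= (1 + nu) * Hinf L (nsq (W x)) (s x) + 4 * ((1 + 1/nu) * eta^2 * ?b)"
  proof -
   define y z r where "y = 4 * k0 * (w x \<bullet> w x) / q" and "z = 4 * nsq (W x) * (prof' L (s x))^2 / q" and "r = (1 + 1/nu) * eta^2 * ?b"
   have H: "Hinf L (nsq (W x)) (s x) = z + y"
    unfolding Hinf_def q_def y_def z_def ww by (simp add: add_divide_distrib[symmetric] algebra_simps)
   have "0 <= y" unfolding y_def using k0 q1 by (intro divide_nonneg_nonneg mult_nonneg_nonneg) auto
   hence "y <= (1 + nu) * y" using nu by (simp add: distrib_right)
   moreover have "0 <= r" unfolding r_def using nu b0 by (intro mult_nonneg_nonneg) auto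
   hence "4 / q * r <= 4 * r" using q1 by (intro mult_right_mono) (auto simp: divide_le_eq)
   moreover have "4 / q * ((1 + nu) * ((prof' L (s x))^2 * nsq (W x))) = (1 + nu) * z" by (simp add: z_def field_simps)
   moreover have "(1 + nu) * (z + y) = (1 + nu) * z + (1 + nu) * y" by (rule distrib_left)
   ultimately have "4 / q * ((1 + nu) * ((prof' L (s x))^2 * nsq (W x))) + 4 / q * r + y <= (1 + nu) * (z + y) + 4 * r" by linarith
   thus ?thesis unfolding H y_def[symmetric] r_def[symmetric] distrib_left[of "4 / q"] .
  qed
  finally show "eta^2 * dens xi eta Q U x
    <= (1 + nu) * Hinf L (nsq (W x)) (s x) + (if norm x < 2 then eta^2 * (4 * (1 + 1/nu) * 13872) * kap x else 0)"
   by (cases "norm x < 2") (simp_all add: algebra_simps)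
 qed
qed

lemma cube_le: assumes "0 <= nu" "nu <= (1::real)" "0 <= x" "x <= nu" shows "(1 + x)^2 * (1 + nu) <= 1 + 7 * nu"
proof -
 have "(1 + x)^2 * (1 + nu) <= (1 + nu)^2 * (1 + nu)" using assms by (intro mult_right_mono power_mono) auto
 also have "... = 1 + 3 * nu + 3 * (nu * nu) + nu * (nu * nu)" by (simp add: power2_eq_square algebra_simps)
 also have "... <= 1 + 3 * nu + 3 * (nu * 1) + nu * (1 * 1)" using assms by (intro add_mono mult_left_mono mult_mono order_refl) auto
 finally show ?thesis by simp
qed

text \<open>The pieces are latitude rings of width h in rad, on which 2 kappa (1 - rad) varies by 2
  kappa h. This oscillation, the truncation error eps1 and the factor 1 + 7 nu take a third of eps
  each.\<close>

lemma good_maps_infinite: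
 assumes eps0: "0 < eps0"
 shows "EX dl>0. ALL xi eta. 0 < xi --> 0 < eta --> eta < dl --> (EX Q. good_map \<infinity> eps0 xi eta Q)"
proof -
 define M where "M = measure sph UNIV + 3"
 have M: "0 < M" using measure_nonneg[of sph UNIV] unfolding M_def by linarith
 define eps where "eps = eps0 / M"
 have eps: "0 < eps" "eps * M = eps0" using eps0 M by (auto simp: eps_def)
 define kappa where "kappa = sqrt k0"
 have kappa: "0 < kappa" using k0 by (simp add: kappa_def)
 obtain i0 where i0: "0 <= i0" "(LI x:ball 0 2. ennreal (kap x)) = ennreal i0" by (rule nn_integral_kap)
 define eps1 where "eps1 = min 1 (eps / 3)"
 have eps1: "0 < eps1" "eps1 <= 1" "eps1 <= eps / 3" using eps by (auto simp: eps1_def)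
 obtain n :: nat where n0: "6 * kappa / eps < real n" using reals_Archimedean2 by blast
 have n1: "0 < real n" using n0 kappa eps by (smt (verit) divide_pos_pos)
 define h where "h = 1 / real n"
 have h: "0 < h" "real n * h = 1" "2 * kappa * h <= eps / 3" using n0 n1 eps by (auto simp: h_def field_simps)
 define B0 where "B0 = 2 * kappa + 1"
 have B0: "0 < B0" using kappa by (simp add: B0_def)
 define nu where "nu = min 1 (eps / (21 * B0))"
 have nu: "0 < nu" "nu <= 1" "7 * nu * B0 <= eps / 3"
 proof -
  show "0 < nu" "nu <= 1" using eps B0 by (auto simp: nu_def)
  have "nu * (21 * B0) <= eps / (21 * B0) * (21 * B0)" using B0 by (intro mult_right_mono) (auto simp: nu_def)
  thus "7 * nu * B0 <= eps / 3" using B0 by simp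
 qed
 define C where "C = 4 * ((kappa + 3/2)^2 + k0)"
 have C: "0 < C" using k0 by (simp add: C_def add_nonneg_pos)
 \<comment> \<open>By exp (- y) <= 1 / y with y = C / eps1 the truncation error is at most
   eps1.\<close>
 define L where "L = 1 + C / (2 * kappa * eps1)"
 have L: "1 <= L" "C * exp (- 2 * kappa * (L - 1)) <= eps1"
 proof -
  show "1 <= L" using C kappa eps1 by (simp add: L_def)
  define y where "y = C / eps1"
  have y: "0 < y" using C eps1 by (simp add: y_def)
  have "y <= exp y" using exp_ge_add_one_self[of y] by linarith
  hence "C * exp (- y) <= eps1" using y eps1 C by (simp add: exp_minus y_def field_simps)
  moreover have "- 2 * kappa * (L - 1) = - y" using kappa eps1 by (simp add: L_def y_def)
  ultimately show "C * exp (- 2 * kappa * (L - 1)) <= eps1" by simp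
 qed
 define c where "c = 4 * (1 + 1/nu) * 13872"
 have c: "0 <= c" using nu by (simp add: c_def)
 define eps' where "eps' = eps / (real n + 1)"
 have eps': "0 < eps'" "(real n + 1) * eps' = eps" "eps' <= eps" using eps n1 by (auto simp: eps'_def field_simps)
 \<comment> \<open>For eta below dl the layer stays inside |x| <= 3/2, its outer radius is at most 1
   + nu, and the \<open>kap\<close> term is at most eps'.\<close>
 define dl where "dl = min (min (1/2) nu / (L + 1)) (eps' / (c * i0 + 1))"
 have dl: "0 < dl" using nu L eps' c i0 by (auto simp: dl_def add_nonneg_pos)
 have "EX Q. good_map \<infinity> eps0 xi eta Q" if xi: "0 < xi" and eta: "0 < eta" "eta < dl" for xi eta
 proof -
  have "eta <= min (1/2) nu / (L + 1)" using eta by (simp add: dl_def)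
  hence "eta * (L + 1) <= min (1/2) nu" using L by (simp add: field_simps)
  hence etaL: "eta * (L + 1) <= 1/2" "eta * (L + 1) <= nu" "0 <= eta * (L + 1)" using eta L by auto
  have "eta <= eps' / (c * i0 + 1)" using eta by (simp add: dl_def)
  moreover have "0 < c * i0 + 1" using c i0 by (simp add: add_nonneg_pos)
  ultimately have "eta * (c * i0 + 1) <= eps'" by (simp only: pos_le_divide_eq)
  hence etac: "eta * c * i0 <= eps'" using eta by (simp add: algebra_simps)
  let ?s = "%x::real^3. 1 + (norm x - 1) / eta"
  define Q where "Q x = uniaxial (stereo (prof L (?s x) *R W x))" for x
  obtain Q' where Q': "C1_on Omega Q Q'" "admissible Q"
   and dn: "!!x xi. x : Omega ==> eta^2 * dens xi eta Q Q' x
    <= (1 + nu) * Hinf L (nsq (W x)) (?s x) + (if norm x < 2 then eta^2 * c * kap x else 0)"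
   using uniaxial_map[OF eta(1) L(1) etaL(1) nu(1)] unfolding Q_def[symmetric] Q_def[abs_def, symmetric] c_def[symmetric] by blast
  define X where "X t = 2 * kappa * (1 - t) + eps1" for t
  have cone: "ennreal eta * energy xi eta Q (cone_over B) <= ennreal ((1 + eta * (L + 1))^2 * (1 + nu) * X t) * emeasure sph B + ennreal eps'"
   if B: "B : sets borel" "B <= sphere 0 1" and t: "0 <= t" "t <= 1" and TB: "!!om. om : B ==> nsq (w0 om) <= (1 - t) / (1 + t)" for B t
  proof -
   define T where "T = (1 - t) / (1 + t)"
   have T: "0 <= T" "T <= 1" "4 * kappa * (T / (1 + T)) = 2 * kappa * (1 - t)"
   proof -
    show "0 <= T" "T <= 1" using t by (auto simp: T_def divide_le_eq)
    have "1 + T = 2 / (1 + t)" using t by (simp add: T_def field_simps)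
    hence "T / (1 + T) = (1 - t) / 2" using t by (simp add: T_def)
    hence "4 * kappa * (T / (1 + T)) = 4 * kappa * ((1 - t) / 2)" by (simp only:)
    thus "4 * kappa * (T / (1 + T)) = 2 * kappa * (1 - t)" by (rule trans) simp
   qed
   let ?H = "%s. (1 + nu) * (Hinf L T s * indicator {..L + 1} s)"
   have "ennreal eta * energy xi eta Q (cone_over B)
     <= ennreal ((1 + eta * (L + 1))^2) * emeasure sph B * (LI s:{1<..}. ennreal (?H s)) + ennreal (eta * c) * (LI x:ball 0 2. ennreal (kap x))"
   proof (rule energy_cone_le[OF Q'(1) eta(1) _ c _ _ B])
    show "0 <= L + 1" using L by simp
    show "?H : borel_measurable borel" by measurable
    show "0 <= ?H s" for s using Hinf_nonneg[OF T(1), of L s] nu by (simp add: indicator_def)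
    fix x assume "x : cone_over B"
    hence x: "1 < norm x" "sgn x : B" using cone_over_eq[OF B(2)] by auto
    hence xO: "x : Omega" by (simp add: mem_Omega)
    have s1: "1 <= ?s x" using x eta by simp
    have "norm (W x) <= norm (w0 x)" unfolding W_def using fade_bounds[of x] by (simp add: mult_left_le_one_le)
    hence "nsq (W x) <= nsq (w0 x)" by (intro power_mono) auto
    also have "... <= T" using TB[OF x(2)] by (simp add: w0_sgn T_def)
    finally have le: "Hinf L (nsq (W x)) (?s x) <= Hinf L T (?s x)" by (intro Hinf_mono T s1) auto
    have eq: "Hinf L T (?s x) * indicator {..L + 1} (?s x) = Hinf L T (?s x)"
     using prof_outside(3)[of L "?s x" T] by (auto simp: indicator_def)
    have out: "Hinf L T (?s x) = 0" if "~ norm x < 1 + eta * (L + 1)"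
    proof (rule prof_outside(3))
     have "L + 1 <= (norm x - 1) / eta" using that eta by (simp add: field_simps)
     thus "L + 1 <= ?s x" by simp
    qed
    have "eta^2 * dens xi eta Q Q' x <= (1 + nu) * Hinf L T (?s x) + (if norm x < 2 then eta^2 * c * kap x else 0)"
     using dn[OF xO, of xi] mult_left_mono[OF le, of "1 + nu"] nu by linarith
    thus "eta^2 * dens xi eta Q Q' x <= (if norm x < 1 + eta * (L + 1) then ?H (?s x) else 0) + (if norm x < 2 then eta^2 * c * kap x else 0)"
     unfolding eq using out by (cases "norm x < 1 + eta * (L + 1)") simp_all
   qed
   also have "... <= ennreal ((1 + eta * (L + 1))^2) * emeasure sph B * ennreal ((1 + nu) * X t) + ennreal eps'"
   proof (intro add_mono mult_left_mono)
    have "(LI s:{1<..}. ennreal (?H s)) = (LI s. ennreal (1 + nu) * (ennreal (Hinf L T s * indicator {..L + 1} s) * indicator {1<..} s))"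
    proof (rule nn_integral_cong)
     fix s
     have "ennreal (?H s) = ennreal (1 + nu) * ennreal (Hinf L T s * indicator {..L + 1} s)" by (rule ennreal_mult') (use nu in simp)
     thus "ennreal (?H s) * indicator {1<..} s = ennreal (1 + nu) * (ennreal (Hinf L T s * indicator {..L + 1} s) * indicator {1<..} s)"
      by (simp only: mult.assoc)
    qed
    also have "... = ennreal (1 + nu) * (LI s:{1<..}. ennreal (Hinf L T s * indicator {..L + 1} s))"
     by (rule nn_integral_cmult) measurable
    also have "... <= ennreal (1 + nu) * ennreal (4 * kappa * (T / (1 + T)) + C * exp (- 2 * kappa * (L - 1)))"
     using Hinf_integral[OF T(1,2) L(1)] unfolding kappa_def[symmetric] C_def[symmetric] by (intro mult_left_mono) auto
    also have "... <= ennreal (1 + nu) * ennreal (X t)" unfolding T(3) X_def using L(2) by (intro mult_left_mono ennreal_leI) auto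
    also have "... = ennreal ((1 + nu) * X t)" using nu by (simp add: ennreal_mult')
    finally show "(LI s:{1<..}. ennreal (?H s)) <= ennreal ((1 + nu) * X t)" .
    have "ennreal (eta * c) * ennreal i0 = ennreal (eta * c * i0)" using i0 by (simp add: ennreal_mult'')
    thus "ennreal (eta * c) * (LI x:ball 0 2. ennreal (kap x)) <= ennreal eps'"
     unfolding i0(2) using etac by (simp add: ennreal_leI)
   qed auto
   also have "ennreal ((1 + eta * (L + 1))^2) * emeasure sph B * ennreal ((1 + nu) * X t) = ennreal ((1 + eta * (L + 1))^2 * (1 + nu) * X t) * emeasure sph B"
   proof -
    have "ennreal ((1 + eta * (L + 1))^2 * (1 + nu) * X t) = ennreal ((1 + eta * (L + 1))^2) * ennreal ((1 + nu) * X t)"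
     unfolding mult.assoc by (rule ennreal_mult') simp
    thus ?thesis by (simp only: mult_ac)
   qed
   finally show ?thesis .
  qed
  define V where "V j = {om : sphere 0 1. 0 < rad om & real j * h <= rad om & rad om < (real j + 1) * h}" for j :: nat
  have Vb: "V j : sets borel" for j
  proof -
   have eq: "V j = sphere 0 1 Int {om. 0 < rad om} Int {om. real j * h <= rad om} Int {om. rad om < (real j + 1) * h}" by (auto simp: V_def)
   show ?thesis unfolding eq
    by (intro sets.Int borel_closed[OF closed_sphere] borel_open[OF open_Om1(1)] borel_closed[OF closed_Collect_le] borel_open[OF open_Collect_less] continuous_rad continuous_on_const)
  qed
  have jh: "real j * h <= 1" if "j <= n" for j using that h mult_right_mono[of "real j" "real n" h] by simp
  have Z: "sphere 0 1 - (UN j:{0..n}. V j) = {om : sphere 0 1. rad om = 0}"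
  proof (intro set_eqI iffI)
   fix om assume om: "om : sphere 0 1 - (UN j:{0..n}. V j)"
   show "om : {om : sphere 0 1. rad om = 0}"
   proof (rule ccontr)
    assume "~ ?thesis"
    hence r: "0 < rad om" "rad om <= 1" "norm om = 1" using om rad_le[of om] by auto
    define j where "j = nat \<lfloor>rad om / h\<rfloor>"
    have j: "real j <= rad om / h" "rad om / h < real j + 1" using r h by (auto simp: j_def of_nat_nat)
    hence j': "real j * h <= rad om" "rad om < (real j + 1) * h" using h by (auto simp: field_simps)
    have "real j * h <= real n * h" using j' r h by linarith
    hence "real j <= real n" using h(1) by (rule mult_right_le_imp_le)
    hence "j <= n" by simp
    thus False using om r j' by (auto simp: V_def)
   qed
  qed (auto simp: V_def)
  \<comment> \<open>The last ring j = n contains the equator, and there (j + 1) * h exceeds 1; hence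
    the maximum with 0.\<close>
  define d where "d j = 2 * kappa * max 0 (1 - (real j + 1) * h)" for j :: nat
  define a where "a j = (1 + eta * (L + 1))^2 * (1 + nu) * X (real j * h)" for j :: nat
  have X: "0 <= X t" "X t <= B0" if "0 <= t" "t <= 1" for t
  proof -
   show "0 <= X t" using that kappa eps1 by (simp add: X_def)
   have "2 * kappa * (1 - t) <= 2 * kappa * 1" using that kappa by (intro mult_left_mono) auto
   thus "X t <= B0" using eps1 by (simp add: X_def B0_def)
  qed
  have "good_map \<infinity> (eps * (measure sph UNIV + 3)) xi eta Q"
  proof (rule good_mapI[where V = V and d = d and a = a and J = "{0..n}" and eps' = eps', OF Q'])
   show "disjoint_family_on V {0..n}"
   proof -
    have "om ~: V j" if "i < j" "om : V i" for i j om
    proof -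
     have "real i + 1 <= real j" using that(1) by linarith
     hence "(real i + 1) * h <= real j * h" using h(1) by (intro mult_right_mono) auto
     thus ?thesis using that(2) by (auto simp: V_def)
    qed
    thus ?thesis unfolding disjoint_family_on_def by (metis disjoint_iff linorder_neqE_nat)
   qed
   show "ennreal eta * energy xi eta Q (cone_over B) <= ennreal (a j) * emeasure sph B + ennreal eps'"
    if "j : {0..n}" "B : sets borel" "B <= V j" for j B
   proof -
    have t: "0 <= real j * h" "real j * h <= 1" using jh that(1) h by auto
    have "nsq (w0 om) <= (1 - real j * h) / (1 + real j * h)" if "om : B" for om
    proof -
     have om: "norm om = 1" "0 < rad om" "real j * h <= rad om" using that \<open>B <= V j\<close> by (auto simp: V_def)
     thus ?thesis unfolding norm_w0_square[OF om(1,2)] using t rad_le[of om] by (intro frac_le) auto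
    qed
    thus ?thesis unfolding a_def using that t by (intro cone) (auto simp: V_def)
   qed
   show "ennreal (d j) <= D \<infinity> (Q_phi om)" if "j : {0..n}" "om : V j" for j om
   proof -
    have om: "norm om = 1" "rad om <= (real j + 1) * h" "rad om <= 1" using that(2) rad_le[of om] by (auto simp: V_def)
    have "max 0 (1 - (real j + 1) * h) <= 1 - rad om" using om by auto
    hence "d j <= 2 * kappa * (1 - \<bar>e_phi om $ 3\<bar>)" unfolding d_def e_phi_3[OF om(1)] using kappa by (intro mult_left_mono) auto
    thus ?thesis unfolding Q_phi_def kappa_def by (rule order_trans[OF ennreal_leI D_infinity_ge[OF norm_e_phi]])
   qed
   fix j assume j: "j : {0..n}"
   have t: "0 <= real j * h" "real j * h <= 1" using jh j h by auto
   show "0 <= a j" unfolding a_def using X(1)[OF t] nu by simp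
   have "a j <= (1 + 7 * nu) * X (real j * h)" unfolding a_def using nu etaL X(1)[OF t] by (intro mult_right_mono cube_le) auto
   also have "... <= X (real j * h) + 7 * nu * B0" using mult_left_mono[OF X(2)[OF t], of "7 * nu"] nu by (simp add: algebra_simps)
   also have "... <= 2 * kappa * (1 - (real j + 1) * h) + eps" using nu(3) eps1(3) h(3) by (simp add: X_def algebra_simps)
   also have "2 * kappa * (1 - (real j + 1) * h) <= d j" unfolding d_def using kappa by (intro mult_left_mono) auto
   finally show "a j <= d j + eps" by simp
   show "0 <= d j" using kappa by (simp add: d_def)
  next
   have "norm (w0 om) ^ 2 <= (1 - 0) / (1 + 0)" for om using norm_w0_le[of om] by (simp add: power_le_one)
   hence "ennreal eta * energy xi eta Q (cone_over {om : sphere 0 1. rad om = 0})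
    <= ennreal ((1 + eta * (L + 1))^2 * (1 + nu) * X 0) * emeasure sph {om : sphere 0 1. rad om = 0} + ennreal eps'"
    by (intro cone borel_poles) auto
   thus "ennreal eta * energy xi eta Q (cone_over (sphere 0 1 - (UN j:{0..n}. V j))) <= ennreal eps"
    unfolding Z sph_poles using eps'(3) by (simp add: ennreal_leI order_trans)
   show "real (card {0..n}) * eps' <= eps" using eps'(2) by (simp add: add.commute)
  qed (use Vb eps eps' in "auto simp: V_def")
  thus ?thesis using eps(2) unfolding M_def by auto
 qed
 thus ?thesis using dl by blast
qed

section \<open>Recovery maps for finite parameters\<close>

text \<open>The squared chord from x/|x| to a is 2 - 2 (x, a) / |x|, which is C^1 off the origin, so
  \<open>step\<close> applied to it gives a cutoff around a. Finitely many of these cover K, and an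
  outer \<open>step\<close> caps their sum at 1.\<close>

lemma cone_cutoff:
 fixes K K' :: "(real^3) set"
 assumes K: "compact K" "K <= sphere 0 1" and K': "closed K'" "K Int K' = {}"
 obtains X where "C1 (- {0}) X" "!!x. 0 <= X x" "!!x. X x <= 1"
  "!!x. x ~= 0 ==> sgn x : K ==> X x = 1" "!!x. x ~= 0 ==> sgn x : K' ==> X x = (0::real)"
proof -
 obtain d where d: "0 < d" "!!x y. x : K ==> y : K' ==> d <= dist x y" using separate_compact_closed[OF K(1) K'] by blast
 \<comment> \<open>The covering balls have radius 1/k = d/2. Each summand is 1 on its ball and 0
   from distance 2/k = d on, hence on K'.\<close>
 define k where "k = 2 / d"
 have k: "0 < k" "k * d = 2" using d by (auto simp: k_def)
 obtain A where A: "finite A" "A <= K" "K <= (UN a:A. ball a (1/k))"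
  using compactE_image[OF K(1), of K "%a. ball a (1/k)"] k by (metis UN_I centre_in_ball open_ball subsetI zero_less_divide_1_iff)
 define b where "b a x = step (2 - k^2 * (2 - 2 * (inverse (norm x) * (x \<bullet> a))))" for a x :: "real^3"
 have b: "b a x = step (2 - (k * norm (sgn x - a))^2)" if "a : A" "x ~= 0" for a x
 proof -
  have "a \<bullet> a = 1" "sgn x \<bullet> sgn x = 1" using that A(2) K(2) by (auto simp: dot_square_norm norm_sgn)
  hence "nsq (sgn x - a) = 2 - 2 * (inverse (norm x) * (x \<bullet> a))"
   unfolding power2_norm_eq_inner by (simp add: inner_diff_left inner_diff_right inner_commute sgn_div_norm)
  thus ?thesis by (simp add: b_def power_mult_distrib)
 qed
 show thesis
 proof (rule that[of "%x. step (SUM a:A. b a x)"])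
  show "C1 (- {0}) (%x. step (SUM a:A. b a x))" unfolding b_def
   by (intro C1_step C1_sum A C1_diff C1_mult C1_const C1_inverse C1_norm C1_linear bounded_linear_inner_left) auto
  fix x :: "real^3" assume x: "x ~= 0"
  { assume "sgn x : K"
   then obtain a where a: "a : A" "norm (sgn x - a) <= 1/k" using A(3) by (force simp: dist_norm norm_minus_commute)
   have "b a x <= (SUM a:A. b a x)" by (rule member_le_sum[OF a(1) _ A(1)]) (simp add: b_def step_bounds)
   moreover have "(k * norm (sgn x - a))^2 <= 1" using a(2) k by (intro power_le_one) (auto simp: field_simps)
   hence "b a x = 1" using b[OF a(1) x] by (simp add: step_eq)
   ultimately have "1 <= (SUM a:A. b a x)" by simp
   thus "step (SUM a:A. b a x) = 1" by (simp add: step_eq) }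
  { assume s: "sgn x : K'"
   have "b a x = 0" if a: "a : A" for a
   proof -
    have "d <= norm (sgn x - a)" using d(2)[OF _ s, of a] a A(2) by (auto simp: dist_norm norm_minus_commute)
    hence "2 <= k * norm (sgn x - a)" using mult_left_mono[of d "norm (sgn x - a)" k] k by simp
    hence "2^2 <= (k * norm (sgn x - a))^2" by (intro power_mono) auto
    thus ?thesis unfolding b[OF a x] by (simp add: step_eq)
   qed
   thus "step (SUM a:A. b a x) = 0" by (simp add: step_eq) }
 qed (rule step_bounds)+
qed

lemma C1_derivative_bounded:
 assumes "C1_on U u u'" "compact K" "K <= U"
 obtains c where "0 <= c" "!!x e. x : K ==> e : Basis ==> norm (u' x e) <= c"
proof -
 have "bounded (UN e:Basis. (%x. u' x e) ` K)"
  using assms by (intro bounded_UN ballI compact_imp_bounded compact_continuous_image continuous_on_subset[OF C1_onD(2)]) auto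
 then obtain c where "0 < c" "ALL y:(UN e:Basis. (%x. u' x e) ` K). norm y <= c" using bounded_pos by blast
 thus thesis by (intro that[of c]) auto
qed

lemma norm_sum_scaleR_le:
 fixes b :: "'j => 'a::real_normed_vector"
 assumes "!!j. j : J ==> \<bar>y j\<bar> <= t" "!!j. j : J ==> norm (b j) <= M"
 shows "norm (SUM j:J. y j *R b j) <= real (card J) * (t * M)"
proof -
 have "norm (SUM j:J. y j *R b j) <= (SUM j:J. t * M)"
  by (rule sum_norm_le) (simp, intro mult_mono assms, auto intro: order_trans[OF abs_ge_zero assms(1)])
 thus ?thesis by simp
qed

text \<open>The cutoffs multiply only the parts \<open>a j\<close>, which vanish at s = 1, so the
  boundary values come from psi times Y and are exact. \<open>A\<close> is the derivative in s with
  X j and Y frozen; the derivatives of X j and Y carry no 1/eta and go to the \<open>kap\<close>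
  term. There 18 = 2 * 9 through 1 <= 9 kap, and 73984 = 2 * 8 * 4624.\<close>

lemma layer_map:
 fixes X :: "'j => real^3 => real" and a a' :: "'j => real => real^3^3" and psi psi' :: "real => real" and c L M :: real
 assumes J: "finite J"
  and X: "!!j. j : J ==> C1_on (- {0}) (X j) (X' j)" "!!j x. j : J ==> \<bar>X j x\<bar> <= 1"
   "!!j x e. j : J ==> x : Omega ==> norm x < 2 ==> e : Basis ==> \<bar>X' j x e\<bar> <= c"
  and a: "!!j s. j : J ==> (a j has_vector_derivative a' j s) (at s)" "!!j. j : J ==> continuous_on UNIV (a' j)"
   "!!j s. j : J ==> L <= s ==> a j s = 0" "!!j. j : J ==> a j 1 = 0" "!!j s. j : J ==> a j s : S0"
   "!!j s. j : J ==> norm (a j s) <= M" "!!j s. j : J ==> norm (a' j s) <= M"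
  and psi: "!!s. (psi has_vector_derivative psi' s) (at s)" "continuous_on UNIV psi'" "!!s. L <= s ==> psi s = 0" "psi 1 = 1"
   "!!s. \<bar>psi s\<bar> <= 1" "!!s. \<bar>psi' s\<bar> <= M"
  and eta: "0 < eta" "eta * L <= 1/2" and nu: "0 < nu"
 defines "s \<equiv> %x::real^3. 1 + (norm x - 1) / eta"
 defines "Y \<equiv> %x. uniaxial (stereo (W x)) - Q_inf"
 defines "Q \<equiv> %x. Q_inf + ((SUM j:J. X j x *R a j (s x)) + psi (s x) *R Y x)"
 defines "A \<equiv> %x. (SUM j:J. X j x *R a' j (s x)) + psi' (s x) *R Y x"
 obtains Q' where "C1_on Omega Q Q'" "admissible Q"
  "!!x xi. x : Omega ==> eta^2 * dens xi eta Q Q' x <= (1 + nu) / 2 * nsq (A x) + (eta / xi)^2 * f_pot (Q x) + g_pot (Q x)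
   + (if norm x < 2 then eta^2 * (2 * (1 + 1/nu) * (18 * (card J * (c * M))^2 + 73984)) * kap x else 0)"
proof -
 have M: "0 <= M" using psi(6)[of 0] by linarith
 obtain W' where W': "C1_on Om1 W W'" "!!x e. x : Om1 ==> W' x e \<bullet> e3 = 0"
   "!!x e. 1 < norm x ==> norm x < 2 ==> e : Basis ==> nsq (W' x e) <= 4624 * kap x"
  by (rule W_C1_on) blast
 obtain U where U: "C1_on Om1 (%x. uniaxial (stereo (W x))) U"
   "!!x e. x : Om1 ==> nsq (U x e) = 8 * nsq (W' x e) / (1 + W x \<bullet> W x)^2"
  using C1_on_uniaxial_stereo[OF W'(1) W_e3(1) W'(2)] by blast
 have YU: "C1_on Om1 Y U" using C1_on_diff[OF U(1) C1_on_const[of Om1 Q_inf]] by (simp add: Y_def)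
 have Y2: "norm (Y x) <= 2" for x unfolding Y_def by (rule norm_uniaxial_diff_le[OF norm_stereo[OF W_e3(1)]])
 have OO: "x : Om1" if "x : Omega" for x using Omega_subset_Om1 that by blast
 have far: "L <= s x" if "3/2 <= norm x" for x
 proof -
  have "L * eta <= norm x - 1" using eta that by (simp add: mult.commute)
  thus ?thesis using eta by (simp add: s_def pos_le_divide_eq add_increasing)
 qed
 define u where "u x = (SUM j:J. X j x *R a j (s x)) + psi (s x) *R Y x" for x
 define B where "B x e = (SUM j:J. X' j x e *R a j (s x)) + psi (s x) *R U x e" for x e
 define u' where "u' x e = (e \<bullet> sgn x) *R ((1/eta) *R A x) + B x e" for x e :: "real^3"
 have u: "C1_on Om1 u u'"
 proof -
  have 1: "C1_on Om1 (%x. X j x *R a j (s x)) (%x e. X j x *R ((e \<bullet> sgn x) *R ((1/eta) *R a' j (s x))) + X' j x e *R a j (s x))" if "j : J" for j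
   unfolding s_def by (intro C1_on_subset[OF C1_on_scaleR[OF X(1) C1_on_radial[OF a(1,2)]] Om1_nonzero] that)
  have 2: "C1_on Om1 (%x. psi (s x) *R Y x) (%x e. psi (s x) *R U x e + ((e \<bullet> sgn x) *R ((1/eta) *R psi' (s x))) *R Y x)"
   unfolding s_def by (intro C1_on_scaleR C1_on_subset[OF C1_on_radial[OF psi(1,2)] Om1_nonzero] YU)
  have 3: "C1_on Om1 (%x. SUM j:J. X j x *R a j (s x)) (%x e. SUM j:J. X j x *R ((e \<bullet> sgn x) *R ((1/eta) *R a' j (s x))) + X' j x e *R a j (s x))"
   by (intro C1_onI has_derivative_sum continuous_on_sum C1_onD(1)[OF 1] C1_onD(2)[OF 1])
  have eq: "u' = (%x e. (SUM j:J. X j x *R ((e \<bullet> sgn x) *R ((1/eta) *R a' j (s x))) + X' j x e *R a j (s x))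
    + (psi (s x) *R U x e + ((e \<bullet> sgn x) *R ((1/eta) *R psi' (s x))) *R Y x))"
   unfolding u'_def[abs_def] A_def B_def by (simp add: sum.distrib scaleR_add_right scaleR_sum_right mult_ac add_ac)
  show ?thesis unfolding eq u_def[abs_def] by (rule C1_on_add[OF 3 2])
 qed
 have Qu: "Q = (%x. Q_inf + u x)" by (simp add: Q_def u_def)
 have uO: "C1_on Omega u u'" by (rule C1_on_subset[OF u Omega_subset_Om1])
 have QU: "C1_on Omega Q u'" using C1_on_add[OF C1_on_const uO] unfolding Qu by simp
 define be where "be = 18 * (card J * (c * M))^2 + 73984"
 have be: "0 <= be" by (simp add: be_def)
 have B: "nsq (B x e) <= (if norm x < 2 then be * kap x else 0)" if x: "x : Omega" and e: "e : Basis" for x e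
 proof (cases "norm x < 2")
  case True
  have x1: "1 < norm x" "x ~= e3" using x by (auto simp: mem_Omega)
  have "1\<^sup>2 <= (1 + W x \<bullet> W x)^2" by (intro power_mono) auto
  hence "8 * nsq (W' x e) / (1 + W x \<bullet> W x)^2 <= 8 * nsq (W' x e) / 1"
   using inner_ge_zero[of "W x"] by (intro divide_left_mono) (auto simp: add_nonneg_eq_0_iff)
  hence U1: "nsq (U x e) <= 36992 * kap x" using U(2)[OF OO[OF x], of e] W'(3)[OF x1(1) True e] by simp
  have "(psi (s x))^2 <= 1" using psi(5)[of "s x"] by (simp add: abs_square_le_1)
  hence "(psi (s x))^2 * nsq (U x e) <= 1 * (36992 * kap x)" using U1 by (intro mult_mono) auto
  hence 1: "nsq (psi (s x) *R U x e) <= 36992 * kap x" by (simp add: power_mult_distrib)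
  have "norm (SUM j:J. X' j x e *R a j (s x)) <= card J * (c * M)" using X(3) a(6) x True e by (intro norm_sum_scaleR_le) auto
  hence "nsq (SUM j:J. X' j x e *R a j (s x)) <= (card J * (c * M))^2 * 1" by (simp add: power_mono)
  also have "... <= (card J * (c * M))^2 * (9 * kap x)" using kap_ge[OF True x1(2)] by (intro mult_left_mono) auto
  finally show ?thesis using True 1 norm_add_square_le[of "SUM j:J. X' j x e *R a j (s x)" "psi (s x) *R U x e"]
   by (simp add: B_def be_def algebra_simps)
 next
  case False
  thus ?thesis using far[of x] a(3) psi(3) by (simp add: B_def)
 qed
 have sq: "eta^2 * (SUM e:Basis. nsq (u' x e)) <= (1 + mu) * nsq (A x) + (1 + 1/mu) * eta^2 * (3 * (if norm x < 2 then be * kap x else 0))"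
  if x: "x : Omega" and mu: "0 < mu" for x mu
 proof -
  have "x ~= 0" using x by (auto simp: mem_Omega)
  from sum_radial_split[OF this mu eta(1) B[OF x], where A = "A x"] show ?thesis unfolding u'_def by simp
 qed
 define g1 where "g1 = card J * (1 * M) + M * 2"
 have A: "norm (A x) <= g1" for x
  unfolding A_def g1_def by (intro order_trans[OF norm_triangle_ineq] add_mono norm_sum_scaleR_le X a) (auto intro!: mult_mono psi Y2 M)
 define M' where "M' = card J * (1 * M) + 2"
 define C where "C = 18 * g1^2 / eta^2 + 6 * be"
 have k: "kap_C1 M' C u u'"
  unfolding kap_C1_def
 proof (intro conjI ballI impI uO)
  show "0 <= C" using be by (simp add: C_def)
  show "0 <= M'" using M by (simp add: M'_def)
  fix x assume x: "x : Omega"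
  show "norm (u x) <= M'"
   unfolding u_def M'_def by (intro order_trans[OF norm_triangle_ineq] add_mono norm_sum_scaleR_le X a) (use mult_mono[OF psi(5)[of "s x"] Y2[of x]] in auto)
  show "u x = 0" if "3/2 <= norm x" using far[OF that] a(3) psi(3) by (simp add: u_def)
  fix e :: "real^3" assume e: "e : Basis" and x2: "norm x < 2"
  have x1: "x ~= e3" using x by (auto simp: mem_Omega)
  have "nsq (u' x e) <= (SUM e:Basis. nsq (u' x e))" using e by (intro member_le_sum) auto
  hence "eta^2 * nsq (u' x e) <= eta^2 * (SUM e:Basis. nsq (u' x e))" by (intro mult_left_mono) auto
  also have "... <= 2 * g1^2 + 2 * eta^2 * (3 * (be * kap x))" using sq[OF x, of 1] power_mono[OF A[of x], of 2] x2 by simp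
  finally have "nsq (u' x e) <= 2 * g1^2 / eta^2 + 6 * be * kap x" using eta by (simp add: field_simps)
  moreover have "1 <= 9 * kap x" using kap_ge[OF x2 x1] by simp
  hence "2 * g1^2 / eta^2 * 1 <= 2 * g1^2 / eta^2 * (9 * kap x)" by (rule mult_left_mono) simp
  ultimately show "nsq (u' x e) <= C * kap x" by (simp add: C_def algebra_simps)
 qed
 have adm: "admissible Q"
  unfolding Qu
 proof (rule kap_C1_admissible[OF k])
  show "continuous_on (closure Omega - {e3, - e3}) u"
   by (rule continuous_on_subset[OF C1_on_continuous[OF u] closure_Omega_subset_Om1])
  fix om :: "real^3" assume o: "norm om = 1"
  have "norm (Q_phi om - Q_inf) <= 2" unfolding Q_phi_def by (rule norm_uniaxial_diff_le[OF norm_e_phi])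
  thus "norm (Q_phi om - Q_inf) <= M'" using M by (simp add: M'_def add_increasing)
  assume n: "om ~= e3" "om ~= - e3"
  have r: "0 < rad om" by (rule e3_poles[OF o n])
  have "s om = 1" "sgn om = om" using o by (simp_all add: s_def sgn_div_norm)
  thus "u om = Q_phi om - Q_inf" using uniaxial_W[OF r] o r a(4) psi(4) by (simp add: u_def Y_def)
 next
  fix x show "u x : S0" unfolding u_def Y_def
   by (intro mem_S0(2) subspace_sum[OF subspace_S0] mem_S0(4) mem_S0(3) a uniaxial_S0 norm_stereo W_e3 Q_inf_S0)
 qed
 show thesis
 proof (rule that[OF QU adm])
  fix x xi assume x: "x : Omega"
  have "eta^2 * dens xi eta Q u' x = 1/2 * (eta^2 * (SUM e:Basis. nsq (u' x e))) + (eta / xi)^2 * f_pot (Q x) + g_pot (Q x)"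
   using eta unfolding dens_def by (simp add: distrib_left power_divide)
  also have "1/2 * (eta^2 * (SUM e:Basis. nsq (u' x e))) <= 1/2 * ((1 + nu) * nsq (A x) + (1 + 1/nu) * eta^2 * (3 * (if norm x < 2 then be * kap x else 0)))"
   by (intro mult_left_mono sq x nu) simp
  also have "... <= (1 + nu) / 2 * nsq (A x) + (if norm x < 2 then eta^2 * (2 * (1 + 1/nu) * be) * kap x else 0)"
  proof -
   define z where "z = (1 + 1/nu) * eta^2 * (be * kap x)"
   have z: "0 <= z" "(1 + 1/nu) * eta^2 * (3 * (be * kap x)) = 3 * z" "eta^2 * (2 * (1 + 1/nu) * be) * kap x = 2 * z"
    unfolding z_def using nu be kap_nonneg[of x] by (simp, simp_all only: mult_ac)
   show ?thesis using z by (cases "norm x < 2") (simp_all add: z(2,3))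
  qed
  finally show "eta^2 * dens xi eta Q u' x <= (1 + nu) / 2 * nsq (A x) + (eta / xi)^2 * f_pot (Q x) + g_pot (Q x)
   + (if norm x < 2 then eta^2 * (2 * (1 + 1/nu) * (18 * (card J * (c * M))^2 + 73984)) * kap x else 0)"
   unfolding be_def by simp
 qed
qed

section \<open>Near-optimal smooth profiles\<close>

lemma constant_profile_deriv_zero:
 fixes p :: "real => 'a::euclidean_space"
 assumes p: "!!s. (p has_vector_derivative p' s) (at s)" and S: "open S" "!!s. s : S ==> p s = q" "s : S"
 shows "p' s = 0"
proof -
 have "((%s. q) has_vector_derivative p' s) (at s)"
  by (rule has_vector_derivative_transform_within_open[OF p S(1,3)]) (rule S(2))
 thus ?thesis by (rule vector_derivative_unique_at) simp
qed

lemma profile_bounded: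
 fixes p :: "real => 'a::euclidean_space"
 assumes p: "!!s. (p has_vector_derivative p' s) (at s)" "continuous_on UNIV p'" "!!s. s <= 1 ==> p s = q" "!!s. L <= s ==> p s = 0"
 shows "s <= 1 ==> p' s = 0" "EX M. ALL s. norm (p s) <= M & norm (p' s) <= M"
proof -
 have 0: "p' s = 0" if "s : {..<1}" for s by (rule constant_profile_deriv_zero[OF p(1) _ _ that]) (auto simp: p(3))
 have L: "p' s = 0" if "s : {L<..}" for s by (rule constant_profile_deriv_zero[OF p(1) _ _ that]) (auto simp: p(4))
 \<comment> \<open>The point s = 1 is included by continuity of the derivative.\<close>
 have "p' s = 0" if "s : closure {..<1}" for s
  by (rule continuous_constant_on_closure[OF continuous_on_subset[OF p(2)] 0 that]) auto
 thus "s <= 1 ==> p' s = 0" by simp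
 have "continuous_on UNIV p" by (intro continuous_at_imp_continuous_on ballI has_vector_derivative_continuous[OF p(1)])
 hence "bounded (p ` {0..L} Un p' ` {0..L})"
  by (intro bounded_Un[THEN iffD2] conjI compact_imp_bounded compact_continuous_image) (auto intro: continuous_on_subset p(2))
 then obtain M where M: "0 < M" "!!s. s : {0..L} ==> norm (p s) <= M & norm (p' s) <= M" unfolding bounded_pos by blast
 have "norm (p s) <= M + norm q & norm (p' s) <= M + norm q" for s
 proof -
  consider "s < 0" | "s : {0..L}" | "L < s" by force
  thus ?thesis
  proof cases
   case 1 thus ?thesis using 0[of s] p(3)[of s] M by simp
  next
   case 2 thus ?thesis using M(2)[OF 2] norm_ge_zero[of q] by linarith
  next
   case 3 thus ?thesis using L[of s] p(4)[of s] M by simp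
  qed
 qed
 thus "EX M. ALL s. norm (p s) <= M & norm (p' s) <= M" by blast
qed

definition pot :: "real => real^3^3 => real" where "pot l Q = l^2 * f_pot Q + g_pot Q"

lemma pot_nonneg: "Q : S0 ==> 0 <= pot l Q" using f_pot_nonneg g_pot_nonneg by (simp add: pot_def)

lemma pot_measurable [measurable]: "pot l : borel_measurable borel" unfolding pot_def[abs_def] by measurable

lemma pot_le: assumes "Q : S0" shows "pot l Q <= (18 * l^2 + 32) * (nsq (Q - Q_inf) + (norm (Q - Q_inf))^4)"
proof -
 have "l^2 * f_pot Q <= l^2 * (18 * (nsq (Q - Q_inf) + (norm (Q - Q_inf))^4))" by (intro mult_left_mono f_pot_quadratic assms) simp
 moreover have "0 <= (norm (Q - Q_inf))^4" by simp
 moreover have "(18 * l^2 + 32) * (a + b) = l^2 * (18 * (a + b)) + 32 * a + 32 * b" for a b by (simp add: algebra_simps)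
 ultimately show ?thesis using g_pot_quadratic[OF assms] unfolding pot_def by (smt (verit))
qed

text \<open>A single predicate, so that witnesses for all pieces can be chosen together. The profile
  starts from the one point w of V, whereas d bounds D from below on all of V; the boundary layer
  makes up for the variation of Q_phi over V.\<close>

definition near_optimal where
 "near_optimal lam e V w p p' L M d \<longleftrightarrow> w : V & (ALL s. (p has_vector_derivative p' s) (at s)) & continuous_on UNIV p' \<and>
   (ALL s<=1. p s = Q_phi w - Q_inf & p' s = 0) & (ALL s>=L. p s = 0) & 1 <= L & (ALL s. p s : S0) \<and>
   (ALL s. norm (p s) <= M & norm (p' s) <= M) & 0 <= d & (ALL om:V. ennreal d <= D lam (Q_phi om)) \<and>
   (LI s:{1<..}. ennreal (1/2 * nsq (p' s) + pot (enn2real lam) (Q_inf + p s))) <= ennreal (d + e)"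

lemma near_optimal_exists:
 assumes lam: "lam < \<infinity>" and V: "V ~= {}" and e: "0 < e"
 shows "EX w p p' L M d. near_optimal lam e V w p p' L M d"
proof -
 define l where "l = enn2real lam"
 define C where "C = 18 * l^2 + 32"
 have C: "0 <= C" by (simp add: C_def)
 define E where "E p p' = (LI s:{1<..}. ennreal (1/2 * nsq (p' s) + pot l (Q_inf + p s)))" for p p' :: "real => real^3^3"
 define m where "m = (INF om\<in>V. D lam (Q_phi om))"
 have m: "m <= D lam (Q_phi om)" if "om : V" for om unfolding m_def by (rule INF_lower[OF that])
 have "EX w p p' L d. w : V & (ALL s. (p has_vector_derivative p' s) (at s)) & continuous_on UNIV p' & (ALL s<=1. p s = Q_phi w - Q_inf) \<and>
   (ALL s>=L. p s = 0) & 1 <= L & (ALL s. p s : S0) & 0 <= d & ennreal d <= m & E p p' <= ennreal (d + e)"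
 \<comment> \<open>If m is infinite, every finite d lies below it. A profile that a cutoff leads
   from its initial value to Q_inf on [1,2] has finite energy, and this energy is taken as
   d.\<close>
 proof (cases "m = \<infinity>")
  case True
  obtain w where w: "w : V" using V by blast
  define q where "q = Q_phi w - Q_inf"
  have q: "norm q <= 2" "q : S0" unfolding q_def Q_phi_def
   by (auto intro: norm_uniaxial_diff_le[OF norm_e_phi] mem_S0 uniaxial_S0[OF norm_e_phi] Q_inf_S0)
  define p p' where "p s = (1 - step (s - 1)) *R q" and "p' s = (- step' (s - 1)) *R q" for s
  have dp: "(p has_vector_derivative p' s) (at s)" for s
  proof -
   have "((%s. s - 1) has_real_derivative 1) (at s)" by (auto intro!: derivative_eq_intros)
   from DERIV_chain'[OF this step_deriv]
   have "((%s. 1 - step (s - 1)) has_real_derivative - step' (s - 1)) (at s)" by (auto intro!: derivative_eq_intros)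
   from has_vector_derivative_scaleR[OF this has_vector_derivative_const[of q]] show ?thesis by (simp add: p_def[abs_def] p'_def)
  qed
  have pS: "p s : S0" for s unfolding p_def by (intro mem_S0 q)
  have p1: "p s = q" if "s <= 1" for s using that by (simp add: p_def step_eq)
  have p2: "p s = 0" if "2 <= s" for s using that by (simp add: p_def step_eq)
  have "E p p' <= (LI s. ennreal (9 + C * 20) * indicator {1..2::real} s)"
   unfolding E_def
  proof (rule nn_integral_mono)
   fix s :: real
   have QS: "Q_inf + p s : S0" by (intro mem_S0 Q_inf_S0 pS)
   have "norm (p s) <= 1 * 2" unfolding p_def using mult_mono[of "1 - step (s - 1)" 1 "norm q" 2] step_bounds[of "s - 1"] q by simp
   hence "nsq (p s) + (norm (p s))^4 <= 2^2 + 2^4" by (intro add_mono power_mono) auto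
   hence "C * (nsq (p s) + (norm (p s))^4) <= C * 20" using C by (intro mult_left_mono) auto
   hence 1: "pot l (Q_inf + p s) <= C * 20" using pot_le[OF QS, of l] by (simp add: C_def)
   have "norm (p' s) <= 3/2 * 2" unfolding p'_def using mult_mono[of "step' (s - 1)" "3/2" "norm q" 2] step'_bounds[of "s - 1"] q by simp
   hence "nsq (p' s) <= 3^2" by (intro power_mono) auto
   hence 2: "1/2 * nsq (p' s) + pot l (Q_inf + p s) <= 9 + C * 20" using 1 by simp
   have "pot l Q_inf <= 0" using pot_le[OF Q_inf_S0, of l] by simp
   hence "1/2 * nsq (p' s) + pot l (Q_inf + p s) <= 0" if "2 < s"
    using that p2[of s] by (simp add: p'_def step_eq)
   thus "ennreal (1/2 * nsq (p' s) + pot l (Q_inf + p s)) * indicator {1<..} s <= ennreal (9 + C * 20) * indicator {1..2} s"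
    using 2 by (auto simp: indicator_def ennreal_neg intro: ennreal_leI)
  qed
  also have "... < \<infinity>" by (simp add: nn_integral_cmult_indicator ennreal_mult_less_top)
  finally obtain d where d: "E p p' = ennreal d" "0 <= d" by (cases "E p p'") auto
  show ?thesis
   by (rule exI[of _ w], rule exI[of _ p], rule exI[of _ p'], rule exI[of _ 2], rule exI[of _ d])
    (use w dp pS p1 p2 d e True in "auto simp: q_def p'_def intro!: continuous_intros ennreal_leI")
 next
  case False
  then obtain d where d: "m = ennreal d" "0 <= d" by (cases m) auto
  have "m < m + ennreal (e/2)" using d e by (simp add: ennreal_plus[symmetric] ennreal_lessI del: ennreal_plus)
  then obtain w where w: "w : V" "D lam (Q_phi w) < m + ennreal (e/2)" unfolding m_def INF_less_iff by blast
  then obtain P where P: "P : profiles (Q_phi w)" "F_energy lam P < m + ennreal (e/2)" unfolding D_def INF_less_iff by blast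
  obtain P' w' where pd: "prof_data P' w'" and PP: "!!r. 1 <= r ==> P' r = P r"
   and int: "!!phi :: real^3^3 => real. phi : borel_measurable borel ==> (!!Q. Q : S0 ==> 0 <= phi Q) ==>
   (LL r:{1<..}. ennreal (1/2 * nsq (weak_deriv {1<..} 1 P r) + phi (P r)))
    = ennreal (1/2) * (LI x. w' x) + (LI r:{1<..}. ennreal (phi (P' r)))"
   using profiles_data[OF P(1)] by blast
  have F: "F_energy lam P = ennreal (1/2) * (LI x. w' x) + (LI r:{1<..}. ennreal (pot l (P' r)))"
   using int[OF pot_measurable pot_nonneg, of l] lam by (simp add: F_energy_def pot_def l_def add.assoc)
  have cont: "continuous_on (- {0}) (pot l)"
   unfolding pot_def[abs_def] by (intro continuous_intros continuous_f_pot continuous_g_pot)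
  obtain p p' L where p: "!!s. (p has_vector_derivative p' s) (at s)" "continuous_on UNIV p'" "!!s. s <= 1 ==> p s = P' 1 - Q_inf"
   "!!s. L <= s ==> p s = 0" "1 <= L" "!!s. p s : S0" "E p p' <= F_energy lam P + ennreal (e/2)"
   unfolding E_def F by (rule smooth_profile_exists[OF pd pot_measurable cont pot_nonneg C pot_le[of _ l, folded C_def], of "e/2"]) (use e in auto)
  have "E p p' <= m + ennreal (e/2) + ennreal (e/2)" using p(7) P(2) by (meson add_right_mono less_imp_le order_trans)
  hence "E p p' <= ennreal (d + e)" using d e by (simp add: ennreal_plus[symmetric] add.assoc del: ennreal_plus)
  moreover have "P' 1 = Q_phi w" using PP[of 1] P(1) by (simp add: profiles_def)
  ultimately show ?thesis
   by (intro exI[of _ w] exI[of _ p] exI[of _ p'] exI[of _ L] exI[of _ d]) (use w p d in auto)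
 qed
 then obtain w p p' L d where *: "w : V" "!!s. (p has_vector_derivative p' s) (at s)" "continuous_on UNIV p'" "!!s. s <= 1 ==> p s = Q_phi w - Q_inf"
   "!!s. s \<ge> L ==> p s = 0" "1 <= L" "!!s. p s : S0" "0 <= d" "ennreal d <= m" "E p p' <= ennreal (d + e)" by blast
 obtain M where "ALL s. norm (p s) <= M & norm (p' s) <= M" using profile_bounded(2)[OF *(2-5)] by blast
 hence "near_optimal lam e V w p p' L M d" unfolding near_optimal_def
  using * profile_bounded(1)[OF *(2-5)] order_trans[OF *(9) m] by (auto simp: E_def l_def)
 thus ?thesis by blast
qed

text \<open>The finite cover is taken in a compact ball of tensors and pulled back, because Q_phi
  does not extend continuously to the poles.\<close>

lemma Q_phi_partition:
 assumes tau: "0 < tau"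
 obtains n :: nat and V where "disjoint_family V" "!!j. V j : sets borel" "!!j. V j <= {om : sphere 0 1. 0 < rad om}"
  "(UN j:{0..<n}. V j) = {om : sphere 0 1. 0 < rad om}" "!!j om om'. om : V j ==> om' : V j ==> norm (Q_phi om - Q_phi om') <= tau"
proof -
 let ?S = "{om : sphere 0 1. 0 < rad om}"
 let ?Y = "%x. uniaxial (stereo (W x))"
 have Y: "?Y om = Q_phi om" if "om : ?S" for om using uniaxial_W[of om] that by (simp add: sgn_div_norm)
 have cY: "continuous_on Om1 ?Y"
 proof -
  obtain W' where W': "C1_on Om1 W W'" "!!x e. x : Om1 ==> W' x e \<bullet> e3 = 0" by (rule W_C1_on) blast
  show ?thesis by (rule C1_on_uniaxial_stereo[OF W'(1) W_e3(1) W'(2)]) (auto intro: C1_on_continuous)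
 qed
 have "norm (?Y x) <= 1" for x
  by (rule power2_le_imp_le) (simp_all add: norm_uniaxial[OF norm_stereo[OF W_e3(1)]])
 hence Yb: "?Y x : cball 0 1" for x by simp
 have cov: "cball (0::real^3^3) 1 <= (UN a:cball 0 1. ball a (tau/2))" using tau by (metis UN_I centre_in_ball half_gt_zero subsetI)
 obtain A where A: "finite A" "cball 0 1 <= (UN a:A. ball a (tau/2))" "A <= cball (0::real^3^3) 1"
  by (rule compactE_image[OF compact_cball _ cov]) auto
 obtain f where f: "bij_betw f {0..<card A} A" using ex_bij_betw_nat_finite[OF A(1)] by blast
 define U where "U j = sphere 0 1 Int {om. 0 < rad om} Int (Om1 Int ?Y -` ball (f j) (tau/2))" for j
 have Ub: "U j : sets borel" for j unfolding U_def
  by (intro sets.Int borel_closed[OF closed_sphere] borel_open open_Om1(1) continuous_open_preimage[OF cY open_Om1(3)] open_ball)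
 show thesis
 proof (rule that[of "disjointed U" "card A"])
  show "disjoint_family (disjointed U)" by (rule disjoint_family_disjointed)
  show "disjointed U j : sets borel" for j unfolding disjointed_def by (intro sets.Diff sets.finite_UN Ub) auto
  show "disjointed U j <= ?S" for j using disjointed_subset[of U j] by (auto simp: U_def)
  have "?S <= (UN j:{0..<card A}. U j)"
  proof
   fix om assume om: "om : ?S"
   obtain a where a: "a : A" "?Y om : ball a (tau/2)" using A(2) Yb[of om] by blast
   have "a : f ` {0..<card A}" using f a(1) by (simp add: bij_betw_def)
   then obtain j where j: "j : {0..<card A}" "a = f j" by (rule imageE)
   have "om : U j" using om a(2) unfolding U_def j(2) by (simp add: Om1_def)
   thus "om : (UN j:{0..<card A}. U j)" using j(1) by (rule UN_I[rotated])
  qed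
  moreover have "(UN j:{0..<card A}. U j) <= ?S" by (auto simp: U_def)
  ultimately show "(UN j:{0..<card A}. disjointed U j) = ?S" unfolding finite_UN_disjointed_eq by blast
  show "norm (Q_phi om - Q_phi om') <= tau" if "om : disjointed U j" "om' : disjointed U j" for j om om'
  proof -
   have o: "om : U j" "om' : U j" using that disjointed_subset[of U j] by auto
   hence "dist (f j) (Q_phi om) < tau/2" "dist (f j) (Q_phi om') < tau/2" using Y[of om] Y[of om'] by (auto simp: U_def)
   thus ?thesis using dist_triangle2[of "Q_phi om" "Q_phi om'" "f j"] by (simp add: dist_norm norm_minus_commute)
  qed
 qed
qed

text \<open>The integrand is the shape of the density bound on a core: a layer of thickness tau, a
  profile delayed by tau at no cost, and a small constant up to L.\<close>

lemma layer_integral: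
 fixes phi :: "real => real"
 assumes phi[measurable]: "phi : borel_measurable borel" and nn: "0 <= C" "0 <= tau" "0 <= a" "0 <= k" "0 <= L" "!!t. 0 <= phi t"
 shows "(LI s:{1<..}. ennreal (C * indicator {1..1+tau} s + (a * (phi (s - tau) * indicator {1<..} (s - tau)) + k * indicator {..L} s)))
  <= ennreal (C * tau) + (ennreal a * (LI t:{1<..}. ennreal (phi t)) + ennreal (k * L))"
proof -
 let ?g = "%t. ennreal (phi t) * indicator {1<..} t"
 have "(LI s:{1<..}. ennreal (C * indicator {1..1+tau} s + (a * (phi (s - tau) * indicator {1<..} (s - tau)) + k * indicator {..L} s)))
  <= (LI s. ennreal C * indicator {1..1+tau} s + (ennreal a * ?g (- tau + 1 * s) + ennreal k * indicator {0..L} s))"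
 proof (rule nn_integral_mono)
  fix s :: real
  have "ennreal (C * indicator {1..1+tau} s + (a * (phi (s - tau) * indicator {1<..} (s - tau)) + k * indicator {..L} s))
   = ennreal C * indicator {1..1+tau} s + (ennreal a * ?g (- tau + 1 * s) + ennreal k * indicator {..L} s)"
   using nn nn(6)[of "s - tau"] by (auto simp: indicator_def ennreal_mult)
  thus "ennreal (C * indicator {1..1+tau} s + (a * (phi (s - tau) * indicator {1<..} (s - tau)) + k * indicator {..L} s)) * indicator {1<..} s
   <= ennreal C * indicator {1..1+tau} s + (ennreal a * ?g (- tau + 1 * s) + ennreal k * indicator {0..L} s)"
   by (cases "1 < s") (auto simp: indicator_def)
 qed
 also have "... = ennreal C * emeasure lborel {1..1+tau} + (ennreal a * (LI s. ?g (- tau + 1 * s)) + ennreal k * emeasure lborel {0..L})"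
  by (simp add: nn_integral_add nn_integral_cmult del: emeasure_lborel_Icc_eq)
 also have "(LI s. ?g (- tau + 1 * s)) = (LI t. ?g t)"
  using nn_integral_real_affine[of ?g 1 "- tau"] by simp
 finally show ?thesis using nn by (simp add: ennreal_mult)
qed

text \<open>Disjoint compact sets have positive distance, which is what angular cutoffs between
  pieces ask for; the rest has small cone measure.\<close>

lemma sph_inner_regular:
 assumes "B : sets borel" "0 < e"
 obtains K where "compact K" "K <= B" "emeasure sph (B - K) <= ennreal e"
proof -
 have fin: "emeasure sph B < \<infinity>" by (rule emeasure_sph_finite)
 have "emeasure sph B = (SUP K\<in>{K. K <= B & compact K}. emeasure sph K)"
  by (rule inner_regular) (use emeasure_sph_finite[of UNIV] assms in auto)
 moreover have "emeasure sph B < emeasure sph B + ennreal e" using fin assms(2) ennreal_add_left_cancel_less[of "emeasure sph B" 0] by auto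
 ultimately have "emeasure sph B < (SUP K\<in>{K. K <= B & compact K}. emeasure sph K) + ennreal e" by simp
 hence "emeasure sph B < (SUP K\<in>{K. K <= B & compact K}. emeasure sph K + ennreal e)"
  by (subst (asm) ennreal_SUP_add_left[symmetric]) auto
 then obtain K where K: "K <= B" "compact K" "emeasure sph B < emeasure sph K + ennreal e" unfolding less_SUP_iff by blast
 have Ks: "K : sets sph" using borel_compact[OF K(2)] by simp
 have "emeasure sph (B - K) = emeasure sph B - emeasure sph K"
  by (rule emeasure_Diff) (use emeasure_sph_finite[of K] assms Ks K in auto)
 also have "... <= ennreal e" using K(3) fin by (simp add: ennreal_minus_le_iff less_imp_le top.not_eq_extremum)
 finally show thesis using K that by blast
qed

text \<open>Constants are chosen in the order tau, pieces and profiles, nu, k1, compact cores K j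
  with cutoffs, and finally the bound on eta. Over a core one cutoff is 1 and the others vanish, so
  the map there is the profile of that piece behind the layer. Between the cores the crude bound CZ
  meets a set of small cone measure.\<close>

lemma good_maps_finite:
 assumes lam: "lam < \<infinity>" and eps0: "0 < eps0"
 shows "EX dl>0. ALL xi eta. 0 < xi --> 0 < eta --> eta < dl --> \<bar>(eta / xi)^2 - (enn2real lam)^2\<bar> < dl --> (EX Q. good_map lam eps0 xi eta Q)"
proof -
 define M where "M = measure sph UNIV + 3"
 have M: "0 < M" using measure_nonneg[of sph UNIV] unfolding M_def by linarith
 define eps where "eps = eps0 / M"
 have eps: "0 < eps" "eps * M = eps0" using eps0 M by (auto simp: eps_def)
 define l where "l = enn2real lam"
 obtain i0 where i0: "0 <= i0" "(LI x:ball 0 2. ennreal (kap x)) = ennreal i0" by (rule nn_integral_kap)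
 \<comment> \<open>Bounds the density in the boundary layer independently of its thickness: the
   slope 3 / (2 tau) of psi is compensated by |Y - q| <= tau, which leaves 9/4; since |Q - Q_inf| <=
   2 there, f is at most 360 = 18 (2^2 + 2^4); and g is at most 2.\<close>
 define C0 where "C0 = 9/4 + (l^2 + 1) * 360 + 2"
 have C0: "0 < C0" by (simp add: C0_def add_pos_nonneg)
 define tau where "tau = min 1 (eps / (8 * C0))"
 have tau: "0 < tau" "tau <= 1" "C0 * tau <= eps / 8"
 proof -
  show "0 < tau" "tau <= 1" using eps C0 by (auto simp: tau_def)
  have "C0 * tau <= C0 * (eps / (8 * C0))" using C0 by (intro mult_left_mono) (auto simp: tau_def)
  thus "C0 * tau <= eps / 8" using C0 by simp
 qed
 obtain n :: nat and V where V: "disjoint_family V" "!!j. V j : sets borel" "!!j. V j <= {om : sphere 0 1. 0 < rad om}"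
  "(UN j:{0..<n}. V j) = {om : sphere 0 1. 0 < rad om}" "!!j om om'. om : V j ==> om' : V j ==> norm (Q_phi om - Q_phi om') <= tau"
  by (rule Q_phi_partition[OF tau(1)]) (rule that)
 define J where "J = {j : {0..<n}. V j ~= {}}"
 have Js: "J <= {0..<n}" by (auto simp: J_def)
 have J: "finite J" "card J <= n" using finite_subset[OF Js] card_mono[OF _ Js] by auto
 have UJ: "(UN j:J. V j) = {om : sphere 0 1. 0 < rad om}" unfolding V(4)[symmetric] by (auto simp: J_def)
 define N where "N = real (card J)"
 have N: "0 <= N" "N <= real n" using J by (auto simp: N_def)
 have "ALL j:J. EX w p p' L M d. near_optimal lam (eps/8) (V j) w p p' L M d"
  using near_optimal_exists[OF lam, of _ "eps/8"] eps by (simp add: J_def)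
 then obtain w p p' L Mj d where no: "!!j. j : J ==> near_optimal lam (eps/8) (V j) (w j) (p j) (p' j) (L j) (Mj j) (d j)"
  by metis
 have w: "w j : V j" and dp: "(p j has_vector_derivative p' j s) (at s)" and cp: "continuous_on UNIV (p' j)"
  and p1: "s <= 1 ==> p j s = Q_phi (w j) - Q_inf" "s <= 1 ==> p' j s = 0" and pL: "L j <= s ==> p j s = 0" and L1: "1 <= L j"
  and pS: "p j s : S0" and pM: "norm (p j s) <= Mj j" "norm (p' j s) <= Mj j" and d0: "0 <= d j"
  and dD: "om : V j ==> ennreal (d j) <= D lam (Q_phi om)"
  and pe: "(LI s:{1<..}. ennreal (1/2 * nsq (p' j s) + pot l (Q_inf + p j s))) <= ennreal (d j + eps/8)"
  if "j : J" for j s om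
  using no[OF that] unfolding near_optimal_def l_def by blast+
 have p'L: "p' j s = 0" if "j : J" "L j < s" for j s
  by (rule constant_profile_deriv_zero[OF dp, of _ "{L j<..}" 0]) (use that pL in auto)
 \<comment> \<open>Exceeds every L j; the summand 2 accommodates the layer and the delay by
   tau.\<close>
 define L' where "L' = 2 + (SUM j:J. L j)"
 have Lj: "L j + 2 <= L'" if "j : J" for j
  using member_le_sum[OF that, of L] L1 J by (force simp: L'_def)
 have L': "2 <= L'" using sum_nonneg[of J L] L1 by (force simp: L'_def)
 define M0 where "M0 = (SUM j:J. Mj j) + 3/tau + 2"
 have Mj0: "0 <= Mj j" if "j : J" for j using pM(1)[OF that, of 0] norm_ge_zero order_trans by blast
 have Mj: "Mj j + 3/tau + 2 <= M0" if "j : J" for j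
  using member_le_sum[OF that, of Mj] Mj0 J by (simp add: M0_def)
 have M0: "2 <= M0" "3/tau <= M0" using sum_nonneg[of J Mj] Mj0 tau by (auto simp: M0_def add_nonneg_nonneg)
 define q where "q j = Q_phi (w j) - Q_inf" for j
 have qS: "q j : S0" and q2: "norm (q j) <= 2" for j
  unfolding q_def Q_phi_def by (intro mem_S0 uniaxial_S0[OF norm_e_phi] Q_inf_S0, intro norm_uniaxial_diff_le norm_e_phi)
 define psi psi' where "psi s = 1 - step ((s - 1) / tau)" and "psi' s = - step' ((s - 1) / tau) / tau" for s
 have psi: "0 <= psi s" "psi s <= 1" "\<bar>psi' s\<bar> <= 3 / (2 * tau)" "1 + tau <= s ==> psi s = 0" "1 + tau <= s ==> psi' s = 0" for s
 proof -
  show "0 <= psi s" "psi s <= 1" using step_bounds by (auto simp: psi_def)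
  show "\<bar>psi' s\<bar> <= 3 / (2 * tau)" using step'_bounds[of "(s - 1) / tau"] tau by (simp add: psi'_def divide_le_eq)
  show "psi s = 0" "psi' s = 0" if "1 + tau <= s"
   using that tau by (simp_all add: psi_def psi'_def step_eq le_divide_eq)
 qed
 have dpsi: "(psi has_vector_derivative psi' s) (at s)" for s
 proof -
  have "((%s. (s - 1) / tau) has_real_derivative 1 / tau) (at s)" using tau by (auto intro!: derivative_eq_intros)
  from DERIV_chain'[OF this step_deriv]
  have "(psi has_real_derivative psi' s) (at s)" unfolding psi_def[abs_def] psi'_def by (auto intro!: derivative_eq_intros)
  thus ?thesis by (simp add: has_real_derivative_iff_has_vector_derivative)
 qed
 have cpsi: "continuous_on UNIV psi'" unfolding psi'_def[abs_def] using tau by (intro continuous_intros) auto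
 define a a' where "a j s = p j (s - tau) - psi s *R q j" and "a' j s = p' j (s - tau) - psi' s *R q j" for j s
 have da: "(a j has_vector_derivative a' j s) (at s)" if "j : J" for j s
 proof -
  have "((%s. s - tau) has_vector_derivative 1) (at s)" by (auto intro!: derivative_eq_intros)
  from vector_diff_chain_at[OF this dp[OF that]]
  have "((%s. p j (s - tau)) has_vector_derivative p' j (s - tau)) (at s)" by (simp add: o_def)
  moreover have "((%s. psi s *R q j) has_vector_derivative psi' s *R q j) (at s)"
   using has_vector_derivative_scaleR[OF dpsi[unfolded has_real_derivative_iff_has_vector_derivative[symmetric]] has_vector_derivative_const[of "q j"]] by simp
  ultimately show ?thesis unfolding a_def[abs_def] a'_def by (rule has_vector_derivative_diff)
 qed
 have ca: "continuous_on UNIV (a' j)" if "j : J" for j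
  unfolding a'_def[abs_def] by (intro continuous_intros cpsi continuous_on_compose2[OF cp[OF that]]) auto
 have aL: "a j s = 0" "a' j s = 0" if "j : J" "L' <= s" for j s
  using that Lj[OF that(1)] L' tau psi(4,5)[of s] pL[OF that(1), of "s - tau"] p'L[OF that(1), of "s - tau"] by (auto simp: a_def a'_def)
 have aS: "a j s : S0" if "j : J" for j s unfolding a_def by (intro mem_S0 pS that qS)
 have psiq: "norm (psi s *R q j) <= 2" "norm (psi' s *R q j) <= 3 / tau" for s j
 proof -
  show "norm (psi s *R q j) <= 2" using mult_mono[OF psi(2)[of s] q2[of j]] psi(1)[of s] by simp
  show "norm (psi' s *R q j) <= 3 / tau" using mult_mono[OF psi(3)[of s] q2[of j]] tau by simp
 qed
 have aM: "norm (a j s) <= M0" "norm (a' j s) <= M0" if "j : J" for j s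
  unfolding a_def a'_def using norm_triangle_ineq4[of "p j (s - tau)" "psi s *R q j"] norm_triangle_ineq4[of "p' j (s - tau)" "psi' s *R q j"]
   psiq[of s j] pM[OF that, of "s - tau"] Mj[OF that] tau divide_nonneg_pos[of 3 tau] by linarith+
 define R0 where "R0 = N * (1 * M0) + 2 + M0"
 define Kf where "Kf = 18 * (R0^2 + R0^4)"
 have Kf: "0 <= Kf" by (simp add: Kf_def)
 have fK: "f_pot Q <= Kf" if "Q : S0" "norm (Q - Q_inf) <= R0" for Q
 proof -
  have "18 * (nsq (Q - Q_inf) + (norm (Q - Q_inf))^4) <= Kf" unfolding Kf_def
   using that by (intro mult_left_mono add_mono power_mono) auto
  thus ?thesis using f_pot_quadratic[OF that(1)] by linarith
 qed
 \<comment> \<open>A density bound valid in every direction, for use between the cores.\<close>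
 define CZ where "CZ = (N * (1 * M0) + M0 * 2)^2 + (l^2 + 1) * Kf + 2"
 have CZ: "0 < CZ" using Kf by (simp add: CZ_def add_nonneg_pos)
 define dm where "dm = (SUM j:J. d j)"
 have dm: "d j <= dm" if "j : J" for j unfolding dm_def by (rule member_le_sum) (use that d0 J in auto)
 have dm0: "0 <= dm" unfolding dm_def by (rule sum_nonneg) (rule d0)
 \<comment> \<open>Collects what is multiplied by nu: the energies of the profiles and the bound Kf
   for f over the length L'.\<close>
 define y0 where "y0 = dm + eps + Kf * L'"
 have y0: "0 < y0" using dm0 eps Kf L' by (simp add: y0_def add_nonneg_pos add_pos_nonneg)
 define nu where "nu = min 1 (eps / (8 * y0))"
 have nu: "0 < nu" "nu <= 1" "nu * y0 <= eps / 8"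
 proof -
  show "0 < nu" "nu <= 1" using eps y0 by (auto simp: nu_def)
  have "nu * y0 <= eps / (8 * y0) * y0" using y0 by (intro mult_right_mono) (auto simp: nu_def)
  thus "nu * y0 <= eps / 8" using y0 by simp
 qed
 \<comment> \<open>Calibrated so that n sets of cone measure k1, with density CZ over the length L'
   and Jacobian at most 4, cost at most eps / 2.\<close>
 define k1 where "k1 = eps / (8 * CZ * L' * (real n + 1))"
 have k1: "0 < k1" "4 * (CZ * L') * (real n * k1) <= eps / 2"
 proof -
  show "0 < k1" using eps CZ L' by (simp add: k1_def)
  have "k1 * (8 * CZ * L') = eps / (real n + 1)" using CZ L' by (simp add: k1_def)
  moreover have "4 * (CZ * L') * (real n * k1) = real n / 2 * (k1 * (8 * CZ * L'))" by simp
  ultimately have "4 * (CZ * L') * (real n * k1) = eps / 2 * (real n / (real n + 1))" by simp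
  also have "... <= eps / 2 * 1" using eps by (intro mult_left_mono) (auto simp: divide_le_eq)
  finally show "4 * (CZ * L') * (real n * k1) <= eps / 2" by simp
 qed
 have "ALL j:J. EX K. compact K & K <= V j & emeasure sph (V j - K) <= ennreal k1"
  using sph_inner_regular[OF V(2) k1(1)] by metis
 then obtain K where K: "!!j. j : J ==> compact (K j)" "!!j. j : J ==> K j <= V j" "!!j. j : J ==> emeasure sph (V j - K j) <= ennreal k1"
  by metis
 have KS: "K j <= sphere 0 1" if "j : J" for j using K(2)[OF that] V(3)[of j] by blast
 have Kd: "K i Int K j = {}" if "i : J" "j : J" "i ~= j" for i j
  using K(2)[OF that(1)] K(2)[OF that(2)] disjoint_family_onD[OF V(1) _ _ that(3)] by blast
 define cutoff where "cutoff j X X' c \<longleftrightarrow> C1_on (- {0}) X X' & (ALL x. \<bar>X x\<bar> <= 1) & (ALL x. x ~= 0 --> sgn x : K j --> X x = (1::real))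
   & (ALL i:J. i ~= j --> (ALL x. x ~= 0 --> sgn x : K i --> X x = 0)) & 0 <= c & (ALL x e. 1 <= norm x --> norm x <= 2 --> e : Basis --> \<bar>X' x e\<bar> <= c)"
  for j X X' and c :: real
 have "EX X X' c. cutoff j X X' c"
  if j: "j : J" for j
 proof -
  obtain X where X: "C1 (- {0}) X" "!!x. 0 <= X x" "!!x. X x <= 1" "!!x. x ~= 0 ==> sgn x : K j ==> X x = 1"
    "!!x. x ~= 0 ==> sgn x : (UN i:J - {j}. K i) ==> X x = (0::real)"
  proof (rule cone_cutoff[OF K(1)[OF j] KS[OF j]])
   show "closed (UN i:J - {j}. K i)" using J K(1) by (intro closed_UN) (auto intro: compact_imp_closed)
   show "K j Int (UN i:J - {j}. K i) = {}" using Kd j by blast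
  qed (rule that)
  obtain X' where X': "C1_on (- {0}) X X'" using X(1) by (auto simp: C1_def)
  have "compact (cball (0::real^3) 2 - ball 0 1)" by (intro compact_diff compact_cball open_ball)
  then obtain c where c: "0 <= c" "!!x e. x : cball 0 2 - ball 0 1 ==> e : Basis ==> norm (X' x e) <= c"
   by (rule C1_derivative_bounded[OF X']) auto
  have "\<bar>X x\<bar> <= 1" for x using X(2,3)[of x] by simp
  moreover have "X x = 0" if "i : J" "i ~= j" "x ~= 0" "sgn x : K i" for i x using X(5)[of x] that by blast
  ultimately have "cutoff j X X' c" unfolding cutoff_def using X(4) X' c by simp
  thus ?thesis by blast
 qed
 then obtain X X' cj where co: "!!j. j : J ==> cutoff j (X j) (X' j) (cj j)" by metis
 have X: "!!j. j : J ==> C1_on (- {0}) (X j) (X' j)" "!!j x. j : J ==> \<bar>X j x\<bar> <= 1"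
   "!!j x. j : J ==> x ~= 0 ==> sgn x : K j ==> X j x = (1::real)"
   "!!i j x. j : J ==> i : J ==> i ~= j ==> x ~= 0 ==> sgn x : K i ==> X j x = 0" "!!j. j : J ==> 0 <= cj j"
   "!!j x e. j : J ==> 1 <= norm x ==> norm x <= 2 ==> e : Basis ==> \<bar>X' j x e\<bar> <= cj j"
  using co unfolding cutoff_def by blast+
 define c where "c = (SUM j:J. cj j)"
 have cj: "cj j <= c" if "j : J" for j unfolding c_def by (rule member_le_sum) (use that X(5) J in auto)
 have Xc: "\<bar>X' j x e\<bar> <= c" if "j : J" "x : Omega" "norm x < 2" "e : Basis" for j x e
  using X(6)[OF that(1) _ _ that(4), of x] cj[OF that(1)] that by (force simp: mem_Omega)
 have a1: "a j 1 = 0" if "j : J" for j using p1(1)[OF that, of "1 - tau"] tau by (simp add: a_def psi_def step_eq q_def)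
 have psiL: "psi s = 0" if "L' <= s" for s using psi(4)[of s] that L' tau by simp
 have psi1: "psi 1 = 1" and psia: "\<bar>psi s\<bar> <= 1" for s using psi(1,2)[of s] by (simp_all add: psi_def step_eq)
 have psiM: "\<bar>psi' s\<bar> <= M0" for s using psi(3)[of s] M0(2) divide_pos_pos[of 3 tau] tau(1) by simp
 \<comment> \<open>The cores are compact and avoid the poles. Over them, up to height rho above the
   sphere, \<open>fade\<close> is therefore 1 and Y is Q_phi - Q_inf.\<close>
 obtain rho where rho: "0 < rho" "!!j om. j : J ==> om : K j ==> rho <= rad om"
 proof (cases "(UN j:J. K j) = {}")
  case False
  have "compact (UN j:J. K j)" using J K by (intro compact_UN) auto
  from continuous_attains_inf[OF this False continuous_rad]
  obtain o1 where o1: "o1 : (UN j:J. K j)" "!!om. om : (UN j:J. K j) ==> rad o1 <= rad om" by blast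
  hence "0 < rad o1" using K(2) V(3) by blast
  thus thesis using o1(2) by (intro that[of "rad o1"]) auto
 qed (use that[of 1] in auto)
 define Cc where "Cc = 2 * (1 + 1/nu) * (18 * (card J * (c * M0))^2 + 73984)"
 have Cc: "0 <= Cc" using nu by (simp add: Cc_def)
 define eps' where "eps' = eps / (2 * (real n + 1))"
 have eps': "0 < eps'" "N * eps' <= eps" "eps' <= eps / 2"
 proof -
  show "0 < eps'" using eps by (simp add: eps'_def)
  have "eps' * (2 * (real n + 1)) = eps" by (simp add: eps'_def)
  hence e: "2 * (real n * eps') + 2 * eps' = eps" by (simp add: algebra_simps)
  have n0: "0 <= real n * eps'" using \<open>0 < eps'\<close> by simp
  thus "eps' <= eps / 2" using e by linarith
  have "N * eps' <= real n * eps'" using N \<open>0 < eps'\<close> by (intro mult_right_mono) auto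
  thus "N * eps' <= eps" using e n0 \<open>0 < eps'\<close> by linarith
 qed
 \<comment> \<open>The sum of all t for which eta * t <= 1 is wanted; eta * y1 <= 1 yields every one
   of these conditions.\<close>
 define y1 where "y1 = 1 + 2 * L' + 1 / rho + 6 * L' * (dm + eps) / eps + Cc * i0 / eps'"
 have y1: "0 <= 2 * L'" "0 <= 1 / rho" "0 <= 6 * L' * (dm + eps) / eps" "0 <= Cc * i0 / eps'"
  using L' rho dm0 eps Cc i0 eps' by auto
 define dl where "dl = nu / y1"
 have y11: "1 <= y1" using y1 unfolding y1_def by linarith
 have dl: "0 < dl" "dl <= nu" using nu y11 by (auto simp: dl_def divide_le_eq)
 have "EX Q. good_map lam eps0 xi eta Q" if xi: "0 < xi" and eta: "0 < eta" "eta < dl" and mu: "\<bar>(eta / xi)^2 - l^2\<bar> < dl" for xi eta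
 proof -
  have ey: "eta * y1 <= 1" using eta y11 nu by (simp add: dl_def pos_less_divide_eq)
  have et: "eta * t <= 1" if "t <= y1" for t using mult_left_mono[OF that, of eta] eta ey by linarith
  have e1: "eta * (2 * L') <= 1" by (rule et) (use y1 in "unfold y1_def, linarith")
  have e2: "eta * (1 / rho) <= 1" by (rule et) (use y1 in "unfold y1_def, linarith")
  have e3': "eta * (6 * L' * (dm + eps) / eps) <= 1" by (rule et) (use y1 in "unfold y1_def, linarith")
  have e4: "eta * (Cc * i0 / eps') <= 1" by (rule et) (use y1 in "unfold y1_def, linarith")
  have etaL: "eta * L' <= 1/2" using e1 by simp
  have etar: "eta <= rho" using e2 rho by (simp add: field_simps)
  have etad: "3 * (eta * L') * (dm + eps) <= eps / 2" using e3' eps by (simp add: field_simps)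
  have etac: "eta * Cc * i0 <= eps'" using e4 eps' by (simp add: field_simps)
  have mu': "(eta / xi)^2 <= l^2 + nu" using mu dl by linarith
  define s where "s x = 1 + (norm x - 1) / eta" for x :: "real^3"
  define Y where "Y x = uniaxial (stereo (W x)) - Q_inf" for x
  define Q where "Q x = Q_inf + ((SUM j:J. X j x *R a j (s x)) + psi (s x) *R Y x)" for x
  define A where "A x = (SUM j:J. X j x *R a' j (s x)) + psi' (s x) *R Y x" for x
  define E where "E x = (1 + nu) / 2 * nsq (A x) + (eta / xi)^2 * f_pot (Q x) + g_pot (Q x)" for x
  have "EX Q'. C1_on Omega Q Q' & admissible Q & (ALL x:Omega. eta^2 * dens xi eta Q Q' x <= E x + (if norm x < 2 then eta^2 * Cc * kap x else 0))"
   unfolding E_def A_def Q_def[abs_def] Y_def s_def Cc_def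
   apply (rule layer_map[where J = J and X = X and X' = X' and c = c and a = a and a' = a' and L = L' and M = M0 and psi = psi and psi' = psi' and eta = eta and nu = nu,
      OF J(1) X(1,2) Xc da ca aL(1) a1 aS aM dpsi cpsi psiL psi1 psia psiM eta(1) etaL nu(1)])
   apply assumption+
   subgoal premises prems for Q' by (intro exI[of _ Q'] conjI ballI prems)
   done
  then obtain Q' where Q': "C1_on Omega Q Q'" "admissible Q"
    and dn: "!!x. x : Omega ==> eta^2 * dens xi eta Q Q' x <= E x + (if norm x < 2 then eta^2 * Cc * kap x else 0)" by blast
  have QS: "Q x : S0" for x unfolding Q_def Y_def
   by (intro mem_S0(2) subspace_sum[OF subspace_S0] mem_S0(4) mem_S0(3) aS uniaxial_S0 norm_stereo W_e3 Q_inf_S0)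
  have Y2: "norm (Y x) <= 2" for x unfolding Y_def by (rule norm_uniaxial_diff_le[OF norm_stereo[OF W_e3(1)]])
  have psiY: "norm (psi (s x) *R Y x) <= 1 * 2" "norm (psi' (s x) *R Y x) <= M0 * 2" for x
   unfolding norm_scaleR using M0 by (intro mult_mono psia psiM Y2; simp)+
  have sa: "norm (SUM j:J. X j x *R a j (s x)) <= N * (1 * M0)" "norm (SUM j:J. X j x *R a' j (s x)) <= N * (1 * M0)" for x
   unfolding N_def by (rule norm_sum_scaleR_le; use X(2) aM in simp)+
  have QR: "norm (Q x - Q_inf) <= R0" for x
   using norm_triangle_ineq[of "SUM j:J. X j x *R a j (s x)" "psi (s x) *R Y x"] psiY(1)[of x] M0 sa(1)[of x] by (simp add: Q_def R0_def)
  have AR: "norm (A x) <= N * (1 * M0) + M0 * 2" for x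
   using norm_triangle_ineq[of "SUM j:J. X j x *R a' j (s x)" "psi' (s x) *R Y x"] psiY(2)[of x] sa(2)[of x] by (simp add: A_def)
  have g0: "g_pot Q_inf = 0" using g_pot_quadratic[OF Q_inf_S0] g_pot_nonneg[OF Q_inf_S0] by simp
  have E0: "E x = 0" if "L' <= s x" for x
  proof -
   have "psi (s x) = 0" "psi' (s x) = 0" using psi(4,5)[of "s x"] that L' tau by auto
   hence "Q x = Q_inf" "A x = 0" using aL that by (simp_all add: Q_def A_def)
   thus ?thesis using g0 f_pot_Q_inf by (simp add: E_def)
  qed
  have muf: "(eta / xi)^2 * f <= l^2 * f + nu * f'" if "0 <= f" "f <= f'" for f f'
  proof -
   have "(eta / xi)^2 * f <= (l^2 + nu) * f" using mu' that by (intro mult_right_mono) auto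
   also have "... <= l^2 * f + nu * f'" using mult_left_mono[OF that(2), of nu] nu unfolding distrib_right by linarith
   finally show ?thesis .
  qed
  have EZ: "E x <= CZ" for x
  proof -
   have "(1 + nu) / 2 * nsq (A x) <= 1 * (N * (1 * M0) + M0 * 2)^2" using AR[of x] nu by (intro mult_mono power_mono) auto
   moreover have "(eta / xi)^2 * f_pot (Q x) <= (l^2 + 1) * Kf"
    using mu' nu fK[OF QS QR] f_pot_nonneg[OF QS[of x]] by (intro mult_mono) auto
   ultimately show ?thesis using g_pot_le[of "Q x"] by (simp add: E_def CZ_def)
  qed
  have core: "A x = a' j (s x) + psi' (s x) *R Y x" "Q x = Q_inf + (a j (s x) + psi (s x) *R Y x)"
   if "j : J" "x ~= 0" "sgn x : K j" for j x
  proof -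
   have "(SUM i:J. X i x *R b i) = b j" for b :: "nat => real^3^3"
   proof -
    have "(SUM i:J. X i x *R b i) = (SUM i:J. if i = j then b j else 0)"
     by (rule sum.cong) (use X(3)[OF that] X(4)[OF _ that(1) _ that(2,3)] in auto)
    thus ?thesis using that(1) J(1) by simp
   qed
   thus "A x = a' j (s x) + psi' (s x) *R Y x" "Q x = Q_inf + (a j (s x) + psi (s x) *R Y x)"
    by (simp_all only: A_def Q_def)
  qed
  define phi where "phi j t = 1/2 * nsq (p' j t) + pot l (Q_inf + p j t)" for j t
  have phi0: "0 <= phi j t" if "j : J" for j t
   unfolding phi_def by (intro add_nonneg_nonneg pot_nonneg mem_S0 Q_inf_S0 pS that) simp
  have phim: "phi j : borel_measurable borel" if "j : J" for j
  proof -
   have [measurable]: "p' j : borel_measurable borel" by (rule borel_measurable_continuous_onI[OF cp[OF that]])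
   have [measurable]: "p j : borel_measurable borel"
    by (intro borel_measurable_continuous_onI continuous_at_imp_continuous_on ballI has_vector_derivative_continuous[OF dp[OF that]])
   show ?thesis unfolding phi_def[abs_def] by measurable
  qed
  \<comment> \<open>C0 in the layer, then the density of the delayed profile, and nu * Kf for the
    difference between (eta / xi)^2 and l^2.\<close>
  define H where "H j t = C0 * indicator {1..1+tau} t + ((1 + nu) * (phi j (t - tau) * indicator {1<..} (t - tau)) + nu * Kf * indicator {..L'} t)" for j t
  have H0: "0 <= H j t" if "j : J" for j t unfolding H_def
   using C0 nu Kf phi0[OF that] by (intro add_nonneg_nonneg mult_nonneg_nonneg) auto
  have EH: "E x <= H j (s x)" if j: "j : J" and x: "x : Omega" "sgn x : K j" and sL: "s x < L'" for j x
  proof -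
   have x1: "1 < norm x" "x ~= 0" using x by (auto simp: mem_Omega)
   have s1: "1 <= s x" using x1 eta by (simp add: s_def)
   note C = core[OF j x1(2) x(2)]
   have nK: "0 <= nu * Kf" using nu Kf by simp
   show ?thesis
   proof (cases "s x <= 1 + tau")
    \<comment> \<open>In the layer |x| - 1 <= eta * tau <= rho, so Y does not depend on |x| and lies
      within tau of q.\<close>
    case True
    have "norm x - 1 = eta * (s x - 1)" using eta by (simp add: s_def)
    also have "... <= eta * 1" using True tau eta by (intro mult_left_mono) auto
    also have "... <= rad (sgn x)" using etar rho(2)[OF j x(2)] by simp
    also have rr: "rad (sgn x) <= rad x"
     using mult_right_mono[of "inverse (norm x)" 1 "rad x"] x1 by (simp add: sgn_div_norm hp_scaleR inverse_le_1_iff)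
    finally have Yx: "Y x = Q_phi (sgn x) - Q_inf"
     using uniaxial_W[OF order.strict_trans2[OF rho(1) order_trans[OF rho(2)[OF j x(2)] rr]]] by (simp add: Y_def)
    have "norm (Y x - q j) <= tau" unfolding Yx q_def using V(5)[of "sgn x" j "w j"] K(2)[OF j] x(2) w[OF j] by auto
    moreover have "A x = psi' (s x) *R (Y x - q j)" using True p1(2)[OF j, of "s x - tau"] by (simp add: C a'_def scaleR_diff_right)
    ultimately have "norm (A x) <= 3 / (2 * tau) * tau" using mult_mono[OF psi(3)[of "s x"], of "norm (Y x - q j)" tau] tau by simp
    hence "nsq (A x) <= (3/2)^2" using tau by (intro power_mono) auto
    hence 1: "(1 + nu) / 2 * nsq (A x) <= 1 * (3/2)^2" using nu by (intro mult_mono) auto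
    have "Q x - Q_inf = (1 - psi (s x)) *R q j + psi (s x) *R Y x"
     using True p1(1)[OF j, of "s x - tau"] by (simp add: C a_def q_def scaleR_diff_left)
    hence "norm (Q x - Q_inf) <= (1 - psi (s x)) * norm (q j) + psi (s x) * norm (Y x)"
     using norm_triangle_ineq[of "(1 - psi (s x)) *R q j" "psi (s x) *R Y x"] psi(1,2)[of "s x"] by simp
    also have "... <= (1 - psi (s x)) * 2 + psi (s x) * 2" using psi(1,2)[of "s x"] q2 Y2 by (intro add_mono mult_left_mono) auto
    finally have "norm (Q x - Q_inf) <= 2" by simp
    hence "18 * (nsq (Q x - Q_inf) + (norm (Q x - Q_inf))^4) <= 18 * (2^2 + 2^4)" by (intro mult_left_mono add_mono power_mono) auto
    hence "f_pot (Q x) <= 360" using f_pot_quadratic[OF QS[of x]] by simp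
    hence "(eta / xi)^2 * f_pot (Q x) <= (l^2 + 1) * 360" using mu' nu f_pot_nonneg[OF QS[of x]] by (intro mult_mono) auto
    hence "E x <= C0" using 1 g_pot_le[of "Q x"] by (simp add: E_def C0_def power2_eq_square)
    also have "C0 <= H j (s x)" using True s1 nK by (simp add: H_def indicator_def)
    finally show ?thesis .
   next
    case False
    hence ps: "psi (s x) = 0" "psi' (s x) = 0" using psi(4,5)[of "s x"] by auto
    have AQ: "A x = p' j (s x - tau)" "Q x = Q_inf + p j (s x - tau)" using ps by (simp_all add: C a_def a'_def)
    have "(eta / xi)^2 * f_pot (Q x) <= l^2 * f_pot (Q x) + nu * Kf" by (rule muf[OF f_pot_nonneg[OF QS] fK[OF QS QR]])
    hence "E x <= (1 + nu) / 2 * nsq (A x) + pot l (Q x) + nu * Kf" by (simp add: E_def pot_def)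
    also have "... <= (1 + nu) * phi j (s x - tau) + nu * Kf"
     using mult_nonneg_nonneg[OF less_imp_le[OF nu(1)] pot_nonneg[OF QS[of x], of l]] by (simp add: phi_def AQ algebra_simps)
    also have "... = H j (s x)" using False s1 sL by (simp add: H_def indicator_def)
    finally show ?thesis .
   qed
  qed
  have Hm: "H j : borel_measurable borel" if "j : J" for j
   using phim[OF that] unfolding H_def[abs_def] by measurable
  have intH: "(LI t:{1<..}. ennreal (H j t)) <= ennreal (d j + eps/2)" if j: "j : J" for j
  proof -
   have "(LI t:{1<..}. ennreal (H j t)) <= ennreal (C0 * tau) + (ennreal (1 + nu) * (LI t:{1<..}. ennreal (phi j t)) + ennreal (nu * Kf * L'))"
    unfolding H_def by (rule layer_integral) (use phim[OF j] phi0[OF j] C0 tau nu Kf L' in auto)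
   also have "... <= ennreal (C0 * tau) + (ennreal (1 + nu) * ennreal (d j + eps/8) + ennreal (nu * Kf * L'))"
    using pe[OF j] unfolding phi_def by (intro add_mono mult_left_mono) auto
   also have "... = ennreal (C0 * tau + ((1 + nu) * (d j + eps/8) + nu * Kf * L'))"
    using C0 tau nu Kf L' d0[OF j] eps by (simp add: ennreal_mult'[symmetric] ennreal_plus[symmetric] del: ennreal_plus)
   also have "... <= ennreal (d j + eps/2)"
   proof (rule ennreal_leI)
    have "nu * (d j + eps/8 + Kf * L') <= nu * y0" unfolding y0_def using dm[OF j] eps nu by (intro mult_left_mono) auto
    moreover have "(1 + nu) * (d j + eps/8) + nu * Kf * L' = d j + eps/8 + nu * (d j + eps/8 + Kf * L')" by (simp add: algebra_simps)
    ultimately show "C0 * tau + ((1 + nu) * (d j + eps/8) + nu * Kf * L') <= d j + eps/2" using tau(3) nu(3) eps by linarith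
   qed
   finally show ?thesis .
  qed
  have sqL: "(1 + eta * L')^2 <= 1 + 3 * (eta * L')" "(1 + eta * L')^2 <= 4" "0 <= eta * L'"
  proof -
   show 0: "0 <= eta * L'" using eta L' by simp
   have "(eta * L') * (eta * L') <= (eta * L') * 1" using 0 etaL by (intro mult_left_mono) auto
   thus 3: "(1 + eta * L')^2 <= 1 + 3 * (eta * L')" by (simp add: power2_eq_square algebra_simps)
   thus "(1 + eta * L')^2 <= 4" using etaL by linarith
  qed
  have cone: "ennreal eta * energy xi eta Q (cone_over B) <= ennreal ((1 + eta * L')^2) * emeasure sph B * (LI t:{1<..}. ennreal (h t)) + ennreal eps'"
   if B: "B : sets borel" "B <= sphere 0 1" and h: "h : borel_measurable borel" "!!t. 0 <= h t"
    and Eh: "!!x. x : Omega ==> sgn x : B ==> s x < L' ==> E x <= h (s x)" for B h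
  proof -
   have "ennreal eta * energy xi eta Q (cone_over B) <= ennreal ((1 + eta * L')^2) * emeasure sph B * (LI t:{1<..}. ennreal (h t))
     + ennreal (eta * Cc) * (LI x:ball 0 2. ennreal (kap x))"
   proof (rule energy_cone_le[OF Q'(1) eta(1) _ Cc h B])
    show "0 <= L'" using L' by simp
    fix x assume "x : cone_over B"
    hence x: "1 < norm x" "sgn x : B" using cone_over_eq[OF B(2)] by auto
    hence xO: "x : Omega" by (simp add: mem_Omega)
    have "E x <= (if norm x < 1 + eta * L' then h (1 + (norm x - 1) / eta) else 0)"
    proof (cases "s x < L'")
     case True
     hence "(norm x - 1) / eta < L'" by (simp add: s_def)
     hence "norm x < 1 + eta * L'" using eta by (simp add: field_simps)
     thus ?thesis using Eh[OF xO x(2) True] by (simp add: s_def)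
    next
     case False
     thus ?thesis using E0[of x] h(2) by simp
    qed
    thus "eta^2 * dens xi eta Q Q' x <= (if norm x < 1 + eta * L' then h (1 + (norm x - 1) / eta) else 0) + (if norm x < 2 then eta^2 * Cc * kap x else 0)"
     using dn[OF xO] by linarith
   qed
   also have "ennreal (eta * Cc) * (LI x:ball 0 2. ennreal (kap x)) <= ennreal eps'"
    unfolding i0(2) using etac eta Cc i0 by (simp add: ennreal_mult'[symmetric] ennreal_leI)
   finally show ?thesis by (simp add: add_left_mono)
  qed
  have "good_map lam (eps * (measure sph UNIV + 3)) xi eta Q"
  proof (rule good_mapI[where V = K and d = d and a = "%j. d j + eps" and J = J and eps' = eps', OF Q' J(1)])
   show "disjoint_family_on K J" using Kd by (auto simp: disjoint_family_on_def)
   show Kb: "K j : sets borel" if "j : J" for j by (rule borel_compact[OF K(1)[OF that]])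
   show "ennreal (d j) <= D lam (Q_phi om)" if "j : J" "om : K j" for j om using dD[OF that(1), of om] K(2)[OF that(1)] that(2) by blast
   show "ennreal eta * energy xi eta Q (cone_over B) <= ennreal (d j + eps) * emeasure sph B + ennreal eps'"
    if j: "j : J" and B: "B : sets borel" "B <= K j" for j B
   proof -
    have "ennreal eta * energy xi eta Q (cone_over B) <= ennreal ((1 + eta * L')^2) * emeasure sph B * (LI t:{1<..}. ennreal (H j t)) + ennreal eps'"
     by (rule cone[OF B(1) _ Hm[OF j] H0[OF j] EH[OF j]]) (use B KS[OF j] in auto)
    also have "... <= ennreal ((1 + eta * L')^2) * emeasure sph B * ennreal (d j + eps/2) + ennreal eps'"
     by (intro add_right_mono mult_left_mono intH[OF j]) auto
    also have "ennreal ((1 + eta * L')^2) * emeasure sph B * ennreal (d j + eps/2) = ennreal ((1 + eta * L')^2 * (d j + eps/2)) * emeasure sph B"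
     using d0[OF j] eps by (simp add: ennreal_mult mult_ac)
    also have "... <= ennreal (d j + eps) * emeasure sph B"
    proof (intro mult_right_mono ennreal_leI)
     have "(1 + eta * L')^2 * (d j + eps/2) <= (1 + 3 * (eta * L')) * (d j + eps/2)" using sqL d0[OF j] eps by (intro mult_right_mono) auto
     also have "... = d j + eps/2 + 3 * (eta * L') * (d j + eps/2)" by (simp add: distrib_right)
     also have "3 * (eta * L') * (d j + eps/2) <= 3 * (eta * L') * (dm + eps)" using sqL dm[OF j] eps by (intro mult_left_mono) auto
     finally show "(1 + eta * L')^2 * (d j + eps/2) <= d j + eps" using etad by linarith
    qed simp
    finally show ?thesis by (simp add: add_right_mono)
   qed
   let ?Z = "sphere 0 1 - (UN j:J. K j)"
   have Zb: "?Z : sets borel" using J Kb by (intro sets.Diff sets.finite_UN borel_closed[OF closed_sphere]) auto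
   have sZ: "emeasure sph ?Z <= ennreal (real n * k1)"
   proof -
    have "emeasure sph ?Z <= emeasure sph ({om : sphere 0 1. rad om = 0} Un (UN j:J. V j - K j))"
    proof (rule emeasure_mono)
     show "?Z <= {om : sphere 0 1. rad om = 0} Un (UN j:J. V j - K j)" using UJ by force
     show "{om : sphere 0 1. rad om = 0} Un (UN j:J. V j - K j) : sets sph"
      using borel_poles V(2) Kb J by (auto intro!: sets.Un sets.finite_UN)
    qed
    also have "... <= emeasure sph {om : sphere 0 1. rad om = 0} + emeasure sph (UN j:J. V j - K j)"
     by (rule emeasure_subadditive) (use borel_poles V(2) Kb J in "auto intro!: sets.finite_UN")
    also have "emeasure sph (UN j:J. V j - K j) <= (SUM j:J. emeasure sph (V j - K j))"
     by (rule emeasure_subadditive_finite) (use V(2) Kb J in auto)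
    also have "... <= (SUM j:J. ennreal k1)" by (rule sum_mono[OF K(3)])
    also have "... = ennreal (N * k1)" using k1 by (simp add: N_def ennreal_mult ennreal_of_nat_eq_real_of_nat)
    also have "... <= ennreal (real n * k1)" using N k1 by (intro ennreal_leI mult_right_mono) auto
    finally show ?thesis unfolding sph_poles by simp
   qed
   have "ennreal eta * energy xi eta Q (cone_over ?Z) <= ennreal ((1 + eta * L')^2) * emeasure sph ?Z * (LI t:{1<..}. ennreal (CZ * indicator {..L'} t)) + ennreal eps'"
    by (rule cone[OF Zb]) (use EZ CZ in "auto intro: less_imp_le")
   also have "... <= ennreal 4 * ennreal (real n * k1) * ennreal (CZ * L') + ennreal eps'"
   proof (intro add_right_mono mult_mono sZ)
    have "(LI t:{1<..}. ennreal (CZ * indicator {..L'} t)) <= (LI t. ennreal CZ * indicator {0..L'} t)"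
     by (intro nn_integral_mono) (auto simp: indicator_def)
    also have "... = ennreal (CZ * L')" using CZ L' by (simp add: nn_integral_cmult_indicator ennreal_mult)
    finally show "(LI t:{1<..}. ennreal (CZ * indicator {..L'} t)) <= ennreal (CZ * L')" .
    show "ennreal ((1 + eta * L')^2) <= ennreal 4" by (rule ennreal_leI[OF sqL(2)])
   qed auto
   also have "... = ennreal (4 * (CZ * L') * (real n * k1) + eps')"
    using CZ L' k1 eps' by (subst ennreal_mult'[symmetric], simp, subst ennreal_mult'[symmetric], simp, subst ennreal_plus[symmetric]) (auto simp: mult_ac)
   also have "... <= ennreal eps" using k1(2) eps'(3) by (intro ennreal_leI) linarith
   finally show "ennreal eta * energy xi eta Q (cone_over ?Z) <= ennreal eps" .
   show "real (card J) * eps' <= eps" using eps'(2) by (simp add: N_def)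
  qed (use KS d0 eps eps' in "auto intro: add_nonneg_nonneg less_imp_le")
  thus ?thesis using eps(2) unfolding M_def by auto
 qed
 thus ?thesis using dl(1) unfolding l_def by blast
qed

theorem theorem1p3:
  fixes F :: "'i filter" and \<xi> \<eta> :: "'i \<Rightarrow> real" and lam :: ennreal
  assumes "\<forall>\<^sub>F i in F. 0 < \<xi> i \<and> 0 < \<eta> i"
    and "(\<xi> \<longlongrightarrow> 0) F" and "(\<eta> \<longlongrightarrow> 0) F"
    and "((\<lambda>i. ennreal (\<eta> i / \<xi> i)) \<longlongrightarrow> lam) F"
  shows "\<exists>Q :: 'i \<Rightarrow> real^3 \<Rightarrow> real^3^3.
    (\<forall>i. admissible (Q i)) \<and>
    (\<forall>U. U \<subseteq> sphere 0 1 \<and> U \<in> sets (hausdorff_measure 2) \<longrightarrow>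
      Limsup F (\<lambda>i. ennreal (\<eta> i) * energy (\<xi> i) (\<eta> i) (Q i) (cone_over U))
        \<le> (\<integral>\<^sup>+\<omega>\<in>U. D lam (Q_phi \<omega>) \<partial>hausdorff_measure 2))"
proof -
 \<comment> \<open>Some admissible map is wanted for the indices outside the eventual set.\<close>
 obtain dl where "0 < dl" "ALL x y. 0 < x --> 0 < y --> y < dl --> (EX Q. good_map \<infinity> 1 x y Q)" using good_maps_infinite[of 1] by auto
 from this(2)[rule_format, of 1 "dl/2"] this(1) obtain Q0 where A: "admissible Q0" unfolding good_map_def by auto
 show ?thesis
 proof (rule recovery_of_good_maps[OF assms(1,3) A])
  fix eps :: real assume eps: "0 < eps"
  show "\<forall>\<^sub>F i in F. EX Q. good_map lam eps (\<xi> i) (\<eta> i) Q"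
  proof (cases "lam = \<infinity>")
   case True
   obtain dl where dl: "0 < dl" "ALL x y. 0 < x --> 0 < y --> y < dl --> (EX Q. good_map \<infinity> eps x y Q)" using good_maps_infinite[OF eps] by auto
   show ?thesis using assms(1) order_tendstoD(2)[OF assms(3) dl(1)] by eventually_elim (use dl(2) True in auto)
  next
   case False
   hence lam: "lam < \<infinity>" by (simp add: top.not_eq_extremum)
   obtain dl where dl: "0 < dl" "ALL x y. 0 < x --> 0 < y --> y < dl --> \<bar>(y / x)^2 - (enn2real lam)^2\<bar> < dl --> (EX Q. good_map lam eps x y Q)"
    using good_maps_finite[OF lam eps] by auto
   \<comment> \<open>\<open>ennreal\<close> truncates negative quotients, but eventually the
     quotient is positive and \<open>enn2real\<close> returns it.\<close>
   have "((%i. enn2real (ennreal (\<eta> i / \<xi> i))) \<longlongrightarrow> enn2real lam) F" using lam assms(4) by (intro tendsto_enn2real) auto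
   hence "((%i. (enn2real (ennreal (\<eta> i / \<xi> i)))^2) \<longlongrightarrow> (enn2real lam)^2) F" by (rule tendsto_power)
   from tendstoD[OF this dl(1)] assms(1) order_tendstoD(2)[OF assms(3) dl(1)]
   show ?thesis
   proof eventually_elim
    case (elim i)
    thus ?case using dl(2)[rule_format, of "\<xi> i" "\<eta> i"] by (simp add: dist_real_def)
   qed
  qed
 qed
qed

end
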